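(* Let $M^n$ be one of $\mathbb S^n,\mathbb E^n,\mathbb H^n$ and $f,g\in\mathbf I(M^n)$. Set $t=1$ if $M^n=\mathbb S^n$, $t=3$ if $M^n=\mathbb E^n$, $t=4$ if $M^n=\mathbb H^n$. If for every $0\le k\le t$ the multiset of dimensions of the connected components of $\Gamma_f(k)$ coincides with that of $\Gamma_g(k)$ (in particular $\Gamma_f(k)=\emptyset$ iff $\Gamma_g(k)=\emptyset$), then $f$ and $g$ have the same Segre symbol (hence the same orbit type). More precisely: for $\mathbb E^n$, the data for $k\le 2$ suffice when $f$ is elliptic and $k\le3$ when hyperbolic; for $\mathbb H^n$, $k\le2$ when elliptic, $k\le3$ when hyperbolic, $k\le4$ when parabolic.
   Context: $\Gamma_f(k)$ is the set of $f$-invariant ($f(N)=N$) closed totally geodesic submanifolds $N\subseteq M^n$ isometric to $M^k$; it is a smooth (possibly empty) manifold whose components may have different dimensions. Concretely: for $\mathbb S^n\subset\mathbb R^{n+1}$, $f\in O(n+1)$, $\Gamma_f(k)\cong\{U\in\mathrm{Gr}_{k+1}(\mathbb R^{n+1}):f(U)=U\}$ (subspheres $U\cap\mathbb S^n$); for $\mathbb E^n$, $\Gamma_f(k)$ is the set of $k$-dimensional affine subspaces invariant under $f$; for $\mathbb H^n\subset\mathbb R^{1,n}$ (form $-x_0y_0+\sum x_iy_i$), $\Gamma_f(k)\cong\{U\in\mathrm{Gr}_{k+1}(\mathbb R^{n+1}): U \text{ contains a vector }v\text{ with }Q(v)<0,\ f(U)=U\}$. Segre symbols: for $f\in O(n+1)$,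 $\tilde\sigma_f$ = multiset of $\dim_{\mathbb C}\ker(f-\lambda)$ over distinct conjugate pairs of non-real eigenvalues plus multiset of $\dim\ker(f-\varepsilon)$ over eigenvalues $\varepsilon\in\{\pm1\}$. For $f=\begin{pmatrix}A&a\\0&1\end{pmatrix}\in\mathrm{Euc}(n)$: $\sigma_f=[t;r;\tilde\sigma_{A|\ker(A-I)^\perp}]$ with $r=\dim\ker(A-I)$, $t=e$ if $f$ has a fixed point, else $t=h$. For $T\in PO(1,n)$: with $V_s$ the sum of real primary components of $T$ on which $Q$ is positive definite and $V_t$ the sum of the others, $\sigma_T=[t;\dim V_t;\tilde\sigma_{T|V_s}]$ with $t=e$ if $T|_{V_t}=\mathrm{id}$, $t=p$ if $T|_{V_t}$ is unipotent $\neq\mathrm{id}$, $t=h$ otherwise. *)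

theory Defs
  imports "HOL-Analysis.Analysis" "HOL-Library.Multiset"
begin

section \<open>Manifold dimension of components\<close>

text \<open>A (nonempty) set C in a Euclidean space is a topological manifold of dimension d
  if every point has a neighbourhood (relatively open in C) homeomorphic to an open
  subset of a d-dimensional linear subspace.  mdim C is that d.\<close>

definition locally_dim :: "'e::euclidean_space set \<Rightarrow> nat \<Rightarrow> bool" where
  "locally_dim C d \<longleftrightarrow> C \<noteq> {} \<and>
     (\<forall>x\<in>C. \<exists>U (T::'e set) (V::'e set). openin (top_of_set C) U \<and> x \<in> U \<and> subspace T \<and> dim T = d
                 \<and> open V \<and> U homeomorphic (V \<inter> T))"

definition mdim :: "'e::euclidean_space set \<Rightarrow> nat" where
  "mdim C = (THE d. locally_dim C d)"

text \<open>Multiset of the dimensions of the connected components of a set.\<close>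
definition comp_dims :: "'e::euclidean_space set \<Rightarrow> nat multiset" where
  "comp_dims S = image_mset mdim (mset_set (components S))"

section \<open>Grassmannians via orthogonal projection matrices\<close>

text \<open>A linear subspace U of R^m is represented by its orthogonal projection matrix P
  (U = range of P); this identifies Gr_d(R^m) with the rank-d symmetric idempotents,
  carrying the standard topology.\<close>

definition grass :: "nat \<Rightarrow> (real^'m^'m) set" where
  "grass d = {P. P ** P = P \<and> transpose P = P \<and> dim (range ((*v) P)) = d}"

definition sub_of :: "real^'m^'m \<Rightarrow> (real^'m) set" where
  "sub_of P = range ((*v) P)"

section \<open>Segre symbol of an orthogonal-type map restricted to a subspace\<close>

definition cplx_mat :: "real^'m^'m \<Rightarrow> complex^'m^'m" where
  "cplx_mat A = (\<chi> i j. complex_of_real (A$i$j))"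

text \<open>complexification of a real subspace W\<close>
definition cplx_sub :: "(real^'m) set \<Rightarrow> (complex^'m) set" where
  "cplx_sub W = {v. (\<chi> i. Re (v$i)) \<in> W \<and> (\<chi> i. Im (v$i)) \<in> W}"

text \<open>complex eigenspace of A restricted to (invariant) W\<close>
definition ceig :: "real^'m^'m \<Rightarrow> (real^'m) set \<Rightarrow> complex \<Rightarrow> (complex^'m) set" where
  "ceig A W c = {v \<in> cplx_sub W. cplx_mat A *v v = c *s v}"

text \<open>real eigenspace of A restricted to W\<close>
definition reig :: "real^'m^'m \<Rightarrow> (real^'m) set \<Rightarrow> real \<Rightarrow> (real^'m) set" where
  "reig A W e = {x \<in> W. A *v x = e *\<^sub>R x}"

text \<open>tilde-sigma of A restricted to W: (multiset of complex dimensions of eigenspaces of the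
  distinct conjugate pairs of non-real eigenvalues (one representative with Im > 0 per pair),
  multiset of dimensions of the eigenspaces of the eigenvalues among +1, -1).\<close>
definition tsigma :: "real^'m^'m \<Rightarrow> (real^'m) set \<Rightarrow> nat multiset \<times> nat multiset" where
  "tsigma A W =
    (image_mset (\<lambda>c. vec.dim (ceig A W c)) (mset_set {c. Im c > 0 \<and> ceig A W c \<noteq> {0}}),
     image_mset (\<lambda>e. dim (reig A W e)) (mset_set {e \<in> {1, -1}. reig A W e \<noteq> {0}}))"

datatype stype = Ell | Par | Hyp

section \<open>Spherical case: f in O(n+1), S^n the unit sphere of R^(n+1) = real^'m\<close>

definition GammaS :: "(real^'m \<Rightarrow> real^'m) \<Rightarrow> nat \<Rightarrow> (real^'m^'m) set" where
  "GammaS f k = {P \<in> grass (k+1). f ` sub_of P = sub_of P}"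

definition segreS :: "(real^'m \<Rightarrow> real^'m) \<Rightarrow> nat multiset \<times> nat multiset" where
  "segreS f = tsigma (matrix f) UNIV"

section \<open>Euclidean case: f an isometry of E^n = real^'n\<close>

definition isomE :: "(real^'n \<Rightarrow> real^'n) \<Rightarrow> bool" where
  "isomE f \<longleftrightarrow> (\<forall>x y. dist (f x) (f y) = dist x y)"

text \<open>An affine k-subspace q + U is represented by (P_U, q) with q orthogonal to U.\<close>
definition GammaE :: "(real^'n \<Rightarrow> real^'n) \<Rightarrow> nat \<Rightarrow> ((real^'n^'n) \<times> (real^'n)) set" where
  "GammaE f k = {(P, q). P \<in> grass k \<and> P *v q = 0 \<and>
       f ` ((\<lambda>u. q + u) ` sub_of P) = (\<lambda>u. q + u) ` sub_of P}"

text \<open>f x = A x + a, A the linear part\<close>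
definition linpart :: "(real^'n \<Rightarrow> real^'n) \<Rightarrow> real^'n^'n" where
  "linpart f = matrix (\<lambda>x. f x - f 0)"

definition segreE :: "(real^'n \<Rightarrow> real^'n) \<Rightarrow> stype \<times> nat \<times> (nat multiset \<times> nat multiset)" where
  "segreE f =
    (let A = linpart f; K = {x. A *v x = x}
     in (if \<exists>x. f x = x then Ell else Hyp,
         dim K,
         tsigma A {y. \<forall>x\<in>K. orthogonal x y}))"

section \<open>Hyperbolic case: R^(1,n) = real^'p with time coordinate i0\<close>

definition lor :: "'p::finite \<Rightarrow> real^'p \<Rightarrow> real^'p \<Rightarrow> real" where
  "lor i0 x y = (\<Sum>i\<in>UNIV. x$i * y$i) - 2 * (x$i0 * y$i0)"

definition hyperboloid :: "'p::finite \<Rightarrow> (real^'p) set" where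
  "hyperboloid i0 = {x. lor i0 x x = -1 \<and> x$i0 > 0}"

text \<open>Isometries of H^n, realised as O^+(1,n) (the representative in PO(1,n) preserving the
  upper sheet of the hyperboloid).\<close>
definition isomH :: "'p::finite \<Rightarrow> (real^'p \<Rightarrow> real^'p) \<Rightarrow> bool" where
  "isomH i0 T \<longleftrightarrow> linear T \<and> (\<forall>x y. lor i0 (T x) (T y) = lor i0 x y)
                  \<and> T ` hyperboloid i0 = hyperboloid i0"

definition GammaH :: "'p::finite \<Rightarrow> (real^'p \<Rightarrow> real^'p) \<Rightarrow> nat \<Rightarrow> (real^'p^'p) set" where
  "GammaH i0 T k = {P \<in> grass (k+1). (\<exists>v\<in>sub_of P. lor i0 v v < 0) \<and> T ` sub_of P = sub_of P}"

text \<open>real primary component of T belonging to the eigenvalue pair lambda, conj lambda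
  (for real lambda = a this is the generalised eigenspace ker (T - a)^N)\<close>
definition prim_comp :: "(real^'p \<Rightarrow> real^'p) \<Rightarrow> complex \<Rightarrow> (real^'p) set" where
  "prim_comp T c = {x. ((\<lambda>y. T (T y) - (2 * Re c) *\<^sub>R T y + (cmod c)\<^sup>2 *\<^sub>R y) ^^ CARD('p)) x = 0}"

definition prim_comps :: "(real^'p \<Rightarrow> real^'p) \<Rightarrow> (real^'p) set set" where
  "prim_comps T = {prim_comp T c | c. Im c \<ge> 0 \<and> prim_comp T c \<noteq> {0}}"

definition posdef_on :: "'p::finite \<Rightarrow> (real^'p) set \<Rightarrow> bool" where
  "posdef_on i0 C \<longleftrightarrow> (\<forall>x\<in>C. x \<noteq> 0 \<longrightarrow> lor i0 x x > 0)"

definition Vs :: "'p::finite \<Rightarrow> (real^'p \<Rightarrow> real^'p) \<Rightarrow> (real^'p) set" where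
  "Vs i0 T = span (\<Union>{C \<in> prim_comps T. posdef_on i0 C})"

definition Vt :: "'p::finite \<Rightarrow> (real^'p \<Rightarrow> real^'p) \<Rightarrow> (real^'p) set" where
  "Vt i0 T = span (\<Union>{C \<in> prim_comps T. \<not> posdef_on i0 C})"

definition segreH :: "'p::finite \<Rightarrow> (real^'p \<Rightarrow> real^'p) \<Rightarrow> stype \<times> nat \<times> (nat multiset \<times> nat multiset)" where
  "segreH i0 T =
    (if \<forall>x\<in>Vt i0 T. T x = x then Ell
     else if \<forall>x\<in>Vt i0 T. ((\<lambda>y. T y - y) ^^ CARD('p)) x = 0 then Par
     else Hyp,
     dim (Vt i0 T),
     tsigma (matrix T) (Vs i0 T))"

end

theory Submission
  imports Defs
begin

text \<open>In each of the three geometries the invariant subspaces of an isometry correspond to pairs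
  \<open>(P, q)\<close>: \<open>P\<close> is the projection onto an invariant subspace of a Euclidean space \<open>W\<close> on which a
  linear isometry \<open>A\<close> acts, and \<open>q\<close> is a fixed vector orthogonal to it that records the position of
  the subspace (with \<open>q = 0\<close> for spheres and for hyperbolic translations).  For \<open>dim P = 0\<close> the pairs
  form the fixed space, which gives its dimension.  For \<open>dim P = 1\<close> they form one piece for each of the
  eigenvalues \<open>1\<close> and \<open>-1\<close>, so the dimensions of these eigenspaces can be read off.  For \<open>dim P = 2\<close> they split into
  a real piece, whose homeomorphism type depends only on the two real eigenspaces, and for each
  pair of non-real eigenvalues of multiplicity \<open>m\<close> a connected piece \<open>CP(m - 1)\<close> times the space of
  the \<open>q\<close>, of real dimension \<open>2m - 2 + dim\<close>.  Cancelling the real pieces leaves the multiset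
  of the \<open>m\<close>.\<close>

section \<open>Dimensions of components\<close>

text \<open>The real pieces can be cancelled without knowing their topology, provided that each has
  finitely many components: \<open>mset_set\<close> of an infinite set is empty, and additivity of
  \<open>comp_dims\<close> would fail. Charts are therefore constructed only for projective and
  linear spaces. The bounds on \<open>k\<close> are the values at which \<open>dim P = 2\<close> is
  reached. A subsphere of dimension \<open>k\<close> spans a linear subspace of dimension
  \<open>k + 1\<close>, so \<open>k = 1\<close> is enough. For elliptic maps of E and H,
  \<open>dim P = k\<close>. The translation direction in E and the two null eigenlines of a
  hyperbolic map of H lie in every invariant subspace and raise \<open>k\<close> by one. For a
  parabolic map a plane of its Jordan chain is forced into the subspace, with one further direction
  outside it, and \<open>k\<close> rises by two. Which of the spaces for \<open>k = 0\<close> and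
  \<open>k = 1\<close> are empty reveals the type. Where \<open>q = 0\<close>, the eigenvalues
  \<open>1\<close> and \<open>-1\<close> cannot be told apart; there the Segre symbol puts both
  dimensions into one multiset, so the symbol is still determined.\<close>

lemma homeomorphism_imp_homeomorphic_image:
  assumes "homeomorphism S T h k" "U \<subseteq> S"
  shows "U homeomorphic h ` U"
proof -
  have "h ` U \<subseteq> T" using assms by (auto simp: homeomorphism_def)
  then have "homeomorphism U (h ` U) h k"
    using homeomorphism_of_subsets[OF assms(1,2)] by blast
  then show ?thesis unfolding homeomorphic_def by blast
qed

lemma homeomorphism_imp_inj_on: "homeomorphism S T h k \<Longrightarrow> inj_on h S"
  by (metis homeomorphism_apply1 inj_onI)

lemma homeomorphic_Times:
  assumes "S homeomorphic S'" "T homeomorphic T'"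
  shows "S \<times> T homeomorphic S' \<times> T'"
proof -
  obtain h k h' k' where "homeomorphism S S' h k" "homeomorphism T T' h' k'"
    using assms unfolding homeomorphic_def by blast
  then have "homeomorphism (S \<times> T) (S' \<times> T') (\<lambda>z. (h (fst z), h' (snd z))) (\<lambda>z. (k (fst z), k' (snd z)))"
    unfolding homeomorphism_def
    by (intro conjI continuous_on_Pair continuous_on_compose2[of S h _ fst] continuous_on_compose2[of T h' _ snd]
        continuous_on_compose2[of S' k _ fst] continuous_on_compose2[of T' k' _ snd] continuous_on_fst
        continuous_on_snd continuous_on_id) (auto simp: image_iff)
  then show ?thesis unfolding homeomorphic_def by blast
qed

text \<open>The definition asks for charts in subspaces of the ambient space of \<open>C\<close>,
  whereas a chart may naturally live in another Euclidean space. Invariance of dimension, applied to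
  the inverse chart, bounds \<open>d\<close> by the ambient dimension, so a subspace of dimension
  \<open>d\<close> exists there and the chart is carried over to it.\<close>

lemma locally_dimI:
  fixes C :: "'e::euclidean_space set"
  assumes ne: "C \<noteq> {}"
    and chart: "\<And>x. x \<in> C \<Longrightarrow> \<exists>U (T::'f::euclidean_space set) V. openin (top_of_set C) U \<and> x \<in> U \<and>
                  subspace T \<and> dim T = d \<and> openin (top_of_set T) V \<and> U homeomorphic V"
  shows "locally_dim C d"
  unfolding locally_dim_def
proof (intro conjI ballI ne)
  fix x assume "x \<in> C"
  obtain U and T :: "'f set" and V where U: "openin (top_of_set C) U" "x \<in> U"
    and T: "subspace T" "dim T = d" and V: "openin (top_of_set T) V" and UV: "U homeomorphic V"
    using chart[OF \<open>x \<in> C\<close>] by blast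
  obtain h k where hk: "homeomorphism V U h k"
    using UV unfolding homeomorphic_sym[of U] unfolding homeomorphic_def by blast
  have "V \<noteq> {}"
    using U homeomorphism_image2[OF hk] by auto
  have "dim T \<le> dim (UNIV :: 'e set)"
  proof (rule invariance_of_dimension_subspaces[OF V T(1) subspace_UNIV])
    show "continuous_on V h" "inj_on h V"
      using homeomorphism_cont1[OF hk] homeomorphism_imp_inj_on[OF hk] by auto
  qed (use \<open>V \<noteq> {}\<close> in auto)
  then obtain T2 :: "'e set" where T2: "subspace T2" "dim T2 = d"
    using choose_subspace_of_subspace[of d "UNIV :: 'e set"] T(2) by auto
  have "T homeomorphic T2"
    by (rule homeomorphic_subspaces) (use T T2 in auto)
  then obtain a b where ab: "homeomorphism T T2 a b"
    unfolding homeomorphic_def by blast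
  have op: "openin (top_of_set T2) (a ` V)"
    using homeomorphism_imp_open_map[OF ab V] .
  then obtain W where W: "open W" "a ` V = T2 \<inter> W"
    unfolding openin_open by auto
  have "V homeomorphic a ` V"
    using homeomorphism_imp_homeomorphic_image[OF ab openin_imp_subset[OF V]] .
  then have "U homeomorphic (W \<inter> T2)"
    using W UV homeomorphic_trans by (metis inf_commute)
  then show "\<exists>U (T::'e set) V. openin (top_of_set C) U \<and> x \<in> U \<and> subspace T \<and> dim T = d \<and> open V \<and> U homeomorphic V \<inter> T"
    using U T2 W(1) by blast
qed

lemma locally_dimE:
  fixes C :: "'e::euclidean_space set"
  assumes "locally_dim C d" "x \<in> C"
  obtains U and T V :: "'e set" where "openin (top_of_set C) U" "x \<in> U" "subspace T" "dim T = d"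
    "openin (top_of_set T) V" "U homeomorphic V"
proof -
  obtain U and T V :: "'e set" where *: "openin (top_of_set C) U" "x \<in> U" "subspace T" "dim T = d"
    "open V" "U homeomorphic V \<inter> T"
    using assms unfolding locally_dim_def by meson
  show thesis
    by (rule that[of U T "V \<inter> T"]) (use * in \<open>auto simp: openin_open\<close>)
qed

lemma locally_dim_homeomorphic:
  fixes C :: "'e::euclidean_space set" and D :: "'f::euclidean_space set"
  assumes "C homeomorphic D" "locally_dim C d"
  shows "locally_dim D d"
proof -
  obtain h k where hk: "homeomorphism C D h k"
    using assms(1) unfolding homeomorphic_def by blast
  show ?thesis
  proof (rule locally_dimI)
    show "D \<noteq> {}"
      using assms(2) hk by (auto simp: locally_dim_def homeomorphism_def)
    fix y assume y: "y \<in> D"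
    then have "k y \<in> C" using hk by (auto simp: homeomorphism_def)
    then obtain U and T V :: "'e set" where *: "openin (top_of_set C) U" "k y \<in> U" "subspace T" "dim T = d"
      "openin (top_of_set T) V" "U homeomorphic V"
      using locally_dimE[OF assms(2)] by metis
    have "openin (top_of_set D) (h ` U)"
      using homeomorphism_imp_open_map[OF hk *(1)] .
    moreover have "y \<in> h ` U"
      using y * hk by (metis homeomorphism_apply2 imageI)
    moreover have "U homeomorphic h ` U"
      using homeomorphism_imp_homeomorphic_image[OF hk openin_imp_subset[OF *(1)]] .
    then have "h ` U homeomorphic V"
      using * homeomorphic_sym homeomorphic_trans by metis
    ultimately show "\<exists>U (T::'e set) V. openin (top_of_set D) U \<and> y \<in> U \<and>
                  subspace T \<and> dim T = d \<and> openin (top_of_set T) V \<and> U homeomorphic V"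
      using * by blast
  qed
qed

text \<open>Both descriptions range over the same predicate, so the equality also covers sets that
  have not been shown to be manifolds; the real pieces are compared in this way.\<close>

lemma mdim_homeomorphic:
  assumes "C homeomorphic D" shows "mdim C = mdim D"
  unfolding mdim_def
  using locally_dim_homeomorphic[OF assms] locally_dim_homeomorphic[OF homeomorphic_sym[THEN iffD1, OF assms]]
  by (intro arg_cong[where f=The] ext iffI)

text \<open>Gives access to the theorem that homeomorphic maps of abstract topologies permute
  components.\<close>

lemma components_eq_connected_components_of:
  "components S = connected_components_of (top_of_set S)"
proof -
  have "connected_component_set S x = connected_component_of_set (top_of_set S) x" for x
    unfolding connected_component_def connected_component_of_def connectedin_subtopology by auto
  then show ?thesis
    by (auto simp: components_def connected_components_of_def)
qed

lemma comp_dims_homeomorphic: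
  assumes "S homeomorphic T" shows "comp_dims S = comp_dims T"
proof -
  obtain h k where hk: "homeomorphism S T h k"
    using assms unfolding homeomorphic_def by blast
  then have "homeomorphic_map (top_of_set S) (top_of_set T) h"
    unfolding homeomorphic_map_maps homeomorphic_maps_def homeomorphism_def
    by (intro exI[of _ k]) auto
  then have comp: "components T = (`) h ` components S"
    using homeomorphic_map_connected_components_of[of "top_of_set S" "top_of_set T" h]
    unfolding components_eq_connected_components_of[symmetric] by simp
  have sub: "C \<subseteq> S" if "C \<in> components S" for C
    using that in_components_subset by blast
  have inj: "inj_on ((`) h) (components S)"
    using inj_on_image_eq_iff[OF homeomorphism_imp_inj_on[OF hk] sub sub] by (intro inj_onI) blast
  have "mdim (h ` C) = mdim C" if "C \<in> components S" for C
    using mdim_homeomorphic[OF homeomorphism_imp_homeomorphic_image[OF hk sub[OF that]]] by simp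
  \<comment> \<open>With infinitely many components both sides are empty by the convention for
    \<open>mset_set\<close>.\<close>
  then have "image_mset (mdim \<circ> (`) h) (mset_set (components S)) = image_mset mdim (mset_set (components S))"
    by (cases "finite (components S)") (auto intro!: image_mset_cong)
  then show ?thesis
    unfolding comp_dims_def comp by (simp add: image_mset_mset_set[OF inj, symmetric] multiset.map_comp)
qed

text \<open>On the overlap of two charts around a point the change of coordinates is a continuous
  injection of an open subset of \<open>T\<close> into \<open>T'\<close>, and invariance of
  dimension applies. Exchanging \<open>d\<close> and \<open>d'\<close> yields uniqueness of the
  dimension.\<close>

lemma locally_dim_le:
  fixes C :: "'e::euclidean_space set"
  assumes "locally_dim C d" "locally_dim C d'"
  shows "d \<le> d'"
proof -
  obtain x where x: "x \<in> C" using assms by (auto simp: locally_dim_def)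
  obtain U and T V :: "'e set" where 1: "openin (top_of_set C) U" "x \<in> U" "subspace T" "dim T = d"
      "openin (top_of_set T) V" "U homeomorphic V"
    using locally_dimE[OF assms(1) x] by metis
  obtain U' and T' V' :: "'e set" where 2: "openin (top_of_set C) U'" "x \<in> U'" "subspace T'" "dim T' = d'"
      "openin (top_of_set T') V'" "U' homeomorphic V'"
    using locally_dimE[OF assms(2) x] by metis
  obtain h k where hk: "homeomorphism U V h k" using 1 unfolding homeomorphic_def by blast
  obtain h' k' where hk': "homeomorphism U' V' h' k'" using 2 unfolding homeomorphic_def by blast
  have o: "openin (top_of_set U) (U \<inter> U')"
    by (meson 1 2 openin_Int openin_imp_subset openin_subset_trans inf_le1)
  then have "openin (top_of_set V) (h ` (U \<inter> U'))"
    using homeomorphism_imp_open_map[OF hk] by blast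
  then have op: "openin (top_of_set T) (h ` (U \<inter> U'))"
    using 1(5) openin_trans by blast
  have kU: "k ` h ` (U \<inter> U') = U \<inter> U'"
    using homeomorphism_apply1[OF hk] by (force simp: image_image)
  have "dim T \<le> dim T'"
  proof (rule invariance_of_dimension_subspaces[OF op 1(3) 2(3)])
    show "continuous_on (h ` (U \<inter> U')) (h' \<circ> k)"
    proof (rule continuous_on_compose)
      show "continuous_on (h ` (U \<inter> U')) k"
        using homeomorphism_cont2[OF hk] continuous_on_subset openin_imp_subset[OF \<open>openin (top_of_set V) _\<close>] by blast
      show "continuous_on (k ` h ` (U \<inter> U')) h'"
        unfolding kU using homeomorphism_cont1[OF hk'] continuous_on_subset by blast
    qed
    show "h' \<circ> k \<in> h ` (U \<inter> U') \<rightarrow> T'"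
      using homeomorphism_image1[OF hk'] homeomorphism_apply1[OF hk] openin_imp_subset[OF 2(5)] by auto
    show "inj_on (h' \<circ> k) (h ` (U \<inter> U'))"
      using homeomorphism_imp_inj_on[OF hk'] homeomorphism_apply1[OF hk]
      by (auto simp: inj_on_def)
    show "h ` (U \<inter> U') \<noteq> {}" using 1 2 by auto
  qed
  then show ?thesis using 1 2 by simp
qed

lemma mdim_eq:
  assumes "locally_dim C d" shows "mdim C = d"
  unfolding mdim_def using assms locally_dim_le by (intro the_equality) (auto intro!: order_antisym)

lemma comp_dims_connected:
  assumes "connected S" "locally_dim S d" shows "comp_dims S = {#d#}"
proof -
  have "components S = {S}"
    using assms by (simp add: components_eq_sing_iff locally_dim_def)
  then show ?thesis by (simp add: comp_dims_def mdim_eq[OF assms(2)])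
qed

lemma comp_dims_empty [simp]: "comp_dims {} = {#}"
  by (simp add: comp_dims_def)

lemma locally_dim_subspace:
  fixes S :: "'e::euclidean_space set"
  assumes "subspace S" shows "locally_dim S (dim S)"
proof (rule locally_dimI)
  show "S \<noteq> {}" using assms subspace_0 by blast
  fix x assume "x \<in> S"
  then show "\<exists>U (T::'e set) V. openin (top_of_set S) U \<and> x \<in> U \<and> subspace T \<and> dim T = dim S \<and>
      openin (top_of_set T) V \<and> U homeomorphic V"
    using assms homeomorphic_refl[of S] openin_subtopology_self by blast
qed

lemma locally_dim_Times:
  fixes C :: "'e::euclidean_space set" and D :: "'f::euclidean_space set"
  assumes "locally_dim C d" "locally_dim D d'"
  shows "locally_dim (C \<times> D) (d + d')"
proof (rule locally_dimI)
  show "C \<times> D \<noteq> {}" using assms by (auto simp: locally_dim_def)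
  fix z assume z: "z \<in> C \<times> D"
  obtain U and T V :: "'e set" where 1: "openin (top_of_set C) U" "fst z \<in> U" "subspace T" "dim T = d"
      "openin (top_of_set T) V" "U homeomorphic V"
    using locally_dimE[OF assms(1)] z by (metis mem_Times_iff)
  obtain U' and T' V' :: "'f set" where 2: "openin (top_of_set D) U'" "snd z \<in> U'" "subspace T'" "dim T' = d'"
      "openin (top_of_set T') V'" "U' homeomorphic V'"
    using locally_dimE[OF assms(2)] z by (metis mem_Times_iff)
  have "subspace (T \<times> T')" "dim (T \<times> T') = d + d'"
    using 1 2 by (auto simp: subspace_Times dim_Times)
  moreover have "openin (top_of_set (C \<times> D)) (U \<times> U')" "z \<in> U \<times> U'"
    using 1 2 by (auto simp: openin_Times mem_Times_iff)
  moreover have "openin (top_of_set (T \<times> T')) (V \<times> V')"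
    using 1 2 by (auto simp: openin_Times)
  moreover have "U \<times> U' homeomorphic V \<times> V'"
    using 1 2 by (intro homeomorphic_Times) auto
  ultimately show "\<exists>U (T::('e \<times> 'f) set) V. openin (top_of_set (C \<times> D)) U \<and> z \<in> U \<and>
                  subspace T \<and> dim T = d + d' \<and> openin (top_of_set T) V \<and> U homeomorphic V"
    by blast
qed

text \<open>A component contains every member of \<open>F\<close> that it meets, so it is determined
  by that member; \<open>SOME\<close> picks the point that names it.\<close>

lemma finite_components_Union:
  assumes "finite F" "\<And>X. X \<in> F \<Longrightarrow> connected X" "S = \<Union>F"
  shows "finite (components S)"
proof -
  have "\<exists>X\<in>F. C = connected_component_set S (SOME x. x \<in> X)" if C: "C \<in> components S" for C
  proof -
    obtain x where x: "x \<in> C" using C in_components_nonempty by blast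
    then have "x \<in> S" using C in_components_subset by blast
    then obtain X where X: "X \<in> F" "x \<in> X" using assms by blast
    have "X \<subseteq> C"
      using components_maximal[OF C assms(2)[OF X(1)]] X x assms(3) by blast
    moreover have "(SOME x. x \<in> X) \<in> X" using X someI by fast
    ultimately show ?thesis
      using X C by (metis components_iff connected_component_eq subsetD)
  qed
  then have "components S \<subseteq> (\<lambda>X. connected_component_set S (SOME x. x \<in> X)) ` F" by blast
  then show ?thesis using assms(1) finite_subset by blast
qed

text \<open>A connected subset of the union that meets \<open>A\<close> cannot leave it, since
  \<open>A\<close> and \<open>B\<close> would separate the subset by disjoint relatively closed
  parts.\<close>

lemma components_Un_closedin:
  assumes "closedin (top_of_set (A \<union> B)) A" "closedin (top_of_set (A \<union> B)) B" "A \<inter> B = {}"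
  shows "components (A \<union> B) = components A \<union> components B"
proof -
  have *: "connected_component_set (A \<union> B) x = connected_component_set A x"
    if hyp: "x \<in> A" "closedin (top_of_set (A \<union> B)) A" "closedin (top_of_set (A \<union> B)) B" "A \<inter> B = {}"
    for x and A B :: "'a set"
  proof
    let ?C = "connected_component_set (A \<union> B) x"
    have C: "connected ?C" "?C \<subseteq> A \<union> B" "x \<in> ?C"
      using that by (auto simp: connected_component_subset)
    have "?C \<subseteq> A"
    proof (rule ccontr)
      assume n: "\<not> ?C \<subseteq> A"
      obtain A' B' where AB: "closed A'" "A = (A \<union> B) \<inter> A'" "closed B'" "B = (A \<union> B) \<inter> B'"
        using hyp(2,3) by (auto simp: closedin_closed)
      have "A' \<inter> ?C \<noteq> {}" "B' \<inter> ?C \<noteq> {}" "A' \<inter> B' \<inter> ?C = {}" "?C \<subseteq> A' \<union> B'"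
        using AB C(2,3) n hyp(1,4) by blast+
      then show False
        using C(1) AB(1,3) unfolding connected_closed by blast
    qed
    then show "?C \<subseteq> connected_component_set A x"
      using connected_component_maximal C by metis
    show "connected_component_set A x \<subseteq> ?C"
      by (simp add: connected_component_mono)
  qed
  show ?thesis
    using *[OF _ assms] *[of _ B A] assms
    by (simp add: components_def Un_commute Int_commute image_Un)
qed

text \<open>Finiteness is what makes this additive: if one summand had infinitely many components,
  \<open>mset_set\<close> would return the empty multiset for the union and lose the other
  summand.\<close>

lemma comp_dims_Un:
  assumes "closedin (top_of_set (A \<union> B)) A" "closedin (top_of_set (A \<union> B)) B" "A \<inter> B = {}"
    and "finite (components A)" "finite (components B)"
  shows "comp_dims (A \<union> B) = comp_dims A + comp_dims B"
proof -
  have "C \<notin> components B" if "C \<in> components A" for C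
    using assms(3) in_components_nonempty[OF that] in_components_subset[OF that] in_components_subset[of C B] by blast
  then have "components A \<inter> components B = {}" by blast
  then show ?thesis
    unfolding comp_dims_def components_Un_closedin[OF assms(1-3)]
    using assms by (simp add: mset_set_Union)
qed

text \<open>The pieces are cut out of \<open>S\<close> by closed sets of the ambient space, so that
  they stay relatively closed in every partial union of the induction; finiteness is carried along
  in the conclusion for the same purpose.\<close>

lemma comp_dims_UN:
  assumes "finite I" "\<And>i. i \<in> I \<Longrightarrow> closed (X i)" "\<And>i j. i \<in> I \<Longrightarrow> j \<in> I \<Longrightarrow> i \<noteq> j \<Longrightarrow> S \<inter> X i \<inter> X j = {}"
    and "\<And>i. i \<in> I \<Longrightarrow> finite (components (S \<inter> X i))"
  shows "comp_dims (\<Union>i\<in>I. S \<inter> X i) = (\<Sum>i\<in>I. comp_dims (S \<inter> X i)) \<and> finite (components (\<Union>i\<in>I. S \<inter> X i))"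
  using assms
proof (induction I rule: finite_induct)
  case empty
  then show ?case by simp
next
  case (insert i I)
  let ?A = "S \<inter> X i" and ?B = "(\<Union>i\<in>I. S \<inter> X i)"
  have a: "?A = (?A \<union> ?B) \<inter> X i" using insert by blast
  have b: "?B = (?A \<union> ?B) \<inter> (\<Union>i\<in>I. X i)" using insert by blast
  have cl: "closed (\<Union>i\<in>I. X i)" using insert by auto
  have d: "?A \<inter> ?B = {}" using insert by blast
  have c1: "closedin (top_of_set (?A \<union> ?B)) ?A"
    using a insert.prems(1) by (metis closedin_closed_Int insertI1)
  have c2: "closedin (top_of_set (?A \<union> ?B)) ?B"
    using b cl by (metis closedin_closed_Int)
  have IH: "comp_dims ?B = (\<Sum>i\<in>I. comp_dims (S \<inter> X i))" "finite (components ?B)"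
    using insert by auto
  have e: "(\<Union>i\<in>insert i I. S \<inter> X i) = ?A \<union> ?B" by blast
  show ?case
    unfolding e using insert comp_dims_Un[OF c1 c2 d] IH components_Un_closedin[OF c1 c2 d] by simp
qed

lemma connectedI_connected_subsets:
  assumes "\<And>x y. x \<in> S \<Longrightarrow> y \<in> S \<Longrightarrow> \<exists>T. connected T \<and> T \<subseteq> S \<and> x \<in> T \<and> y \<in> T"
  shows "connected S"
  unfolding connected_iff_connected_component
  unfolding connected_component_def
proof (intro ballI)
  fix x y assume "x \<in> S" "y \<in> S"
  from assms[OF this] show "\<exists>T. connected T \<and> T \<subseteq> S \<and> x \<in> T \<and> y \<in> T" .
qed

section \<open>Orthogonal projections\<close>

definition isP :: "real^'m^'m \<Rightarrow> bool" where
  "isP P \<longleftrightarrow> P ** P = P \<and> transpose P = P"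

lemma inner_transpose: "(transpose A *v x) \<bullet> y = x \<bullet> (A *v (y :: real^'m))"
  by (simp add: dot_lmul_matrix)

lemma isP_sym: "isP P \<Longrightarrow> (P *v x) \<bullet> y = x \<bullet> (P *v y)"
  by (metis inner_transpose isP_def)

lemma isP_idem: "isP P \<Longrightarrow> P *v (P *v x) = P *v x"
  by (simp add: isP_def matrix_vector_mul_assoc)

lemma isPI:
  fixes P :: "real^'m^'m"
  assumes "\<And>x. P *v (P *v x) = P *v x" "\<And>x y. (P *v x) \<bullet> y = x \<bullet> (P *v y)"
  shows "isP P"
proof -
  have "transpose P *v x = P *v x" for x
    by (rule vector_eq_ldot[THEN iffD1]) (metis assms(2) inner_commute inner_transpose)
  then show ?thesis
    using assms(1) by (auto simp: isP_def matrix_eq matrix_vector_mul_assoc[symmetric])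
qed

lemma sub_of_iff: "isP P \<Longrightarrow> x \<in> sub_of P \<longleftrightarrow> P *v x = x"
  unfolding sub_of_def by (metis isP_idem rangeE rangeI)

lemma subspace_sub_of: "subspace (sub_of P)"
  unfolding sub_of_def by (simp add: linear_subspace_image)

lemma sub_of_mult [simp]: "P *v x \<in> sub_of P"
  by (simp add: sub_of_def)

text \<open>Equal ranges give \<open>Q ** P = P\<close> and \<open>P ** Q = Q\<close>; transposing
  the first equation gives \<open>P ** Q = P\<close>.\<close>

lemma isP_eqI:
  assumes "isP P" "isP Q" "sub_of P = sub_of Q"
  shows "P = Q"
proof -
  have "Q *v (P *v x) = P *v x" "P *v (Q *v x) = Q *v x" for x
    using assms sub_of_iff sub_of_mult by metis+
  then have "Q ** P = P" "P ** Q = Q"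
    by (auto simp: matrix_eq matrix_vector_mul_assoc[symmetric])
  then show ?thesis
    using assms by (metis isP_def matrix_transpose_mul)
qed

lemma isP_orth: "isP P \<Longrightarrow> y \<in> sub_of P \<Longrightarrow> P *v x = 0 \<Longrightarrow> x \<bullet> y = 0"
  by (metis inner_zero_left isP_sym sub_of_iff)

lemma isP_kerI: "isP P \<Longrightarrow> (\<And>y. y \<in> sub_of P \<Longrightarrow> x \<bullet> y = 0) \<Longrightarrow> P *v x = 0"
  by (metis inner_eq_zero_iff isP_idem isP_sym sub_of_mult)

lemma isP_ker_iff: "isP P \<Longrightarrow> P *v x = 0 \<longleftrightarrow> (\<forall>y\<in>sub_of P. x \<bullet> y = 0)"
  using isP_orth isP_kerI by metis

lemma grass_iff: "P \<in> grass d \<longleftrightarrow> isP P \<and> dim (sub_of P) = d"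
  by (auto simp: grass_def isP_def sub_of_def)

definition outer :: "real^'m \<Rightarrow> real^'m \<Rightarrow> real^'m^'m" where
  "outer v w = (\<chi> i j. v$i * w$j)"

lemma outer_mult: "outer v w *v x = (w \<bullet> x) *\<^sub>R v"
  by (simp add: outer_def matrix_vector_mult_def vec_eq_iff inner_vec_def sum_distrib_left mult_ac)

lemma continuous_on_outer [continuous_intros]:
  "continuous_on S f \<Longrightarrow> continuous_on S g \<Longrightarrow> continuous_on S (\<lambda>x. outer (f x) (g x))"
  unfolding outer_def by (intro continuous_intros)

lemma scaleR_mult_vec: "(k *\<^sub>R A) *v x = k *\<^sub>R (A *v (x::real^'m))"
  by (simp add: scaleR_matrix_vector_assoc)

lemma sum_matrix_mult: "(\<Sum>i\<in>I. A i) *v x = (\<Sum>i\<in>I. A i *v (x::real^'m))"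
  by (induction I rule: infinite_finite_induct) (auto simp: matrix_vector_mult_add_rdistrib)

lemma ex_isP:
  fixes S :: "(real^'m) set"
  assumes "subspace S" shows "\<exists>P. isP P \<and> sub_of P = S"
proof -
  obtain B where B: "B \<subseteq> S" "pairwise orthogonal B" "\<And>x. x \<in> B \<Longrightarrow> norm x = 1"
     "independent B" "span B = S"
    using orthonormal_basis_subspace[OF assms] by metis
  have fin: "finite B" using B(4) independent_imp_finite by blast
  define P where "P = (\<Sum>b\<in>B. outer b b)"
  have Px: "P *v x = (\<Sum>b\<in>B. (b \<bullet> x) *\<^sub>R b)" for x
    by (simp add: P_def sum_matrix_mult outer_mult)
  have PS1: "P *v x = x" if "x \<in> S" for x
    using that unfolding B(5)[symmetric]
  proof (induction rule: span_induct)
    case base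
    then show ?case by (auto simp: subspace_def matrix_vector_right_distrib matrix_vector_mult_scaleR)
  next
    case (step x)
    have "(b \<bullet> x) *\<^sub>R b = (if b = x then x else 0)" if "b \<in> B" for b
      using B(2) B(3)[OF step] that step by (auto simp: pairwise_def orthogonal_def norm_eq_1)
    then show ?case using fin step by (simp add: Px)
  qed
  have PS2: "P *v x \<in> S" for x
    unfolding Px using assms B(1) by (auto intro!: subspace_sum subspace_scale)
  have "isP P"
  proof (rule isPI)
    show "P *v (P *v x) = P *v x" for x using PS1 PS2 by blast
    show "(P *v x) \<bullet> y = x \<bullet> (P *v y)" for x y
      by (simp add: Px inner_sum_left inner_sum_right inner_commute mult.commute)
  qed
  moreover have "sub_of P = S"
    using PS1 PS2 unfolding sub_of_def by (metis image_subset_iff rangeI subsetI subset_antisym)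
  ultimately show ?thesis by blast
qed

lemma isP_add:
  assumes "isP P" "isP Q" "\<And>x y. x \<in> sub_of P \<Longrightarrow> y \<in> sub_of Q \<Longrightarrow> x \<bullet> y = 0"
  shows "isP (P + Q)"
    and "sub_of (P + Q) = {x + y | x y. x \<in> sub_of P \<and> y \<in> sub_of Q}"
proof -
  have PQ: "P *v (Q *v x) = 0" "Q *v (P *v x) = 0" for x
    using assms by (auto intro!: isP_kerI simp: inner_commute) (metis inner_commute sub_of_mult)
  show "isP (P + Q)"
    using assms(1,2) by (intro isPI)
      (auto simp: matrix_vector_mult_add_rdistrib matrix_vector_right_distrib PQ isP_idem isP_sym inner_add_left inner_add_right)
  have "x + y \<in> sub_of (P + Q)" if "x \<in> sub_of P" "y \<in> sub_of Q" for x y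
  proof -
    have xy: "P *v x = x" "Q *v y = y" using that assms(1,2) sub_of_iff by blast+
    then have "P *v y = 0" "Q *v x = 0" using PQ(1)[of y] PQ(2)[of x] by simp_all
    with xy have "(P + Q) *v (x + y) = x + y"
      by (simp add: matrix_vector_mult_add_rdistrib matrix_vector_right_distrib)
    then show ?thesis by (metis sub_of_mult)
  qed
  moreover have "\<exists>x y. z = x + y \<and> x \<in> sub_of P \<and> y \<in> sub_of Q" if "z \<in> sub_of (P + Q)" for z
  proof -
    have "z = P *v z + Q *v z"
      using that sub_of_iff[OF \<open>isP (P + Q)\<close>] by (simp add: matrix_vector_mult_add_rdistrib)
    then show ?thesis using sub_of_mult by blast
  qed
  ultimately show "sub_of (P + Q) = {x + y | x y. x \<in> sub_of P \<and> y \<in> sub_of Q}" by blast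
qed

lemma dim_sum_orthogonal:
  fixes A B :: "'a::euclidean_space set"
  assumes "subspace A" "subspace B" "\<And>x y. x \<in> A \<Longrightarrow> y \<in> B \<Longrightarrow> x \<bullet> y = 0"
  shows "dim {x + y | x y. x \<in> A \<and> y \<in> B} = dim A + dim B"
proof -
  have "{x + y | x y. x \<in> A \<and> y \<in> B} = span (A \<union> B)"
    using assms by (simp add: span_Un span_eq_iff[THEN iffD2])
  then show ?thesis using dim_orthogonal_sum assms(3) by (metis dim_span)
qed

lemma isP_diff:
  assumes "isP P" "isP Q" "sub_of Q \<subseteq> sub_of P"
  shows "isP (P - Q)" "sub_of (P - Q) = {x \<in> sub_of P. Q *v x = 0}"
proof -
  have PQ: "P *v (Q *v x) = Q *v x" for x
    using assms(3) sub_of_iff[OF assms(1)] sub_of_mult[of Q x] by blast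
  have QP: "Q *v (P *v x) = Q *v x" for x
  proof (rule vector_eq_ldot[THEN iffD1], rule allI)
    show "y \<bullet> (Q *v (P *v x)) = y \<bullet> (Q *v x)" for y
      using isP_sym[OF assms(2), of y] isP_sym[OF assms(1), of "Q *v y"] PQ[of y] by simp
  qed
  show *: "isP (P - Q)"
    using assms(1,2) by (intro isPI)
      (auto simp: matrix_vector_mult_diff_rdistrib matrix_vector_mult_diff_distrib PQ QP isP_idem isP_sym inner_diff_left inner_diff_right)
  show "sub_of (P - Q) = {x \<in> sub_of P. Q *v x = 0}"
  proof (intro set_eqI iffI)
    fix x assume "x \<in> sub_of (P - Q)"
    then have x: "P *v x - Q *v x = x" using sub_of_iff[OF *] by (simp add: matrix_vector_mult_diff_rdistrib)
    have "P *v x - Q *v x = P *v x" "Q *v x - Q *v x = Q *v x"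
      using arg_cong[OF x, of "(*v) P"] arg_cong[OF x, of "(*v) Q"] assms(1,2)
      by (simp_all add: matrix_vector_mult_diff_distrib PQ QP isP_idem)
    then have "P *v x = x" "Q *v x = 0" using x by simp_all
    then show "x \<in> {x \<in> sub_of P. Q *v x = 0}" using assms(1) sub_of_iff by blast
  next
    fix x assume "x \<in> {x \<in> sub_of P. Q *v x = 0}"
    then show "x \<in> sub_of (P - Q)"
      using assms(1) by (simp add: sub_of_iff[OF *] sub_of_iff matrix_vector_mult_diff_rdistrib)
  qed
qed

section \<open>Projective spaces as spaces of projections\<close>

text \<open>The parameter \<open>\<kappa>\<close> treats real and complex projective spaces together: for \<open>\<kappa> = 0\<close> the map \<open>J\<close>
  vanishes on \<open>E\<close>, for \<open>\<kappa> = 1\<close> it is an orthogonal complex structure on \<open>E\<close>.\<close>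

definition cstr :: "(real^'m) set \<Rightarrow> (real^'m \<Rightarrow> real^'m) \<Rightarrow> nat \<Rightarrow> bool" where
  "cstr E J \<kappa> \<longleftrightarrow> subspace E \<and> linear J \<and> (\<forall>v\<in>E. J v \<in> E) \<and> (\<forall>v\<in>E. \<forall>w\<in>E. v \<bullet> J w = - (J v \<bullet> w))
     \<and> (\<forall>v\<in>E. J (J v) = - real \<kappa> *\<^sub>R v) \<and> \<kappa> \<in> {0, 1}"

text \<open>The orthogonal projection onto the real or complex line of \<open>v\<close>. One
  normalising factor serves both terms, because \<open>J v\<close> is orthogonal to \<open>v\<close>
  and is either zero or as long as \<open>v\<close>.\<close>

definition Pj :: "(real^'m \<Rightarrow> real^'m) \<Rightarrow> real^'m \<Rightarrow> real^'m^'m" where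
  "Pj J v = (1 / (v \<bullet> v)) *\<^sub>R (outer v v + outer (J v) (J v))"

definition PS :: "(real^'m) set \<Rightarrow> (real^'m \<Rightarrow> real^'m) \<Rightarrow> (real^'m^'m) set" where
  "PS E J = Pj J ` (E - {0})"

lemma Pj_mult: "Pj J v *v x = (1 / (v \<bullet> v)) *\<^sub>R ((v \<bullet> x) *\<^sub>R v + (J v \<bullet> x) *\<^sub>R J v)"
  by (simp add: Pj_def scaleR_mult_vec matrix_vector_mult_add_rdistrib outer_mult)

context
  fixes E :: "(real^'m) set" and J \<kappa>
  assumes cstr: "cstr E J \<kappa>"
begin

lemma cstr_facts:
  "subspace E" "linear J" "v \<in> E \<Longrightarrow> J v \<in> E" "v \<in> E \<Longrightarrow> w \<in> E \<Longrightarrow> v \<bullet> J w = - (J v \<bullet> w)"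
  "v \<in> E \<Longrightarrow> J (J v) = - real \<kappa> *\<^sub>R v" "\<kappa> \<in> {0, 1}"
  using cstr by (auto simp: cstr_def)

lemma J_self: "v \<in> E \<Longrightarrow> v \<bullet> J v = 0" "v \<in> E \<Longrightarrow> J v \<bullet> v = 0"
  using cstr_facts(4)[of v v] by (auto simp: inner_commute)

lemma J_norm: "v \<in> E \<Longrightarrow> w \<in> E \<Longrightarrow> J v \<bullet> J w = real \<kappa> * (v \<bullet> w)"
  using cstr_facts(4)[of "J v" w] cstr_facts(3)[of v] cstr_facts(5)[of v] by simp

lemma J_zero: "v \<in> E \<Longrightarrow> \<kappa> = 0 \<Longrightarrow> J v = 0"
  using J_norm[of v v] by simp

text \<open>Absorbs the factor that \<open>J_norm\<close> introduces, so that one computation covers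
  both values of \<open>\<kappa>\<close>.\<close>

lemma kappa_J: "v \<in> E \<Longrightarrow> real \<kappa> *\<^sub>R J v = J v"
  using J_zero[of v] cstr_facts(6) by (auto)

lemma Pj_self:
  assumes "v \<in> E - {0}"
  shows "Pj J v *v v = v" "Pj J v *v J v = J v"
  using assms J_self[of v] J_norm[of v v] kappa_J[of v] by (auto simp: Pj_mult)

lemma isP_Pj:
  assumes "v \<in> E - {0}" shows "isP (Pj J v)"
proof (rule isPI)
  show "Pj J v *v (Pj J v *v x) = Pj J v *v x" for x
    unfolding Pj_mult[of J v x]
    by (simp add: matrix_vector_mult_scaleR matrix_vector_right_distrib Pj_self[OF assms])
qed (simp add: Pj_mult inner_add_left inner_add_right inner_commute algebra_simps)

lemma sub_of_Pj:
  assumes "v \<in> E - {0}" shows "sub_of (Pj J v) = span {v, J v}"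
proof
  show "sub_of (Pj J v) \<subseteq> span {v, J v}"
    unfolding sub_of_def by (auto simp: Pj_mult intro!: span_scale span_add intro: span_base)
  have "{v, J v} \<subseteq> sub_of (Pj J v)"
    using Pj_self[OF assms] sub_of_iff[OF isP_Pj[OF assms]] by auto
  then show "span {v, J v} \<subseteq> sub_of (Pj J v)"
    by (simp add: span_minimal subspace_sub_of)
qed

lemma dim_span_J:
  assumes "v \<in> E - {0}" shows "dim (span {v, J v}) = 1 + \<kappa>"
proof (cases "\<kappa> = 0")
  case True
  then have "J v = 0" using J_zero assms by simp
  then have "span {v, J v} = span {v}" by (simp add: insert_commute span_insert_0)
  then show ?thesis using True assms by (simp add: dim_insert)
next
  case False
  then have k: "\<kappa> = 1" using cstr_facts(6) by auto
  have n: "J v \<noteq> 0" "v \<noteq> 0" using J_norm[of v v] assms k by auto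
  have "v \<noteq> J v" using J_self[of v] n assms by auto
  moreover have "independent {v, J v}"
    using J_self[of v] n assms by (intro pairwise_orthogonal_independent) (auto simp: pairwise_def orthogonal_def)
  ultimately show ?thesis using k by (simp add: dim_eq_card_independent)
qed

text \<open>Any nonzero \<open>v\<close> in a \<open>J\<close>-stable subspace generates together
  with \<open>J v\<close> a subspace of dimension \<open>1 + \<kappa>\<close>, which by the
  dimension count is everything.\<close>

lemma PS_eq:
  "PS E J = {P \<in> grass (1 + \<kappa>). sub_of P \<subseteq> E \<and> (\<forall>x\<in>sub_of P. J x \<in> sub_of P)}"
proof (intro set_eqI iffI)
  fix P assume "P \<in> PS E J"
  then obtain v where v: "v \<in> E - {0}" and P: "P = Pj J v" by (auto simp: PS_def)
  have "P \<in> grass (1 + \<kappa>)"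
    using v P isP_Pj sub_of_Pj dim_span_J by (simp add: grass_iff)
  moreover have "span {v, J v} \<subseteq> E"
    using v cstr_facts(1,3) by (intro span_minimal) auto
  moreover have "J x \<in> span {v, J v}" if "x \<in> span {v, J v}" for x
  proof -
    have "J x \<in> J ` span {v, J v}" using that by blast
    also have "J ` span {v, J v} = span {J v, J (J v)}"
      using linear_span_image[OF cstr_facts(2), of "{v, J v}"] by simp
    also have "\<dots> \<subseteq> span {v, J v}"
      using cstr_facts(5)[of v] v by (intro span_minimal) (auto intro: span_base span_scale span_neg)
    finally show ?thesis .
  qed
  ultimately show "P \<in> {P \<in> grass (1 + \<kappa>). sub_of P \<subseteq> E \<and> (\<forall>x\<in>sub_of P. J x \<in> sub_of P)}"
    using P sub_of_Pj[OF v] by auto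
next
  fix P assume "P \<in> {P \<in> grass (1 + \<kappa>). sub_of P \<subseteq> E \<and> (\<forall>x\<in>sub_of P. J x \<in> sub_of P)}"
  then have P: "isP P" "dim (sub_of P) = 1 + \<kappa>" "sub_of P \<subseteq> E" "\<And>x. x \<in> sub_of P \<Longrightarrow> J x \<in> sub_of P"
    by (auto simp: grass_iff)
  then obtain v where v: "v \<in> sub_of P" "v \<noteq> 0"
    by (metis add_is_0 dim_eq_0 singletonI subsetI zero_neq_one)
  have "span {v, J v} \<subseteq> sub_of P"
    using v P(4) by (intro span_minimal) (auto simp: subspace_sub_of)
  moreover have vE: "v \<in> E - {0}" using v P by auto
  ultimately have "span {v, J v} = sub_of P"
    using dim_span_J[OF vE] P(2) by (intro subspace_dim_equal) (auto simp: subspace_sub_of)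
  then have "P = Pj J v"
    using isP_eqI P(1) isP_Pj[OF vE] sub_of_Pj[OF vE] by metis
  then show "P \<in> PS E J" using vE by (auto simp: PS_def)
qed

lemma continuous_on_Pj: "continuous_on (E - {0}) (Pj J)"
proof -
  have "continuous_on (E - {0}) J"
    using cstr_facts(2) linear_continuous_on linear_conv_bounded_linear by blast
  then show ?thesis
    unfolding Pj_def[abs_def] by (intro continuous_intros) auto
qed

text \<open>A punctured subspace is connected except in dimension one; in that case every member has
  range \<open>E\<close>, so there is at most one.\<close>

lemma connected_PS: "connected (PS E J)"
proof (cases "dim E = 1")
  case False
  have "aff_dim E \<noteq> 1" using cstr_facts(1) False by (simp add: aff_dim_subspace)
  then have "connected (E - {0})"
    by (intro connected_punctured_convex) (auto simp: cstr_facts(1) subspace_imp_convex)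
  then show ?thesis
    unfolding PS_def by (intro connected_continuous_image continuous_on_Pj)
next
  case True
  have "P = Q" if "P \<in> PS E J" "Q \<in> PS E J" for P Q
  proof (rule isP_eqI)
    have *: "isP R \<and> sub_of R = E" if "R \<in> PS E J" for R
    proof -
      have "isP R" "sub_of R \<subseteq> E" "dim (sub_of R) = 1 + \<kappa>"
        using that PS_eq by (auto simp: grass_iff)
      moreover have "sub_of R = E"
        using calculation True by (intro subspace_dim_equal) (auto simp: subspace_sub_of cstr_facts(1))
      ultimately show ?thesis by simp
    qed
    show "isP P" "isP Q" "sub_of P = sub_of Q" using * that by auto
  qed
  then show ?thesis by (metis connected_iff_connected_component connected_component_refl)
qed

lemma Pj_scale_rot:
  assumes "v \<in> E - {0}" "w = a *\<^sub>R v + b *\<^sub>R J v" "w \<noteq> 0"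
  shows "Pj J w = Pj J v"
proof (rule isP_eqI)
  have w: "w \<in> E - {0}"
    using assms cstr_facts(1,3) by (auto intro!: subspace_add subspace_scale)
  show "isP (Pj J w)" "isP (Pj J v)" using w assms isP_Pj by auto
  have "Pj J v \<in> PS E J" using assms(1) by (auto simp: PS_def)
  then have "J w \<in> sub_of (Pj J v)" "w \<in> sub_of (Pj J v)"
    using PS_eq assms sub_of_Pj[OF assms(1)] by (auto intro!: span_add span_scale intro: span_base)
  then have "sub_of (Pj J w) \<subseteq> sub_of (Pj J v)"
    unfolding sub_of_Pj[OF w] by (intro span_minimal) (auto simp: subspace_sub_of)
  then show "sub_of (Pj J w) = sub_of (Pj J v)"
    using w assms dim_span_J sub_of_Pj by (intro subspace_dim_equal) (auto simp: subspace_sub_of)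
qed

text \<open>The chart around the line of a unit vector \<open>v\<close> sends \<open>w\<close>, orthogonal to \<open>v\<close> and \<open>J v\<close>, to the
  line of \<open>v + w\<close>; it is inverted by rescaling \<open>P v\<close> to have inner product \<open>1\<close> with \<open>v\<close>.\<close>

lemma locally_dim_PS:
  assumes "E \<noteq> {0}"
  shows "locally_dim (PS E J) (dim E - (1 + \<kappa>))"
proof (rule locally_dimI)
  have "E - {0} \<noteq> {}" using assms cstr_facts(1) subspace_0 by blast
  then show "PS E J \<noteq> {}" by (auto simp: PS_def)
  fix P0 assume "P0 \<in> PS E J"
  then obtain u where u: "u \<in> E - {0}" "P0 = Pj J u" by (auto simp: PS_def)
  define v where "v = (1 / norm u) *\<^sub>R u"
  have vE: "v \<in> E - {0}" using u cstr_facts(1) by (auto simp: v_def subspace_scale)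
  have vv: "v \<bullet> v = 1" using u by (auto simp: v_def dot_square_norm power2_eq_square)
  have P0: "P0 = Pj J v"
    using Pj_scale_rot[OF u(1), of v "1 / norm u" 0] u vE by (simp add: v_def)
  define T where "T = {w \<in> E. \<forall>x\<in>span {v, J v}. orthogonal x w}"
  have TE: "T \<subseteq> E" by (auto simp: T_def)
  have T: "w \<in> T \<longleftrightarrow> w \<in> E \<and> w \<bullet> v = 0 \<and> w \<bullet> J v = 0" for w
  proof -
    have "orthogonal x w" if "w \<bullet> v = 0" "w \<bullet> J v = 0" "x \<in> span {v, J v}" for x
    proof -
      have "orthogonal w x"
        by (rule orthogonal_to_span[OF that(3)]) (use that in \<open>auto simp: orthogonal_def\<close>)
      then show ?thesis by (simp add: orthogonal_commute)
    qed
    moreover have "v \<in> span {v, J v}" "J v \<in> span {v, J v}" by (auto intro: span_base)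
    ultimately show ?thesis unfolding T_def by (auto simp: orthogonal_def inner_commute)
  qed
  have subT: "subspace T"
    unfolding subspace_def using cstr_facts(1) by (auto simp: T subspace_0 subspace_add subspace_scale inner_add_left)
  have sp: "span {v, J v} \<subseteq> E"
    using vE cstr_facts(1,3) by (intro span_minimal) auto
  have dT: "dim T = dim E - (1 + \<kappa>)"
    using dim_subspace_orthogonal_to_vectors[OF subspace_span cstr_facts(1) sp] dim_span_J[OF vE]
    by (simp add: T_def)
  \<comment> \<open>Since \<open>(P *v v) \<bullet> v\<close> is the squared length of
    \<open>P *v v\<close>, these are the lines not orthogonal to \<open>v\<close>.\<close>
  define U where "U = {P \<in> PS E J. (P *v v) \<bullet> v > 0}"
  define h where "h = (\<lambda>w. Pj J (v + w))"
  define k where "k = (\<lambda>P. (1 / ((P *v v) \<bullet> v)) *\<^sub>R (P *v v) - v)"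
  have c1: "continuous_on X (\<lambda>P. P *v v)" for X
    by (intro linear_continuous_on) (simp add: linear_conv_bounded_linear[symmetric] linear_iff matrix_vector_mult_add_rdistrib scaleR_mult_vec)
  have vw: "v + w \<in> E - {0}" "v \<bullet> (v + w) = 1" "J (v + w) \<bullet> v = 0" if "w \<in> T" for w
  proof -
    show 2: "v \<bullet> (v + w) = 1" using that vv by (simp add: T inner_add_right inner_commute)
    show "v + w \<in> E - {0}" using that vE cstr_facts(1) 2 by (auto simp: T subspace_add)
    then show "J (v + w) \<bullet> v = 0"
      using cstr_facts(4)[of "v + w" v] that vE J_self[of v] by (auto simp: T inner_add_left)
  qed
  have hv: "h w *v v = (1 / ((v + w) \<bullet> (v + w))) *\<^sub>R (v + w)" if "w \<in> T" for w
    unfolding h_def Pj_mult using vw[OF that] by (simp add: inner_commute)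
  have hvv: "(h w *v v) \<bullet> v = 1 / ((v + w) \<bullet> (v + w))" if "w \<in> T" for w
    unfolding hv[OF that] using vw[OF that] by (simp add: inner_commute)
  have hom: "homeomorphism T U h k"
    unfolding homeomorphism_def
  proof (intro conjI ballI)
    show kh: "k (h w) = w" if "w \<in> T" for w
    proof -
      have "(v + w) \<bullet> (v + w) \<noteq> 0" using vw(1)[OF that] by auto
      moreover have "(v + w) \<bullet> v = 1" using vw(2)[OF that] by (simp add: inner_commute)
      ultimately show ?thesis unfolding k_def hvv[OF that] hv[OF that] by simp
    qed
    have hU: "h w \<in> U" if "w \<in> T" for w
      using vw(1)[OF that] hvv[OF that] by (auto simp: U_def PS_def h_def)
    have kU: "k P \<in> T \<and> h (k P) = P" if "P \<in> U" for P
    proof -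
      obtain x where x: "x \<in> E - {0}" "P = Pj J x" using \<open>P \<in> U\<close> by (auto simp: U_def PS_def)
      define z where "z = P *v v"
      have zpos: "z \<bullet> v > 0" using \<open>P \<in> U\<close> by (simp add: U_def z_def)
      have z: "z = ((x \<bullet> v) / (x \<bullet> x)) *\<^sub>R x + ((J x \<bullet> v) / (x \<bullet> x)) *\<^sub>R J x"
        by (simp add: z_def x Pj_mult scaleR_add_right)
      have k: "v + k P = ((x \<bullet> v) / (x \<bullet> x) / (z \<bullet> v)) *\<^sub>R x + ((J x \<bullet> v) / (x \<bullet> x) / (z \<bullet> v)) *\<^sub>R J x"
        unfolding k_def z_def[symmetric] by (subst (2) z) (simp add: scaleR_add_right mult.commute)
      have zE: "z \<in> E" unfolding z using x cstr_facts(1,3) by (auto intro!: subspace_add subspace_scale)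
      \<comment> \<open>The contributions of \<open>x\<close> and of \<open>J x\<close> cancel: for
        \<open>\<kappa> = 1\<close> by skewness of \<open>J\<close>, while for
        \<open>\<kappa> = 0\<close> each of them vanishes.\<close>
      have zJ: "z \<bullet> J v = 0"
      proof -
        have "x \<bullet> J v = - (J x \<bullet> v)" "J x \<bullet> J v = real \<kappa> * (x \<bullet> v)"
          using cstr_facts(4)[of x v] J_norm[of x v] x vE by auto
        moreover have "real \<kappa> * (J x \<bullet> v) = J x \<bullet> v"
          using kappa_J[of x] x by (metis DiffD1 inner_scaleR_left)
        ultimately show ?thesis unfolding z by (auto simp: inner_add_left)
      qed
      have "k P \<in> T"
        unfolding T k_def z_def[symmetric] using zE vE zpos zJ vv J_self[of v] cstr_facts(1)
        by (auto simp: inner_diff_left intro!: subspace_diff subspace_scale)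
      then show ?thesis
        using Pj_scale_rot[OF x(1) k] vw(1) x(2) by (auto simp: h_def)
    qed
    show "h ` T = U"
    proof (intro subset_antisym subsetI)
      fix P assume "P \<in> U"
      with kU show "P \<in> h ` T" by (intro rev_image_eqI[of "k P"]) auto
    qed (use hU in auto)
    show "k ` U = T"
    proof (intro subset_antisym subsetI)
      fix w assume "w \<in> T"
      with kh hU show "w \<in> k ` U" by (intro rev_image_eqI[of "h w"]) auto
    qed (use kU in auto)
    show "h (k P) = P" if "P \<in> U" for P using kU that by blast
    show "continuous_on T h"
      unfolding h_def
      by (rule continuous_on_compose2[OF continuous_on_Pj]) (use vw in \<open>auto intro!: continuous_intros\<close>)
    show "continuous_on U k"
      unfolding k_def by (intro continuous_intros c1) (auto simp: U_def)
  qed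
  have "U = PS E J \<inter> {P. 0 < (P *v v) \<bullet> v}" by (auto simp: U_def)
  moreover have "open {P. 0 < (P *v v) \<bullet> v}"
    by (intro open_Collect_less continuous_intros c1)
  ultimately have "openin (top_of_set (PS E J)) U"
    by (simp add: openin_open_Int)
  moreover have "P0 \<in> U"
    using \<open>P0 \<in> PS E J\<close> Pj_self[OF vE] vv by (auto simp: U_def P0)
  moreover have "U homeomorphic T"
    using hom homeomorphism_symD unfolding homeomorphic_def by blast
  ultimately show "\<exists>U (T::(real^'m) set) V. openin (top_of_set (PS E J)) U \<and> P0 \<in> U \<and>
      subspace T \<and> dim T = dim E - (1 + \<kappa>) \<and> openin (top_of_set T) V \<and> U homeomorphic V"
    using subT dT openin_subtopology_self by blast
qed

end

section \<open>Invariant subspaces of linear isometries\<close>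

text \<open>Only the restriction to \<open>W\<close> is isometric: the Lorentz transformations to
  which this is applied preserve the Euclidean norm merely on a spacelike subspace.\<close>

definition isoW :: "(real^'m \<Rightarrow> real^'m) \<Rightarrow> (real^'m) set \<Rightarrow> bool" where
  "isoW A W \<longleftrightarrow> linear A \<and> subspace W \<and> (\<forall>x\<in>W. A x \<in> W \<and> norm (A x) = norm x)"

definition Er :: "('a::real_vector \<Rightarrow> 'a) \<Rightarrow> 'a set \<Rightarrow> real \<Rightarrow> 'a set" where
  "Er A W e = {x \<in> W. A x = e *\<^sub>R x}"

text \<open>The real eigenspace of the pair \<open>exp (\<plusminus> i t)\<close> with \<open>c = cos t\<close>; its real dimension is twice the multiplicity.\<close>

definition Wc :: "('a::real_vector \<Rightarrow> 'a) \<Rightarrow> 'a set \<Rightarrow> real \<Rightarrow> 'a set" where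
  "Wc A W c = {x \<in> W. A (A x) - (2 * c) *\<^sub>R A x + x = 0}"

definition Wcs :: "('a::real_vector \<Rightarrow> 'a) \<Rightarrow> 'a set \<Rightarrow> real set" where
  "Wcs A W = {c. -1 < c \<and> c < 1 \<and> Wc A W c \<noteq> {0}}"

definition GG :: "(real^'m \<Rightarrow> real^'m) \<Rightarrow> (real^'m) set \<Rightarrow> (real^'m) set \<Rightarrow> nat \<Rightarrow> ((real^'m^'m) \<times> (real^'m)) set" where
  "GG A W K k = {(P, q). P \<in> grass k \<and> sub_of P \<subseteq> W \<and> (\<forall>x\<in>sub_of P. A x \<in> sub_of P) \<and> q \<in> K \<and> P *v q = 0}"

text \<open>The pairs whose subspace splits along \<open>E\<close> and \<open>F\<close>; for the eigenspaces \<open>1\<close> and \<open>-1\<close> these are the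
  ones with \<open>A\<^sup>2 = id\<close> on the subspace.\<close>

definition Gen :: "nat \<Rightarrow> (real^'m) set \<Rightarrow> (real^'m) set \<Rightarrow> (real^'m) set \<Rightarrow> ((real^'m^'m) \<times> (real^'m)) set" where
  "Gen d E F K = {(P, q). P \<in> grass d \<and> (\<forall>x\<in>sub_of P. \<exists>a\<in>sub_of P \<inter> E. \<exists>b\<in>sub_of P \<inter> F. x = a + b)
      \<and> q \<in> K \<and> P *v q = 0}"

lemma isoW_inner:
  assumes "isoW A W" "x \<in> W" "y \<in> W" shows "A x \<bullet> A y = x \<bullet> y"
proof -
  have "x + y \<in> W" using assms by (auto simp: isoW_def subspace_add)
  then have "norm (A x + A y) = norm (x + y)"
    using assms by (auto simp: isoW_def linear_add[symmetric])
  then show ?thesis using assms by (simp add: isoW_def dot_norm)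
qed

lemma subspace_Er: "linear A \<Longrightarrow> subspace W \<Longrightarrow> subspace (Er A W e)"
  by (auto simp: subspace_def Er_def linear_add linear_scale linear_0 scaleR_add_right)

lemma subspace_Wc:
  assumes "linear A" "subspace W" shows "subspace (Wc A W c)"
proof -
  have "linear (\<lambda>x. A (A x) - (2 * c) *\<^sub>R A x + x)"
    using assms(1) by (auto simp: linear_iff algebra_simps)
  then have "subspace (W \<inter> {x. A (A x) - (2 * c) *\<^sub>R A x + x = 0})"
    using assms(2) by (intro subspace_inter linear_subspace_kernel)
  then show ?thesis by (simp add: Wc_def Int_def)
qed

lemma continuous_on_mult_vec [continuous_intros]:
  fixes f :: "'a::topological_space \<Rightarrow> real^'m^'m"
  assumes "continuous_on S f" "continuous_on S g"
  shows "continuous_on S (\<lambda>z. f z *v g z)"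
  unfolding matrix_vector_mult_def using assms by (intro continuous_intros)

lemma isP_zero: "isP 0" "sub_of (0 :: real^'m^'m) = {0}"
  by (auto simp: isP_def sub_of_def matrix_eq)

lemma grass_0: "grass 0 = {0 :: real^'m^'m}"
proof -
  have "P = 0" if "isP P" "dim (sub_of P) = 0" for P :: "real^'m^'m"
  proof (rule isP_eqI[OF that(1) isP_zero(1)])
    have "sub_of P \<subseteq> {0}" using that(2) by simp
    moreover have "0 \<in> sub_of P" using subspace_sub_of subspace_0 by blast
    ultimately show "sub_of P = sub_of 0" using isP_zero(2) by auto
  qed
  then show ?thesis using isP_zero by (auto simp: grass_iff)
qed

lemma locally_dim_singleton: "locally_dim {a :: 'a::euclidean_space} 0"
proof (rule locally_dim_homeomorphic)
  show "{0 :: 'a} homeomorphic {a}" by (simp add: homeomorphic_finite)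
  show "locally_dim {0 :: 'a} 0" using locally_dim_subspace[OF subspace_single_0] by simp
qed

lemma comp_dims_GG_0:
  assumes "linear A" "subspace W" "subspace K"
  shows "comp_dims (GG A W K 0) = {#dim K#}"
proof -
  have "(P, q) \<in> GG A W K 0 \<longleftrightarrow> P = 0 \<and> q \<in> K" for P q
    using subspace_0[OF assms(2)] linear_0[OF assms(1)] unfolding GG_def grass_0 by (auto simp: isP_zero(2))
  then have "GG A W K 0 = {0} \<times> K" by auto
  moreover have "locally_dim ({0 :: real^'a^'a} \<times> K) (0 + dim K)"
    by (rule locally_dim_Times[OF locally_dim_singleton locally_dim_subspace[OF assms(3)]])
  moreover have "connected ({0 :: real^'a^'a} \<times> K)"
    by (rule connected_Times[OF connected_sing convex_connected[OF subspace_imp_convex[OF assms(3)]]])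
  ultimately show ?thesis using comp_dims_connected[of "{0 :: real^'a^'a} \<times> K" "0 + dim K"] by simp
qed

text \<open>The admissible \<open>q\<close> over \<open>P\<close> are the vectors
  \<open>x - P *v x\<close> with \<open>x\<close> in \<open>K\<close>, so the total space is a
  continuous image of \<open>S \<times> K\<close>; no local triviality enters.\<close>

lemma connected_fiber:
  fixes S :: "(real^'m^'m) set"
  assumes "connected S" "subspace K" "\<And>P. P \<in> S \<Longrightarrow> isP P" "\<And>P x. P \<in> S \<Longrightarrow> x \<in> K \<Longrightarrow> P *v x \<in> K"
  shows "connected {(P, q). P \<in> S \<and> q \<in> K \<and> P *v q = 0}"
proof -
  have "connected ((\<lambda>(P, x). (P, x - P *v x)) ` (S \<times> K))"
    using convex_connected[OF subspace_imp_convex[OF assms(2)]] assms(1)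
    by (intro connected_continuous_image connected_Times)
       (auto simp: case_prod_beta intro!: continuous_intros)
  moreover have "(\<lambda>(P, x). (P, x - P *v x)) ` (S \<times> K) = {(P, q). P \<in> S \<and> q \<in> K \<and> P *v q = 0}" (is "?L = ?R")
  proof (intro subset_antisym subsetI)
    fix z assume "z \<in> ?L"
    then show "z \<in> ?R"
      using assms by (auto simp: subspace_diff matrix_vector_mult_diff_distrib isP_idem)
  next
    fix z assume "z \<in> ?R"
    then show "z \<in> ?L" by (intro image_eqI[of _ _ z]) auto
  qed
  ultimately show ?thesis by simp
qed

lemma cstr_0: "subspace E \<Longrightarrow> cstr E (\<lambda>_. 0) 0"
  by (auto simp: cstr_def subspace_0 linear_zero)

lemma PS_0_eq:
  assumes "subspace E" shows "PS E (\<lambda>_. 0) = {P \<in> grass 1. sub_of P \<subseteq> E}"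
  using PS_eq[OF cstr_0[OF assms]] subspace_0[OF subspace_sub_of] by auto

text \<open>The two positions of \<open>K\<close> that occur: it is the eigenspace containing the
  range of \<open>P\<close>, or it is orthogonal to that range and \<open>P\<close> annihilates
  it.\<close>

lemma isP_keepK:
  assumes "isP P" "sub_of P \<subseteq> E" "x \<in> K" "subspace K"
    and "K = E \<or> (\<forall>x\<in>K. \<forall>y\<in>E. x \<bullet> y = 0)"
  shows "P *v x \<in> K"
  using assms(5)
proof
  assume "K = E" then show ?thesis using assms(2) sub_of_mult by blast
next
  assume "\<forall>x\<in>K. \<forall>y\<in>E. x \<bullet> y = 0"
  then have "P *v x = 0" using assms by (intro isP_kerI) auto
  then show ?thesis using assms(4) subspace_0 by auto
qed

text \<open>Two planes through \<open>v\<close> and \<open>w\<close> are joined by the planes through \<open>v\<close>, those through \<open>w\<close>, and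
  a plane containing both.\<close>

lemma connected_Gr2:
  assumes E: "subspace E" shows "connected {P \<in> grass 2. sub_of P \<subseteq> (E :: (real^'m) set)}"
proof -
  define pr where "pr = (\<lambda>v :: real^'m. Pj (\<lambda>_. 0) v)"
  define H where "H v = {x \<in> E. x \<bullet> v = 0}" for v
  have H: "subspace (H v)" "H v \<subseteq> E" for v
    using E by (auto simp: H_def subspace_def inner_add_left)
  have pr: "isP (pr v)" "sub_of (pr v) = span {v}" if "v \<noteq> 0" for v
  proof -
    have "v \<in> UNIV - {0}" using that by simp
    from isP_Pj[OF cstr_0[OF subspace_UNIV] this] sub_of_Pj[OF cstr_0[OF subspace_UNIV] this]
    show "isP (pr v)" "sub_of (pr v) = span {v}"
      by (auto simp: pr_def insert_commute span_insert_0)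
  qed
  \<comment> \<open>The planes of \<open>E\<close> through \<open>v\<close>, parametrised by the
    line in which they meet the orthogonal complement of \<open>v\<close>.\<close>
  define C where "C v = (\<lambda>Q. pr v + Q) ` PS (H v) (\<lambda>_. 0)" for v
  have conC: "connected (C v)" for v
    unfolding C_def by (intro connected_continuous_image connected_PS[OF cstr_0[OF H(1)]] continuous_intros)
  have CG: "P \<in> C v" if P: "P \<in> grass 2" "sub_of P \<subseteq> E" and v: "v \<in> sub_of P" "v \<noteq> 0" for P v
  proof -
    have iP: "isP P" using P grass_iff by blast
    have sv: "sub_of (pr v) \<subseteq> sub_of P"
      unfolding pr(2)[OF v(2)] using v by (intro span_minimal) (auto simp: subspace_sub_of)
    note D = isP_diff[OF iP pr(1)[OF v(2)] sv]
    have "pr v *v x = 0 \<longleftrightarrow> x \<bullet> v = 0" for x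
      using v(2) by (simp add: pr_def Pj_mult inner_commute)
    then have s: "sub_of (P - pr v) = {x \<in> sub_of P. x \<bullet> v = 0}" using D(2) by simp
    have "{y \<in> sub_of P. \<forall>x\<in>span {v}. orthogonal x y} = {x \<in> sub_of P. x \<bullet> v = 0}"
      by (auto simp: span_singleton orthogonal_def inner_commute)
    then have "dim (sub_of (P - pr v)) + 1 = 2"
      using dim_subspace_orthogonal_to_vectors[OF subspace_span subspace_sub_of, of "{v}" P] sv pr(2)[OF v(2)] P(1) v(2)
      by (simp add: s grass_iff dim_insert)
    then have "P - pr v \<in> PS (H v) (\<lambda>_. 0)"
      unfolding PS_0_eq[OF H(1)] using D(1) P(2) s by (auto simp: grass_iff H_def)
    then show ?thesis unfolding C_def by (intro image_eqI[of _ _ "P - pr v"]) auto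
  qed
  have CG': "C v \<subseteq> {P \<in> grass 2. sub_of P \<subseteq> E}" "\<And>P. P \<in> C v \<Longrightarrow> v \<in> sub_of P" if v: "v \<in> E" "v \<noteq> 0" for v
  proof -
    have "P \<in> grass 2 \<and> sub_of P \<subseteq> E \<and> v \<in> sub_of P" if PC: "P \<in> C v" for P
    proof -
      obtain Q where PQ: "P = pr v + Q" "Q \<in> PS (H v) (\<lambda>_. 0)"
        using PC unfolding C_def by blast
      then have Q: "P = pr v + Q" "isP Q" "dim (sub_of Q) = 1" "sub_of Q \<subseteq> H v"
        unfolding PS_0_eq[OF H(1)] by (simp_all add: grass_iff)
      have o: "x \<bullet> y = 0" if "x \<in> sub_of (pr v)" "y \<in> sub_of Q" for x y
        using that Q(4) pr(2)[OF v(2)] by (auto simp: span_singleton H_def inner_commute)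
      have A: "isP (pr v + Q)" "sub_of (pr v + Q) = {x + y |x y. x \<in> sub_of (pr v) \<and> y \<in> sub_of Q}"
        by (rule isP_add[OF pr(1)[OF v(2)] Q(2)]; use o in blast)+
      have "dim (sub_of P) = 2"
        using A(2) dim_sum_orthogonal[of "sub_of (pr v)" "sub_of Q", OF subspace_sub_of subspace_sub_of o] Q(1,3)
          pr(2)[OF v(2)] v(2)
        by (simp add: dim_insert)
      moreover have "sub_of P \<subseteq> E"
        unfolding Q(1) A(2) using pr(2)[OF v(2)] span_minimal[of "{v}" E] v(1) E Q(4) H(2)[of v]
        by (auto intro!: subspace_add)
      moreover have "v \<in> sub_of P"
      proof -
        have "v \<in> sub_of (pr v)" "v = v + 0" unfolding pr(2)[OF v(2)] by (auto simp: span_base)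
        then show ?thesis unfolding Q(1) A(2) using subspace_0[OF subspace_sub_of, of Q] by blast
      qed
      ultimately show ?thesis using A(1) Q(1) by (simp add: grass_iff)
    qed
    then show "C v \<subseteq> {P \<in> grass 2. sub_of P \<subseteq> E}" "\<And>P. P \<in> C v \<Longrightarrow> v \<in> sub_of P" by auto
  qed
  show ?thesis
  proof (rule connectedI_connected_subsets)
    fix P Q assume PQ: "P \<in> {P \<in> grass 2. sub_of P \<subseteq> E}" "Q \<in> {P \<in> grass 2. sub_of P \<subseteq> E}"
    then obtain v w where v: "v \<in> sub_of P" "v \<noteq> 0" and w: "w \<in> sub_of Q" "w \<noteq> 0"
      by (metis (no_types, lifting) dim_eq_0 grass_iff mem_Collect_eq singletonI subsetI zero_neq_numeral)
    have vE: "v \<in> E" "w \<in> E" using v w PQ by auto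
    have PC: "P \<in> C v" "Q \<in> C w" using CG PQ v w by auto
    show "\<exists>T. connected T \<and> T \<subseteq> {P \<in> grass 2. sub_of P \<subseteq> E} \<and> P \<in> T \<and> Q \<in> T"
    proof (cases "dim {v, w} = 2")
      case True
      obtain R where R: "isP R" "sub_of R = span {v, w}" using ex_isP[OF subspace_span] by blast
      have "R \<in> grass 2" "sub_of R \<subseteq> E"
        using R True vE E by (auto simp: grass_iff span_minimal subsetD)
      then have "R \<in> C v" "R \<in> C w" using CG R v w by (auto simp: span_base)
      then have "connected (C v \<union> C w)" using conC by (intro connected_Un) auto
      then show ?thesis using PC CG'(1)[OF vE(1) v(2)] CG'(1)[OF vE(2) w(2)] by blast
    next
      case False
      have "dim {v, w} \<noteq> 0" using v(2) by simp
      moreover have "dim {v, w} \<le> 2" by (simp add: dim_insert)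
      ultimately have "dim (span {v, w}) = 1" unfolding dim_span using False by linarith
      moreover have "span {w} \<subseteq> span {v, w}" by (simp add: span_mono)
      ultimately have "span {w} = span {v, w}" using w(2) by (intro subspace_dim_equal) (auto simp: dim_insert)
      then have "v \<in> span {w}" by (simp add: span_base)
      then have "v \<in> sub_of Q" using span_minimal[of "{w}" "sub_of Q"] w(1) subspace_sub_of by auto
      then have "Q \<in> C v" using CG PQ v by auto
      then show ?thesis using conC PC CG'(1)[OF vE(1) v(2)] by blast
    qed
  qed
qed

section \<open>Lines and planes that split along two orthogonal eigenspaces\<close>

lemma Gen_1_eq:
  assumes "subspace E"
  shows "Gen 1 E {0} K = {(P, q). P \<in> PS E (\<lambda>_. 0) \<and> q \<in> K \<and> P *v q = 0}"
proof -
  have "(\<forall>x\<in>sub_of P. \<exists>a\<in>sub_of P \<inter> E. \<exists>b\<in>sub_of P \<inter> {0}. x = a + b) \<longleftrightarrow> sub_of P \<subseteq> E" for P :: "real^'a^'a"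
    using subspace_0[OF subspace_sub_of, of P] by fastforce
  then show ?thesis unfolding Gen_def PS_0_eq[OF assms] by auto
qed

lemma connected_Gen_1:
  assumes "subspace E" "subspace K" "K = E \<or> (\<forall>x\<in>K. \<forall>y\<in>E. x \<bullet> y = 0)"
  shows "connected (Gen 1 E {0} K)"
  unfolding Gen_1_eq[OF assms(1)]
proof (rule connected_fiber[OF connected_PS[OF cstr_0[OF assms(1)]] assms(2)])
  fix P assume "P \<in> PS E (\<lambda>_. 0)"
  then have P: "isP P" "sub_of P \<subseteq> E" by (auto simp: PS_0_eq[OF assms(1)] grass_iff)
  then show "isP P" by simp
  show "P *v x \<in> K" if "x \<in> K" for x using isP_keepK[OF P that assms(2,3)] .
qed

lemma comp_dims_PS_Times:
  assumes "cstr E J \<kappa>" "subspace K" "E \<noteq> {0}"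
  shows "comp_dims (PS E J \<times> K) = {#dim E - (1 + \<kappa>) + dim K#}" "connected (PS E J \<times> K)"
proof -
  show c: "connected (PS E J \<times> K)"
    using assms(2) by (intro connected_Times connected_PS[OF assms(1)] convex_connected subspace_imp_convex)
  show "comp_dims (PS E J \<times> K) = {#dim E - (1 + \<kappa>) + dim K#}"
    by (intro comp_dims_connected[OF c] locally_dim_Times locally_dim_PS[OF assms(1)] locally_dim_subspace assms)
qed

text \<open>For \<open>K\<close> orthogonal to \<open>E\<close> the condition
  \<open>P *v q = 0\<close> is automatic, and the piece is the product of a real projective space
  with \<open>K\<close>. For \<open>E = {0}\<close> the projective space is empty.\<close>

lemma comp_dims_Gen_1:
  assumes "subspace E" "subspace K" "\<And>x y. x \<in> K \<Longrightarrow> y \<in> E \<Longrightarrow> x \<bullet> y = 0"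
  shows "comp_dims (Gen 1 E {0} K) = (if dim E = 0 then {#} else {#dim E - 1 + dim K#})"
proof -
  have "P *v q = 0" if "P \<in> PS E (\<lambda>_. 0)" "q \<in> K" for P q
    using that assms(3) by (intro isP_kerI) (auto simp: PS_0_eq[OF assms(1)] grass_iff)
  then have eq: "Gen 1 E {0} K = PS E (\<lambda>_. 0) \<times> K"
    unfolding Gen_1_eq[OF assms(1)] by auto
  have 0: "E = {0} \<longleftrightarrow> dim E = 0" using subspace_0[OF assms(1)] by auto
  show ?thesis
  proof (cases "E = {0}")
    case True
    then have "PS E (\<lambda>_. 0) = {}" by (simp add: PS_def)
    then show ?thesis using True eq 0 by simp
  next
    case False
    then show ?thesis using comp_dims_PS_Times(1)[OF cstr_0[OF assms(1)] assms(2) False] 0 eq by simp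
  qed
qed

declare transpose_matrix_vector [simp del]

lemma homeomorphicI:
  assumes "continuous_on S h" "continuous_on T k"
    and "\<And>x. x \<in> S \<Longrightarrow> h x \<in> T" "\<And>x. x \<in> S \<Longrightarrow> k (h x) = x"
    and "\<And>y. y \<in> T \<Longrightarrow> k y \<in> S" "\<And>y. y \<in> T \<Longrightarrow> h (k y) = y"
  shows "S homeomorphic T"
proof -
  have "h ` S = T"
  proof (intro subset_antisym subsetI)
    fix y assume "y \<in> T"
    then show "y \<in> h ` S" using assms(5,6) by (intro rev_image_eqI[of "k y"]) auto
  qed (use assms(3) in auto)
  moreover have "k ` T = S"
  proof (intro subset_antisym subsetI)
    fix y assume "y \<in> S"
    then show "y \<in> k ` T" using assms(3,4) by (intro rev_image_eqI[of "h y"]) auto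
  qed (use assms(5) in auto)
  ultimately have "homeomorphism S T h k"
    using assms unfolding homeomorphism_def by auto
  then show ?thesis unfolding homeomorphic_def by blast
qed

text \<open>The parts of such a plane in \<open>E\<close> and \<open>F\<close> are orthogonal and
  have dimensions adding up to 2, so the cases are \<open>(2, 0)\<close>, \<open>(0, 2)\<close> and
  \<open>(1, 1)\<close>.\<close>

lemma Gen_2_eq:
  fixes E F :: "(real^'m) set"
  assumes EF: "subspace E" "subspace F" "\<And>x y. x \<in> E \<Longrightarrow> y \<in> F \<Longrightarrow> x \<bullet> y = 0"
  shows "Gen 2 E F K = {(P, q). P \<in> {P \<in> grass 2. sub_of P \<subseteq> E} \<and> q \<in> K \<and> P *v q = 0}
     \<union> {(P, q). P \<in> {P \<in> grass 2. sub_of P \<subseteq> F} \<and> q \<in> K \<and> P *v q = 0}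
     \<union> {(P, q). P \<in> (\<lambda>(P, Q). P + Q) ` (PS E (\<lambda>_. 0) \<times> PS F (\<lambda>_. 0)) \<and> q \<in> K \<and> P *v q = 0}"
proof -
  define sp where "sp P \<longleftrightarrow> (\<forall>x\<in>sub_of P. \<exists>a\<in>sub_of P \<inter> E. \<exists>b\<in>sub_of P \<inter> F. x = a + b)" for P
  have "P \<in> grass 2 \<and> sp P \<longleftrightarrow> P \<in> {P \<in> grass 2. sub_of P \<subseteq> E} \<or> P \<in> {P \<in> grass 2. sub_of P \<subseteq> F}
      \<or> P \<in> (\<lambda>(P, Q). P + Q) ` (PS E (\<lambda>_. 0) \<times> PS F (\<lambda>_. 0))" (is "?L \<longleftrightarrow> ?R") for P
  proof
    assume ?L
    then have P: "isP P" "dim (sub_of P) = 2" "sp P" by (auto simp: grass_iff)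
    let ?E = "sub_of P \<inter> E" and ?F = "sub_of P \<inter> F"
    have sE: "subspace ?E" "subspace ?F" using EF subspace_sub_of by (auto intro: subspace_inter)
    have o: "x \<bullet> y = 0" if "x \<in> ?E" "y \<in> ?F" for x y using that EF(3) by auto
    have eq: "sub_of P = {x + y | x y. x \<in> ?E \<and> y \<in> ?F}"
      using P(3) subspace_add[OF subspace_sub_of, of _ P] unfolding sp_def by blast
    have d: "dim ?E + dim ?F = 2"
      using dim_sum_orthogonal[of ?E ?F, OF sE o] P(2) eq by simp
    consider "dim ?E = 0" | "dim ?F = 0" | "dim ?E = 1" "dim ?F = 1" using d by linarith
    then show ?R
    proof cases
      case 1
      then have "?E \<subseteq> {0}" by simp
      then have "sub_of P \<subseteq> F" using P(3) unfolding sp_def by fastforce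
      then show ?thesis using \<open>?L\<close> by blast
    next
      case 2
      then have "?F \<subseteq> {0}" by simp
      then have "sub_of P \<subseteq> E" using P(3) unfolding sp_def by fastforce
      then show ?thesis using \<open>?L\<close> by blast
    next
      case 3
      obtain A where A: "isP A" "sub_of A = ?E" using ex_isP[OF sE(1)] by blast
      obtain B where B: "isP B" "sub_of B = ?F" using ex_isP[OF sE(2)] by blast
      have oo: "x \<bullet> y = 0" if "x \<in> sub_of A" "y \<in> sub_of B" for x y using that A B o by auto
      have "isP (A + B)" "sub_of (A + B) = {x + y |x y. x \<in> sub_of A \<and> y \<in> sub_of B}"
        by (rule isP_add[OF A(1) B(1)]; use oo in blast)+
      then have "P = A + B" using isP_eqI[OF P(1), of "A + B"] eq A(2) B(2) by simp
      moreover have "A \<in> PS E (\<lambda>_. 0)" "B \<in> PS F (\<lambda>_. 0)"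
        using A B 3 by (simp_all add: PS_0_eq EF grass_iff)
      ultimately show ?thesis by (auto intro!: image_eqI[of _ _ "(A, B)"])
    qed
  next
    assume ?R
    then consider "P \<in> grass 2" "sub_of P \<subseteq> E" | "P \<in> grass 2" "sub_of P \<subseteq> F"
      | A B where "P = A + B" "A \<in> PS E (\<lambda>_. 0)" "B \<in> PS F (\<lambda>_. 0)" by auto
    then show ?L
    proof cases
      case 1
      have "\<exists>a\<in>sub_of P \<inter> E. \<exists>b\<in>sub_of P \<inter> F. x = a + b" if "x \<in> sub_of P" for x
        by (rule bexI[of _ x], rule bexI[of _ 0])
           (use 1 that subspace_0[OF EF(2)] subspace_0[OF subspace_sub_of, of P] in auto)
      then show ?thesis using 1 unfolding sp_def by blast
    next
      case 2
      have "\<exists>a\<in>sub_of P \<inter> E. \<exists>b\<in>sub_of P \<inter> F. x = a + b" if "x \<in> sub_of P" for x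
        by (rule bexI[of _ 0], rule bexI[of _ x])
           (use 2 that subspace_0[OF EF(1)] subspace_0[OF subspace_sub_of, of P] in auto)
      then show ?thesis using 2 unfolding sp_def by blast
    next
      case 3
      then have A: "isP A" "dim (sub_of A) = 1" "sub_of A \<subseteq> E" and B: "isP B" "dim (sub_of B) = 1" "sub_of B \<subseteq> F"
        by (simp_all add: PS_0_eq EF grass_iff)
      have oo: "x \<bullet> y = 0" if "x \<in> sub_of A" "y \<in> sub_of B" for x y using that A B EF(3) by auto
      have AB: "isP (A + B)" "sub_of (A + B) = {x + y |x y. x \<in> sub_of A \<and> y \<in> sub_of B}"
        by (rule isP_add[OF A(1) B(1)]; use oo in blast)+
      have "dim (sub_of P) = 2"
        using AB(2) dim_sum_orthogonal[of "sub_of A" "sub_of B", OF subspace_sub_of subspace_sub_of oo] A(2) B(2) 3(1)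
        by simp
      moreover have "sp P" unfolding sp_def 3(1)
      proof
        fix x assume "x \<in> sub_of (A + B)"
        then obtain a b where ab: "x = a + b" "a \<in> sub_of A" "b \<in> sub_of B" using AB(2) by blast
        have "a = a + 0" "b = 0 + b" "0 \<in> sub_of A" "0 \<in> sub_of B"
          using subspace_0[OF subspace_sub_of] by auto
        then have "a \<in> sub_of (A + B)" "b \<in> sub_of (A + B)" unfolding AB(2) using ab by blast+
        then show "\<exists>a\<in>sub_of (A + B) \<inter> E. \<exists>b\<in>sub_of (A + B) \<inter> F. x = a + b" using ab A(3) B(3) by blast
      qed
      ultimately show ?thesis using AB(1) 3(1) by (simp add: grass_iff)
    qed
  qed
  then have *: "P \<in> grass 2 \<and> (\<forall>x\<in>sub_of P. \<exists>a\<in>sub_of P \<inter> E. \<exists>b\<in>sub_of P \<inter> F. x = a + b)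
     \<longleftrightarrow> P \<in> {P \<in> grass 2. sub_of P \<subseteq> E} \<or> P \<in> {P \<in> grass 2. sub_of P \<subseteq> F}
      \<or> P \<in> (\<lambda>(P, Q). P + Q) ` (PS E (\<lambda>_. 0) \<times> PS F (\<lambda>_. 0))" for P
    unfolding sp_def .
  have "(P, q) \<in> Gen 2 E F K \<longleftrightarrow> (P \<in> grass 2 \<and> (\<forall>x\<in>sub_of P. \<exists>a\<in>sub_of P \<inter> E. \<exists>b\<in>sub_of P \<inter> F. x = a + b))
      \<and> q \<in> K \<and> P *v q = 0" for P q
    by (simp add: Gen_def)
  then show ?thesis unfolding * by (intro set_eqI) (simp only: split_paired_all, blast)
qed

text \<open>Each of the three kinds of planes forms a connected set of pairs. Their individual
  dimensions are left undetermined; finiteness is what the later cancellation requires.\<close>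

lemma finite_components_Gen_2:
  fixes E F :: "(real^'m) set"
  assumes EF: "subspace E" "subspace F" "\<And>x y. x \<in> E \<Longrightarrow> y \<in> F \<Longrightarrow> x \<bullet> y = 0"
    and K: "subspace K" "K = {0} \<or> K = E"
  shows "finite (components (Gen 2 E F K))"
proof -
  have KE: "K = E \<or> (\<forall>x\<in>K. \<forall>y\<in>E. x \<bullet> y = 0)" "\<forall>x\<in>K. \<forall>y\<in>F. x \<bullet> y = 0"
    using K(2) EF(3) by auto
  let ?A = "{P \<in> grass 2. sub_of P \<subseteq> E}" and ?B = "{P \<in> grass 2. sub_of P \<subseteq> F}"
  let ?C = "(\<lambda>(P, Q). P + Q) ` (PS E (\<lambda>_. 0) \<times> PS F (\<lambda>_. 0))"
  have 1: "connected {(P, q). P \<in> ?A \<and> q \<in> K \<and> P *v q = 0}"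
    by (rule connected_fiber[OF connected_Gr2[OF EF(1)] K(1)])
       (use isP_keepK[OF _ _ _ K(1) KE(1)] in \<open>auto simp: grass_iff\<close>)
  have 2: "connected {(P, q). P \<in> ?B \<and> q \<in> K \<and> P *v q = 0}"
    by (rule connected_fiber[OF connected_Gr2[OF EF(2)] K(1)])
       (use isP_keepK[OF _ _ _ K(1) disjI2[OF KE(2)]] in \<open>auto simp: grass_iff\<close>)
  have "connected ?C"
    by (intro connected_continuous_image connected_Times connected_PS[OF cstr_0[OF EF(1)]] connected_PS[OF cstr_0[OF EF(2)]])
       (auto simp: case_prod_beta intro!: continuous_intros)
  then have 3: "connected {(P, q). P \<in> ?C \<and> q \<in> K \<and> P *v q = 0}"
  proof (rule connected_fiber[OF _ K(1)])
    fix P assume "P \<in> ?C"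
    then obtain A B where P: "P = A + B" and AB: "A \<in> PS E (\<lambda>_. 0)" "B \<in> PS F (\<lambda>_. 0)" by auto
    then have A: "isP A" "sub_of A \<subseteq> E" and B: "isP B" "sub_of B \<subseteq> F"
      by (simp_all add: PS_0_eq EF grass_iff)
    have oo: "x \<bullet> y = 0" if "x \<in> sub_of A" "y \<in> sub_of B" for x y using that A B EF(3) by auto
    show "isP P" unfolding P by (rule isP_add[OF A(1) B(1)]; use oo in blast)
    show "P *v x \<in> K" if "x \<in> K" for x
      unfolding P matrix_vector_mult_add_rdistrib
      using isP_keepK[OF A that K(1) KE(1)] isP_keepK[OF B that K(1) disjI2[OF KE(2)]] K(1)
      by (intro subspace_add)
  qed
  show ?thesis
    by (rule finite_components_Union[of "{{(P, q). P \<in> ?A \<and> q \<in> K \<and> P *v q = 0},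
        {(P, q). P \<in> ?B \<and> q \<in> K \<and> P *v q = 0}, {(P, q). P \<in> ?C \<and> q \<in> K \<and> P *v q = 0}}"])
       (use 1 2 3 Gen_2_eq[OF EF] in auto)
qed

text \<open>A partial isometry that need not be defined on the whole space, so that \<open>E\<close> and \<open>F\<close> can be
  matched without an extension theorem.\<close>

definition carries :: "real^'m^'m \<Rightarrow> (real^'m) set \<Rightarrow> (real^'m) set \<Rightarrow> bool" where
  "carries M E E' \<longleftrightarrow> (\<forall>x\<in>E. M *v x \<in> E' \<and> transpose M *v (M *v x) = x)
      \<and> (\<forall>y\<in>E'. transpose M *v y \<in> E \<and> M *v (transpose M *v y) = y)"

lemma carries_transpose: "carries M E E' \<Longrightarrow> carries (transpose M) E' E"
  by (auto simp: carries_def)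

text \<open>The product \<open>transpose M ** M\<close> acts as the identity on \<open>E\<close> and
  \<open>F\<close>, hence on the range of \<open>P\<close>, every vector of which is a sum of one
  vector from each. This makes the conjugate of \<open>P\<close> a projection again and conjugation
  by the transpose its inverse.\<close>

lemma carries_Gen:
  assumes EF: "carries M E E'" "carries M F F'" and K: "carries M K K'"
    and Pq: "(P, q) \<in> Gen d E F K"
  shows "(M ** P ** transpose M, M *v q) \<in> Gen d E' F' K'"
    and "(transpose M ** (M ** P ** transpose M) ** M, transpose M *v (M *v q)) = (P, q)"
proof -
  have P: "isP P" "dim (sub_of P) = d" "q \<in> K" "P *v q = 0"
    and sp: "\<And>x. x \<in> sub_of P \<Longrightarrow> \<exists>a\<in>sub_of P \<inter> E. \<exists>b\<in>sub_of P \<inter> F. x = a + b"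
    using Pq by (auto simp: Gen_def grass_iff)
  have MM: "transpose M *v (M *v x) = x" if x: "x \<in> sub_of P" for x
  proof -
    obtain a b where "x = a + b" "a \<in> E" "b \<in> F" using sp[OF x] by blast
    then show ?thesis using EF by (simp add: carries_def matrix_vector_right_distrib)
  qed
  have MMP: "transpose M *v (M *v (P *v x)) = P *v x" for x using MM by simp
  \<comment> \<open>The adjoint of \<open>MMP\<close>.\<close>
  have PMM: "P *v (transpose M *v (M *v x)) = P *v x" for x
  proof (rule vector_eq_ldot[THEN iffD1], rule allI)
    fix y
    have "y \<bullet> (P *v (transpose M *v (M *v x))) = (transpose M *v (M *v (P *v y))) \<bullet> x"
      using isP_sym[OF P(1), of y "transpose M *v (M *v x)"] inner_transpose[of M]
      by (metis inner_commute)
    then show "y \<bullet> (P *v (transpose M *v (M *v x))) = y \<bullet> (P *v x)"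
      using MMP isP_sym[OF P(1)] by simp
  qed
  let ?Q = "M ** P ** transpose M"
  have Q: "?Q *v x = M *v (P *v (transpose M *v x))" for x by (simp add: matrix_vector_mul_assoc[symmetric])
  have iQ: "isP ?Q"
  proof (rule isPI)
    show "?Q *v (?Q *v x) = ?Q *v x" for x unfolding Q by (simp add: MMP isP_idem[OF P(1)])
    show "(?Q *v x) \<bullet> y = x \<bullet> (?Q *v y)" for x y
      unfolding Q using inner_transpose[of M] isP_sym[OF P(1)] by (metis inner_commute)
  qed
  have sQ: "sub_of ?Q = (*v) M ` sub_of P"
  proof (intro subset_antisym subsetI)
    fix y assume "y \<in> sub_of ?Q"
    then have "y = M *v (P *v (transpose M *v y))" using sub_of_iff[OF iQ] Q by simp
    then show "y \<in> (*v) M ` sub_of P" using sub_of_mult by blast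
  next
    fix y assume "y \<in> (*v) M ` sub_of P"
    then obtain x where "y = M *v x" "x \<in> sub_of P" by auto
    then show "y \<in> sub_of ?Q" using MM sub_of_iff[OF iQ] sub_of_iff[OF P(1)] Q by simp
  qed
  have "inj_on ((*v) M) (sub_of P)" using MM by (metis inj_onI)
  then have "dim (sub_of ?Q) = d"
    unfolding sQ using P(2) dim_image_eq[of "(*v) M" "sub_of P"]
    by (simp add: span_eq_iff[THEN iffD2, OF subspace_sub_of[of P]])
  moreover have "\<exists>a\<in>sub_of ?Q \<inter> E'. \<exists>b\<in>sub_of ?Q \<inter> F'. y = a + b" if y: "y \<in> sub_of ?Q" for y
  proof -
    obtain x where x: "y = M *v x" "x \<in> sub_of P" using y sQ by auto
    obtain a b where "x = a + b" "a \<in> sub_of P \<inter> E" "b \<in> sub_of P \<inter> F" using sp[OF x(2)] by blast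
    then have "y = M *v a + M *v b" "M *v a \<in> sub_of ?Q \<inter> E'" "M *v b \<in> sub_of ?Q \<inter> F'"
      using EF x by (auto simp: carries_def matrix_vector_right_distrib sQ)
    then show ?thesis by blast
  qed
  moreover have "M *v q \<in> K'" "transpose M *v (M *v q) = q" using K P(3) by (auto simp: carries_def)
  moreover have "?Q *v (M *v q) = 0" unfolding Q using \<open>transpose M *v (M *v q) = q\<close> P(4) by simp
  ultimately show "(?Q, M *v q) \<in> Gen d E' F' K'"
    using iQ by (auto simp: Gen_def grass_iff)
  have "transpose M ** ?Q ** M = P"
    unfolding matrix_eq
    by (simp add: matrix_vector_mul_assoc[symmetric] MMP PMM)
  then show "(transpose M ** ?Q ** M, transpose M *v (M *v q)) = (P, q)"
    using \<open>transpose M *v (M *v q) = q\<close> by simp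
qed

lemma continuous_on_matrix_mult [continuous_intros]:
  fixes f :: "'a::topological_space \<Rightarrow> real^'m^'m"
  assumes "continuous_on S f" "continuous_on S g"
  shows "continuous_on S (\<lambda>z. f z ** g z)"
  unfolding matrix_matrix_mult_def using assms by (intro continuous_intros)

lemma Gen_homeomorphic:
  assumes "carries M E E'" "carries M F F'" "carries M K K'"
  shows "Gen d E F K homeomorphic Gen d E' F' K'"
proof -
  let ?h = "\<lambda>(P, q). (M ** P ** transpose M, M *v q)"
  let ?k = "\<lambda>(P, q). (transpose M ** P ** M, transpose M *v q)"
  have 1: "?h z \<in> Gen d E' F' K'" "?k (?h z) = z" if "z \<in> Gen d E F K" for z
    using carries_Gen[OF assms, of "fst z" "snd z"] that by (auto simp: case_prod_beta)
  have 2: "?k z \<in> Gen d E F K" "?h (?k z) = z" if "z \<in> Gen d E' F' K'" for z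
    using carries_Gen[OF assms[THEN carries_transpose], of "fst z" "snd z"] that by (auto simp: case_prod_beta)
  show ?thesis
    by (rule homeomorphicI[of _ ?h _ ?k])
       (use 1 2 in \<open>auto simp: case_prod_beta intro!: continuous_intros\<close>)
qed

text \<open>\<open>M\<close> is the sum of the rank-one maps sending an orthonormal basis of
  \<open>E\<close> to one of \<open>E'\<close> and a basis of \<open>F\<close> to one of
  \<open>F'\<close>. Orthogonality between the two spaces on each side keeps the sums from
  interfering, and the transpose sends the image bases back.\<close>

lemma ex_carries:
  fixes E F E' F' :: "(real^'m) set"
  assumes EF: "subspace E" "subspace F" "\<And>x y. x \<in> E \<Longrightarrow> y \<in> F \<Longrightarrow> x \<bullet> y = 0"
    and EF': "subspace E'" "subspace F'" "\<And>x y. x \<in> E' \<Longrightarrow> y \<in> F' \<Longrightarrow> x \<bullet> y = 0"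
    and d: "dim E = dim E'" "dim F = dim F'"
  shows "\<exists>M. carries M E E' \<and> carries M F F'"
proof -
  have basis: "\<exists>B \<beta>. finite B \<and> B \<subseteq> E \<and> span B = E \<and> (\<forall>x\<in>B. \<forall>y\<in>B. x \<bullet> y = (if x = y then 1 else 0)) \<and>
      span (\<beta> ` B) = E' \<and> \<beta> ` B \<subseteq> E' \<and> (\<forall>x\<in>B. \<forall>y\<in>B. \<beta> x \<bullet> \<beta> y = (if x = y then 1 else 0))"
    if s: "subspace E" "subspace E'" and de: "dim E = dim E'" for E E' :: "(real^'m) set"
  proof -
    obtain B where B: "B \<subseteq> E" "pairwise orthogonal B" "\<And>x. x \<in> B \<Longrightarrow> norm x = 1"
       "independent B" "card B = dim E" "span B = E"
      using orthonormal_basis_subspace[OF s(1)] by metis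
    obtain B' where B': "B' \<subseteq> E'" "pairwise orthogonal B'" "\<And>x. x \<in> B' \<Longrightarrow> norm x = 1"
       "independent B'" "card B' = dim E'" "span B' = E'"
      using orthonormal_basis_subspace[OF s(2)] by metis
    have f: "finite B" "finite B'" using B(4) B'(4) independent_imp_finite by auto
    then obtain \<beta> where \<beta>: "bij_betw \<beta> B B'"
      using B(5) B'(5) de finite_same_card_bij[of B B'] by auto
    have i: "\<beta> ` B = B'" "inj_on \<beta> B" using \<beta> by (auto simp: bij_betw_def)
    have "\<forall>x\<in>B. \<forall>y\<in>B. x \<bullet> y = (if x = y then 1 else 0)"
      using B(2,3) by (auto simp: pairwise_def orthogonal_def norm_eq_1)
    moreover have "\<forall>x\<in>B'. \<forall>y\<in>B'. x \<bullet> y = (if x = y then 1 else 0)"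
      using B'(2,3) by (auto simp: pairwise_def orthogonal_def norm_eq_1)
    then have "\<forall>x\<in>B. \<forall>y\<in>B. \<beta> x \<bullet> \<beta> y = (if x = y then 1 else 0)"
      using i by (auto simp: inj_on_def)
    ultimately show ?thesis using B B' f i by (intro exI[of _ B] exI[of _ \<beta>]) simp
  qed
  obtain B \<beta> where B: "finite B" "B \<subseteq> E" "span B = E" "\<forall>x\<in>B. \<forall>y\<in>B. x \<bullet> y = (if x = y then 1 else 0)"
    "span (\<beta> ` B) = E'" "\<beta> ` B \<subseteq> E'" "\<forall>x\<in>B. \<forall>y\<in>B. \<beta> x \<bullet> \<beta> y = (if x = y then 1 else 0)"
    using basis[OF EF(1) EF'(1) d(1)] by metis
  obtain C \<gamma> where C: "finite C" "C \<subseteq> F" "span C = F" "\<forall>x\<in>C. \<forall>y\<in>C. x \<bullet> y = (if x = y then 1 else 0)"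
    "span (\<gamma> ` C) = F'" "\<gamma> ` C \<subseteq> F'" "\<forall>x\<in>C. \<forall>y\<in>C. \<gamma> x \<bullet> \<gamma> y = (if x = y then 1 else 0)"
    using basis[OF EF(2) EF'(2) d(2)] by metis
  define M where "M = (\<Sum>b\<in>B. outer (\<beta> b) b) + (\<Sum>b\<in>C. outer (\<gamma> b) b)"
  have tr: "transpose (outer v w) = outer w v" for v w :: "real^'m"
    by (simp add: outer_def transpose_def mult.commute)
  have tadd: "transpose (X + Y) = transpose X + transpose Y" for X Y :: "real^'m^'m"
    by (simp add: transpose_def vec_eq_iff)
  have tsum: "transpose (\<Sum>i\<in>I. f i) = (\<Sum>i\<in>I. transpose (f i))" for f :: "real^'m \<Rightarrow> real^'m^'m" and I
    by (simp add: transpose_def vec_eq_iff)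
  have M: "M *v x = (\<Sum>b\<in>B. (b \<bullet> x) *\<^sub>R \<beta> b) + (\<Sum>b\<in>C. (b \<bullet> x) *\<^sub>R \<gamma> b)" for x
    by (simp add: M_def matrix_vector_mult_add_rdistrib sum_matrix_mult outer_mult)
  have Mt: "transpose M *v x = (\<Sum>b\<in>B. (\<beta> b \<bullet> x) *\<^sub>R b) + (\<Sum>b\<in>C. (\<gamma> b \<bullet> x) *\<^sub>R b)" for x
    by (simp add: M_def tadd tsum tr matrix_vector_mult_add_rdistrib sum_matrix_mult outer_mult)
  have pick: "(\<Sum>b\<in>X. (if b = x then 1 else 0) *\<^sub>R f b) = f x" if "x \<in> X" "finite X" for X x and f :: "real^'m \<Rightarrow> real^'m"
  proof -
    have "(\<Sum>b\<in>X. (if b = x then 1 else 0) *\<^sub>R f b) = (\<Sum>b\<in>X. if b = x then f b else 0)"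
      by (intro sum.cong) auto
    then show ?thesis using that by simp
  qed
  have MB: "M *v x = \<beta> x" "transpose M *v \<beta> x = x" if x: "x \<in> B" for x
  proof -
    have "(\<Sum>b\<in>B. (b \<bullet> x) *\<^sub>R \<beta> b) = \<beta> x" "(\<Sum>b\<in>B. (\<beta> b \<bullet> \<beta> x) *\<^sub>R b) = x"
      using B(4,7) x pick[OF x B(1), of \<beta>] pick[OF x B(1), of id] by simp_all
    moreover have "(\<Sum>b\<in>C. (b \<bullet> x) *\<^sub>R \<gamma> b) = 0" "(\<Sum>b\<in>C. (\<gamma> b \<bullet> \<beta> x) *\<^sub>R b) = 0"
    proof -
      have "y \<bullet> x = 0" "\<gamma> y \<bullet> \<beta> x = 0" if "y \<in> C" for y
        using EF(3)[of x y] EF'(3)[of "\<beta> x" "\<gamma> y"] x that B(2,6) C(2,6)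
          unfolding inner_commute[of y] inner_commute[of "\<gamma> y"] by blast+
      then show "(\<Sum>b\<in>C. (b \<bullet> x) *\<^sub>R \<gamma> b) = 0" "(\<Sum>b\<in>C. (\<gamma> b \<bullet> \<beta> x) *\<^sub>R b) = 0"
        by (auto intro!: sum.neutral)
    qed
    ultimately show "M *v x = \<beta> x" "transpose M *v \<beta> x = x" by (simp_all add: M Mt)
  qed
  have MC: "M *v x = \<gamma> x" "transpose M *v \<gamma> x = x" if x: "x \<in> C" for x
  proof -
    have "(\<Sum>b\<in>C. (b \<bullet> x) *\<^sub>R \<gamma> b) = \<gamma> x" "(\<Sum>b\<in>C. (\<gamma> b \<bullet> \<gamma> x) *\<^sub>R b) = x"
      using C(4,7) x pick[OF x C(1), of \<gamma>] pick[OF x C(1), of id] by simp_all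
    moreover have "(\<Sum>b\<in>B. (b \<bullet> x) *\<^sub>R \<beta> b) = 0" "(\<Sum>b\<in>B. (\<beta> b \<bullet> \<gamma> x) *\<^sub>R b) = 0"
    proof -
      have "y \<bullet> x = 0" "\<beta> y \<bullet> \<gamma> x = 0" if "y \<in> B" for y
        using EF(3)[of y x] EF'(3)[of "\<beta> y" "\<gamma> x"] x that B(2,6) C(2,6) by blast+
      then show "(\<Sum>b\<in>B. (b \<bullet> x) *\<^sub>R \<beta> b) = 0" "(\<Sum>b\<in>B. (\<beta> b \<bullet> \<gamma> x) *\<^sub>R b) = 0"
        by (auto intro!: sum.neutral)
    qed
    ultimately show "M *v x = \<gamma> x" "transpose M *v \<gamma> x = x" by (simp_all add: M Mt)
  qed
  have fin: "carries M (span X) (span (f ` X))"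
    if *: "\<And>x. x \<in> X \<Longrightarrow> M *v x = f x" "\<And>x. x \<in> X \<Longrightarrow> transpose M *v f x = x" for X f
  proof -
    have L: "linear ((*v) M)" "linear ((*v) (transpose M))" by auto
    have "(*v) M ` X = f ` X" "(*v) (transpose M) ` f ` X = X" using * by (auto simp: image_iff)
    then have a: "(*v) M ` span X = span (f ` X)" "(*v) (transpose M) ` span (f ` X) = span X"
      using linear_span_image[OF L(1), of X] linear_span_image[OF L(2), of "f ` X"] by simp_all
    have "transpose M *v (M *v x) = x" if "x \<in> span X" for x
      by (rule linear_eq_on_span[OF _ linear_id, of "\<lambda>x. transpose M *v (M *v x)" X x, unfolded id_def])
         (use * that L in \<open>auto intro: linear_compose[unfolded o_def]\<close>)
    then show ?thesis using a unfolding carries_def by (metis (no_types, lifting) imageE imageI)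
  qed
  show ?thesis using fin[of B \<beta>] MB fin[of C \<gamma>] MC B(3,5) C(3,5) by (intro exI[of _ M]) simp
qed

section \<open>Rotation eigenspaces and the classification of invariant lines and planes\<close>

declare One_nat_def [simp del]

text \<open>On \<open>Wc A W c\<close> the defining equation says that \<open>A\<close> plus its
  inverse is \<open>2 * c\<close>, and the inverse of an isometry is its adjoint. Concretely, the
  equation is paired with \<open>A y\<close>.\<close>

lemma Wc_inner:
  assumes A: "isoW A W" and x: "x \<in> Wc A W c" and y: "y \<in> W"
  shows "A x \<bullet> y + x \<bullet> A y = 2 * c * (x \<bullet> y)"
proof -
  have xW: "x \<in> W" "A x \<in> W" "A (A x) \<in> W" "A y \<in> W" using A x y by (auto simp: Wc_def isoW_def)
  have "(A (A x) - (2 * c) *\<^sub>R A x + x) \<bullet> A y = 0" using x by (simp add: Wc_def)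
  then have "A (A x) \<bullet> A y - 2 * c * (A x \<bullet> A y) + x \<bullet> A y = 0" by (simp add: inner_add_left inner_diff_left)
  then show ?thesis using isoW_inner[OF A xW(2) y] isoW_inner[OF A xW(1) y] by simp
qed

text \<open>These are eigenspaces, for the distinct eigenvalues \<open>2 * c\<close> and
  \<open>2 * c'\<close>, of the symmetric operator \<open>A\<close> plus adjoint. The values
  \<open>c = 1\<close> and \<open>c = -1\<close> are included, which makes the fixed space
  orthogonal to all rotation planes.\<close>

lemma Wc_orth:
  assumes A: "isoW A W" and x: "x \<in> Wc A W c" and y: "y \<in> Wc A W c'" and "c \<noteq> c'"
  shows "x \<bullet> y = 0"
proof -
  have "x \<in> W" "y \<in> W" using x y by (auto simp: Wc_def)
  then have "2 * c * (x \<bullet> y) = 2 * c' * (x \<bullet> y)"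
    using Wc_inner[OF A x, of y] Wc_inner[OF A y, of x]
    unfolding inner_commute[of "A y"] inner_commute[of y] by linarith
  then show ?thesis using assms(4) by simp
qed

lemma Er_subset_Wc: "linear A \<Longrightarrow> Er A W 1 \<subseteq> Wc A W 1" "linear A \<Longrightarrow> Er A W (-1) \<subseteq> Wc A W (-1)"
  by (auto simp: Er_def Wc_def linear_neg scaleR_2)

lemma Er_orth: "isoW A W \<Longrightarrow> x \<in> Er A W 1 \<Longrightarrow> y \<in> Er A W (-1) \<Longrightarrow> x \<bullet> y = 0"
  using Er_subset_Wc[of A W] Wc_orth[of A W x 1 y "-1"] by (auto simp: isoW_def)

lemma finite_Wcs:
  assumes A: "isoW A W" shows "finite (Wcs A W)"
proof -
  have "\<forall>c\<in>Wcs A W. \<exists>v. v \<in> Wc A W c \<and> v \<noteq> 0"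
    using subspace_Wc[of A W] subspace_0 A unfolding Wcs_def isoW_def by blast
  then obtain v where v: "\<And>c. c \<in> Wcs A W \<Longrightarrow> v c \<in> Wc A W c \<and> v c \<noteq> 0" by metis
  have o: "v c \<bullet> v c' = 0" if "c \<in> Wcs A W" "c' \<in> Wcs A W" "c \<noteq> c'" for c c'
    using Wc_orth[OF A] v that by blast
  have inj: "inj_on v (Wcs A W)"
    using o v by (intro inj_onI) (metis inner_eq_zero_iff)
  have "independent (v ` Wcs A W)"
    using o v by (intro pairwise_orthogonal_independent) (auto simp: pairwise_def orthogonal_def)
  then show ?thesis using independent_imp_finite finite_imageD[OF _ inj] by blast
qed

text \<open>On \<open>Wc A W c\<close> the map \<open>A\<close> is the rotation
  \<open>c + sqrt (1 - c^2) J\<close> by the angle with cosine \<open>c\<close>; solving for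
  \<open>J\<close> gives this quarter turn.\<close>

definition Jc :: "(real^'m \<Rightarrow> real^'m) \<Rightarrow> real \<Rightarrow> real^'m \<Rightarrow> real^'m" where
  "Jc A c x = (1 / sqrt (1 - c\<^sup>2)) *\<^sub>R (A x - c *\<^sub>R x)"

lemma abs_square_less: "-1 < c \<Longrightarrow> c < 1 \<Longrightarrow> c\<^sup>2 < (1::real)"
  by (simp add: abs_square_less_1 abs_less_iff)

lemma A_Wc: 
  assumes "isoW A W" "x \<in> Wc A W c" shows "A x \<in> Wc A W c"
proof -
  have l: "linear A" using assms by (simp add: isoW_def)
  have "A (A (A x) - (2 * c) *\<^sub>R A x + x) = 0" using assms(2) linear_0[OF l] by (simp add: Wc_def)
  then have "A (A (A x)) - (2 * c) *\<^sub>R A (A x) + A x = 0"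
    by (simp add: linear_add[OF l] linear_diff[OF l] linear_scale[OF l])
  then show ?thesis using assms by (auto simp: Wc_def isoW_def)
qed

text \<open>Completing the square in the equation of \<open>Wc\<close> gives
  \<open>J (J v) = - v\<close>, and skewness is a rewriting of \<open>Wc_inner\<close>.\<close>

lemma cstr_Wc:
  assumes A: "isoW A W" and c: "-1 < c" "c < 1" shows "cstr (Wc A W c) (Jc A c) 1"
  unfolding cstr_def
proof (intro conjI ballI)
  have l: "linear A" and sW: "subspace W" using A by (auto simp: isoW_def)
  have c2: "1 - c\<^sup>2 > 0" using abs_square_less[OF c] by simp
  then have s2: "sqrt (1 - c\<^sup>2) * sqrt (1 - c\<^sup>2) = 1 - c\<^sup>2" "sqrt (1 - c\<^sup>2) \<noteq> 0" by auto
  show S: "subspace (Wc A W c)" by (rule subspace_Wc[OF l sW])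
  show lJ: "linear (Jc A c)"
    unfolding Jc_def using l by (auto simp: linear_iff algebra_simps)
  fix v assume v: "v \<in> Wc A W c"
  show "Jc A c v \<in> Wc A W c"
    unfolding Jc_def using A_Wc[OF A v] v S by (intro subspace_scale subspace_diff)
  show "Jc A c (Jc A c v) = - real 1 *\<^sub>R v"
  proof -
    have two: "(2 * c) *\<^sub>R X = c *\<^sub>R X + c *\<^sub>R X" for X :: "real^'a"
      by (simp only: mult_2 scaleR_left_distrib)
    have "A (A v - c *\<^sub>R v) - c *\<^sub>R (A v - c *\<^sub>R v)
        = (A (A v) - (2 * c) *\<^sub>R A v + v) - (1 - c\<^sup>2) *\<^sub>R v"
      unfolding two by (simp add: linear_diff[OF l] linear_scale[OF l] algebra_simps power2_eq_square)
    then have e: "A (A v - c *\<^sub>R v) - c *\<^sub>R (A v - c *\<^sub>R v) = - ((1 - c\<^sup>2) *\<^sub>R v)"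
      using v by (simp add: Wc_def)
    let ?t = "1 / sqrt (1 - c\<^sup>2)"
    have "Jc A c (Jc A c v) = (?t * ?t) *\<^sub>R (A (A v - c *\<^sub>R v) - c *\<^sub>R (A v - c *\<^sub>R v))"
      unfolding Jc_def linear_scale[OF l] by (simp add: algebra_simps)
    also have "?t * ?t = 1 / (1 - c\<^sup>2)" using s2 by simp
    finally show ?thesis unfolding e using c2 by simp
  qed
  fix w assume w: "w \<in> Wc A W c"
  have wW: "w \<in> W" using w by (simp add: Wc_def)
  have "v \<bullet> (A w - c *\<^sub>R w) = - ((A v - c *\<^sub>R v) \<bullet> w)"
    using Wc_inner[OF A v wW] by (simp add: inner_diff_left inner_diff_right)
  then show "v \<bullet> Jc A c w = - (Jc A c v \<bullet> w)" by (simp add: Jc_def)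
qed simp

text \<open>Guarantees that the truncated difference \<open>dim (Wc A W c) - 2\<close> in the
  dimension formula loses no information.\<close>

lemma dim_Wc_ge:
  assumes A: "isoW A W" and c: "c \<in> Wcs A W" shows "2 \<le> dim (Wc A W c)"
proof -
  note C = cstr_Wc[OF A, of c]
  obtain v where v: "v \<in> Wc A W c - {0}"
    using c subspace_Wc[of A W c] subspace_0 A unfolding Wcs_def isoW_def by blast
  have "span {v, Jc A c v} \<subseteq> Wc A W c"
    using cstr_facts(1,3)[OF C] v c by (intro span_minimal) (auto simp: Wcs_def)
  then show ?thesis using dim_span_J[OF C v] c dim_subset[of "span {v, Jc A c v}" "Wc A W c"] by (simp add: Wcs_def)
qed

lemma grass_1_eigen:
  assumes A: "isoW A W" and P: "P \<in> grass 1" "sub_of P \<subseteq> W" "\<And>x. x \<in> sub_of P \<Longrightarrow> A x \<in> sub_of P"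
  shows "\<exists>e\<in>{1, -1}. \<forall>x. A (P *v x) = e *\<^sub>R (P *v x)"
proof -
  have iP: "isP P" "dim (sub_of P) = 1" using P by (auto simp: grass_iff)
  then obtain v where v: "v \<in> sub_of P" "v \<noteq> 0"
    by (metis dim_eq_0 singletonI subsetI zero_neq_one)
  have "span {v} \<subseteq> sub_of P" using v by (intro span_minimal) (auto simp: subspace_sub_of)
  then have s: "sub_of P = span {v}"
    using v iP(2) by (intro subspace_dim_equal[symmetric]) (auto simp: subspace_sub_of dim_insert)
  obtain e where e: "A v = e *\<^sub>R v" using P(3)[OF v(1)] s by (auto simp: span_singleton)
  have "norm (A v) = norm v" using A v P(2) by (auto simp: isoW_def)
  then have "\<bar>e\<bar> = 1" using e v(2) by simp
  moreover have "A (P *v x) = e *\<^sub>R (P *v x)" for x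
  proof -
    obtain t where "P *v x = t *\<^sub>R v" using sub_of_mult[of P x] s by (auto simp: span_singleton)
    then show ?thesis using e A by (simp add: isoW_def linear_scale)
  qed
  moreover have "e = 1 \<or> e = -1" using \<open>\<bar>e\<bar> = 1\<close> by linarith
  ultimately show ?thesis by blast
qed

text \<open>Supplies the closed sets for \<open>comp_dims_UN\<close>: quantifying over all
  \<open>P *v x\<close>, instead of over the range of \<open>P\<close>, exhibits the condition as an
  intersection of closed ones.\<close>

lemma closed_eqn:
  fixes f g :: "real^'m \<Rightarrow> real^'m"
  assumes "linear f" "linear g"
  shows "closed {z :: (real^'m^'m) \<times> (real^'m). \<forall>x. f (fst z *v x) = g (fst z *v x)}"
proof -
  have c: "continuous_on UNIV f" "continuous_on UNIV g"
    using assms linear_continuous_on linear_conv_bounded_linear by blast+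
  show ?thesis
    by (intro closed_Collect_all closed_Collect_eq continuous_on_compose2[OF c(1)] continuous_on_compose2[OF c(2)] continuous_intros) auto
qed

text \<open>An invariant line is an eigenline for \<open>1\<close> or \<open>-1\<close>, and having
  a given eigenvalue is a closed condition, so the two kinds of lines lie in different
  components.\<close>

lemma comp_dims_GG_1:
  assumes A: "isoW A W" and K: "subspace K" "K = {0} \<or> K = Er A W 1"
  shows "comp_dims (GG A W K 1) = comp_dims (Gen 1 (Er A W 1) {0} K) + comp_dims (Gen 1 (Er A W (-1)) {0} K)"
proof -
  have l: "linear A" and sW: "subspace W" using A by (auto simp: isoW_def)
  define X where "X e = {z :: (real^'a^'a) \<times> (real^'a). \<forall>x. A (fst z *v x) = e *\<^sub>R (fst z *v x)}" for e
  have piece: "GG A W K 1 \<inter> X e = Gen 1 (Er A W e) {0} K" for e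
  proof -
    have "(P \<in> grass 1 \<and> sub_of P \<subseteq> W \<and> (\<forall>x\<in>sub_of P. A x \<in> sub_of P)) \<and> (\<forall>x. A (P *v x) = e *\<^sub>R (P *v x))
       \<longleftrightarrow> P \<in> grass 1 \<and> sub_of P \<subseteq> Er A W e" for P
    proof (cases "P \<in> grass 1")
      case True
      then have iP: "isP P" by (simp add: grass_iff)
      have "(\<forall>x. A (P *v x) = e *\<^sub>R (P *v x)) \<longleftrightarrow> (\<forall>x\<in>sub_of P. A x = e *\<^sub>R x)"
        by (auto simp: sub_of_def)
      then show ?thesis using True subspace_scale[OF subspace_sub_of] by (auto simp: Er_def)
    qed simp
    note * = this
    have "(P, q) \<in> GG A W K 1 \<inter> X e \<longleftrightarrow> (P, q) \<in> Gen 1 (Er A W e) {0} K" for P q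
      unfolding Gen_1_eq[OF subspace_Er[OF l sW]] PS_0_eq[OF subspace_Er[OF l sW]] mem_Collect_eq prod.case
        *[symmetric] Int_iff GG_def X_def by auto
    then show ?thesis by (intro set_eqI) (simp only: split_paired_all)
  qed
  have GG: "GG A W K 1 = (\<Union>e\<in>{1,-1}. GG A W K 1 \<inter> X e)"
  proof -
    have "\<exists>e\<in>{1,-1}. (P, q) \<in> X e" if "(P, q) \<in> GG A W K 1" for P q
    proof -
      have P: "P \<in> grass 1" "sub_of P \<subseteq> W" "\<And>x. x \<in> sub_of P \<Longrightarrow> A x \<in> sub_of P" using that by (auto simp: GG_def)
      from grass_1_eigen[OF A P] show ?thesis unfolding X_def by (simp only: mem_Collect_eq fst_conv)
    qed
    then show ?thesis by (intro subset_antisym subrelI) auto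
  qed
  have clX: "closed (X e)" for e
    unfolding X_def by (rule closed_eqn[OF l]) (simp add: linear_scale_self)
  have "GG A W K 1 \<inter> X 1 \<inter> X (-1) = {}"
  proof (rule ccontr)
    assume "\<not> ?thesis"
    then obtain P q where Pq: "(P, q) \<in> GG A W K 1" "(P, q) \<in> X 1" "(P, q) \<in> X (-1)" by auto
    then have "P \<in> grass 1" by (simp add: GG_def)
    have "P *v x = - (P *v x)" for x
      using Pq(2,3) unfolding X_def by (metis (mono_tags, lifting) fst_conv mem_Collect_eq scaleR_minus1_left scaleR_one)
    then have "P *v x = 0" for x by (metis equation_minus_iff neg_equal_zero vec_eq_iff vector_uminus_component zero_index)
    then have "sub_of P \<subseteq> {0}" by (auto simp: sub_of_def)
    then have "dim (sub_of P) = 0" by simp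
    then show False using \<open>P \<in> grass 1\<close> by (simp add: grass_iff del: dim_eq_0)
  qed
  then have disj: "GG A W K 1 \<inter> X i \<inter> X j = {}" if "i \<in> {1,-1}" "j \<in> {1,-1}" "i \<noteq> j" for i j
    using that by auto
  have fin: "finite (components (GG A W K 1 \<inter> X e))" if "e \<in> {1, -1}" for e
  proof -
    have "K = Er A W e \<or> (\<forall>x\<in>K. \<forall>y\<in>Er A W e. x \<bullet> y = 0)"
      using K(2) that Er_orth[OF A] by auto
    from connected_Gen_1[OF subspace_Er[OF l sW] K(1) this]
    show ?thesis unfolding piece by (intro finite_components_Union[of "{Gen 1 (Er A W e) {0} K}"]) auto
  qed
  show ?thesis
    by (subst GG, subst conjunct1[OF comp_dims_UN]) (use clX disj fin piece in auto)
qed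

text \<open>In an orthonormal basis \<open>A\<close> acts on the plane by an orthogonal 2 by 2
  matrix. With determinant -1 it is a reflection, whose square is the identity; with determinant 1
  it is a rotation with cosine \<open>a\<close>, and either \<open>\<bar>a\<bar> = 1\<close>, with
  square the identity again, or \<open>a\<close> belongs to \<open>Wcs\<close>.\<close>

lemma grass_2_class:
  assumes A: "isoW A W" and P: "P \<in> grass 2" "sub_of P \<subseteq> W" "\<And>x. x \<in> sub_of P \<Longrightarrow> A x \<in> sub_of P"
  shows "(\<forall>x\<in>sub_of P. A (A x) = x) \<or> (\<exists>c\<in>Wcs A W. sub_of P \<subseteq> Wc A W c)"
proof -
  have l: "linear A" and sW: "subspace W" using A by (auto simp: isoW_def)
  have iP: "isP P" "dim (sub_of P) = 2" using P by (auto simp: grass_iff)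
  obtain B where B: "B \<subseteq> sub_of P" "pairwise orthogonal B" "\<And>x. x \<in> B \<Longrightarrow> norm x = 1"
     "independent B" "card B = 2" "span B = sub_of P"
    using orthonormal_basis_subspace[OF subspace_sub_of[of P]] iP(2) by metis
  obtain u w where uw: "B = {u, w}" "u \<noteq> w" using B(5) by (auto simp: card_2_iff)
  have ip: "u \<bullet> u = 1" "w \<bullet> w = 1" "u \<bullet> w = 0" "w \<bullet> u = 0"
    using B(2) B(3) uw by (auto simp: pairwise_def orthogonal_def norm_eq_1)
  have sp: "\<exists>a b. x = a *\<^sub>R u + b *\<^sub>R w" if "x \<in> sub_of P" for x
  proof -
    from that obtain k where "x - k *\<^sub>R u \<in> span {w}"
      using span_breakdown_eq[of x u "{w}"] B(6) uw(1) by auto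
    then obtain ka where "x - k *\<^sub>R u = ka *\<^sub>R w" by (auto simp: span_singleton)
    then have "x = k *\<^sub>R u + ka *\<^sub>R w" by (simp add: algebra_simps)
    then show ?thesis by blast
  qed
  have uP: "u \<in> sub_of P" "w \<in> sub_of P" using B(1) uw by auto
  obtain a b where Au: "A u = a *\<^sub>R u + b *\<^sub>R w" using sp P(3) uP by blast
  obtain c d where Aw: "A w = c *\<^sub>R u + d *\<^sub>R w" using sp P(3) uP by blast
  have uW: "u \<in> W" "w \<in> W" using uP P(2) by auto
  have 1: "a * a + b * b = 1" "c * c + d * d = 1" "a * c + b * d = 0"
    using isoW_inner[OF A uW(1) uW(1)] isoW_inner[OF A uW(2) uW(2)] isoW_inner[OF A uW(1) uW(2)]
    by (simp_all add: Au Aw inner_add_left inner_add_right ip mult.commute)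
  \<comment> \<open>The determinant. Its square is 1 by the Lagrange identity, and the second column
    is \<open>D\<close> times the quarter turn of the first.\<close>
  define D where "D = a * d - b * c"
  have D: "D * D = 1" "d = D * a" "c = - D * b"
  proof -
    have "D * D = (a * a + b * b) * (c * c + d * d) - (a * c + b * d) * (a * c + b * d)"
      "D * a = (a * a + b * b) * d - b * (a * c + b * d)" "- D * b = (a * a + b * b) * c - a * (a * c + b * d)"
      unfolding D_def by (simp_all add: algebra_simps)
    then show "D * D = 1" "d = D * a" "c = - D * b" unfolding 1 by simp_all
  qed
  have AA: "A (A (s *\<^sub>R u + t *\<^sub>R w)) = s *\<^sub>R A (A u) + t *\<^sub>R A (A w)" for s t
    by (simp add: linear_add[OF l] linear_scale[OF l])
  have AAu: "A (A u) = (a * a + b * c) *\<^sub>R u + (a * b + b * d) *\<^sub>R w"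
    unfolding Au by (simp add: linear_add[OF l] linear_scale[OF l] Au Aw algebra_simps)
  have AAw: "A (A w) = (c * a + d * c) *\<^sub>R u + (c * b + d * d) *\<^sub>R w"
    unfolding Aw by (simp add: linear_add[OF l] linear_scale[OF l] Au Aw algebra_simps)
  have "D = 1 \<or> D = -1" using D(1) by (simp add: square_eq_1_iff)
  have fin: "\<forall>x\<in>sub_of P. A (A x) = x" if "A (A u) = u" "A (A w) = w"
  proof
    fix x assume "x \<in> sub_of P"
    then obtain s t where "x = s *\<^sub>R u + t *\<^sub>R w" using sp by blast
    then show "A (A x) = x" using AA that by simp
  qed
  from \<open>D = 1 \<or> D = -1\<close> show ?thesis
  proof
    assume "D = -1"
    then have "d = - a" "c = b" using D by auto
    then have "A (A u) = u" "A (A w) = w" unfolding AAu AAw using 1 by (simp_all add: algebra_simps)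
    then show ?thesis using fin by blast
  next
    assume "D = 1"
    then have dc: "d = a" "c = - b" using D by auto
    have a1: "\<bar>a\<bar> \<le> 1" using 1(1) zero_le_square[of b] unfolding abs_square_le_1[symmetric] power2_eq_square by linarith
    show ?thesis
    proof (cases "\<bar>a\<bar> = 1")
      case True
      then have "a * a = 1" by (metis abs_mult_self_eq mult_1)
      then have "b = 0" using 1(1) by simp
      then have "A (A u) = u" "A (A w) = w" unfolding AAu AAw using \<open>a * a = 1\<close> dc by simp_all
      then show ?thesis using fin by blast
    next
      case False
      \<comment> \<open>The Cayley-Hamilton equation of a rotation: trace \<open>2 * a\<close> and
        determinant 1.\<close>
      have q: "A (A u) - (2 * a) *\<^sub>R A u + u = 0" "A (A w) - (2 * a) *\<^sub>R A w + w = 0"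
      proof -
        have k: "(a * a + b * c) - 2 * a * a + 1 = 0" "(a * b + b * d) - 2 * a * b = 0"
          "(c * a + d * c) - 2 * a * c = 0" "(c * b + d * d) - 2 * a * d + 1 = 0"
          using 1(1) by (simp_all add: dc algebra_simps)
        have e1: "x *\<^sub>R u + y *\<^sub>R w - (2 * a) *\<^sub>R (m *\<^sub>R u + n *\<^sub>R w) = (x - 2 * a * m) *\<^sub>R u + (y - 2 * a * n) *\<^sub>R w" for x y m n
          by (simp add: scaleR_left_diff_distrib scaleR_right_distrib)
        have e2: "x *\<^sub>R u + y *\<^sub>R w + u = (x + 1) *\<^sub>R u + y *\<^sub>R w" "x *\<^sub>R u + y *\<^sub>R w + w = x *\<^sub>R u + (y + 1) *\<^sub>R w" for x y
          by (simp_all add: scaleR_add_left)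
        show "A (A u) - (2 * a) *\<^sub>R A u + u = 0" "A (A w) - (2 * a) *\<^sub>R A w + w = 0"
          unfolding AAu AAw unfolding Au Aw unfolding e1 unfolding e2 unfolding k scaleR_zero_left add_0 by (rule refl)+
      qed
      have "sub_of P \<subseteq> Wc A W a"
      proof
        fix x assume x: "x \<in> sub_of P"
        have "{u, w} \<subseteq> Wc A W a" using q uW by (auto simp: Wc_def)
        then have "span {u, w} \<subseteq> Wc A W a" by (intro span_minimal subspace_Wc l sW)
        then show "x \<in> Wc A W a" using x B(6) uw by auto
      qed
      moreover have "u \<in> Wc A W a" "u \<noteq> 0" unfolding Wc_def using q(1) uW(1) ip(1) by auto
      then have "Wc A W a \<noteq> {0}" by blast
      then have "a \<in> Wcs A W" using False a1 by (auto simp: Wcs_def abs_if split: if_splits)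
      ultimately show ?thesis by blast
    qed
  qed
qed

lemma sum_singleton_mset: "finite C \<Longrightarrow> (\<Sum>c\<in>C. {#f c#}) = image_mset f (mset_set C)"
  by (induction C rule: finite_induct) auto

text \<open>The piece on which \<open>A\<close> squares to the identity stays an unevaluated
  \<open>comp_dims\<close> term. On a complex piece \<open>K\<close> is orthogonal to the plane, so
  the condition on \<open>q\<close> is automatic and the piece is a product.\<close>

lemma comp_dims_GG_2:
  assumes A: "isoW A W" and K: "subspace K" "K = {0} \<or> K = Er A W 1"
  shows "comp_dims (GG A W K 2) = comp_dims (Gen 2 (Er A W 1) (Er A W (-1)) K)
     + image_mset (\<lambda>c. dim (Wc A W c) - 2 + dim K) (mset_set (Wcs A W))"
proof -
  have l: "linear A" and sW: "subspace W" using A by (auto simp: isoW_def)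
  \<comment> \<open>The value of \<open>A (A x)\<close> prescribed on a piece. The index 2, which is
    no cosine, marks the real piece, where \<open>A\<close> squares to the identity.\<close>
  define g where "g c x = (if c = 2 then x else (2 * c) *\<^sub>R A x - x)" for c :: real and x
  define X where "X c = {z :: (real^'a^'a) \<times> (real^'a). \<forall>x. A (A (fst z *v x)) = g c (fst z *v x)}" for c
  have clX: "closed (X c)" for c
    unfolding X_def
  proof (rule closed_eqn)
    show "linear (\<lambda>x. A (A x))" using linear_compose[OF l l] by (simp add: o_def)
    show "linear (g c)"
      by (rule linearI) (simp_all add: g_def linear_add[OF l] linear_scale[OF l] algebra_simps)
  qed
  have X: "(P, q) \<in> X c \<longleftrightarrow> (\<forall>x\<in>sub_of P. A (A x) = g c x)" for P q c
    by (auto simp: X_def sub_of_def)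
  have GGi: "(P, q) \<in> GG A W K 2 \<longleftrightarrow> P \<in> grass 2 \<and> sub_of P \<subseteq> W \<and> (\<forall>x\<in>sub_of P. A x \<in> sub_of P) \<and> q \<in> K \<and> P *v q = 0" for P q
    by (simp add: GG_def)
  have c2: "c \<noteq> 2" if "c \<in> Wcs A W" for c using that by (auto simp: Wcs_def)
  have WX: "sub_of P \<subseteq> Wc A W c \<longleftrightarrow> sub_of P \<subseteq> W \<and> (P, q) \<in> X c" if "c \<noteq> 2" for P q c
  proof -
    have "x \<in> Wc A W c \<longleftrightarrow> x \<in> W \<and> A (A x) = g c x" for x
      using that by (simp add: Wc_def g_def algebra_simps)
    then show ?thesis unfolding X by blast
  qed
  have X2: "(P, q) \<in> X 2 \<longleftrightarrow> (\<forall>x\<in>sub_of P. A (A x) = x)" for P q unfolding X by (simp add: g_def)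
  have GG: "GG A W K 2 = (\<Union>c\<in>insert 2 (Wcs A W). GG A W K 2 \<inter> X c)"
  proof -
    have "\<exists>c\<in>insert 2 (Wcs A W). (P, q) \<in> X c" if "(P, q) \<in> GG A W K 2" for P q
    proof -
      have P: "P \<in> grass 2" "sub_of P \<subseteq> W" "\<And>x. x \<in> sub_of P \<Longrightarrow> A x \<in> sub_of P" using that GGi by blast+
      from grass_2_class[OF A P] show ?thesis
      proof
        assume "\<forall>x\<in>sub_of P. A (A x) = x"
        then show ?thesis using X2 by blast
      next
        assume "\<exists>c\<in>Wcs A W. sub_of P \<subseteq> Wc A W c"
        then show ?thesis using WX c2 by blast
      qed
    qed
    then show ?thesis by (intro subset_antisym subrelI) auto
  qed
  have disj: "GG A W K 2 \<inter> X i \<inter> X j = {}" if ij: "i \<in> insert 2 (Wcs A W)" "j \<in> insert 2 (Wcs A W)" "i \<noteq> j" for i j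
  proof (rule ccontr)
    assume "\<not> ?thesis"
    then obtain P q where Pq: "(P, q) \<in> GG A W K 2" "(P, q) \<in> X i" "(P, q) \<in> X j" by auto
    have "dim (sub_of P) = 2" using Pq(1) by (simp add: GGi grass_iff)
    then obtain x where x: "x \<in> sub_of P" "x \<noteq> 0"
      by (metis dim_eq_0 singletonI subsetI zero_neq_numeral)
    have xW: "x \<in> W" using x Pq(1) GGi by auto
    have n: "norm (A x) = norm x" using A xW by (auto simp: isoW_def)
    \<comment> \<open>Both equations together give \<open>x = c\<close> times \<open>A x\<close>;
      comparing norms forces \<open>\<bar>c\<bar> = 1\<close>, outside the range of
      \<open>Wcs\<close>.\<close>
    have main: False if "c \<in> Wcs A W" "(P, q) \<in> X 2" "(P, q) \<in> X c" for c
    proof -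
      have "x = (2 * c) *\<^sub>R A x - x" using that x c2[OF that(1)] unfolding X by (simp add: g_def)
      then have "2 *\<^sub>R x = (2 * c) *\<^sub>R A x" by (simp add: scaleR_2)
      then have "2 * norm x = \<bar>2 * c\<bar> * norm x" using n by (metis norm_scaleR abs_numeral)
      then show False using x that(1) by (auto simp: Wcs_def)
    qed
    have "i = 2 \<Longrightarrow> False" using main[of j] ij Pq by auto
    moreover have "j = 2 \<Longrightarrow> False" using main[of i] ij Pq by auto
    moreover have False if "i \<noteq> 2" "j \<noteq> 2"
    proof -
      have 1: "A (A x) = (2 * i) *\<^sub>R A x - x" using that(1) Pq(2) x(1) unfolding X g_def by auto
      have 2: "A (A x) = (2 * j) *\<^sub>R A x - x" using that(2) Pq(3) x(1) unfolding X g_def by auto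
      have "(2 * i) *\<^sub>R A x - x = (2 * j) *\<^sub>R A x - x" by (rule trans[OF 1[symmetric] 2])
      then have "A x = 0" using ij(3) by auto
      then show False using n x by simp
    qed
    ultimately show False by blast
  qed
  have Er_o: "\<And>x y. x \<in> Er A W 1 \<Longrightarrow> y \<in> Er A W (-1) \<Longrightarrow> x \<bullet> y = 0" by (rule Er_orth[OF A])
  have piece2: "GG A W K 2 \<inter> X 2 = Gen 2 (Er A W 1) (Er A W (-1)) K"
  proof -
    have "(sub_of P \<subseteq> W \<and> (\<forall>x\<in>sub_of P. A x \<in> sub_of P)) \<and> (\<forall>x\<in>sub_of P. A (A x) = x) \<longleftrightarrow>
       (\<forall>x\<in>sub_of P. \<exists>a\<in>sub_of P \<inter> Er A W 1. \<exists>b\<in>sub_of P \<inter> Er A W (-1). x = a + b)" (is "?L \<longleftrightarrow> ?R") for P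
    proof
      assume L: ?L
      show ?R
      proof
        fix x assume x: "x \<in> sub_of P"
        have xs: "A x \<in> sub_of P" "x \<in> W" "A x \<in> W" "A (A x) = x" using L x by auto
        define a where "a = (1/2) *\<^sub>R (x + A x)"
        define b where "b = (1/2) *\<^sub>R (x - A x)"
        have "a \<in> sub_of P" "b \<in> sub_of P"
          unfolding a_def b_def using x xs(1) subspace_sub_of[of P]
          by (blast intro: subspace_scale subspace_add subspace_diff)+
        moreover have "A a = 1 *\<^sub>R a" "A b = (-1) *\<^sub>R b"
          unfolding a_def b_def linear_scale[OF l] linear_add[OF l] linear_diff[OF l] xs(4)
          by (simp_all add: add.commute flip: scaleR_minus_right)
        ultimately have "a \<in> sub_of P \<inter> Er A W 1" "b \<in> sub_of P \<inter> Er A W (-1)"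
          using L by (auto simp: Er_def)
        moreover have "x = a + b" unfolding a_def b_def by (simp flip: scaleR_add_right scaleR_2)
        ultimately show "\<exists>a\<in>sub_of P \<inter> Er A W 1. \<exists>b\<in>sub_of P \<inter> Er A W (-1). x = a + b" by blast
      qed
    next
      assume R: ?R
      have "x \<in> W \<and> A x \<in> sub_of P \<and> A (A x) = x" if xP: "x \<in> sub_of P" for x
      proof -
        obtain a b where ab: "a \<in> sub_of P" "b \<in> sub_of P" "a \<in> W" "b \<in> W" "A a = a" "A b = - b" "x = a + b"
        proof -
          obtain a b where "a \<in> sub_of P \<inter> Er A W 1" "b \<in> sub_of P \<inter> Er A W (-1)" "x = a + b" using R xP by blast
          then show ?thesis by (intro that[of a b]) (auto simp: Er_def)
        qed
        then have "A x = a - b" "A (A x) = x"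
          by (simp_all add: linear_add[OF l] linear_diff[OF l] linear_neg[OF l])
        then show ?thesis using ab sW subspace_sub_of[of P] by (auto simp: subspace_add subspace_diff)
      qed
      then show ?L by blast
    qed
    note * = this
    have "(P, q) \<in> GG A W K 2 \<inter> X 2 \<longleftrightarrow> (P, q) \<in> Gen 2 (Er A W 1) (Er A W (-1)) K" for P q
      unfolding Gen_def mem_Collect_eq prod.case *[symmetric] Int_iff GGi X2 by blast
    then show ?thesis by (intro set_eqI) (simp only: split_paired_all)
  qed
  have piece: "GG A W K 2 \<inter> X c = PS (Wc A W c) (Jc A c) \<times> K" if c: "c \<in> Wcs A W" for c
  proof -
    have cc: "-1 < c" "c < 1" using c by (auto simp: Wcs_def)
    then have s0: "sqrt (1 - c\<^sup>2) \<noteq> 0" using abs_square_less[OF cc] by auto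
    have KW: "x \<bullet> y = 0" if "x \<in> K" "y \<in> Wc A W c" for x y
    proof (cases "K = {0}")
      case False
      then have "x \<in> Wc A W 1" using K(2) that(1) Er_subset_Wc(1)[OF l] by auto
      then show ?thesis using Wc_orth[OF A _ that(2)] cc by auto
    qed (use that in auto)
    \<comment> \<open>Each of \<open>A\<close> and \<open>J\<close> is a combination of the other
      and the identity, so they have the same invariant subspaces; this identifies the piece with a
      complex projective space.\<close>
    have J: "(\<forall>x\<in>sub_of P. Jc A c x \<in> sub_of P) \<longleftrightarrow> (\<forall>x\<in>sub_of P. A x \<in> sub_of P)" for P
    proof -
      have "Jc A c x \<in> sub_of P" if "A x \<in> sub_of P" "x \<in> sub_of P" for x
        unfolding Jc_def using that subspace_sub_of by (intro subspace_scale subspace_diff)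
      moreover have "A x \<in> sub_of P" if "Jc A c x \<in> sub_of P" "x \<in> sub_of P" for x
      proof -
        have "A x = sqrt (1 - c\<^sup>2) *\<^sub>R Jc A c x + c *\<^sub>R x" using s0 by (simp add: Jc_def)
        then show ?thesis using that subspace_sub_of by (metis subspace_add subspace_scale)
      qed
      ultimately show ?thesis by blast
    qed
    have "(P, q) \<in> GG A W K 2 \<inter> X c \<longleftrightarrow> P \<in> PS (Wc A W c) (Jc A c) \<and> q \<in> K" for P q
    proof -
      have "P *v q = 0" if "P \<in> grass 2" "sub_of P \<subseteq> Wc A W c" "q \<in> K"
        using that KW by (intro isP_kerI) (auto simp: grass_iff)
      then show ?thesis
        unfolding PS_eq[OF cstr_Wc[OF A cc]] J mem_Collect_eq Int_iff GGi
        using WX[OF c2[OF c], of P q] by (simp, blast)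
    qed
    then show ?thesis by auto
  qed
  have fin: "finite (components (GG A W K 2 \<inter> X c))" if "c \<in> insert 2 (Wcs A W)" for c
  proof (cases "c = 2")
    case True
    then show ?thesis
      using finite_components_Gen_2[OF subspace_Er[OF l sW] subspace_Er[OF l sW] Er_o K] piece2 by simp
  next
    case False
    then have c: "c \<in> Wcs A W" using that by auto
    then have "connected (PS (Wc A W c) (Jc A c) \<times> K)"
      using comp_dims_PS_Times(2)[OF cstr_Wc[OF A] K(1)] by (auto simp: Wcs_def)
    then show ?thesis unfolding piece[OF c]
      by (intro finite_components_Union[of "{PS (Wc A W c) (Jc A c) \<times> K}"]) auto
  qed
  have f: "finite (Wcs A W)" by (rule finite_Wcs[OF A])
  have "comp_dims (GG A W K 2) = (\<Sum>c\<in>insert 2 (Wcs A W). comp_dims (GG A W K 2 \<inter> X c))"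
    by (subst GG, rule conjunct1[OF comp_dims_UN]) (use f clX disj fin in auto)
  also have "\<dots> = comp_dims (GG A W K 2 \<inter> X 2) + (\<Sum>c\<in>Wcs A W. comp_dims (GG A W K 2 \<inter> X c))"
    using f c2 by (intro sum.insert) auto
  also have "(\<Sum>c\<in>Wcs A W. comp_dims (GG A W K 2 \<inter> X c)) = (\<Sum>c\<in>Wcs A W. {#dim (Wc A W c) - 2 + dim K#})"
  proof (rule sum.cong[OF refl])
    fix c assume c: "c \<in> Wcs A W"
    then have cc: "-1 < c" "c < 1" "Wc A W c \<noteq> {0}" by (auto simp: Wcs_def)
    show "comp_dims (GG A W K 2 \<inter> X c) = {#dim (Wc A W c) - 2 + dim K#}"
      unfolding piece[OF c] using comp_dims_PS_Times(1)[OF cstr_Wc[OF A cc(1,2)] K(1) cc(3)] by simp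
  qed
  finally show ?thesis unfolding piece2 sum_singleton_mset[OF f] .
qed

text \<open>The entries are real dimensions, twice those of the Segre symbol.\<close>

definition csym :: "('a::euclidean_space \<Rightarrow> 'a) \<Rightarrow> 'a set \<Rightarrow> nat multiset" where
  "csym A W = image_mset (\<lambda>c. dim (Wc A W c)) (mset_set (Wcs A W))"

text \<open>The contribution of an eigenvalue \<open>1\<close> or \<open>-1\<close> to a Segre
  symbol: a zero eigenspace leaves no entry.\<close>

definition nz :: "nat \<Rightarrow> nat multiset" where
  "nz d = (if d = 0 then {#} else {#d#})"

text \<open>Adding 2 and subtracting \<open>d\<close> undoes the shift; by \<open>dim_Wc_ge\<close>
  the truncated subtractions are exact.\<close>

lemma csym_eqI:
  assumes A: "isoW A W" and B: "isoW B W'"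
    and eq: "image_mset (\<lambda>c. dim (Wc A W c) - 2 + d) (mset_set (Wcs A W))
        = image_mset (\<lambda>c. dim (Wc B W' c) - 2 + d) (mset_set (Wcs B W'))"
  shows "csym A W = csym B W'"
proof -
  have *: "csym A W = image_mset (\<lambda>n. n + 2 - d) (image_mset (\<lambda>c. dim (Wc A W c) - 2 + d) (mset_set (Wcs A W)))"
    if A: "isoW A W" for A :: "real^'m \<Rightarrow> real^'m" and W
    unfolding csym_def multiset.map_comp
  proof (rule image_mset_cong)
    fix c assume "c \<in># mset_set (Wcs A W)"
    then have "c \<in> Wcs A W" using finite_Wcs[OF A] by simp
    then show "dim (Wc A W c) = ((\<lambda>n. n + 2 - d) \<circ> (\<lambda>c. dim (Wc A W c) - 2 + d)) c"
      using dim_Wc_ge[OF A] by fastforce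
  qed
  show ?thesis unfolding *[OF A] *[OF B] eq ..
qed

section \<open>Eigenspace dimensions recovered from component dimensions\<close>

lemma carries_0: "carries M {0} {0}"
  by (auto simp: carries_def)

theorem core_fixed:
  fixes A B :: "real^'m \<Rightarrow> real^'m"
  assumes A: "isoW A W" and B: "isoW B W'"
    and eq: "\<And>k. k \<le> 2 \<Longrightarrow> comp_dims (GG A W (Er A W 1) k) = comp_dims (GG B W' (Er B W' 1) k)"
  shows "dim (Er A W 1) = dim (Er B W' 1)" "dim (Er A W (-1)) = dim (Er B W' (-1))" "csym A W = csym B W'"
proof -
  let ?E = "Er A W 1" and ?F = "Er A W (-1)" and ?E' = "Er B W' 1" and ?F' = "Er B W' (-1)"
  have l: "linear A" "subspace W" "linear B" "subspace W'" using A B by (auto simp: isoW_def)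
  have s: "subspace ?E" "subspace ?F" "subspace ?E'" "subspace ?F'" using l subspace_Er by blast+
  show 1: "dim ?E = dim ?E'"
    using eq[of 0] comp_dims_GG_0[OF l(1,2) s(1)] comp_dims_GG_0[OF l(3,4) s(3)] by simp
  have "\<exists>M. carries M ?E ?E' \<and> carries M {0} {0}"
    by (rule ex_carries) (use s 1 in \<open>auto simp: subspace_single_0\<close>)
  then obtain M where M: "carries M ?E ?E'" by blast
  \<comment> \<open>Here \<open>q\<close> runs through the complement of the line inside the same
    eigenspace, a bundle that is in general no product. Its dimension is not computed; equality of
    the two sides suffices to cancel it and isolate the eigenvalue \<open>-1\<close>.\<close>
  have "comp_dims (Gen 1 ?E {0} ?E) = comp_dims (Gen 1 ?E' {0} ?E')"
    by (rule comp_dims_homeomorphic[OF Gen_homeomorphic[OF M carries_0 M]])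
  then have "comp_dims (Gen 1 ?F {0} ?E) = comp_dims (Gen 1 ?F' {0} ?E')"
    using eq[of 1] comp_dims_GG_1[OF A s(1)] comp_dims_GG_1[OF B s(3)] by simp
  then show 2: "dim ?F = dim ?F'"
    using comp_dims_Gen_1[OF s(2,1)] Er_orth[OF A] comp_dims_Gen_1[OF s(4,3)] Er_orth[OF B] 1
    by (simp del: dim_eq_0 split: if_splits)
  have "\<exists>M. carries M ?E ?E' \<and> carries M ?F ?F'"
    by (rule ex_carries) (use s 1 2 Er_orth[OF A] Er_orth[OF B] in auto)
  then obtain N where N: "carries N ?E ?E'" "carries N ?F ?F'" by blast
  have "comp_dims (Gen 2 ?E ?F ?E) = comp_dims (Gen 2 ?E' ?F' ?E')"
    by (rule comp_dims_homeomorphic[OF Gen_homeomorphic[OF N N(1)]])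
  then show "csym A W = csym B W'"
    using eq[of 2] comp_dims_GG_2[OF A s(1)] comp_dims_GG_2[OF B s(3)] 1 by (intro csym_eqI[OF A B]) auto
qed

lemma nz_pred_eq:
  fixes r s r' s' :: nat
  assumes "(if r = 0 then {#} else {#r - 1#}) + (if s = 0 then {#} else {#s - 1#})
     = (if r' = 0 then {#} else {#r' - 1#}) + (if s' = 0 then {#} else {#s' - 1#})"
  shows "r = r' \<and> s = s' \<or> r = s' \<and> s = r'"
  using assms by (cases r; cases s; cases r'; cases s') (auto simp: add_eq_conv_diff One_nat_def split: if_splits)

lemma Gen_commute: "Gen d E F K = Gen d F E K"
  unfolding Gen_def by (auto; metis add.commute)

text \<open>Without the vector \<open>q\<close> the eigenvalues \<open>1\<close> and
  \<open>-1\<close> play symmetric roles, so their dimensions are found only up to order. If they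
  are exchanged between \<open>A\<close> and \<open>B\<close>, the real pieces are still
  homeomorphic because \<open>Gen\<close> is symmetric in its two eigenspaces.\<close>

theorem core_0:
  fixes A B :: "real^'m \<Rightarrow> real^'m"
  assumes A: "isoW A W" and B: "isoW B W'"
    and eq: "\<And>k. k \<le> 2 \<Longrightarrow> comp_dims (GG A W {0} k) = comp_dims (GG B W' {0} k)"
  shows "nz (dim (Er A W 1)) + nz (dim (Er A W (-1))) = nz (dim (Er B W' 1)) + nz (dim (Er B W' (-1)))"
    "csym A W = csym B W'"
proof -
  let ?E = "Er A W 1" and ?F = "Er A W (-1)" and ?E' = "Er B W' 1" and ?F' = "Er B W' (-1)"
  have l: "linear A" "subspace W" "linear B" "subspace W'" using A B by (auto simp: isoW_def)
  have s: "subspace ?E" "subspace ?F" "subspace ?E'" "subspace ?F'" using l subspace_Er by blast+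
  have G: "comp_dims (Gen 1 E {0} {0}) = (if dim E = 0 then {#} else {#dim E - 1#})" if "subspace E" for E :: "(real^'m) set"
    using comp_dims_Gen_1[OF that subspace_single_0] by simp
  have "(if dim ?E = 0 then {#} else {#dim ?E - 1#}) + (if dim ?F = 0 then {#} else {#dim ?F - 1#})
      = (if dim ?E' = 0 then {#} else {#dim ?E' - 1#}) + (if dim ?F' = 0 then {#} else {#dim ?F' - 1#})"
    using eq[of 1] comp_dims_GG_1[OF A subspace_single_0] comp_dims_GG_1[OF B subspace_single_0] by (simp add: G s del: dim_eq_0)
  then have d: "dim ?E = dim ?E' \<and> dim ?F = dim ?F' \<or> dim ?E = dim ?F' \<and> dim ?F = dim ?E'"
    by (rule nz_pred_eq)
  then show "nz (dim ?E) + nz (dim ?F) = nz (dim ?E') + nz (dim ?F')" by auto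
  have "Gen 2 ?E ?F {0} homeomorphic Gen 2 ?E' ?F' {0}"
    using d
  proof
    assume *: "dim ?E = dim ?E' \<and> dim ?F = dim ?F'"
    have "\<exists>M. carries M ?E ?E' \<and> carries M ?F ?F'"
      by (rule ex_carries) (use s * Er_orth[OF A] Er_orth[OF B] in auto)
    then obtain N where N: "carries N ?E ?E'" "carries N ?F ?F'" by blast
    show ?thesis by (rule Gen_homeomorphic[OF N carries_0])
  next
    assume *: "dim ?E = dim ?F' \<and> dim ?F = dim ?E'"
    have o: "x \<bullet> y = 0" if "x \<in> ?F'" "y \<in> ?E'" for x y using Er_orth[OF B that(2,1)] by (simp add: inner_commute)
    have "\<exists>M. carries M ?E ?F' \<and> carries M ?F ?E'"
      by (rule ex_carries) (use s * Er_orth[OF A] o in auto)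
    then obtain N where N: "carries N ?E ?F'" "carries N ?F ?E'" by blast
    show ?thesis unfolding Gen_commute[of 2 ?E'] by (rule Gen_homeomorphic[OF N carries_0])
  qed
  then have "comp_dims (Gen 2 ?E ?F {0}) = comp_dims (Gen 2 ?E' ?F' {0})" by (rule comp_dims_homeomorphic)
  then show "csym A W = csym B W'"
    using eq[of 2] comp_dims_GG_2[OF A subspace_single_0] comp_dims_GG_2[OF B subspace_single_0]
    by (intro csym_eqI[OF A B, of "dim {0 :: real^'m}"]) auto
qed

section \<open>Complex eigenspaces\<close>

lemma matrix_apply:
  fixes A :: "real^'m \<Rightarrow> real^'n"
  assumes "linear A" shows "matrix A *v x = A x"
  using fun_cong[OF matrix_vector_mul(2)[OF assms], of x] by simp

lemma sum_decomp_dim: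
  fixes S T :: "'a::euclidean_space set"
  assumes "subspace S" "subspace T" "S \<inter> T \<subseteq> {0}"
  shows "dim {x + y | x y. x \<in> S \<and> y \<in> T} = dim S + dim T"
proof -
  have "dim (S \<inter> T) = 0" using assms(3) by simp
  then show ?thesis using dim_sums_Int[OF assms(1,2)] by linarith
qed

lemma complex_scale_real: "complex_of_real r *s v = r *\<^sub>R (v :: complex^'m)"
proof -
  have "complex_of_real r * v $ i = r *\<^sub>R (v $ i)" for i by (simp add: scaleR_conv_of_real)
  then show ?thesis by (simp add: vec_eq_iff)
qed

lemma vec_subspace_imp_subspace: "vec.subspace S \<Longrightarrow> subspace (S :: (complex^'m) set)"
  unfolding subspace_def vec.subspace_def by (metis complex_scale_real)

text \<open>A further complex independent vector contributes the real plane of its complex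
  multiples, which meets the previous span only in 0.\<close>

lemma dim_complex_span:
  fixes B :: "(complex^'m) set"
  assumes "finite B" "vec.independent B"
  shows "dim (vec.span B) = 2 * card B"
  using assms
proof (induction B rule: finite_induct)
  case empty
  then show ?case by simp
next
  case (insert b B)
  have ind: "vec.independent B" "b \<notin> vec.span B"
    using insert.prems insert.hyps by (auto simp: vec.independent_insert split: if_splits)
  define L where "L = range (\<lambda>z. z *s b)"
  have lin: "linear (\<lambda>z. z *s b)"
    by (auto simp: linear_iff vec.scale_left_distrib) (simp add: vec_eq_iff)
  have sL: "subspace L" unfolding L_def using linear_subspace_image[OF lin subspace_UNIV] .
  have "b \<noteq> 0" using ind(2) vec.span_zero by auto
  then have "inj (\<lambda>z. z *s b)" by (auto simp: inj_on_def)
  then have dL: "dim L = 2"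
    unfolding L_def using dim_image_eq[OF lin, of UNIV] by simp
  have sB: "subspace (vec.span B)" by (simp add: vec_subspace_imp_subspace)
  have eq: "vec.span (insert b B) = {x + y | x y. x \<in> L \<and> y \<in> vec.span B}"
  proof (intro set_eqI iffI)
    fix x assume "x \<in> vec.span (insert b B)"
    then obtain k where "x - k *s b \<in> vec.span B" unfolding vec.span_insert by blast
    moreover have "x = k *s b + (x - k *s b)" by simp
    ultimately show "x \<in> {x + y | x y. x \<in> L \<and> y \<in> vec.span B}" unfolding L_def by blast
  next
    fix x assume "x \<in> {x + y | x y. x \<in> L \<and> y \<in> vec.span B}"
    then obtain k y where "x = k *s b + y" "y \<in> vec.span B" unfolding L_def by blast
    then show "x \<in> vec.span (insert b B)" unfolding vec.span_insert by (intro CollectI exI[of _ k]) simp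
  qed
  have "L \<inter> vec.span B \<subseteq> {0}"
  proof
    fix x assume "x \<in> L \<inter> vec.span B"
    then obtain k where k: "x = k *s b" "k *s b \<in> vec.span B" by (auto simp: L_def)
    have "k = 0"
    proof (rule ccontr)
      assume "k \<noteq> 0"
      then have "b \<in> vec.span B" using vec.span_scale[OF k(2), of "inverse k"] by simp
      then show False using ind(2) by blast
    qed
    then show "x \<in> {0}" using k by simp
  qed
  then have "dim (vec.span (insert b B)) = 2 + dim (vec.span B)"
    unfolding eq using sum_decomp_dim[OF sL sB] dL by simp
  then show ?case using insert ind by simp
qed

lemma dim_complex_subspace:
  fixes V :: "(complex^'m) set"
  assumes "vec.subspace V" shows "dim V = 2 * vec.dim V"
proof -
  obtain B where B: "B \<subseteq> V" "vec.independent B" "V \<subseteq> vec.span B" "card B = vec.dim V"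
    using vec.basis_exists by blast
  have "vec.span B = V" using B(1,3) assms vec.span_minimal by blast
  moreover have "finite B" using B(2) by (rule vec.finiteI_independent)
  ultimately show ?thesis using dim_complex_span[OF _ B(2)] B(4) by simp
qed

definition Rev :: "complex^'m \<Rightarrow> real^'m" where "Rev v = (\<chi> i. Re (v $ i))"
definition Imv :: "complex^'m \<Rightarrow> real^'m" where "Imv v = (\<chi> i. Im (v $ i))"

lemma Rev_Imv_eq: "v = w \<longleftrightarrow> Rev v = Rev w \<and> Imv v = Imv w"
  by (auto simp: Rev_def Imv_def vec_eq_iff complex_eq_iff)

lemma Rev_mult: "Rev (cplx_mat A *v v) = A *v Rev v" "Imv (cplx_mat A *v v) = A *v Imv v"
  by (simp_all add: Rev_def Imv_def cplx_mat_def matrix_vector_mult_def vec_eq_iff)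

lemma Rev_scale: "Rev (c *s v) = Re c *\<^sub>R Rev v - Im c *\<^sub>R Imv v" "Imv (c *s v) = Im c *\<^sub>R Rev v + Re c *\<^sub>R Imv v"
  by (simp_all add: Rev_def Imv_def vec_eq_iff)

lemma ceig_iff:
  "v \<in> ceig A W c \<longleftrightarrow> Rev v \<in> W \<and> Imv v \<in> W \<and> A *v Rev v = Re c *\<^sub>R Rev v - Im c *\<^sub>R Imv v
     \<and> A *v Imv v = Im c *\<^sub>R Rev v + Re c *\<^sub>R Imv v"
  unfolding ceig_def cplx_sub_def Rev_def[symmetric] Imv_def[symmetric]
  by (auto simp: Rev_Imv_eq[of "_ *v _"] Rev_mult Rev_scale)

lemma vec_subspace_ceig:
  assumes "subspace W" shows "vec.subspace (ceig A W c)"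
proof -
  have a: "Rev (v + w) = Rev v + Rev w" "Imv (v + w) = Imv v + Imv w" for v w :: "complex^'a"
    by (simp_all add: Rev_def Imv_def vec_eq_iff)
  have z: "Rev (0 :: complex^'a) = 0" "Imv (0 :: complex^'a) = 0"
    by (simp_all add: Rev_def Imv_def vec_eq_iff)
  have "cplx_mat A *v (k *s v) = k *s (cplx_mat A *v v)" for k v
    by (simp add: vec_eq_iff matrix_vector_mult_def sum_distrib_left mult_ac)
  moreover have "Rev v \<in> W \<and> Imv v \<in> W \<Longrightarrow> Rev (k *s v) \<in> W \<and> Imv (k *s v) \<in> W" for k v
    using assms by (auto simp: Rev_scale intro!: subspace_diff subspace_add subspace_scale)
  ultimately show ?thesis
    unfolding vec.subspace_def ceig_def cplx_sub_def Rev_def[symmetric] Imv_def[symmetric]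
    using assms by (auto simp: a z subspace_0 subspace_add matrix_vector_right_distrib vec.scale_right_distrib mult.commute)
qed

text \<open>All eigenvalues of \<open>A\<close> on the complexification of \<open>W\<close> have modulus one.\<close>

definition rotpos :: "('a::real_vector \<Rightarrow> 'a) \<Rightarrow> 'a set \<Rightarrow> bool" where
  "rotpos A W \<longleftrightarrow> (\<forall>x\<in>W. \<forall>y\<in>W. \<forall>a b. A x = a *\<^sub>R x - b *\<^sub>R y \<and> A y = b *\<^sub>R x + a *\<^sub>R y \<and> \<not> (x = 0 \<and> y = 0)
     \<longrightarrow> a\<^sup>2 + b\<^sup>2 = 1)"

text \<open>Stated for an arbitrary form because it is applied to the inner product and to the
  Lorentz form. In the sum of the two invariance relations for \<open>x\<close> and \<open>y\<close>
  the mixed terms cancel, leaving \<open>a\<^sup>2 + b\<^sup>2 - 1\<close> times a positive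
  number.\<close>

lemma rotposI:
  assumes "linear A" "bilinear \<phi>" "\<And>x y. \<phi> x y = \<phi> y x" "\<And>x. x \<in> W \<Longrightarrow> x \<noteq> 0 \<Longrightarrow> \<phi> x x > (0::real)"
    and inv: "\<And>x. x \<in> W \<Longrightarrow> \<phi> (A x) (A x) = \<phi> x x"
  shows "rotpos A W"
  unfolding rotpos_def
proof (intro ballI allI impI)
  fix x y a b assume xy: "x \<in> W" "y \<in> W"
    and h: "A x = a *\<^sub>R x - b *\<^sub>R y \<and> A y = b *\<^sub>R x + a *\<^sub>R y \<and> \<not> (x = 0 \<and> y = 0)"
  have "\<phi> x x = a * a * \<phi> x x - 2 * a * b * \<phi> x y + b * b * \<phi> y y"
    using inv[OF xy(1)] h assms(3)[of x y]
    by (simp add: bilinear_lsub[OF assms(2)] bilinear_rsub[OF assms(2)] bilinear_lmul[OF assms(2)] bilinear_rmul[OF assms(2)] algebra_simps)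
  moreover have "\<phi> y y = b * b * \<phi> x x + 2 * a * b * \<phi> x y + a * a * \<phi> y y"
    using inv[OF xy(2)] h assms(3)[of x y]
    by (simp add: bilinear_ladd[OF assms(2)] bilinear_radd[OF assms(2)] bilinear_lmul[OF assms(2)] bilinear_rmul[OF assms(2)] algebra_simps)
  ultimately have "(a\<^sup>2 + b\<^sup>2 - 1) * (\<phi> x x + \<phi> y y) = 0" by (simp add: power2_eq_square algebra_simps)
  moreover have "\<phi> x x + \<phi> y y > 0"
    using assms(4)[OF xy(1)] assms(4)[OF xy(2)] h bilinear_lzero[OF assms(2)]
    by (cases "x = 0"; cases "y = 0") (auto intro: add_pos_pos)
  ultimately show "a\<^sup>2 + b\<^sup>2 = 1" by simp
qed

text \<open>With \<open>c = a + i b\<close> and \<open>b \<noteq> 0\<close>, an eigenvector is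
  determined by its real part \<open>x\<close>: the imaginary part must be
  \<open>(a x - A x) / b\<close>. Modulus one turns the real quadratic polynomial of the conjugate
  pair into the equation of \<open>Wc\<close>.\<close>

lemma ceig_Wc:
  fixes A :: "real^'m \<Rightarrow> real^'m"
  assumes A: "linear A" and W: "subspace W" "\<And>x. x \<in> W \<Longrightarrow> A x \<in> W" and c: "Im c > 0" "cmod c = 1"
  shows "Rev ` ceig (matrix A) W c = Wc A W (Re c)" "inj_on Rev (ceig (matrix A) W c)"
proof -
  note m = matrix_apply[OF A]
  have cc: "(Re c)\<^sup>2 + (Im c)\<^sup>2 = 1" using c(2) by (metis cmod_power2 one_power2)
  have two: "(2 * r) *\<^sub>R X = r *\<^sub>R X + r *\<^sub>R X" for r and X :: "real^'m"
    by (simp only: mult_2 scaleR_left_distrib)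
  let ?a = "Re c" and ?b = "Im c"
  have Wc: "x \<in> Wc A W ?a \<longleftrightarrow> x \<in> W \<and> A (A x) = (2 * ?a) *\<^sub>R A x - x" for x
    by (auto simp: Wc_def algebra_simps)
  show "Rev ` ceig (matrix A) W c = Wc A W ?a"
  proof (intro set_eqI iffI)
    fix x assume "x \<in> Rev ` ceig (matrix A) W c"
    then obtain v where v: "x = Rev v" "v \<in> ceig (matrix A) W c" by blast
    let ?y = "Imv v"
    have xy: "x \<in> W" "A x = ?a *\<^sub>R x - ?b *\<^sub>R ?y" "A ?y = ?b *\<^sub>R x + ?a *\<^sub>R ?y"
      using v by (auto simp: ceig_iff m)
    have "A (A x) = ?a *\<^sub>R A x - ?b *\<^sub>R (?b *\<^sub>R x + ?a *\<^sub>R ?y)"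
      by (subst xy(2)) (simp add: linear_diff[OF A] linear_scale[OF A] xy(3))
    also have "\<dots> = (2 * ?a) *\<^sub>R A x - (?a\<^sup>2 + ?b\<^sup>2) *\<^sub>R x"
      unfolding xy(2) by (simp add: vec_eq_iff algebra_simps power2_eq_square)
    finally show "x \<in> Wc A W ?a" using xy(1) cc by (simp add: Wc)
  next
    fix x assume "x \<in> Wc A W ?a"
    then have x: "x \<in> W" "A (A x) = (2 * ?a) *\<^sub>R A x - x" by (auto simp: Wc)
    define y where "y = (1 / ?b) *\<^sub>R (?a *\<^sub>R x - A x)"
    have yW: "y \<in> W" unfolding y_def using x W by (intro subspace_scale subspace_diff) auto
    have bY: "?b *\<^sub>R y = ?a *\<^sub>R x - A x" using c(1) by (simp add: y_def)
    then have Ax: "A x = ?a *\<^sub>R x - ?b *\<^sub>R y" by (simp add: algebra_simps)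
    have "?b *\<^sub>R A y = ?a *\<^sub>R A x - A (A x)"
      using arg_cong[OF bY, of A] by (simp add: linear_diff[OF A] linear_scale[OF A])
    also have "\<dots> = x - ?a *\<^sub>R A x" unfolding x(2) two by (simp add: algebra_simps)
    also have "\<dots> = (1 - ?a\<^sup>2) *\<^sub>R x + (?a * ?b) *\<^sub>R y" unfolding Ax by (simp add: algebra_simps power2_eq_square)
    also have "1 - ?a\<^sup>2 = ?b * ?b" using cc by (simp add: power2_eq_square)
    finally have "?b *\<^sub>R A y = ?b *\<^sub>R (?b *\<^sub>R x + ?a *\<^sub>R y)" by (simp add: algebra_simps)
    then have Ay: "A y = ?b *\<^sub>R x + ?a *\<^sub>R y" using c(1) by simp
    define v where "v = (\<chi> i. Complex (x $ i) (y $ i))"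
    have "Rev v = x" "Imv v = y" by (simp_all add: v_def Rev_def Imv_def vec_eq_iff)
    then show "x \<in> Rev ` ceig (matrix A) W c"
      using x(1) yW Ax Ay by (intro image_eqI[of _ _ v]) (auto simp: ceig_iff m)
  qed
  show "inj_on Rev (ceig (matrix A) W c)"
  proof (rule inj_onI)
    fix v w assume vw: "v \<in> ceig (matrix A) W c" "w \<in> ceig (matrix A) W c" "Rev v = Rev w"
    then have "?b *\<^sub>R Imv v = ?b *\<^sub>R Imv w" by (auto simp: ceig_iff m)
    then show "v = w" using vw(3) c(1) by (simp add: Rev_Imv_eq)
  qed
qed

lemma vec_dim_ceig:
  fixes A :: "real^'m \<Rightarrow> real^'m"
  assumes A: "linear A" and W: "subspace W" "\<And>x. x \<in> W \<Longrightarrow> A x \<in> W" and c: "Im c > 0" "cmod c = 1"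
  shows "vec.dim (ceig (matrix A) W c) = dim (Wc A W (Re c)) div 2"
    and "ceig (matrix A) W c \<noteq> {0} \<longleftrightarrow> Wc A W (Re c) \<noteq> {0}"
proof -
  note C = ceig_Wc[OF A W c]
  have sc: "subspace (ceig (matrix A) W c)" by (rule vec_subspace_imp_subspace[OF vec_subspace_ceig[OF W(1)]])
  have l: "linear (Rev :: complex^'m \<Rightarrow> real^'m)" by (auto simp: linear_iff Rev_def vec_eq_iff)
  have "dim (Wc A W (Re c)) = dim (ceig (matrix A) W c)"
    using dim_image_eq[OF l, of "ceig (matrix A) W c"] C sc by (simp add: span_eq_iff[THEN iffD2])
  then show "vec.dim (ceig (matrix A) W c) = dim (Wc A W (Re c)) div 2"
    using dim_complex_subspace[OF vec_subspace_ceig[OF W(1), of "matrix A" c]] by simp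
  have 0: "0 \<in> ceig (matrix A) W c" using sc subspace_0 by blast
  have R0: "Rev (0 :: complex^'m) = 0" using l linear_0 by blast
  show "ceig (matrix A) W c \<noteq> {0} \<longleftrightarrow> Wc A W (Re c) \<noteq> {0}"
  proof -
    have "ceig (matrix A) W c = {0}" if "Wc A W (Re c) = {0}"
    proof -
      have "v = 0" if "v \<in> ceig (matrix A) W c" for v
      proof -
        have "Rev v = Rev 0" using C(1) that \<open>Wc A W (Re c) = {0}\<close> R0 by auto
        then show ?thesis using inj_onD[OF C(2) _ that 0] by simp
      qed
      then show ?thesis using 0 by blast
    qed
    moreover have "Wc A W (Re c) = {0}" if "ceig (matrix A) W c = {0}"
      using C(1) that R0 by (metis image_empty image_insert)
    ultimately show ?thesis by blast
  qed
qed

text \<open>By \<open>rotpos\<close> every non-real eigenvalue has modulus one, so those in the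
  upper half plane are parametrised by their real parts through \<open>h\<close>. The sum over
  eigenvalues becomes one over cosines, and complex dimensions become halves of real ones.\<close>

lemma tsigma_eq:
  fixes A :: "real^'m \<Rightarrow> real^'m"
  assumes A: "linear A" and W: "subspace W" "\<And>x. x \<in> W \<Longrightarrow> A x \<in> W" and rp: "rotpos A W"
  shows "tsigma (matrix A) W = (image_mset (\<lambda>n. n div 2) (csym A W), nz (dim (Er A W 1)) + nz (dim (Er A W (-1))))"
proof -
  note m = matrix_apply[OF A]
  define h where "h r = Complex r (sqrt (1 - r\<^sup>2))" for r
  have unit: "cmod c = 1" if c: "Im c > 0" "ceig (matrix A) W c \<noteq> {0}" for c
  proof -
    have "0 \<in> ceig (matrix A) W c"
      using vec_subspace_ceig[OF W(1)] vec.subspace_0 by blast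
    then obtain v where v: "v \<in> ceig (matrix A) W c" "v \<noteq> 0" using c(2) by blast
    have "\<not> (Rev v = 0 \<and> Imv v = 0)"
      using v(2) Rev_Imv_eq[of v 0] by (auto simp: Rev_def Imv_def vec_eq_iff)
    then have "(Re c)\<^sup>2 + (Im c)\<^sup>2 = 1" using v(1) rp unfolding rotpos_def ceig_iff m by metis
    then show ?thesis by (simp add: cmod_def)
  qed
  have hWcs: "Im (h r) > 0" "cmod (h r) = 1" "Re (h r) = r" if "-1 < r" "r < 1" for r
    using abs_square_less[OF that] by (auto simp: h_def cmod_def)
  have set: "{c. Im c > 0 \<and> ceig (matrix A) W c \<noteq> {0}} = h ` Wcs A W"
  proof (intro set_eqI iffI)
    fix c assume "c \<in> {c. Im c > 0 \<and> ceig (matrix A) W c \<noteq> {0}}"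
    then have c: "Im c > 0" "ceig (matrix A) W c \<noteq> {0}" by auto
    then have n: "cmod c = 1" using unit by blast
    then have cc: "(Re c)\<^sup>2 + (Im c)\<^sup>2 = 1" by (metis cmod_power2 one_power2)
    then have "(Re c)\<^sup>2 < 1" using c(1) zero_less_power[OF c(1), of 2] by linarith
    then have "-1 < Re c" "Re c < 1" using abs_square_less_1[of "Re c"] by auto
    moreover have "Wc A W (Re c) \<noteq> {0}" using vec_dim_ceig(2)[OF A W c(1) n] c(2) by simp
    moreover have "1 - (Re c)\<^sup>2 = (Im c)\<^sup>2" using cc by simp
    then have "c = h (Re c)" using c(1) by (simp add: h_def complex_eq_iff)
    ultimately show "c \<in> h ` Wcs A W" by (auto simp: Wcs_def)
  next
    fix c assume "c \<in> h ` Wcs A W"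
    then obtain r where r: "c = h r" "-1 < r" "r < 1" "Wc A W r \<noteq> {0}" by (auto simp: Wcs_def)
    then show "c \<in> {c. Im c > 0 \<and> ceig (matrix A) W c \<noteq> {0}}"
      using hWcs[OF r(2,3)] vec_dim_ceig(2)[OF A W, of c] by simp
  qed
  have inj: "inj_on h (Wcs A W)" by (auto simp: h_def inj_on_def)
  have "image_mset (\<lambda>c. vec.dim (ceig (matrix A) W c)) (mset_set (h ` Wcs A W))
      = image_mset (\<lambda>r. dim (Wc A W r) div 2) (mset_set (Wcs A W))"
    unfolding image_mset_mset_set[OF inj, symmetric] multiset.map_comp
  proof (cases "finite (Wcs A W)")
    case True
    show "image_mset ((\<lambda>c. vec.dim (ceig (matrix A) W c)) \<circ> h) (mset_set (Wcs A W)) = image_mset (\<lambda>r. dim (Wc A W r) div 2) (mset_set (Wcs A W))"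
    proof (rule image_mset_cong)
      fix r assume "r \<in># mset_set (Wcs A W)"
      then have r: "-1 < r" "r < 1" using True by (auto simp: Wcs_def)
      show "((\<lambda>c. vec.dim (ceig (matrix A) W c)) \<circ> h) r = dim (Wc A W r) div 2"
        using vec_dim_ceig(1)[OF A W hWcs(1,2)[OF r]] hWcs(3)[OF r] by simp
    qed
  qed simp
  moreover have "reig (matrix A) W e = Er A W e" for e by (simp add: reig_def Er_def m)
  moreover have "image_mset (\<lambda>e. dim (Er A W e)) (mset_set {e \<in> {1, -1}. Er A W e \<noteq> {0}}) =
     nz (dim (Er A W 1)) + nz (dim (Er A W (-1)))"
  proof -
    have 0: "dim (Er A W e) = 0 \<longleftrightarrow> Er A W e = {0}" for e
      using subspace_0[OF subspace_Er[OF A W(1)]] by auto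
    have "{e \<in> {1, -1}. Er A W e \<noteq> {0}} = (if Er A W 1 = {0} then {} else {1}) \<union> (if Er A W (-1) = {0} then {} else {-1})"
      by auto
    then show ?thesis by (simp add: nz_def 0 del: dim_eq_0)
  qed
  ultimately show ?thesis
    unfolding tsigma_def set csym_def multiset.map_comp by (simp add: o_def)
qed

section \<open>Spherical and Euclidean isometries\<close>

lemma image_subspace_eq:
  fixes f :: "'a::euclidean_space \<Rightarrow> 'a"
  assumes "linear f" "inj_on f U" "subspace U" "f ` U \<subseteq> U"
  shows "f ` U = U"
proof -
  have "dim (f ` U) = dim U"
    using dim_image_eq[OF assms(1), of U] assms(2,3) by (simp add: span_eq_iff[THEN iffD2])
  then show ?thesis
    using assms by (intro subspace_dim_equal) (auto intro: linear_subspace_image)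
qed

lemma isoW_image_eq:
  assumes A: "isoW A W" and U: "subspace U" "U \<subseteq> W"
  shows "A ` U = U \<longleftrightarrow> (\<forall>x\<in>U. A x \<in> U)"
proof -
  have l: "linear A" using A by (simp add: isoW_def)
  have "inj_on A U"
  proof (rule inj_onI)
    fix x y assume xy: "x \<in> U" "y \<in> U" "A x = A y"
    then have "x - y \<in> W" using U subspace_diff by blast
    then have "norm (A (x - y)) = norm (x - y)" using A by (simp add: isoW_def)
    then show "x = y" using xy(3) by (simp add: linear_diff[OF l])
  qed
  then show ?thesis using image_subspace_eq[OF l _ U(1)] by blast
qed

lemma isoW_orthogonal_transformation: "orthogonal_transformation f \<Longrightarrow> isoW f UNIV"
  by (simp add: isoW_def orthogonal_transformation)

lemma isoW_rotpos: assumes "isoW A W" shows "rotpos A W"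
proof (rule rotposI)
  show "linear A" using assms by (simp add: isoW_def)
  show "bilinear (inner :: real^'a \<Rightarrow> _)" by (simp add: bilinear_conv_bounded_bilinear bounded_bilinear_inner)
  show "A x \<bullet> A x = x \<bullet> x" if "x \<in> W" for x using isoW_inner[OF assms that that] .
qed (auto simp: inner_commute)

text \<open>\<open>A\<close> maps the range of \<open>P\<close> onto itself and preserves inner
  products on \<open>W\<close>, so it also preserves the orthogonal complement of that range within
  \<open>W\<close>.\<close>

lemma isoW_commute:
  assumes A: "isoW A W" and P: "isP P" "sub_of P \<subseteq> W" "\<And>u. u \<in> sub_of P \<Longrightarrow> A u \<in> sub_of P" and x: "x \<in> W"
  shows "P *v A x = A (P *v x)"
proof -
  have l: "linear A" and sW: "subspace W" using A by (auto simp: isoW_def)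
  have Px: "P *v x \<in> W" using P(2) sub_of_mult by blast
  have "P *v (A (x - P *v x)) = 0"
  proof (rule isP_kerI[OF P(1)])
    fix y assume "y \<in> sub_of P"
    moreover have "A ` sub_of P = sub_of P"
      using isoW_image_eq[OF A subspace_sub_of P(2)] P(3) by blast
    ultimately obtain u where u: "y = A u" "u \<in> sub_of P" by blast
    have "x - P *v x \<in> W" "u \<in> W" using x Px sW u P(2) by (auto intro: subspace_diff)
    then have "A (x - P *v x) \<bullet> y = (x - P *v x) \<bullet> u" unfolding u(1) by (rule isoW_inner[OF A])
    also have "\<dots> = 0"
      by (rule isP_orth[OF P(1) u(2)]) (simp add: matrix_vector_mult_diff_distrib isP_idem[OF P(1)])
    finally show "A (x - P *v x) \<bullet> y = 0" .
  qed
  moreover have "P *v (A (P *v x)) = A (P *v x)"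
    using P(3)[OF sub_of_mult] sub_of_iff[OF P(1)] by blast
  ultimately show ?thesis by (simp add: linear_diff[OF l] matrix_vector_mult_diff_distrib)
qed

theorem segreS_determined:
  fixes f g :: "real^'m \<Rightarrow> real^'m"
  assumes f: "orthogonal_transformation f" and g: "orthogonal_transformation g"
    and eq: "\<And>k. k \<le> 1 \<Longrightarrow> comp_dims (GammaS f k) = comp_dims (GammaS g k)"
  shows "segreS f = segreS g"
proof -
  have *: "comp_dims (GammaS f k) = comp_dims (GG f UNIV {0} (k + 1))" if "orthogonal_transformation f"
    for f :: "real^'m \<Rightarrow> real^'m" and k
  proof (rule comp_dims_homeomorphic, rule homeomorphicI[of _ "\<lambda>P. (P, 0)" _ fst])
    have inv: "f ` sub_of P = sub_of P \<longleftrightarrow> (\<forall>x\<in>sub_of P. f x \<in> sub_of P)" for P :: "real^'m^'m"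
      using isoW_image_eq[OF isoW_orthogonal_transformation[OF that] subspace_sub_of] by blast
    show "(P, 0) \<in> GG f UNIV {0} (k + 1)" if "P \<in> GammaS f k" for P
      using that inv by (auto simp: GG_def GammaS_def)
    show "fst z \<in> GammaS f k" if "z \<in> GG f UNIV {0} (k + 1)" for z
      using that inv by (auto simp: GG_def GammaS_def)
    show "(fst z, 0) = z" if "z \<in> GG f UNIV {0} (k + 1)" for z
      using that by (auto simp: GG_def)
  qed (auto intro!: continuous_intros)
  have A: "isoW f UNIV" "isoW g UNIV" using f g isoW_orthogonal_transformation by blast+
  have "comp_dims (GG f UNIV {0} k) = comp_dims (GG g UNIV {0} k)" if "k \<le> 2" for k
  proof (cases k)
    \<comment> \<open>Zero-dimensional subspaces give no subsphere, but with \<open>q = 0\<close>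
      both spaces are a single point. The data for \<open>k = 0\<close> and \<open>k = 1\<close>
      then cover lines and planes.\<close>
    case 0
    have "linear f" "linear g" using A by (simp_all add: isoW_def)
    then show ?thesis
      unfolding 0 using comp_dims_GG_0[OF _ subspace_UNIV subspace_single_0, of f]
        comp_dims_GG_0[OF _ subspace_UNIV subspace_single_0, of g] by simp
  next
    case (Suc j)
    then show ?thesis using *[OF f, of j] *[OF g, of j] eq[of j] that by (simp add: One_nat_def)
  qed
  from core_0[OF A this] show ?thesis
    unfolding segreS_def
    using tsigma_eq[OF _ subspace_UNIV _ isoW_rotpos[OF A(1)]] tsigma_eq[OF _ subspace_UNIV _ isoW_rotpos[OF A(2)]] A
    by (simp add: isoW_def)
qed

section \<open>Euclidean isometries\<close>

lemma csym_cong: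
  assumes "\<And>c. -1 < c \<Longrightarrow> c < 1 \<Longrightarrow> Wc A W c = Wc A W' c"
  shows "csym A W = csym A W'"
proof -
  have "Wcs A W = Wcs A W'" using assms by (auto simp: Wcs_def)
  moreover have "image_mset (\<lambda>c. dim (Wc A W c)) (mset_set (Wcs A W')) = image_mset (\<lambda>c. dim (Wc A W' c)) (mset_set (Wcs A W'))"
  proof (cases "finite (Wcs A W')")
    case True
    then show ?thesis using assms by (intro image_mset_cong) (auto simp: Wcs_def)
  qed simp
  ultimately show ?thesis by (simp add: csym_def)
qed

text \<open>The subspace \<open>q + U\<close> is invariant iff \<open>A\<close> preserves
  \<open>U\<close> and the displacement \<open>f q - q\<close> lies in \<open>U\<close>. The
  component of the displacement outside \<open>U\<close> is a difference of a vector fixed by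
  \<open>A\<close> and a vector in the range of \<open>A - 1\<close>; such vectors are orthogonal,
  so both vanish. The first says that \<open>U\<close> contains the translation \<open>b\<close>,
  the second that the position relative to \<open>c\<close> is fixed.\<close>

lemma GammaE_iff:
  fixes f :: "real^'n \<Rightarrow> real^'n"
  assumes A: "isoW A UNIV" and fA: "\<And>x. f x = A x + b + (c - A c)" and b: "A b = b"
  shows "(P, q) \<in> GammaE f k \<longleftrightarrow> P \<in> grass k \<and> P *v q = 0 \<and> (\<forall>u\<in>sub_of P. A u \<in> sub_of P) \<and> P *v b = b
     \<and> A (q - c + P *v c) = q - c + P *v c"
proof -
  have l: "linear A" using A by (simp add: isoW_def)
  let ?U = "sub_of P"
  let ?z = "f q - q"
  have fq: "f (q + u) = q + (?z + A u)" for u by (simp add: fA linear_add[OF l])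
  have sU: "subspace ?U" by (rule subspace_sub_of)
  have 1: "f ` ((\<lambda>u. q + u) ` ?U) = (\<lambda>u. q + u) ` ?U \<longleftrightarrow> (\<forall>u\<in>?U. A u \<in> ?U) \<and> ?z \<in> ?U" (is "?L \<longleftrightarrow> ?R")
  proof
    assume L: ?L
    have m: "?z + A u \<in> ?U" if "u \<in> ?U" for u
    proof -
      have "f (q + u) \<in> (\<lambda>u. q + u) ` ?U" using L that by blast
      then obtain v where v: "v \<in> ?U" "f (q + u) = q + v" by blast
      then have "?z + A u = v" using fq[of u] by (simp only: add_left_cancel)
      then show ?thesis using v(1) by simp
    qed
    have z: "?z \<in> ?U" using m[OF subspace_0[OF sU]] by (simp add: linear_0[OF l])
    moreover have "A u \<in> ?U" if "u \<in> ?U" for u using subspace_diff[OF sU m[OF that] z] by simp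
    ultimately show ?R by blast
  next
    assume R: ?R
    then have AU: "A ` ?U = ?U" using isoW_image_eq[OF A sU] by simp
    show ?L
    proof (intro subset_antisym subsetI)
      fix y assume "y \<in> f ` ((\<lambda>u. q + u) ` ?U)"
      then obtain u where u: "u \<in> ?U" "y = q + (?z + A u)" using fq by auto
      then have "?z + A u \<in> ?U" using R sU by (auto intro: subspace_add)
      then show "y \<in> (\<lambda>u. q + u) ` ?U" using u by blast
    next
      fix y assume "y \<in> (\<lambda>u. q + u) ` ?U"
      then obtain v where v: "v \<in> ?U" "y = q + v" by blast
      have "v - ?z \<in> A ` ?U" unfolding AU using v R sU by (auto intro: subspace_diff)
      then obtain u where u: "u \<in> ?U" "v - ?z = A u" by blast
      then have "y = f (q + u)" unfolding fq v(2) using u(2) by (simp add: algebra_simps)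
      then show "y \<in> f ` ((\<lambda>u. q + u) ` ?U)" using u by blast
    qed
  qed
  have 2: "?z \<in> ?U \<longleftrightarrow> P *v b = b \<and> A (q - c + P *v c) = q - c + P *v c"
    if P: "isP P" "P *v q = 0" "\<forall>u\<in>?U. A u \<in> ?U"
  proof -
    have com: "P *v A x = A (P *v x)" for x by (rule isoW_commute[OF A P(1)]) (use P in auto)
    \<comment> \<open>Since \<open>P *v q = 0\<close>, this is the component of \<open>q - c\<close>
      orthogonal to the range of \<open>P\<close>.\<close>
    let ?q = "q - c + P *v c"
    have Pz: "P *v ?z = P *v b + P *v c - A (P *v c)"
      by (simp add: fA matrix_vector_right_distrib matrix_vector_mult_diff_distrib com P(2) linear_0[OF l])
    have zz: "P *v ?z - ?z = (P *v b - b) - (A ?q - ?q)"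
      unfolding Pz by (simp add: fA linear_add[OF l] linear_diff[OF l])
    have "A (P *v b - b) = P *v b - b" by (simp add: linear_diff[OF l] com[symmetric] b)
    \<comment> \<open>Fixed vectors are orthogonal to the range of \<open>A - 1\<close>.\<close>
    moreover have "A w = w \<Longrightarrow> w \<bullet> (A y - y) = 0" for w y
      using isoW_inner[OF A, of w y] by (simp add: inner_diff_right)
    ultimately have o: "(P *v b - b) \<bullet> (A ?q - ?q) = 0" by blast
    have "?z \<in> ?U \<longleftrightarrow> (P *v b - b) = (A ?q - ?q)" unfolding sub_of_iff[OF P(1), of ?z] using zz
      by (metis right_minus_eq)
    also have "\<dots> \<longleftrightarrow> P *v b - b = 0 \<and> A ?q - ?q = 0"
    proof
      assume e: "P *v b - b = A ?q - ?q"
      then have "(P *v b - b) \<bullet> (P *v b - b) = 0" using o by simp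
      then show "P *v b - b = 0 \<and> A ?q - ?q = 0" using e by simp
    qed simp
    finally show ?thesis by simp
  qed
  show ?thesis unfolding GammaE_def mem_Collect_eq prod.case 1 grass_iff using 2 by blast
qed

lemma Pj_line:
  fixes b :: "real^'m"
  assumes "b \<noteq> 0"
  shows "isP (Pj (\<lambda>_. 0) b)" "sub_of (Pj (\<lambda>_. 0) b) = span {b}" "Pj (\<lambda>_. 0) b *v x = ((b \<bullet> x) / (b \<bullet> b)) *\<^sub>R b"
proof -
  have "b \<in> UNIV - {0}" using assms by simp
  from isP_Pj[OF cstr_0[OF subspace_UNIV] this] sub_of_Pj[OF cstr_0[OF subspace_UNIV] this]
  show "isP (Pj (\<lambda>_. 0) b)" "sub_of (Pj (\<lambda>_. 0) b) = span {b}"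
    by (auto simp: insert_commute span_insert_0)
qed (simp add: Pj_mult)

definition Gfix :: "(real^'m \<Rightarrow> real^'m) \<Rightarrow> (real^'m) set \<Rightarrow> nat \<Rightarrow> ((real^'m^'m) \<times> (real^'m)) set" where
  "Gfix A W = GG A W (Er A W 1)"

text \<open>The fixed point \<open>c\<close> is taken as the origin; subtracting
  \<open>c - P *v c\<close> keeps the representative orthogonal to the range of
  \<open>P\<close>.\<close>

lemma GammaE_elliptic:
  fixes f :: "real^'n \<Rightarrow> real^'n"
  assumes A: "isoW A UNIV" and fA: "\<And>x. f x = A x + 0 + (c - A c)"
  shows "comp_dims (GammaE f k) = comp_dims (Gfix A UNIV k)"
proof (rule comp_dims_homeomorphic, rule homeomorphicI[of _ "\<lambda>(P, q). (P, q - c + P *v c)" _ "\<lambda>(P, q). (P, q + c - P *v c)"])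
  have l: "linear A" using A by (simp add: isoW_def)
  have iff: "(P, q) \<in> GammaE f k \<longleftrightarrow> P \<in> grass k \<and> P *v q = 0 \<and> (\<forall>u\<in>sub_of P. A u \<in> sub_of P)
     \<and> A (q - c + P *v c) = q - c + P *v c" for P q
    using GammaE_iff[OF A fA linear_0[OF l]] by simp
  have iff2: "(P, q) \<in> Gfix A UNIV k \<longleftrightarrow> P \<in> grass k \<and> (\<forall>u\<in>sub_of P. A u \<in> sub_of P) \<and> A q = q \<and> P *v q = 0" for P q
    by (auto simp: Gfix_def GG_def Er_def)
  show "(\<lambda>(P, q). (P, q - c + P *v c)) z \<in> Gfix A UNIV k" if "z \<in> GammaE f k" for z
    using that by (cases z) (auto simp: iff iff2 grass_iff matrix_vector_right_distrib matrix_vector_mult_diff_distrib isP_idem)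
  show "(\<lambda>(P, q). (P, q + c - P *v c)) z \<in> GammaE f k" if "z \<in> Gfix A UNIV k" for z
    using that by (cases z) (auto simp: iff iff2 grass_iff matrix_vector_right_distrib matrix_vector_mult_diff_distrib isP_idem)
qed (auto simp: case_prod_beta intro!: continuous_intros)

text \<open>Every invariant subspace contains the translation direction \<open>b\<close>. No point
  is invariant, and splitting off the line of \<open>b\<close>, with projection \<open>B\<close>,
  lowers the dimension by one and leaves a subspace of the hyperplane orthogonal to
  \<open>b\<close>.\<close>

lemma GammaE_hyperbolic:
  fixes f :: "real^'n \<Rightarrow> real^'n"
  assumes A: "isoW A UNIV" and fA: "\<And>x. f x = A x + b + (c - A c)" and b: "A b = b" "b \<noteq> 0"
    and W: "W = {x. x \<bullet> b = 0}"
  shows "GammaE f 0 = {}" "comp_dims (GammaE f (Suc k)) = comp_dims (Gfix A W k)"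
proof -
  have l: "linear A" using A by (simp add: isoW_def)
  note iff = GammaE_iff[OF A fA b(1)]
  show "GammaE f 0 = {}" using b(2) by (auto simp: iff grass_0)
  define B where "B = Pj (\<lambda>_. 0) b"
  note B = Pj_line[OF b(2), folded B_def]
  have Bb: "B *v b = b" using b(2) by (simp add: B(3))
  have Bx: "B *v x = 0 \<longleftrightarrow> x \<bullet> b = 0" for x using b(2) by (simp add: B(3) inner_commute)
  have iff2: "(P, q) \<in> Gfix A W k \<longleftrightarrow> P \<in> grass k \<and> sub_of P \<subseteq> W \<and> (\<forall>u\<in>sub_of P. A u \<in> sub_of P) \<and> q \<bullet> b = 0 \<and> A q = q \<and> P *v q = 0" for P q
    by (auto simp: Gfix_def GG_def Er_def W)
  show "comp_dims (GammaE f (Suc k)) = comp_dims (Gfix A W k)"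
  proof (rule comp_dims_homeomorphic, rule homeomorphicI[of _ "\<lambda>(P, q). (P - B, q - c + P *v c)" _ "\<lambda>(P, q). (P + B, q + c - (P + B) *v c)"])
    have Pq'0: "P *v (q - c + P *v c) = 0" if "isP P" "P *v q = 0" for P q
      using that by (simp add: matrix_vector_right_distrib matrix_vector_mult_diff_distrib isP_idem)
    show F: "(\<lambda>(P, q). (P - B, q - c + P *v c)) z \<in> Gfix A W k" if z: "z \<in> GammaE f (Suc k)" for z
    proof -
      obtain P q where Pq: "z = (P, q)" by (cases z)
      have P: "isP P" "dim (sub_of P) = Suc k" "P *v q = 0" "\<forall>u\<in>sub_of P. A u \<in> sub_of P" "P *v b = b"
        "A (q - c + P *v c) = q - c + P *v c"
        using z unfolding Pq iff grass_iff by blast+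
      have bP: "b \<in> sub_of P" using P(1,5) sub_of_iff by blast
      have sb: "sub_of B \<subseteq> sub_of P" unfolding B(2) using bP by (intro span_minimal) (auto simp: subspace_sub_of)
      note D = isP_diff[OF P(1) B(1) sb]
      have sD: "sub_of (P - B) = {x \<in> sub_of P. x \<bullet> b = 0}" unfolding D(2) Bx ..
      have "{y \<in> sub_of P. \<forall>x\<in>span {b}. orthogonal x y} = {x \<in> sub_of P. x \<bullet> b = 0}"
        by (auto simp: span_singleton orthogonal_def inner_commute)
      then have "dim (sub_of (P - B)) + dim (span {b}) = Suc k"
        using dim_subspace_orthogonal_to_vectors[OF subspace_span subspace_sub_of, of "{b}" P] sb P(2)
        by (simp add: sD B(2))
      then have dk: "dim (sub_of (P - B)) = k" using b(2) by (simp add: dim_insert)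
      have Ao: "A u \<bullet> b = 0" if "u \<bullet> b = 0" for u using isoW_inner[OF A, of u b] that b(1) by simp
      have q'b: "(q - c + P *v c) \<bullet> b = 0" using isP_orth[OF P(1) bP Pq'0[OF P(1,3)]] .
      then have "(P - B) *v (q - c + P *v c) = 0"
        using Pq'0[OF P(1,3)] Bx by (simp add: matrix_vector_mult_diff_rdistrib)
      then have "(P - B, q - c + P *v c) \<in> Gfix A W k"
        unfolding iff2 grass_iff using D(1) dk sD P(4,6) q'b Ao by (auto simp: W)
      then show ?thesis unfolding Pq by simp
    qed
    show "(\<lambda>(P, q). (P + B, q + c - (P + B) *v c)) z \<in> GammaE f (Suc k)" if z: "z \<in> Gfix A W k" for z
    proof -
      obtain P q where Pq: "z = (P, q)" by (cases z)
      have P: "isP P" "dim (sub_of P) = k" "sub_of P \<subseteq> W" "\<forall>u\<in>sub_of P. A u \<in> sub_of P" "q \<bullet> b = 0" "A q = q" "P *v q = 0"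
        using z unfolding Pq iff2 grass_iff by blast+
      have o: "x \<bullet> y = 0" if "x \<in> sub_of P" "y \<in> sub_of B" for x y
        using that P(3) by (auto simp: B(2) span_singleton W)
      have D: "isP (P + B)" "sub_of (P + B) = {x + y |x y. x \<in> sub_of P \<and> y \<in> sub_of B}"
        by (rule isP_add[OF P(1) B(1)]; use o in blast)+
      have dk: "dim (sub_of (P + B)) = Suc k"
        using dim_sum_orthogonal[of "sub_of P" "sub_of B", OF subspace_sub_of subspace_sub_of o] P(2) b(2)
        by (simp add: D(2) B(2) dim_insert One_nat_def)
      have "P *v b = 0" by (rule isP_kerI[OF P(1)]) (use P(3) in \<open>auto simp: W inner_commute\<close>)
      then have PBb: "(P + B) *v b = b" by (simp add: matrix_vector_mult_add_rdistrib Bb)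
      have Pq0: "(P + B) *v q = 0" using P(7) Bx P(5) by (simp add: matrix_vector_mult_add_rdistrib)
      then have Pqc: "(P + B) *v (q + c - (P + B) *v c) = 0"
        using isP_idem[OF D(1)] by (simp add: matrix_vector_right_distrib matrix_vector_mult_diff_distrib)
      have inv: "A u \<in> sub_of (P + B)" if u: "u \<in> sub_of (P + B)" for u
      proof -
        obtain x y where xy: "u = x + y" "x \<in> sub_of P" "y \<in> sub_of B" using u D(2) by blast
        have "A y = y" using xy(3) b(1) by (auto simp: B(2) span_singleton linear_scale[OF l])
        then have "A u = A x + y" "A x \<in> sub_of P" using xy P(4) by (auto simp: linear_add[OF l])
        then show ?thesis unfolding D(2) using xy(3) by blast
      qed
      have "A (q + c - (P + B) *v c - c + (P + B) *v c) = q + c - (P + B) *v c - c + (P + B) *v c" using P(6) by simp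
      then have "(P + B, q + c - (P + B) *v c) \<in> GammaE f (Suc k)"
        unfolding iff grass_iff using D(1) dk PBb Pqc inv by blast
      then show ?thesis unfolding Pq by simp
    qed
  qed (auto simp: case_prod_beta intro!: continuous_intros)
qed

text \<open>The translation part decomposes as \<open>b + (c - A c)\<close> with \<open>b\<close>
  orthogonal to the range of \<open>1 - A\<close>; then \<open>b\<close> is fixed by
  \<open>A\<close>, and it vanishes exactly for elliptic maps. In the hyperbolic case
  \<open>W\<close> is the complement of \<open>b\<close>, which removes one dimension of the fixed
  space: hence the \<open>+ 1\<close>.\<close>

lemma segreE_data:
  fixes f :: "real^'n \<Rightarrow> real^'n"
  assumes f: "isomE f"
  shows "\<exists>(A :: real^'n \<Rightarrow> real^'n) W. isoW A W \<and>
    (segreE f = (Ell, dim (Er A W 1), image_mset (\<lambda>n. n div 2) (csym A W), nz (dim (Er A W (-1))))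
        \<and> (\<forall>k. comp_dims (GammaE f k) = comp_dims (Gfix A W k))
     \<or> segreE f = (Hyp, dim (Er A W 1) + 1, image_mset (\<lambda>n. n div 2) (csym A W), nz (dim (Er A W (-1))))
        \<and> GammaE f 0 = {} \<and> (\<forall>k. comp_dims (GammaE f (Suc k)) = comp_dims (Gfix A W k)))"
proof -
  define A where "A x = f x - f 0" for x
  have "orthogonal_transformation A"
    using f unfolding orthogonal_transformation_isometry by (auto simp: isomE_def A_def dist_norm)
  then have A: "isoW A UNIV" by (rule isoW_orthogonal_transformation)
  have l: "linear A" using A by (simp add: isoW_def)
  have lp: "linpart f = matrix A" by (simp add: linpart_def A_def[abs_def])
  let ?K = "Er A UNIV 1" and ?F = "Er A UNIV (-1)"
  define W' where "W' = {y. \<forall>x\<in>?K. orthogonal x y}"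
  have sK: "subspace ?K" by (rule subspace_Er[OF l subspace_UNIV])
  have sW': "subspace W'" unfolding W'_def orthogonal_def by (auto simp: subspace_def inner_add_right)
  have iW': "A x \<in> W'" if x: "x \<in> W'" for x
  proof -
    have "y \<bullet> A x = 0" if "y \<in> ?K" for y
      using isoW_inner[OF A, of y x] x that by (auto simp: W'_def Er_def orthogonal_def)
    then show ?thesis by (auto simp: W'_def orthogonal_def)
  qed
  have A': "isoW A W'" using A sW' iW' by (auto simp: isoW_def)
  \<comment> \<open>The rotation planes are orthogonal to the fixed space, so any \<open>V\<close>
    containing the complement of the fixed space contains them all. This covers both the complement
    itself and \<open>W\<close>.\<close>
  have WcU: "Wc A V c = Wc A UNIV c" if c: "-1 < c" "c < 1" and V: "\<And>y. (\<And>x. x \<in> ?K \<Longrightarrow> x \<bullet> y = 0) \<Longrightarrow> y \<in> V" for V c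
  proof -
    have "y \<in> V" if y: "y \<in> Wc A UNIV c" for y
    proof (rule V)
      fix x assume "x \<in> ?K"
      then have "x \<in> Wc A UNIV 1" using Er_subset_Wc(1)[OF l] by blast
      then show "x \<bullet> y = 0" using Wc_orth[OF A _ y] c by auto
    qed
    then show ?thesis by (auto simp: Wc_def)
  qed
  have ErU: "Er A V (-1) = ?F" if V: "\<And>y. (\<And>x. x \<in> ?K \<Longrightarrow> x \<bullet> y = 0) \<Longrightarrow> y \<in> V" for V
  proof -
    have "y \<in> V" if "y \<in> ?F" for y using V Er_orth[OF A _ that] by blast
    then show ?thesis by (auto simp: Er_def)
  qed
  have W'I: "y \<in> W'" if "\<And>x. x \<in> ?K \<Longrightarrow> x \<bullet> y = 0" for y using that by (simp add: W'_def orthogonal_def)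
  have "x = 0" if "x \<in> Er A W' 1" for x
  proof -
    have "x \<in> ?K" "x \<in> W'" using that by (auto simp: Er_def)
    then show ?thesis by (auto simp: W'_def orthogonal_def)
  qed
  then have "Er A W' 1 \<subseteq> {0}" by blast
  then have "dim (Er A W' 1) = 0" by simp
  moreover have "csym A W' = csym A UNIV" by (rule csym_cong, rule WcU) (use W'I in auto)
  moreover have "Er A W' (-1) = ?F" by (rule ErU) (use W'I in auto)
  ultimately have ts: "tsigma (matrix A) W' = (image_mset (\<lambda>n. n div 2) (csym A UNIV), nz (dim ?F))"
    using tsigma_eq[OF l sW' iW' isoW_rotpos[OF A']] by (simp add: nz_def)
  have K: "{x. matrix A *v x = x} = ?K" by (simp add: matrix_apply[OF l] Er_def)
  have seg: "segreE f = (if \<exists>x. f x = x then Ell else Hyp, dim ?K, image_mset (\<lambda>n. n div 2) (csym A UNIV), nz (dim ?F))"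
    unfolding segreE_def lp Let_def K W'_def[symmetric] ts ..
  \<comment> \<open>A translation by an element of \<open>R\<close> can be absorbed by moving the
    origin.\<close>
  define R where "R = range (\<lambda>x. x - A x)"
  have lR: "linear (\<lambda>x. x - A x)" by (intro linear_compose_sub linear_ident l)
  have sR: "subspace R" unfolding R_def using linear_subspace_image[OF lR subspace_UNIV] .
  obtain Q where Q: "isP Q" "sub_of Q = R" using ex_isP[OF sR] by blast
  obtain c where c: "Q *v f 0 = c - A c" using sub_of_mult[of Q "f 0"] Q(2) by (auto simp: R_def)
  define b where "b = f 0 - Q *v f 0"
  have Qb: "Q *v b = 0" by (simp add: b_def matrix_vector_mult_diff_distrib isP_idem[OF Q(1)])
  have bR: "b \<bullet> y = 0" if "y \<in> R" for y using isP_orth[OF Q(1) _ Qb] Q(2) that by blast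
  \<comment> \<open>By isometry the squared length equals
    \<open>2 * (b \<bullet> (b - A b))\<close>, and \<open>b - A b\<close> lies in \<open>R\<close>,
    to which \<open>b\<close> is orthogonal.\<close>
  have "(A b - b) \<bullet> (A b - b) = 2 * (b \<bullet> (b - A b))"
    using isoW_inner[OF A, of b b] by (simp add: inner_diff_left inner_diff_right inner_commute)
  also have "b \<bullet> (b - A b) = 0" by (rule bR) (auto simp: R_def)
  finally have Ab: "A b = b" by simp
  have fA: "f x = A x + b + (c - A c)" for x using c by (simp add: A_def b_def)
  show ?thesis
  proof (cases "b = 0")
    case True
    then have fA0: "f x = A x + 0 + (c - A c)" for x using fA by simp
    then have "f c = c" by simp
    then have "\<exists>x. f x = x" by blast
    then show ?thesis using A seg GammaE_elliptic[OF A fA0] by (intro exI[of _ A] exI[of _ UNIV]) simp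
  next
    case False
    define W where "W = {x. x \<bullet> b = 0}"
    have "f x \<noteq> x" for x
    proof
      assume "f x = x"
      then have "b = (x - c) - A (x - c)" using fA[of x] by (simp add: linear_diff[OF l] algebra_simps)
      then have "b \<in> R" unfolding R_def by blast
      then show False using bR[of b] False by simp
    qed
    then have nf: "\<nexists>x. f x = x" by blast
    have sW: "subspace W" unfolding W_def by (auto simp: subspace_def inner_add_left)
    have iW: "A x \<in> W" if "x \<in> W" for x using isoW_inner[OF A, of x b] that Ab by (simp add: W_def)
    have AW: "isoW A W" using A sW iW by (auto simp: isoW_def)
    have bK: "b \<in> ?K" using Ab by (simp add: Er_def)
    have KW: "y \<in> W" if "\<And>x. x \<in> ?K \<Longrightarrow> x \<bullet> y = 0" for y using that[OF bK] by (simp add: W_def inner_commute)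
    have "csym A W = csym A UNIV" by (rule csym_cong, rule WcU) (use KW in auto)
    moreover have "Er A W (-1) = ?F" by (rule ErU) (use KW in auto)
    moreover have "Er A W 1 = {y \<in> ?K. \<forall>x\<in>span {b}. orthogonal x y}"
      by (auto simp: Er_def W_def span_singleton orthogonal_def inner_commute)
    then have "dim (Er A W 1) + dim (span {b}) = dim ?K"
      using dim_subspace_orthogonal_to_vectors[OF subspace_span sK, of "{b}"] span_minimal[of "{b}" ?K] bK sK by simp
    then have "dim (Er A W 1) + 1 = dim ?K" using False by (simp add: dim_insert)
    ultimately have "segreE f = (Hyp, dim (Er A W 1) + 1, image_mset (\<lambda>n. n div 2) (csym A W), nz (dim (Er A W (-1))))"
      using seg nf by simp
    then show ?thesis using AW GammaE_hyperbolic[OF A fA Ab False W_def] by (intro exI[of _ A] exI[of _ W]) simp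
  qed
qed

text \<open>\<open>Gfix\<close> is never empty in dimension 0, so \<open>GammaE f 0\<close> is empty
  exactly for hyperbolic \<open>f\<close> and the types agree. In the hyperbolic case all indices
  are shifted by one, which is where \<open>k = 3\<close> enters.\<close>

theorem segreE_determined:
  fixes f g :: "real^'n \<Rightarrow> real^'n"
  assumes f: "isomE f" and g: "isomE g"
    and eq: "\<And>k. k \<le> 2 \<Longrightarrow> comp_dims (GammaE f k) = comp_dims (GammaE g k)"
    and eq3: "fst (segreE f) \<noteq> Ell \<Longrightarrow> comp_dims (GammaE f 3) = comp_dims (GammaE g 3)"
  shows "segreE f = segreE g"
proof -
  have ne: "comp_dims (Gfix A W 0) \<noteq> {#}" if "isoW A W" for A :: "real^'n \<Rightarrow> real^'n" and W
    using that comp_dims_GG_0[of A W "Er A W 1"] subspace_Er[of A W 1] by (simp add: isoW_def Gfix_def)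
  obtain A :: "real^'n \<Rightarrow> real^'n" and W where A: "isoW A W" and fd:
    "segreE f = (Ell, dim (Er A W 1), image_mset (\<lambda>n. n div 2) (csym A W), nz (dim (Er A W (-1))))
        \<and> (\<forall>k. comp_dims (GammaE f k) = comp_dims (Gfix A W k))
     \<or> segreE f = (Hyp, dim (Er A W 1) + 1, image_mset (\<lambda>n. n div 2) (csym A W), nz (dim (Er A W (-1))))
        \<and> GammaE f 0 = {} \<and> (\<forall>k. comp_dims (GammaE f (Suc k)) = comp_dims (Gfix A W k))"
    using segreE_data[OF f] by blast
  obtain B :: "real^'n \<Rightarrow> real^'n" and V where B: "isoW B V" and gd:
    "segreE g = (Ell, dim (Er B V 1), image_mset (\<lambda>n. n div 2) (csym B V), nz (dim (Er B V (-1))))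
        \<and> (\<forall>k. comp_dims (GammaE g k) = comp_dims (Gfix B V k))
     \<or> segreE g = (Hyp, dim (Er B V 1) + 1, image_mset (\<lambda>n. n div 2) (csym B V), nz (dim (Er B V (-1))))
        \<and> GammaE g 0 = {} \<and> (\<forall>k. comp_dims (GammaE g (Suc k)) = comp_dims (Gfix B V k))"
    using segreE_data[OF g] by blast
  note core = core_fixed[OF A B, folded Gfix_def]
  from fd gd consider
      (ee) "segreE f = (Ell, dim (Er A W 1), image_mset (\<lambda>n. n div 2) (csym A W), nz (dim (Er A W (-1))))"
        "\<forall>k. comp_dims (GammaE f k) = comp_dims (Gfix A W k)"
        "segreE g = (Ell, dim (Er B V 1), image_mset (\<lambda>n. n div 2) (csym B V), nz (dim (Er B V (-1))))"
        "\<forall>k. comp_dims (GammaE g k) = comp_dims (Gfix B V k)"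
    | (hh) "segreE f = (Hyp, dim (Er A W 1) + 1, image_mset (\<lambda>n. n div 2) (csym A W), nz (dim (Er A W (-1))))"
        "\<forall>k. comp_dims (GammaE f (Suc k)) = comp_dims (Gfix A W k)"
        "segreE g = (Hyp, dim (Er B V 1) + 1, image_mset (\<lambda>n. n div 2) (csym B V), nz (dim (Er B V (-1))))"
        "\<forall>k. comp_dims (GammaE g (Suc k)) = comp_dims (Gfix B V k)"
    | (eh) "\<forall>k. comp_dims (GammaE f k) = comp_dims (Gfix A W k)" "GammaE g 0 = {}"
    | (he) "\<forall>k. comp_dims (GammaE g k) = comp_dims (Gfix B V k)" "GammaE f 0 = {}"
    by argo
  then show ?thesis
  proof cases
    case ee
    then show ?thesis using core eq by simp
  next
    case hh
    have "comp_dims (Gfix A W k) = comp_dims (Gfix B V k)" if "k \<le> 2" for k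
    proof -
      have "Suc k \<le> 2 \<or> Suc k = 3" using that by linarith
      then have "comp_dims (GammaE f (Suc k)) = comp_dims (GammaE g (Suc k))" using eq[of "Suc k"] eq3 hh(1) by auto
      then show ?thesis using hh(2,4) by simp
    qed
    then show ?thesis using core hh(1,3) by simp
  next
    case eh
    then show ?thesis using eq[of 0] ne[OF A] by simp
  next
    case he
    then show ?thesis using eq[of 0] ne[OF B] by simp
  qed
qed

section \<open>Lorentzian linear algebra\<close>

lemma lor_eq: "lor i0 x y = x \<bullet> y - 2 * (x $ i0 * y $ i0)"
  by (simp add: lor_def inner_vec_def)

lemma lor_sym: "lor i0 x y = lor i0 y x"
  by (simp add: lor_eq inner_commute mult.commute)

lemma lor_linear [simp]:
  "lor i0 (x + y) z = lor i0 x z + lor i0 y z" "lor i0 z (x + y) = lor i0 z x + lor i0 z y"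
  "lor i0 (x - y) z = lor i0 x z - lor i0 y z" "lor i0 z (x - y) = lor i0 z x - lor i0 z y"
  "lor i0 (r *\<^sub>R x) z = r * lor i0 x z" "lor i0 z (r *\<^sub>R x) = r * lor i0 z x"
  "lor i0 (- x) z = - lor i0 x z" "lor i0 z (- x) = - lor i0 z x" "lor i0 0 z = 0" "lor i0 z 0 = 0"
  by (simp_all add: lor_eq inner_add_left inner_add_right inner_diff_left inner_diff_right algebra_simps)

lemma bilinear_lor: "bilinear (lor i0)"
  by (auto simp: bilinear_def intro!: linearI)

lemma lor_space: "v $ i0 = 0 \<Longrightarrow> lor i0 v w = v \<bullet> w"
  by (simp add: lor_eq)

text \<open>The combination of \<open>x\<close> and \<open>y\<close> on the right has time
  coordinate 0, where the Lorentz form is the inner product. This single identity replaces the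
  reversed Cauchy-Schwarz inequality in the two lemmas on orthogonal vectors.\<close>

lemma lor_combination:
  "(x $ i0)\<^sup>2 * lor i0 y y + (y $ i0)\<^sup>2 * lor i0 x x - 2 * (x $ i0) * (y $ i0) * lor i0 x y
     = (norm ((x $ i0) *\<^sub>R y - (y $ i0) *\<^sub>R x))\<^sup>2"
proof -
  let ?v = "(x $ i0) *\<^sub>R y - (y $ i0) *\<^sub>R x"
  have "lor i0 ?v ?v = ?v \<bullet> ?v" by (rule lor_space) simp
  moreover have "lor i0 ?v ?v = (x $ i0)\<^sup>2 * lor i0 y y + (y $ i0)\<^sup>2 * lor i0 x x - 2 * (x $ i0) * (y $ i0) * lor i0 x y"
    by (simp add: lor_sym[of i0 y x] algebra_simps power2_eq_square)
  ultimately show ?thesis by (simp add: power2_norm_eq_inner)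
qed

lemma lor_nonpos_time:
  assumes "lor i0 x x \<le> 0" "x \<noteq> 0" shows "x $ i0 \<noteq> 0"
proof
  assume "x $ i0 = 0"
  then have "lor i0 x x = x \<bullet> x" by (rule lor_space)
  then show False using assms by (metis inner_gt_zero_iff not_le)
qed

lemma lor_timelike_orth:
  assumes x: "lor i0 x x < 0" and xy: "lor i0 x y = 0" and y: "y \<noteq> 0"
  shows "lor i0 y y > 0"
proof -
  have x0: "x $ i0 \<noteq> 0" using lor_nonpos_time[of i0 x] x by force
  have e: "(x $ i0)\<^sup>2 * lor i0 y y = (norm ((x $ i0) *\<^sub>R y - (y $ i0) *\<^sub>R x))\<^sup>2 + (y $ i0)\<^sup>2 * (- lor i0 x x)"
    using lor_combination[where x = x and y = y and ?i0.0 = i0] xy by simp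
  have "0 < (norm ((x $ i0) *\<^sub>R y - (y $ i0) *\<^sub>R x))\<^sup>2 + (y $ i0)\<^sup>2 * (- lor i0 x x)"
  proof (cases "y $ i0 = 0")
    case True
    then show ?thesis using x0 y by simp
  next
    case False
    then have "(y $ i0)\<^sup>2 * (- lor i0 x x) > 0" using x by (intro mult_pos_pos) auto
    then show ?thesis using zero_le_power2[of "norm ((x $ i0) *\<^sub>R y - (y $ i0) *\<^sub>R x)"] by linarith
  qed
  then have "(x $ i0)\<^sup>2 * lor i0 y y > 0" using e by simp
  then show ?thesis by (simp add: zero_less_mult_iff)
qed

lemma lor_null_orth:
  assumes x: "lor i0 x x = 0" "x \<noteq> 0" and xy: "lor i0 x y = 0"
  shows "lor i0 y y \<ge> 0" "lor i0 y y = 0 \<Longrightarrow> \<exists>t. y = t *\<^sub>R x"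
proof -
  have x0: "x $ i0 \<noteq> 0" using lor_nonpos_time[of i0 x] x by force
  have e: "(x $ i0)\<^sup>2 * lor i0 y y = (norm ((x $ i0) *\<^sub>R y - (y $ i0) *\<^sub>R x))\<^sup>2"
    using lor_combination[where x = x and y = y and ?i0.0 = i0] xy x by simp
  then have "(x $ i0)\<^sup>2 * lor i0 y y \<ge> 0" by simp
  then show "lor i0 y y \<ge> 0" using x0 by (simp add: zero_le_mult_iff)
  show "\<exists>t. y = t *\<^sub>R x" if "lor i0 y y = 0"
  proof -
    have "(x $ i0) *\<^sub>R y = (y $ i0) *\<^sub>R x" using e that by simp
    then have "(1 / (x $ i0)) *\<^sub>R ((x $ i0) *\<^sub>R y) = (1 / (x $ i0)) *\<^sub>R ((y $ i0) *\<^sub>R x)" by simp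
    then have "y = (y $ i0 / x $ i0) *\<^sub>R x" using x0 by simp
    then show ?thesis by blast
  qed
qed

text \<open>The full Lorentz group. The preservation of the upper sheet demanded by
  \<open>isomH\<close> enters through \<open>isomH_time\<close>, in the search for an
  eigenvector.\<close>

definition lorT :: "'p::finite \<Rightarrow> (real^'p \<Rightarrow> real^'p) \<Rightarrow> bool" where
  "lorT i0 T \<longleftrightarrow> linear T \<and> (\<forall>x y. lor i0 (T x) (T y) = lor i0 x y)"

lemma lor_nondeg: "(\<And>y. lor i0 x y = 0) \<Longrightarrow> x = 0"
proof -
  assume *: "\<And>y. lor i0 x y = 0"
  have "lor i0 x (axis i0 1) = - (x $ i0)" by (simp add: lor_eq inner_axis)
  then have "x $ i0 = 0" using * by simp
  then have "x \<bullet> x = 0" using *[of x] lor_space by metis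
  then show "x = 0" by simp
qed

lemma lorT_bij:
  assumes "lorT i0 T" shows "inj T" "surj T"
proof -
  have l: "linear T" using assms by (simp add: lorT_def)
  have "x = 0" if "T x = 0" for x
  proof (rule lor_nondeg[of i0])
    show "lor i0 x y = 0" for y using assms that by (metis lorT_def lor_linear(9))
  qed
  then show "inj T" using linear_injective_0[OF l] by blast
  then show "surj T" using linear_injective_imp_surjective[OF l] by blast
qed

section \<open>Primary components and the Lorentz form\<close>

definition pol :: "('a::real_vector \<Rightarrow> 'a) \<Rightarrow> complex \<Rightarrow> 'a \<Rightarrow> 'a" where
  "pol T c y = T (T y) - (2 * Re c) *\<^sub>R T y + (cmod c)\<^sup>2 *\<^sub>R y"

lemma linear_pol: "linear T \<Longrightarrow> linear (pol T c)"
  unfolding pol_def by (rule linearI) (simp_all add: linear_add linear_scale algebra_simps)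

lemma linear_funpow:
  fixes f :: "'a::real_vector \<Rightarrow> 'a"
  assumes "linear f" shows "linear (f ^^ n)"
proof (induction n)
  case (Suc n)
  then show ?case using linear_compose[OF Suc assms] by (simp add: o_def)
qed (simp add: id_def linear_ident)

lemma prim_comp_iff: "x \<in> prim_comp T c \<longleftrightarrow> (pol T c ^^ CARD('p)) (x :: real^'p::finite) = 0"
  by (simp add: prim_comp_def pol_def[abs_def])

lemma subspace_prim_comp:
  fixes T :: "real^'p::finite \<Rightarrow> real^'p"
  assumes "linear T" shows "subspace (prim_comp T c)"
proof -
  have "prim_comp T c = {x. (pol T c ^^ CARD('p)) x = 0}" by (auto simp: prim_comp_iff)
  then show ?thesis using linear_subspace_kernel[OF linear_funpow[OF linear_pol[OF assms]]] by simp
qed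

lemma funpow_zero:
  fixes f :: "'a::real_vector \<Rightarrow> 'a"
  assumes "linear f" "(f ^^ m) x = 0" "m \<le> n" shows "(f ^^ n) x = 0"
proof -
  have "(f ^^ n) x = (f ^^ (n - m)) ((f ^^ m) x)"
    using assms(3) by (metis comp_apply funpow_add le_add_diff_inverse2)
  then show ?thesis using assms(2) linear_0[OF linear_funpow[OF assms(1)]] by simp
qed

lemma prim_compI:
  fixes x :: "real^'p::finite"
  assumes "linear T" "pol T c x = 0" shows "x \<in> prim_comp T c"
  unfolding prim_comp_iff
  by (rule funpow_zero[OF linear_pol[OF assms(1)], of 1]) (use assms(2) in \<open>simp_all add: Suc_leI One_nat_def\<close>)

lemma T_prim_comp:
  fixes x :: "real^'p::finite"
  assumes "linear T" "x \<in> prim_comp T c" shows "T x \<in> prim_comp T c"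
proof -
  have "pol T c (T y) = T (pol T c y)" for y
    using assms(1) by (simp add: pol_def linear_add linear_diff linear_scale)
  then have "(pol T c ^^ n) (T y) = T ((pol T c ^^ n) y)" for n y
    by (induction n) auto
  then show ?thesis using assms linear_0 by (auto simp: prim_comp_iff)
qed

text \<open>Both sides are the value at the real number \<open>k\<close> of
  \<open>(X - c)(X - conj c)\<close>, the polynomial behind \<open>pol T c\<close>; it is nonzero
  unless \<open>c = k\<close>.\<close>

lemma norm_diff_of_real: "(k - Re c)\<^sup>2 + (Im c)\<^sup>2 = k\<^sup>2 - 2 * Re c * k + (cmod c)\<^sup>2"
  by (simp add: cmod_power2 power2_diff algebra_simps)

text \<open>On \<open>S\<close> the functional \<open>lor i0 _ z\<close> turns \<open>T\<close> into
  multiplication by \<open>k\<close>, hence \<open>pol T c\<close> into multiplication by a nonzero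
  number, while a power of \<open>pol T c\<close> kills \<open>x\<close>. A proper subspace
  \<open>S\<close> is used for the vectors of a Jordan chain, which are eigenvectors only modulo the
  earlier ones.\<close>

lemma prim_comp_orth:
  fixes T :: "real^'p::finite \<Rightarrow> real^'p"
  assumes T: "linear T" and S: "\<And>y. y \<in> S \<Longrightarrow> T y \<in> S" "subspace S"
    and z: "\<And>y. y \<in> S \<Longrightarrow> lor i0 (T y) z = k * lor i0 y z" and x: "x \<in> S" "x \<in> prim_comp T c" and c: "c \<noteq> of_real k"
  shows "lor i0 x z = 0"
proof -
  let ?d = "(k - Re c)\<^sup>2 + (Im c)\<^sup>2"
  have "?d \<noteq> 0" using c by (auto simp: complex_eq_iff sum_power2_eq_zero_iff)
  have pS: "pol T c y \<in> S" if "y \<in> S" for y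
    unfolding pol_def using S that by (intro subspace_add subspace_diff subspace_scale) auto
  have "lor i0 (pol T c y) z = ?d * lor i0 y z" if "y \<in> S" for y
    unfolding norm_diff_of_real using z[OF that] z[OF S(1)[OF that]]
    by (simp add: pol_def algebra_simps power2_eq_square)
  then have "lor i0 ((pol T c ^^ n) y) z = ?d ^ n * lor i0 y z \<and> (pol T c ^^ n) y \<in> S" if "y \<in> S" for n y
    using that pS by (induction n) (simp_all add: mult.assoc)
  from this[OF x(1), of "CARD('p)"] have "0 = ?d ^ CARD('p) * lor i0 x z" using x(2) unfolding prim_comp_iff by (metis lor_linear(9))
  then show ?thesis using \<open>?d \<noteq> 0\<close> power_not_zero by (metis mult_eq_0_iff)
qed

text \<open>\<open>B\<close> collects the eigenvalues whose components contain a timelike or null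
  vector; all other components lie in the positive definite space \<open>X\<close>. Knowing such a
  \<open>B\<close> makes \<open>Vt\<close> explicit.\<close>

lemma Vs_Vt:
  fixes T :: "real^'p::finite \<Rightarrow> real^'p"
  assumes T: "linear T" and X: "subspace X" "\<And>x. x \<in> X \<Longrightarrow> x \<noteq> 0 \<Longrightarrow> lor i0 x x > 0"
    and g: "\<And>c. Im c \<ge> 0 \<Longrightarrow> c \<notin> B \<Longrightarrow> prim_comp T c \<subseteq> X"
    and b: "\<And>c. c \<in> B \<Longrightarrow> Im c \<ge> 0" "\<And>c. c \<in> B \<Longrightarrow> \<exists>x\<in>prim_comp T c. x \<noteq> 0 \<and> lor i0 x x \<le> 0"
  shows "Vt i0 T = span (\<Union>c\<in>B. prim_comp T c)" "Vs i0 T \<subseteq> X"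
    "\<And>c. Im c \<ge> 0 \<Longrightarrow> c \<notin> B \<Longrightarrow> prim_comp T c \<subseteq> Vs i0 T"
    "subspace (Vs i0 T)" "\<And>x. x \<in> Vs i0 T \<Longrightarrow> T x \<in> Vs i0 T"
proof -
  have nb: "\<not> posdef_on i0 (prim_comp T c)" if "c \<in> B" for c
    using b(2)[OF that] unfolding posdef_on_def by force
  have pg: "posdef_on i0 (prim_comp T c)" if "Im c \<ge> 0" "c \<notin> B" for c
    using g[OF that] X(2) unfolding posdef_on_def by blast
  have n0: "prim_comp T c \<noteq> {0}" if "c \<in> B" for c using b(2)[OF that] by blast
  have "{C \<in> prim_comps T. \<not> posdef_on i0 C} = prim_comp T ` B"
    using nb pg n0 b(1) unfolding prim_comps_def by blast
  then show "Vt i0 T = span (\<Union>c\<in>B. prim_comp T c)" unfolding Vt_def by simp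
  have "C \<subseteq> X" if C: "C \<in> prim_comps T" "posdef_on i0 C" for C
    using C nb g unfolding prim_comps_def by blast
  then show "Vs i0 T \<subseteq> X" unfolding Vs_def using X(1) by (intro span_minimal) auto
  show "subspace (Vs i0 T)" unfolding Vs_def by simp
  show "prim_comp T c \<subseteq> Vs i0 T" if c: "Im c \<ge> 0" "c \<notin> B" for c
  proof (cases "prim_comp T c = {0}")
    case True
    then show ?thesis unfolding Vs_def by (simp add: span_zero)
  next
    case False
    then have "prim_comp T c \<in> {C \<in> prim_comps T. posdef_on i0 C}" using c pg unfolding prim_comps_def by blast
    then have "prim_comp T c \<subseteq> \<Union>{C \<in> prim_comps T. posdef_on i0 C}" by blast
    then show ?thesis unfolding Vs_def using span_superset by (rule subset_trans)
  qed
  have "T ` (\<Union>{C \<in> prim_comps T. posdef_on i0 C}) \<subseteq> \<Union>{C \<in> prim_comps T. posdef_on i0 C}"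
    using T_prim_comp[OF T] unfolding prim_comps_def by fast
  then have "T ` Vs i0 T \<subseteq> Vs i0 T"
    unfolding Vs_def linear_span_image[OF T, symmetric] by (rule span_mono)
  then show "T x \<in> Vs i0 T" if "x \<in> Vs i0 T" for x using that by blast
qed

text \<open>The space \<open>X\<close> may differ from \<open>W\<close> in vectors fixed by
  \<open>T\<close>, but the rotation planes and the eigenspace for \<open>-1\<close> lie in primary
  components for \<open>c \<noteq> 1\<close>, hence already in \<open>X\<close>.\<close>

lemma tsigma_Vs:
  fixes T :: "real^'p::finite \<Rightarrow> real^'p"
  assumes T: "lorT i0 T" and X: "subspace X" "\<And>x. x \<in> X \<Longrightarrow> T x \<in> X" "\<And>x. x \<in> X \<Longrightarrow> x \<noteq> 0 \<Longrightarrow> lor i0 x x > 0"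
    and XW: "X \<subseteq> W" and c: "\<And>c. c \<noteq> 1 \<Longrightarrow> cmod c = 1 \<Longrightarrow> Im c \<ge> 0 \<Longrightarrow> prim_comp T c \<subseteq> X"
  shows "tsigma (matrix T) X = (image_mset (\<lambda>n. n div 2) (csym T W), nz (dim (Er T X 1)) + nz (dim (Er T W (-1))))"
proof -
  have l: "linear T" using T by (simp add: lorT_def)
  have "rotpos T X"
    by (rule rotposI[OF l bilinear_lor[of i0] lor_sym]) (use X(3) T in \<open>auto simp: lorT_def\<close>)
  then have ts: "tsigma (matrix T) X = (image_mset (\<lambda>n. n div 2) (csym T X), nz (dim (Er T X 1)) + nz (dim (Er T X (-1))))"
    by (intro tsigma_eq[OF l X(1,2)])
  have "csym T X = csym T W"
  proof (rule csym_cong)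
    fix c :: real assume cc: "-1 < c" "c < 1"
    have "x \<in> X" if x: "x \<in> Wc T W c" for x
    proof -
      define d where "d = Complex c (sqrt (1 - c\<^sup>2))"
      have d: "cmod d = 1" "Im d \<ge> 0" "d \<noteq> 1" "Re d = c"
        using abs_square_less[OF cc] cc by (auto simp: d_def cmod_def complex_eq_iff)
      have "pol T d x = 0" using x d by (simp add: pol_def Wc_def)
      then show ?thesis using prim_compI[OF l] c[OF d(3,1,2)] by blast
    qed
    then show "Wc T X c = Wc T W c" using XW by (auto simp: Wc_def)
  qed
  moreover have "Er T X (-1) = Er T W (-1)"
  proof -
    have "x \<in> X" if x: "x \<in> Er T W (-1)" for x
    proof -
      have Tx: "T x = - x" using x by (simp add: Er_def)
      then have TTx: "T (T x) = x" by (simp add: linear_neg[OF l])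
      have "pol T (-1) x = 0" unfolding pol_def TTx unfolding Tx by (simp add: vec_eq_iff)
      then show ?thesis using prim_compI[OF l] c[of "-1"] by auto
    qed
    then show ?thesis using XW by (auto simp: Er_def)
  qed
  ultimately show ?thesis using ts by simp
qed

text \<open>If \<open>y = T w - w\<close> is fixed, then
  \<open>lor i0 y y = lor i0 (T w) (T y) - lor i0 w y = 0\<close>, and positivity gives
  \<open>y = 0\<close>. The induction reduces the exponent to this case.\<close>

lemma lor_unipotent_fixed:
  assumes T: "lorT i0 T" and W: "\<And>x. x \<in> W \<Longrightarrow> T x \<in> W" "subspace W" "\<And>x. x \<in> W \<Longrightarrow> x \<noteq> 0 \<Longrightarrow> lor i0 x x > 0"
    and w: "w \<in> W" "((\<lambda>y. T y - y) ^^ n) w = 0" "n > 0"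
  shows "T w = w"
  using w
proof (induction n arbitrary: w)
  case (Suc n)
  have l: "linear T" using T by (simp add: lorT_def)
  let ?y = "T w - w"
  have yW: "?y \<in> W" using W Suc.prems(1) by (auto intro: subspace_diff)
  have e: "((\<lambda>y. T y - y) ^^ n) ?y = 0" using Suc.prems(2) by (simp only: funpow_Suc_right o_def)
  show ?case
  proof (cases "n = 0")
    case True
    then show ?thesis using e by simp
  next
    case False
    then have ty: "T ?y = ?y" using Suc.IH[OF yW e] by simp
    have "lor i0 ?y ?y = lor i0 (T w) (T ?y) - lor i0 w ?y" unfolding ty by simp
    also have "\<dots> = 0" using T unfolding lorT_def by simp
    finally show ?thesis using W(3)[OF yW] by fastforce
  qed
qed simp

lemma pol_1: "linear T \<Longrightarrow> pol T 1 = (\<lambda>y. T y - y) ^^ 2"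
  by (auto simp: pol_def fun_eq_iff numeral_2_eq_2 linear_diff scaleR_2[unfolded numeral_2_eq_2] algebra_simps)

lemma prim_comp_1_iff:
  fixes x :: "real^'p::finite"
  assumes "linear T" shows "x \<in> prim_comp T 1 \<longleftrightarrow> ((\<lambda>y. T y - y) ^^ (2 * CARD('p))) x = 0"
  unfolding prim_comp_iff pol_1[OF assms] funpow_mult[symmetric] by (simp add: mult.commute)

lemma linear_T1: "linear T \<Longrightarrow> linear (\<lambda>y. T y - y)"
  by (intro linear_compose_sub linear_ident)

lemma lorT_image_eq:
  assumes "lorT i0 T" "subspace Y" "\<And>y. y \<in> Y \<Longrightarrow> T y \<in> Y" shows "T ` Y = Y"
  using assms lorT_bij(1)[OF assms(1)]
  by (intro image_subspace_eq) (auto simp: lorT_def inj_on_def dest: injD)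

section \<open>Lorentz complements and the Segre symbol of each type\<close>

definition lperp :: "'p::finite \<Rightarrow> (real^'p) set \<Rightarrow> (real^'p) set" where
  "lperp i0 U = {x. \<forall>u\<in>U. lor i0 u x = 0}"

lemma subspace_lperp: "subspace (lperp i0 U)"
  by (auto simp: subspace_def lperp_def)

lemma lperp_posdef: "v \<in> U \<Longrightarrow> lor i0 v v < 0 \<Longrightarrow> x \<in> lperp i0 U \<Longrightarrow> x \<noteq> 0 \<Longrightarrow> lor i0 x x > 0"
  using lor_timelike_orth unfolding lperp_def by blast

lemma lperp_Int: "v \<in> U \<Longrightarrow> lor i0 v v < 0 \<Longrightarrow> x \<in> U \<Longrightarrow> x \<in> lperp i0 U \<Longrightarrow> x = 0"
  using lperp_posdef[of v U i0 x] unfolding lperp_def by fastforce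

lemma lperp_inv:
  assumes T: "lorT i0 T" and U: "T ` U = U" and x: "x \<in> lperp i0 U" shows "T x \<in> lperp i0 U"
  unfolding lperp_def
proof (intro CollectI ballI)
  fix u assume "u \<in> U"
  then obtain u' where "u = T u'" "u' \<in> U" using U by blast
  then show "lor i0 u (T x) = 0" using T x unfolding lorT_def lperp_def by simp
qed

text \<open>A timelike vector in \<open>U\<close> makes the complement positive definite, so the
  form is nondegenerate on \<open>U\<close>. The endomorphism of \<open>U\<close> that represents
  the form is then injective, hence bijective, and solves for the component
  \<open>y\<close>.\<close>

lemma lor_split:
  fixes U :: "(real^'p::finite) set"
  assumes U: "subspace U" and v: "v \<in> U" "lor i0 v v < 0"
  shows "\<exists>y\<in>U. x - y \<in> lperp i0 U"
proof -
  obtain Q where Q: "isP Q" "sub_of Q = U" using ex_isP[OF U] by blast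
  \<comment> \<open>Reversal of the time coordinate, which turns the Lorentz form into the inner
    product.\<close>
  define h where "h y = y - (2 * y $ i0) *\<^sub>R axis i0 1" for y :: "real^'p"
  have lh: "linear h" by (rule linearI) (simp_all add: h_def algebra_simps)
  have h: "lor i0 u y = u \<bullet> h y" for u y by (simp add: lor_eq h_def inner_diff_right inner_axis)
  have Qh: "(Q *v h y) \<bullet> u = lor i0 u y" if "u \<in> U" for u y
  proof -
    have "Q *v u = u" using that Q sub_of_iff by blast
    then show ?thesis unfolding h isP_sym[OF Q(1)] by (simp add: inner_commute)
  qed
  let ?G = "\<lambda>y. Q *v h y"
  have lG: "linear ?G" using linear_compose[OF lh matrix_vector_mul_linear[of Q]] by (simp add: o_def)
  have "inj_on ?G U"
  proof (rule inj_onI)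
    fix y z assume yz: "y \<in> U" "z \<in> U" "?G y = ?G z"
    then have d: "y - z \<in> U" using U subspace_diff by blast
    have "?G (y - z) = 0" using yz(3) by (simp add: linear_diff[OF lh] matrix_vector_mult_diff_distrib)
    then have "lor i0 u (y - z) = 0" if "u \<in> U" for u using Qh[OF that, of "y - z"] by simp
    then have "y - z \<in> lperp i0 U" unfolding lperp_def by blast
    then show "y = z" using lperp_Int[OF v d] by simp
  qed
  moreover have "?G ` U \<subseteq> U" using sub_of_mult[of Q] Q(2) by blast
  ultimately have "?G ` U = U" by (intro image_subspace_eq[OF lG _ U])
  moreover have "?G x \<in> U" using sub_of_mult[of Q] Q(2) by blast
  ultimately obtain y where y: "y \<in> U" "?G x = ?G y" by blast
  have "lor i0 u (x - y) = 0" if "u \<in> U" for u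
    using Qh[OF that, of x] Qh[OF that, of y] y(2) by simp
  then show ?thesis using y(1) unfolding lperp_def by blast
qed

text \<open>Serves the elliptic type, with \<open>Y\<close> a timelike line, and the parabolic one,
  with \<open>Y\<close> the span of a Jordan chain. On the positive definite complement of
  \<open>Y\<close> the unipotent part of \<open>T\<close> is trivial, so the component for the
  eigenvalue 1 is \<open>Y\<close> plus the fixed vectors of the complement.\<close>

lemma unipotent_split:
  fixes T :: "real^'p::finite \<Rightarrow> real^'p"
  assumes T: "lorT i0 T" and Y: "subspace Y" "\<And>y. y \<in> Y \<Longrightarrow> T y \<in> Y" and v: "v \<in> Y" "lor i0 v v < 0"
    and m: "\<And>y. y \<in> Y \<Longrightarrow> ((\<lambda>y. T y - y) ^^ m) y = 0" "m \<le> 2 * CARD('p)"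
    and c: "\<And>c. c \<noteq> 1 \<Longrightarrow> prim_comp T c \<subseteq> lperp i0 Y"
  defines "W \<equiv> lperp i0 Y"
  shows "Vt i0 T = {y + w | y w. y \<in> Y \<and> w \<in> Er T W 1}"
    "dim (Vt i0 T) = dim Y + dim (Er T W 1)"
    "tsigma (matrix T) (Vs i0 T) = (image_mset (\<lambda>n. n div 2) (csym T W), nz (dim (Er T W (-1))))"
proof -
  have l: "linear T" using T by (simp add: lorT_def)
  have TY: "T ` Y = Y" by (rule lorT_image_eq[OF T Y])
  have sW: "subspace W" unfolding W_def by (rule subspace_lperp)
  have TW: "T x \<in> W" if "x \<in> W" for x using lperp_inv[OF T TY] that unfolding W_def by blast
  have pW: "lor i0 x x > 0" if "x \<in> W" "x \<noteq> 0" for x using lperp_posdef[OF v] that unfolding W_def by blast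
  have sE: "subspace (Er T W 1)" by (rule subspace_Er[OF l sW])
  \<comment> \<open>The complement of the whole component for the eigenvalue 1; all other components
    are orthogonal to the fixed vectors and fall into it.\<close>
  define X where "X = {x \<in> W. \<forall>z\<in>Er T W 1. lor i0 z x = 0}"
  have sX: "subspace X" using sW unfolding X_def by (auto simp: subspace_def)
  have pX: "lor i0 x x > 0" if "x \<in> X" "x \<noteq> 0" for x using pW that unfolding X_def by blast
  have cX: "prim_comp T c \<subseteq> X" if "c \<noteq> 1" for c
  proof
    fix x assume x: "x \<in> prim_comp T c"
    have "lor i0 z x = 0" if z: "z \<in> Er T W 1" for z
    proof -
      have "T z = z" using z by (simp add: Er_def)
      then have "lor i0 (T y) z = 1 * lor i0 y z" for y using T unfolding lorT_def by (metis mult_1)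
      then have "lor i0 x z = 0"
        using prim_comp_orth[OF l _ subspace_UNIV, of i0 z 1 x c] x \<open>c \<noteq> 1\<close> by simp
      then show ?thesis by (simp add: lor_sym)
    qed
    then show "x \<in> X" using x c[OF \<open>c \<noteq> 1\<close>] unfolding X_def W_def by blast
  qed
  have pc1: "x \<in> prim_comp T 1 \<longleftrightarrow> ((\<lambda>y. T y - y) ^^ (2 * CARD('p))) x = 0" for x
    by (rule prim_comp_1_iff[OF l])
  have Yp: "y \<in> prim_comp T 1" if "y \<in> Y" for y
    unfolding pc1 by (rule funpow_zero[OF linear_T1[OF l] m(1)[OF that] m(2)])
  have Ep: "w \<in> prim_comp T 1" if "w \<in> Er T W 1" for w
    unfolding pc1 by (rule funpow_zero[OF linear_T1[OF l], of 1]) (use that in \<open>simp_all add: Er_def Suc_leI One_nat_def\<close>)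
  have sP: "subspace (prim_comp T 1)" by (rule subspace_prim_comp[OF l])
  have eqP: "prim_comp T 1 = {y + w | y w. y \<in> Y \<and> w \<in> Er T W 1}"
  proof (intro set_eqI iffI)
    fix x assume x: "x \<in> prim_comp T 1"
    obtain y where y: "y \<in> Y" "x - y \<in> W" using lor_split[OF Y(1) v] unfolding W_def by blast
    have "x - y \<in> prim_comp T 1" using subspace_diff[OF sP x Yp[OF y(1)]] .
    then have "T (x - y) = x - y" unfolding pc1
      by (intro lor_unipotent_fixed[OF T TW sW pW y(2)]) auto
    then have "x - y \<in> Er T W 1" using y(2) by (simp add: Er_def)
    moreover have "x = y + (x - y)" by simp
    ultimately show "x \<in> {y + w | y w. y \<in> Y \<and> w \<in> Er T W 1}" using y(1) by blast
  next
    fix x assume "x \<in> {y + w | y w. y \<in> Y \<and> w \<in> Er T W 1}"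
    then show "x \<in> prim_comp T 1" using Yp Ep subspace_add[OF sP] by blast
  qed
  have v0: "v \<noteq> 0" using v(2) by auto
  have g1: "prim_comp T c \<subseteq> X" if "Im c \<ge> 0" "c \<notin> {1}" for c using cX that(2) by simp
  have b1: "Im c \<ge> 0" if "c \<in> {1}" for c using that by simp
  have b2: "\<exists>x\<in>prim_comp T c. x \<noteq> 0 \<and> lor i0 x x \<le> 0" if "c \<in> {1}" for c
    using that Yp[OF v(1)] v(2) v0 by (intro bexI[of _ v]) auto
  have VV: "Vt i0 T = span (\<Union>c\<in>{1}. prim_comp T c)" "Vs i0 T \<subseteq> X"
    "\<And>c. Im c \<ge> 0 \<Longrightarrow> c \<notin> {1} \<Longrightarrow> prim_comp T c \<subseteq> Vs i0 T"
    "subspace (Vs i0 T)" "\<And>x. x \<in> Vs i0 T \<Longrightarrow> T x \<in> Vs i0 T"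
    by (rule Vs_Vt[OF l sX pX g1 b1 b2]; assumption)+
  show eqV: "Vt i0 T = {y + w | y w. y \<in> Y \<and> w \<in> Er T W 1}"
    unfolding VV(1) using sP eqP by (simp add: span_eq_iff[THEN iffD2])
  have "Y \<inter> Er T W 1 \<subseteq> {0}" using lperp_Int[OF v] unfolding W_def Er_def by blast
  then show "dim (Vt i0 T) = dim Y + dim (Er T W 1)"
    unfolding eqV by (rule sum_decomp_dim[OF Y(1) sE])
  \<comment> \<open>A fixed vector of \<open>Vs\<close> lies in \<open>X\<close> and in
    \<open>Er T W 1\<close>, hence is orthogonal to itself.\<close>
  have "Er T (Vs i0 T) 1 \<subseteq> {0}"
  proof
    fix x assume x: "x \<in> Er T (Vs i0 T) 1"
    then have xX: "x \<in> X" using VV(2) unfolding Er_def by blast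
    then have "x \<in> Er T W 1" using x unfolding X_def Er_def by simp
    then have "lor i0 x x = 0" using xX unfolding X_def by blast
    then show "x \<in> {0}" using pX[OF xX] by force
  qed
  then have "dim (Er T (Vs i0 T) 1) = 0" by simp
  moreover have "Vs i0 T \<subseteq> W" using VV(2) unfolding X_def by blast
  then have "tsigma (matrix T) (Vs i0 T) = (image_mset (\<lambda>n. n div 2) (csym T W), nz (dim (Er T (Vs i0 T) 1)) + nz (dim (Er T W (-1))))"
  proof (intro tsigma_Vs[OF T VV(4,5)])
    show "0 < lor i0 x x" if "x \<in> Vs i0 T" "x \<noteq> 0" for x using pX that VV(2) by blast
    show "prim_comp T c \<subseteq> Vs i0 T" if "c \<noteq> 1" "Im c \<ge> 0" for c using VV(3)[of c] that by simp
  qed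
  ultimately show "tsigma (matrix T) (Vs i0 T) = (image_mset (\<lambda>n. n div 2) (csym T W), nz (dim (Er T W (-1))))"
    by (simp add: nz_def)
qed

lemma segreH_elliptic:
  fixes T :: "real^'p::finite \<Rightarrow> real^'p"
  assumes T: "lorT i0 T" and v: "T v = v" "lor i0 v v < 0"
  defines "W \<equiv> lperp i0 (span {v})"
  shows "segreH i0 T = (Ell, 1 + dim (Er T W 1), image_mset (\<lambda>n. n div 2) (csym T W), nz (dim (Er T W (-1))))"
proof -
  have l: "linear T" using T by (simp add: lorT_def)
  have v0: "v \<noteq> 0" using v(2) by auto
  have Y: "T y = y" if "y \<in> span {v}" for y using that v(1) by (auto simp: span_singleton linear_scale[OF l])
  have lv: "lor i0 (T y) v = 1 * lor i0 y v" for y using T v(1) unfolding lorT_def by (metis mult_1)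
  have c: "prim_comp T c \<subseteq> lperp i0 (span {v})" if "c \<noteq> 1" for c
  proof
    fix x assume "x \<in> prim_comp T c"
    then have "lor i0 x v = 0" using prim_comp_orth[OF l _ subspace_UNIV, of i0 v 1 x c] lv that by simp
    then show "x \<in> lperp i0 (span {v})" by (auto simp: lperp_def span_singleton lor_sym)
  qed
  have m: "((\<lambda>y. T y - y) ^^ 1) y = 0" if "y \<in> span {v}" for y using Y[OF that] by (simp add: One_nat_def)
  have N: "1 \<le> 2 * CARD('p)" by (simp add: Suc_leI One_nat_def)
  have TY: "T y \<in> span {v}" if "y \<in> span {v}" for y using Y[OF that] that by simp
  have vv: "v \<in> span {v}" by (simp add: span_base)
  have U: "Vt i0 T = {y + w | y w. y \<in> span {v} \<and> w \<in> Er T W 1}"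
    "dim (Vt i0 T) = dim (span {v}) + dim (Er T W 1)"
    "tsigma (matrix T) (Vs i0 T) = (image_mset (\<lambda>n. n div 2) (csym T W), nz (dim (Er T W (-1))))"
    unfolding W_def by (rule unipotent_split[OF T subspace_span _ vv v(2) _ N]; use TY m c in blast)+
  have "T x = x" if "x \<in> Vt i0 T" for x
    using that Y U(1) by (auto simp: Er_def linear_add[OF l])
  then show ?thesis unfolding segreH_def using U(2,3) v0 by (simp add: dim_insert)
qed

text \<open>\<open>b\<close>, \<open>u\<close>, \<open>e\<close> is a Jordan chain of length three
  for \<open>T - 1\<close>, so its span is unipotent. Other primary components are shown orthogonal
  to \<open>e\<close>, \<open>u\<close> and \<open>b\<close> one after the other.\<close>

lemma segreH_parabolic:
  fixes T :: "real^'p::finite \<Rightarrow> real^'p"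
  assumes T: "lorT i0 T" and eub: "T e = e" "T u = u + e" "T b = b + u" "e \<noteq> 0" and v: "v \<in> span {e, u, b}" "lor i0 v v < 0"
  defines "W \<equiv> lperp i0 (span {e, u, b})"
  shows "segreH i0 T = (Par, 3 + dim (Er T W 1), image_mset (\<lambda>n. n div 2) (csym T W), nz (dim (Er T W (-1))))"
    "dim (span {e, u}) = 2" "dim (span {e, u, b}) = 3"
proof -
  have l: "linear T" using T by (simp add: lorT_def)
  have N3: "((\<lambda>y. T y - y) ^^ 3) y = 0" if "y \<in> span {e, u, b}" for y
    using that
  proof (induction rule: span_induct)
    case base
    have "{y. ((\<lambda>y. T y - y) ^^ 3) y = 0} = {y. ((\<lambda>y. T y - y) ^^ 3) y = 0}" ..
    then show ?case using linear_subspace_kernel[OF linear_funpow[OF linear_T1[OF l]], of 3] by simp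
  next
    case (step x)
    then show ?case using eub by (auto simp: numeral_3_eq_3 linear_add[OF l] linear_0[OF l])
  qed
  have ue: "u \<notin> span {e}"
  proof
    assume "u \<in> span {e}"
    then have "T u = u" using eub(1) by (auto simp: span_singleton linear_scale[OF l])
    then show False using eub by simp
  qed
  have be: "b \<notin> span {e, u}"
  proof
    assume "b \<in> span {e, u}"
    then obtain k where "b - k *\<^sub>R u \<in> span {e}" by (metis insert_commute span_breakdown_eq)
    then obtain j where "b - k *\<^sub>R u = j *\<^sub>R e" by (auto simp: span_singleton)
    then have "b = k *\<^sub>R u + j *\<^sub>R e" by (simp add: algebra_simps)
    then have "T b = b + k *\<^sub>R e" using eub by (simp add: linear_add[OF l] linear_scale[OF l] algebra_simps)
    then have "u = k *\<^sub>R e" using eub(3) by simp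
    then show False using ue by (auto simp: span_singleton)
  qed
  show d2: "dim (span {e, u}) = 2" using ue eub(4) by (simp add: dim_insert insert_commute[of e u])
  have "{e, u, b} = insert b {e, u}" by auto
  then show d3: "dim (span {e, u, b}) = 3" using be d2 by (simp add: dim_insert)
  \<comment> \<open>The definition of the parabolic type uses the exponent \<open>CARD('p)\<close>,
    whereas the chain is killed by exponent 3.\<close>
  then have C3: "3 \<le> CARD('p)" using dim_subset_UNIV[of "span {e, u, b}"] by simp
  have TY: "T y \<in> span {e, u, b}" if "y \<in> span {e, u, b}" for y
  proof -
    have "T y \<in> T ` span {e, u, b}" using that by blast
    also have "\<dots> = span (T ` {e, u, b})" by (rule linear_span_image[OF l, symmetric])
    also have "\<dots> \<subseteq> span {e, u, b}" using eub by (intro span_minimal) (auto intro: span_add span_base)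
    finally show ?thesis .
  qed
  have c: "prim_comp T c \<subseteq> lperp i0 (span {e, u, b})" if c1: "c \<noteq> 1" for c
  proof
    fix x assume x: "x \<in> prim_comp T c"
    have i: "lor i0 (T y) (T z) = lor i0 y z" for y z using T by (simp add: lorT_def)
    have c1': "c \<noteq> of_real 1" using c1 by simp
    have z1: "lor i0 (T y) e = 1 * lor i0 y e" for y using i[of y e] eub(1) by simp
    have xe: "lor i0 x e = 0"
      by (rule prim_comp_orth[OF l _ subspace_UNIV z1 _ x c1']) auto
    \<comment> \<open>On this subspace the summand \<open>e\<close> of \<open>T u\<close> is
      invisible, and \<open>u\<close> behaves like a fixed vector; the same is repeated for
      \<open>b\<close> on \<open>?R\<close>.\<close>
    let ?S = "{y. lor i0 y e = 0}"
    have S: "subspace ?S" "\<And>y. y \<in> ?S \<Longrightarrow> T y \<in> ?S" using z1 by (auto simp: subspace_def)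
    have z2: "lor i0 (T y) u = 1 * lor i0 y u" if "y \<in> ?S" for y
      using i[of y u] eub(2) S(2)[OF that] by simp
    have xu: "lor i0 x u = 0"
      by (rule prim_comp_orth[OF l S(2,1) z2 _ x c1']) (use xe in auto)
    let ?R = "{y. lor i0 y e = 0 \<and> lor i0 y u = 0}"
    have R: "subspace ?R" "\<And>y. y \<in> ?R \<Longrightarrow> T y \<in> ?R" using z1 z2 by (auto simp: subspace_def)
    have z3: "lor i0 (T y) b = 1 * lor i0 y b" if "y \<in> ?R" for y
      using i[of y b] eub(3) R(2)[OF that] by simp
    have xb: "lor i0 x b = 0"
      by (rule prim_comp_orth[OF l R(2,1) z3 _ x c1']) (use xe xu in auto)
    have "lor i0 y x = 0" if "y \<in> span {e, u, b}" for y
      using that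
    proof (induction rule: span_induct)
      case base
      then show ?case by (auto simp: subspace_def)
    next
      case (step y)
      then show ?case using xe xu xb by (auto simp: lor_sym[of i0 _ x])
    qed
    then show "x \<in> lperp i0 (span {e, u, b})" by (simp add: lperp_def)
  qed
  have N: "3 \<le> 2 * CARD('p)" using C3 by simp
  have U: "Vt i0 T = {y + w | y w. y \<in> span {e, u, b} \<and> w \<in> Er T W 1}"
    "dim (Vt i0 T) = dim (span {e, u, b}) + dim (Er T W 1)"
    "tsigma (matrix T) (Vs i0 T) = (image_mset (\<lambda>n. n div 2) (csym T W), nz (dim (Er T W (-1))))"
    unfolding W_def by (rule unipotent_split[OF T subspace_span _ v _ N]; use TY N3 c in blast)+
  have bV: "b \<in> Vt i0 T"
  proof -
    have "b \<in> span {e, u, b}" "0 \<in> Er T W 1" "b = b + 0"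
      by (auto simp: span_base Er_def W_def lperp_def linear_0[OF l])
    then show ?thesis unfolding U(1) by blast
  qed
  have "u \<noteq> 0" using ue span_zero by auto
  then have "T b \<noteq> b" using eub(3) by simp
  moreover have "((\<lambda>y. T y - y) ^^ CARD('p)) x = 0" if xV: "x \<in> Vt i0 T" for x
  proof -
    obtain y w where yw: "x = y + w" "y \<in> span {e, u, b}" "w \<in> Er T W 1" using xV U(1) by blast
    note L = linear_T1[OF l]
    have "((\<lambda>y. T y - y) ^^ CARD('p)) y = 0" by (rule funpow_zero[OF L N3[OF yw(2)] C3])
    moreover have "((\<lambda>y. T y - y) ^^ CARD('p)) w = 0"
      by (rule funpow_zero[OF L, of 1]) (use yw(3) in \<open>simp_all add: Er_def Suc_leI One_nat_def\<close>)
    ultimately show ?thesis unfolding yw(1) linear_add[OF linear_funpow[OF L]] by simp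
  qed
  ultimately show "segreH i0 T = (Par, 3 + dim (Er T W 1), image_mset (\<lambda>n. n div 2) (csym T W), nz (dim (Er T W (-1))))"
    unfolding segreH_def using U(2,3) bV d3 by auto
qed

text \<open>Invariance forces \<open>e\<close> and \<open>b\<close> to be null, and they span a
  Lorentzian plane with positive definite complement \<open>W\<close>. Writing a vector as a
  combination of \<open>e\<close>, \<open>b\<close> and a part in \<open>W\<close>, pairing with
  \<open>e\<close> or \<open>b\<close> removes one coefficient and \<open>Winj\<close> removes the
  part in \<open>W\<close>; so the components for \<open>\<mu>\<close> and \<open>1 / \<mu>\<close>
  are just the two null lines.\<close>

lemma segreH_hyperbolic:
  fixes T :: "real^'p::finite \<Rightarrow> real^'p"
  assumes T: "lorT i0 T" and mu: "\<mu> > 0" "\<mu> \<noteq> 1" and eb: "T e = \<mu> *\<^sub>R e" "T b = (1 / \<mu>) *\<^sub>R b" "e \<noteq> 0" "b \<noteq> 0"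
    and v: "v \<in> span {e, b}" "lor i0 v v < 0"
  defines "W \<equiv> lperp i0 (span {e, b})"
  shows "segreH i0 T = (Hyp, 2, image_mset (\<lambda>n. n div 2) (csym T W), nz (dim (Er T W 1)) + nz (dim (Er T W (-1))))"
    "dim (span {e, b}) = 2"
proof -
  have l: "linear T" using T by (simp add: lorT_def)
  have i: "lor i0 (T y) (T z) = lor i0 y z" for y z using T by (simp add: lorT_def)
  have mm: "\<mu> * \<mu> \<noteq> 1" "\<mu> \<noteq> 1 / \<mu>" using mu by (auto simp: square_eq_1_iff field_simps)
  have ee: "lor i0 e e = 0"
  proof -
    have "\<mu> * \<mu> * lor i0 e e = lor i0 e e" using i[of e e] eb(1) by (simp add: mult.assoc)
    then show ?thesis using mm by simp
  qed
  have bb: "lor i0 b b = 0"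
  proof -
    have "lor i0 b b = \<mu> * \<mu> * lor i0 b b" using i[of b b] eb(2) mu by (simp add: field_simps)
    then show ?thesis using mm by simp
  qed
  have sp: "\<exists>s t. y = s *\<^sub>R e + t *\<^sub>R b" if "y \<in> span {e, b}" for y
  proof -
    from that obtain s where "y - s *\<^sub>R e \<in> span {b}" using span_breakdown_eq[of y e "{b}"] by auto
    then obtain t where "y - s *\<^sub>R e = t *\<^sub>R b" by (auto simp: span_singleton)
    then have "y = s *\<^sub>R e + t *\<^sub>R b" by (simp add: algebra_simps)
    then show ?thesis by blast
  qed
  have eb0: "lor i0 e b \<noteq> 0"
  proof
    assume 0: "lor i0 e b = 0"
    obtain s t where "v = s *\<^sub>R e + t *\<^sub>R b" using sp[OF v(1)] by blast
    moreover have "lor i0 b e = 0" using 0 lor_sym[of i0 b e] by simp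
    ultimately have "lor i0 v v = 0" using 0 ee bb by simp
    then show False using v(2) by simp
  qed
  have be: "e \<notin> span {b}" using eb0 bb by (auto simp: span_singleton)
  then show d: "dim (span {e, b}) = 2" using eb(4) by (simp add: dim_insert)
  have TY: "T y \<in> span {e, b}" if "y \<in> span {e, b}" for y
  proof -
    have "T y \<in> T ` span {e, b}" using that by blast
    also have "\<dots> = span (T ` {e, b})" by (rule linear_span_image[OF l, symmetric])
    also have "\<dots> \<subseteq> span {e, b}" using eb by (intro span_minimal) (auto intro: span_scale span_base)
    finally show ?thesis .
  qed
  have TYY: "T ` span {e, b} = span {e, b}" by (rule lorT_image_eq[OF T subspace_span TY])
  have sW: "subspace W" unfolding W_def by (rule subspace_lperp)
  have TW: "T x \<in> W" if "x \<in> W" for x using lperp_inv[OF T TYY] that unfolding W_def by blast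
  have pW: "lor i0 x x > 0" if "x \<in> W" "x \<noteq> 0" for x using lperp_posdef[OF v] that unfolding W_def by blast
  have WI: "x \<in> W" if "lor i0 x e = 0" "lor i0 x b = 0" for x
    unfolding W_def lperp_def
  proof (intro CollectI ballI)
    fix y assume "y \<in> span {e, b}"
    then obtain s t where "y = s *\<^sub>R e + t *\<^sub>R b" using sp by blast
    then show "lor i0 y x = 0" using that unfolding lor_sym[of i0 x e] lor_sym[of i0 x b] by simp
  qed
  \<comment> \<open>Pairing with an eigenvector for \<open>\<mu>\<close> multiplies by
    \<open>1 / \<mu>\<close>, so \<open>e\<close> is orthogonal to every component except the one of
    \<open>b\<close>.\<close>
  have ze: "lor i0 (T y) e = (1 / \<mu>) * lor i0 y e" for y using i[of y e] eb(1) mu by (simp add: field_simps)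
  have zb: "lor i0 (T y) b = \<mu> * lor i0 y b" for y using i[of y b] eb(2) mu by (simp add: field_simps)
  have xe: "lor i0 x e = 0" if "x \<in> prim_comp T c" "c \<noteq> of_real (1 / \<mu>)" for x c
    by (rule prim_comp_orth[OF l _ subspace_UNIV ze _ that]) auto
  have xb: "lor i0 x b = 0" if "x \<in> prim_comp T c" "c \<noteq> of_real \<mu>" for x c
    by (rule prim_comp_orth[OF l _ subspace_UNIV zb _ that]) auto
  let ?m = "complex_of_real \<mu>" and ?n = "complex_of_real (1 / \<mu>)"
  have mn: "?m \<noteq> ?n" unfolding of_real_eq_iff by (rule mm(2))
  have cW: "prim_comp T c \<subseteq> W" if "c \<notin> {?m, ?n}" for c
  proof
    fix x assume x: "x \<in> prim_comp T c"
    have "c \<noteq> ?n" "c \<noteq> ?m" using that by blast+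
    then show "x \<in> W" by (intro WI xe[OF x] xb[OF x])
  qed
  have ep: "e \<in> prim_comp T ?m"
    by (rule prim_compI[OF l]) (simp add: pol_def eb linear_scale[OF l] power2_eq_square vec_eq_iff)
  have bp: "b \<in> prim_comp T ?n"
    by (rule prim_compI[OF l]) (use mu in \<open>simp add: pol_def eb linear_scale[OF l] power2_eq_square vec_eq_iff norm_divide\<close>)
  \<comment> \<open>An isometry of a positive definite space has no real eigenvalue \<open>k\<close>
    with \<open>k * k \<noteq> 1\<close>, hence no generalised eigenvector for it either.\<close>
  have Winj: "w = 0" if w: "w \<in> W" and p: "w \<in> prim_comp T (of_real k)" and k: "k = \<mu> \<or> k = 1 / \<mu>" for w k
  proof -
    have "1 / \<mu> * (1 / \<mu>) \<noteq> 1" using mm(1) mu(1) by (simp add: field_simps)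
    then have kk: "k * k \<noteq> 1" using k mm(1) by auto
    have ev: "y = 0" if y: "y \<in> W" "T y = k *\<^sub>R y" for y
    proof (rule ccontr)
      assume "y \<noteq> 0"
      have "lor i0 y y = k * k * lor i0 y y" using i[of y y] y(2) by (simp add: mult.assoc)
      then show False using kk pW[OF y(1) \<open>y \<noteq> 0\<close>] by simp
    qed
    have pz: "y = 0" if y: "y \<in> W" "pol T (of_real k) y = 0" for y
    proof -
      let ?z = "T y - k *\<^sub>R y"
      have zW: "?z \<in> W" using TW y(1) sW by (auto intro: subspace_diff subspace_scale)
      have "T ?z - k *\<^sub>R ?z = pol T (of_real k) y"
        by (simp add: pol_def linear_diff[OF l] linear_scale[OF l] power2_eq_square vec_eq_iff algebra_simps)
      then have "T ?z = k *\<^sub>R ?z" using y(2) by simp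
      then have "?z = 0" using ev[OF zW] by blast
      then show ?thesis using ev[OF y(1)] by simp
    qed
    have pw: "pol T (of_real k) y \<in> W" if "y \<in> W" for y
      unfolding pol_def using TW that sW by (intro subspace_add subspace_diff subspace_scale) auto
    have "(pol T (of_real k) ^^ n) y = 0 \<Longrightarrow> y = 0" if "y \<in> W" for n y
      using that
    proof (induction n arbitrary: y)
      case (Suc n)
      have "(pol T (of_real k) ^^ n) (pol T (of_real k) y) = 0" using Suc.prems(1) by (simp only: funpow_Suc_right o_def)
      then have "pol T (of_real k) y = 0" by (rule Suc.IH[OF _ pw[OF Suc.prems(2)]])
      then show ?case by (rule pz[OF Suc.prems(2)])
    qed simp
    then show ?thesis using w p unfolding prim_comp_iff by blast
  qed
  have dec: "\<exists>s t. x - (s *\<^sub>R e + t *\<^sub>R b) \<in> W" for x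
    using lor_split[OF subspace_span v] sp unfolding W_def by blast
  have We: "lor i0 w e = 0 \<and> lor i0 w b = 0" if "w \<in> W" for w
  proof -
    have "e \<in> span {e, b}" "b \<in> span {e, b}" by (auto simp: span_base)
    then have "lor i0 e w = 0" "lor i0 b w = 0" using that unfolding W_def lperp_def by blast+
    then show ?thesis unfolding lor_sym[of i0 w e] lor_sym[of i0 w b] by blast
  qed
  have pm: "prim_comp T ?m = span {e}"
  proof (intro subset_antisym subsetI)
    fix x assume x: "x \<in> prim_comp T ?m"
    obtain s t where w: "x - (s *\<^sub>R e + t *\<^sub>R b) \<in> W" using dec by blast
    have be: "lor i0 b e = lor i0 e b" by (rule lor_sym)
    have "lor i0 (x - (s *\<^sub>R e + t *\<^sub>R b)) e = 0" using We[OF w] by blast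
    then have "t * lor i0 e b = 0" unfolding lor_linear ee be using xe[OF x mn] by simp
    then have "t = 0" using eb0 by simp
    then have "x - s *\<^sub>R e \<in> W" using w by simp
    moreover have "x - s *\<^sub>R e \<in> prim_comp T ?m"
      using subspace_prim_comp[OF l] x ep by (intro subspace_diff subspace_scale)
    ultimately have "x - s *\<^sub>R e = 0" using Winj by blast
    then show "x \<in> span {e}" by (auto simp: span_singleton)
  qed (use ep span_minimal[of "{e}" "prim_comp T ?m"] subspace_prim_comp[OF l] in auto)
  have pn: "prim_comp T ?n = span {b}"
  proof (intro subset_antisym subsetI)
    fix x assume x: "x \<in> prim_comp T ?n"
    obtain s t where w: "x - (s *\<^sub>R e + t *\<^sub>R b) \<in> W" using dec by blast
    have "lor i0 (x - (s *\<^sub>R e + t *\<^sub>R b)) b = 0" using We[OF w] by blast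
    then have "s * lor i0 e b = 0" unfolding lor_linear bb using xb[OF x mn[symmetric]] by simp
    then have "s = 0" using eb0 by simp
    then have "x - t *\<^sub>R b \<in> W" using w by simp
    moreover have "x - t *\<^sub>R b \<in> prim_comp T ?n"
      using subspace_prim_comp[OF l] x bp by (intro subspace_diff subspace_scale)
    ultimately have "x - t *\<^sub>R b = 0" using Winj by blast
    then show "x \<in> span {b}" by (auto simp: span_singleton)
  qed (use bp span_minimal[of "{b}" "prim_comp T ?n"] subspace_prim_comp[OF l] in auto)
  have nonpos: "\<exists>x\<in>prim_comp T c. x \<noteq> 0 \<and> lor i0 x x \<le> 0" if "c \<in> {?m, ?n}" for c
  proof -
    have "\<exists>x\<in>prim_comp T ?m. x \<noteq> 0 \<and> lor i0 x x \<le> 0" using ep eb(3) ee by (intro bexI[of _ e]) auto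
    moreover have "\<exists>x\<in>prim_comp T ?n. x \<noteq> 0 \<and> lor i0 x x \<le> 0" using bp eb(4) bb by (intro bexI[of _ b]) auto
    ultimately show ?thesis using that by blast
  qed
  have g1: "prim_comp T c \<subseteq> W" if "Im c \<ge> 0" "c \<notin> {?m, ?n}" for c using cW[OF that(2)] .
  have b1: "Im c \<ge> 0" if "c \<in> {?m, ?n}" for c using that by auto
  have VV: "Vt i0 T = span (\<Union>c\<in>{?m, ?n}. prim_comp T c)" "Vs i0 T \<subseteq> W"
    "\<And>c. Im c \<ge> 0 \<Longrightarrow> c \<notin> {?m, ?n} \<Longrightarrow> prim_comp T c \<subseteq> Vs i0 T"
    "subspace (Vs i0 T)" "\<And>x. x \<in> Vs i0 T \<Longrightarrow> T x \<in> Vs i0 T"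
    by (rule Vs_Vt[OF l sW pW g1 b1 nonpos]; assumption)+
  have "span {e} \<union> span {b} \<subseteq> span {e, b}" by (simp add: span_mono)
  moreover have "{e, b} \<subseteq> span {e} \<union> span {b}" by (auto simp: span_base)
  ultimately have "span (span {e} \<union> span {b}) = span {e, b}"
    using span_minimal[OF _ subspace_span[of "{e, b}"], of "span {e} \<union> span {b}"]
      span_mono[of "{e, b}" "span {e} \<union> span {b}"] by blast
  then have Vt: "Vt i0 T = span {e, b}" unfolding VV(1) by (simp only: UN_insert UN_empty pm pn Un_empty_right)
  have c1: "c \<notin> {?m, ?n}" if "cmod c = 1" for c
  proof -
    have "cmod ?m \<noteq> 1" "cmod ?n \<noteq> 1" using mu by (simp_all only: norm_of_real) (simp_all add: field_simps)
    then show ?thesis using that by blast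
  qed
  have ts: "tsigma (matrix T) (Vs i0 T) = (image_mset (\<lambda>n. n div 2) (csym T W), nz (dim (Er T (Vs i0 T) 1)) + nz (dim (Er T W (-1))))"
  proof (intro tsigma_Vs[OF T VV(4,5) _ VV(2)])
    show "0 < lor i0 x x" if "x \<in> Vs i0 T" "x \<noteq> 0" for x using pW that VV(2) by blast
    show "prim_comp T c \<subseteq> Vs i0 T" if "cmod c = 1" "Im c \<ge> 0" for c using VV(3)[OF that(2) c1[OF that(1)]] .
  qed
  have "Er T (Vs i0 T) 1 = Er T W 1"
  proof -
    have "x \<in> Vs i0 T" if "x \<in> Er T W 1" for x
    proof -
      have Tx: "T x = x" using that by (simp add: Er_def)
      have "pol T 1 x = 0" unfolding pol_def Tx by (simp add: vec_eq_iff)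
      then have "x \<in> prim_comp T 1" by (rule prim_compI[OF l])
      moreover have "1 \<notin> {?m, ?n}" using mu by auto
      ultimately show ?thesis using VV(3)[of 1] by auto
    qed
    then show ?thesis using VV(2) by (auto simp: Er_def)
  qed
  note ts = ts[unfolded this]
  have eV: "e \<in> Vt i0 T" unfolding Vt by (simp add: span_base)
  have "T e \<noteq> e"
  proof
    assume "T e = e"
    then have "(\<mu> - 1) *\<^sub>R e = 0" using eb(1) by (simp add: scaleR_left_diff_distrib)
    then show False using mu(2) eb(3) by simp
  qed
  moreover have "((\<lambda>y. T y - y) ^^ n) e = (\<mu> - 1) ^ n *\<^sub>R e" for n
    by (induction n) (simp_all add: linear_scale[OF l] eb algebra_simps)
  \<comment> \<open>Excludes the parabolic branch of the definition.\<close>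
  then have "((\<lambda>y. T y - y) ^^ CARD('p)) e \<noteq> 0" using mu eb by simp
  ultimately show "segreH i0 T = (Hyp, 2, image_mset (\<lambda>n. n div 2) (csym T W), nz (dim (Er T W 1)) + nz (dim (Er T W (-1))))"
    unfolding segreH_def ts using eV d Vt by auto
qed

section \<open>Subspaces containing a given invariant subspace\<close>

text \<open>A subspace containing the range of \<open>Y\<close> is the orthogonal sum of that range
  and its part in \<open>W\<close>. Since \<open>T\<close> preserves both summands, removing
  \<open>Y\<close> respects invariance.\<close>

lemma GG_quotient:
  fixes T :: "real^'p::finite \<Rightarrow> real^'p"
  assumes T: "linear T" and Y: "isP Y" "\<And>y. y \<in> sub_of Y \<Longrightarrow> T y \<in> sub_of Y" "dim (sub_of Y) = d"
    and W: "W = {x. Y *v x = 0}" "\<And>x. x \<in> W \<Longrightarrow> T x \<in> W"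
  shows "{P \<in> grass (k + d). sub_of Y \<subseteq> sub_of P \<and> (\<forall>x\<in>sub_of P. T x \<in> sub_of P)} homeomorphic GG T W {0} k"
    (is "?S homeomorphic _")
proof (rule homeomorphicI[of _ "\<lambda>P. (P - Y, 0)" _ "\<lambda>z. fst z + Y"])
  have GGi: "(P, q) \<in> GG T W {0} k \<longleftrightarrow> isP P \<and> dim (sub_of P) = k \<and> sub_of P \<subseteq> W \<and> (\<forall>x\<in>sub_of P. T x \<in> sub_of P) \<and> q = 0" for P q
    by (auto simp: GG_def grass_iff)
  show "(P - Y, 0) \<in> GG T W {0} k" if "P \<in> ?S" for P
  proof -
    have P: "isP P" "dim (sub_of P) = k + d" "sub_of Y \<subseteq> sub_of P" "\<And>x. x \<in> sub_of P \<Longrightarrow> T x \<in> sub_of P"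
      using that by (auto simp: grass_iff)
    note D = isP_diff[OF P(1) Y(1) P(3)]
    have s: "sub_of (P - Y) = sub_of P \<inter> W" unfolding D(2) W(1) by blast
    have o: "x \<bullet> y = 0" if "x \<in> sub_of (P - Y)" "y \<in> sub_of Y" for x y
      using isP_orth[OF Y(1) that(2)] that(1) D(2) by blast
    have "sub_of (P - Y + Y) = {x + y |x y. x \<in> sub_of (P - Y) \<and> y \<in> sub_of Y}"
      by (rule isP_add(2)[OF D(1) Y(1)]) (use o in blast)
    then have "dim (sub_of P) = dim (sub_of (P - Y)) + d"
      using dim_sum_orthogonal[of "sub_of (P - Y)" "sub_of Y", OF subspace_sub_of subspace_sub_of o] Y(3) by simp
    then show ?thesis unfolding GGi using D(1) P(2,4) W(2) s by auto
  qed
  show "fst z + Y \<in> ?S" "(fst z + Y - Y, 0) = z" if "z \<in> GG T W {0} k" for z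
  proof -
    obtain P where P: "z = (P, 0)" "isP P" "dim (sub_of P) = k" "sub_of P \<subseteq> W" "\<And>x. x \<in> sub_of P \<Longrightarrow> T x \<in> sub_of P"
    proof (cases z)
      case (Pair P q)
      then show ?thesis using \<open>z \<in> GG T W {0} k\<close> GGi[of P q] by (intro that[of P]) auto
    qed
    have o: "x \<bullet> y = 0" if "x \<in> sub_of P" "y \<in> sub_of Y" for x y
      using isP_orth[OF Y(1) that(2)] that(1) P(4) W(1) by blast
    have D: "isP (P + Y)" "sub_of (P + Y) = {x + y |x y. x \<in> sub_of P \<and> y \<in> sub_of Y}"
      by (rule isP_add[OF P(2) Y(1)]; use o in blast)+
    have "dim (sub_of (P + Y)) = k + d"
      using dim_sum_orthogonal[of "sub_of P" "sub_of Y", OF subspace_sub_of subspace_sub_of o] P(3) Y(3) D(2) by simp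
    moreover have "sub_of Y \<subseteq> sub_of (P + Y)"
    proof
      fix y assume "y \<in> sub_of Y"
      moreover have "0 \<in> sub_of P" "y = 0 + y" using subspace_0[OF subspace_sub_of] by auto
      ultimately show "y \<in> sub_of (P + Y)" unfolding D(2) by blast
    qed
    moreover have "T x \<in> sub_of (P + Y)" if x: "x \<in> sub_of (P + Y)" for x
    proof -
      obtain a b where "x = a + b" "a \<in> sub_of P" "b \<in> sub_of Y" using x D(2) by blast
      then have "T x = T a + T b" "T a \<in> sub_of P" "T b \<in> sub_of Y" using P(5) Y(2) linear_add[OF T] by auto
      then show ?thesis unfolding D(2) by blast
    qed
    ultimately show "fst z + Y \<in> ?S" using D(1) P(1) by (simp add: grass_iff)
    show "(fst z + Y - Y, 0) = z" using P(1) by simp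
  qed
qed (auto intro!: continuous_intros)

text \<open>The vector \<open>z\<close> for which \<open>b + z\<close> is the point of the affine hyperplane \<open>x \<bullet> b = 1\<close>
  in the range of \<open>P - D\<close> that is orthogonal to the rest of this range.\<close>

definition graph_vec :: "real^'p^'p \<Rightarrow> real^'p \<Rightarrow> real^'p^'p \<Rightarrow> real^'p" where
  "graph_vec D b P = (1 / (((P - D) *v b) \<bullet> b)) *\<^sub>R ((P - D) *v b) - b"

text \<open>A subspace in \<open>S\<close> is the orthogonal sum of the range of \<open>D\<close>,
  of its part \<open>N\<close> in \<open>W\<close>, and of the line of \<open>b + z\<close>, where
  \<open>z = graph_vec D b P\<close> is a \<open>T\<close>-fixed vector of \<open>W\<close>
  orthogonal to \<open>N\<close>; the pair of \<open>N\<close> and \<open>z\<close> is the point of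
  \<open>Gfix\<close>. The set \<open>\<Omega>\<close> encodes the existence of a timelike vector:
  it is the unit ball for elliptic maps (\<open>D = 0\<close>, \<open>b\<close> the time axis) and
  everything for parabolic ones.\<close>

lemma Gfix_quotient:
  fixes T :: "real^'p::finite \<Rightarrow> real^'p" and k :: nat
  assumes T: "isoW T W" and D: "isP D" "\<And>y. y \<in> sub_of D \<Longrightarrow> T y \<in> sub_of D" "dim (sub_of D) = d"
    and b: "b \<bullet> b = 1" "D *v b = 0" "T b - b \<in> sub_of D"
    and W: "W = {x. D *v x = 0 \<and> x \<bullet> b = 0}"
  defines "S \<equiv> {P \<in> grass (k + 1 + d). sub_of D \<subseteq> sub_of P \<and> (\<exists>x\<in>sub_of P. x \<bullet> b \<noteq> 0) \<and> (\<forall>x\<in>sub_of P. T x \<in> sub_of P)}"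
  shows "{P \<in> S. graph_vec D b P \<in> \<Omega>} homeomorphic {(P, z). (P, z) \<in> Gfix T W k \<and> z \<in> \<Omega>}"
    and "\<And>P x. P \<in> S \<Longrightarrow> x \<in> sub_of P \<Longrightarrow> x - (x \<bullet> b) *\<^sub>R (b + graph_vec D b P) \<in> sub_of P \<and> (x - (x \<bullet> b) *\<^sub>R (b + graph_vec D b P)) \<bullet> b = 0"
    and "\<And>P. P \<in> S \<Longrightarrow> b + graph_vec D b P \<in> sub_of P \<and> graph_vec D b P \<in> W"
    and "\<And>P x. P \<in> S \<Longrightarrow> x \<in> sub_of P \<Longrightarrow> D *v x = 0 \<Longrightarrow> x \<bullet> b = 0 \<Longrightarrow> x \<bullet> graph_vec D b P = 0"
proof -
  have l: "linear T" and sW: "subspace W" and TW: "\<And>x. x \<in> W \<Longrightarrow> T x \<in> W" and nW: "\<And>x. x \<in> W \<Longrightarrow> norm (T x) = norm x"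
    using T by (auto simp: isoW_def)
  have b0: "b \<noteq> 0" using b(1) by auto
  define V where "V = {x. D *v x = 0}"
  \<comment> \<open>The map induced by \<open>T\<close> modulo the range of \<open>D\<close>,
    realised on the orthogonal complement \<open>V\<close>. It fixes \<open>b\<close> and is
    isometric on all of \<open>V\<close>, although \<open>T\<close> itself need not preserve
    \<open>V\<close>.\<close>
  define T' where "T' x = T x - D *v T x" for x
  have lT': "linear T'"
    unfolding T'_def using linear_compose[OF l matrix_vector_mul_linear[of D]] by (intro linear_compose_sub l) (simp add: o_def)
  have sV: "subspace V" unfolding V_def by (auto simp: subspace_def matrix_vector_right_distrib matrix_vector_mult_scaleR)
  have T'b: "T' b = b"
  proof -
    have "D *v (T b - b) = T b - b" using b(3) sub_of_iff[OF D(1)] by blast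
    then show ?thesis by (simp add: T'_def matrix_vector_mult_diff_distrib b(2))
  qed
  have T'W: "T' w = T w" if "w \<in> W" for w using TW[OF that] by (simp add: T'_def W)
  have dec: "x - (x \<bullet> b) *\<^sub>R b \<in> W" if "x \<in> V" for x
    using that b by (simp add: V_def W matrix_vector_mult_diff_distrib matrix_vector_mult_scaleR inner_diff_left)
  have isoT': "isoW T' V"
    unfolding isoW_def
  proof (intro conjI ballI lT' sV)
    fix x assume x: "x \<in> V"
    show "T' x \<in> V" by (simp add: T'_def V_def matrix_vector_mult_diff_distrib isP_idem[OF D(1)])
    define w where "w = x - (x \<bullet> b) *\<^sub>R b"
    have w: "w \<in> W" "T w \<in> W" using dec[OF x] TW w_def by auto
    have xx: "x = (x \<bullet> b) *\<^sub>R b + w" by (simp add: w_def)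
    have "T' x = (x \<bullet> b) *\<^sub>R b + T w"
      by (subst xx) (simp add: linear_add[OF lT'] linear_scale[OF lT'] T'b T'W[OF w(1)])
    moreover have nn: "norm (t *\<^sub>R b + y) ^ 2 = t\<^sup>2 + norm y ^ 2" if "y \<in> W" for t y
    proof -
      have "b \<bullet> y = 0" using that by (simp add: W inner_commute)
      then show ?thesis
        unfolding power2_norm_eq_inner using b(1) by (simp add: inner_add_left inner_add_right inner_commute power2_eq_square)
    qed
    ultimately have "norm (T' x) ^ 2 = norm x ^ 2"
      using nn[OF w(1), of "x \<bullet> b"] nn[OF w(2), of "x \<bullet> b"] nW[OF w(1)] xx by simp
    then show "norm (T' x) = norm x" by simp
  qed
  define pj where "pj = (\<lambda>v :: real^'p. Pj (\<lambda>_. 0) v)"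
  have pj: "isP (pj v)" "sub_of (pj v) = span {v}" "pj v *v x = ((v \<bullet> x) / (v \<bullet> v)) *\<^sub>R v" if "v \<noteq> 0" for v x
    using Pj_line[OF that] unfolding pj_def by blast+
  have pjs: "pj (t *\<^sub>R v) = pj v" if "t \<noteq> 0" "v \<noteq> 0" for t v
    unfolding pj_def using Pj_scale_rot[OF cstr_0[OF subspace_UNIV], of v "t *\<^sub>R v" t 0] that by simp
  have cpj: "continuous_on X (\<lambda>x. pj (f x))" if "continuous_on X f" "\<And>x. x \<in> X \<Longrightarrow> f x \<noteq> 0" for X and f :: "'a::topological_space \<Rightarrow> real^'p"
    unfolding pj_def using that by (intro continuous_on_compose2[OF continuous_on_Pj[OF cstr_0[OF subspace_UNIV]]]) auto
  have main: "let M = P - D; y = M *v b; \<zeta> = graph_vec D b P in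
      y \<bullet> b > 0 \<and> y = (y \<bullet> b) *\<^sub>R (b + \<zeta>) \<and> \<zeta> \<in> W \<and> T \<zeta> = \<zeta> \<and> isP M \<and> sub_of M = {x \<in> sub_of P. D *v x = 0}
      \<and> y \<in> sub_of P \<and> isP (M - pj y) \<and> sub_of (M - pj y) = {x \<in> sub_of P. D *v x = 0 \<and> x \<bullet> b = 0}
      \<and> (\<forall>x\<in>sub_of M. x \<bullet> y = x \<bullet> b) \<and> dim (sub_of (M - pj y)) = k"
    if PS: "P \<in> S" for P
  proof -
    have P: "isP P" "dim (sub_of P) = k + 1 + d" "sub_of D \<subseteq> sub_of P" "\<exists>x\<in>sub_of P. x \<bullet> b \<noteq> 0" "\<And>x. x \<in> sub_of P \<Longrightarrow> T x \<in> sub_of P"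
      using PS by (auto simp: S_def grass_iff)
    define M where "M = P - D"
    have M: "isP M" "sub_of M = {x \<in> sub_of P. D *v x = 0}" unfolding M_def by (rule isP_diff[OF P(1) D(1) P(3)])+
    define y where "y = M *v b"
    define \<zeta> where "\<zeta> = graph_vec D b P"
    have MV: "sub_of M \<subseteq> V" using M(2) by (auto simp: V_def)
    have T'M: "T' x \<in> sub_of M" if "x \<in> sub_of M" for x
    proof -
      have "T x \<in> sub_of P" "D *v T x \<in> sub_of P" using that M(2) P(3,5) sub_of_mult by blast+
      then have "T' x \<in> sub_of P" unfolding T'_def using subspace_sub_of by (intro subspace_diff)
      then show ?thesis unfolding M(2) by (simp add: T'_def matrix_vector_mult_diff_distrib isP_idem[OF D(1)])
    qed
    have bV: "b \<in> V" using b(2) by (simp add: V_def)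
    \<comment> \<open>The projection onto an invariant subspace commutes with the isometry
      \<open>T'\<close>, so the projection of the fixed vector \<open>b\<close> is fixed.\<close>
    have Ty: "T' y = y" unfolding y_def using isoW_commute[OF isoT' M(1) MV T'M bV] T'b by simp
    have xy: "x \<bullet> y = x \<bullet> b" if "x \<in> sub_of M" for x
      unfolding y_def using isP_sym[OF M(1), of x b] that sub_of_iff[OF M(1)] by metis
    have yM: "y \<in> sub_of M" unfolding y_def by simp
    have "y \<noteq> 0"
    proof
      assume "y = 0"
      obtain x where x: "x \<in> sub_of P" "x \<bullet> b \<noteq> 0" using P(4) by blast
      have "D *v x \<in> sub_of P" using P(3) sub_of_mult[of D x] by blast
      then have "x - D *v x \<in> sub_of P" by (rule subspace_diff[OF subspace_sub_of x(1)])
      then have "x - D *v x \<in> sub_of M"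
        unfolding M(2) by (simp add: matrix_vector_mult_diff_distrib isP_idem[OF D(1)])
      then have "(x - D *v x) \<bullet> b = 0" using xy[of "x - D *v x"] \<open>y = 0\<close> by simp
      moreover have "(D *v x) \<bullet> b = 0" using isP_sym[OF D(1), of x b] b(2) by simp
      ultimately show False using x(2) by (simp add: inner_diff_left)
    qed
    moreover have "y \<bullet> y = y \<bullet> b" using xy[OF yM] .
    ultimately have yb: "y \<bullet> b > 0" by (metis inner_gt_zero_iff)
    have z: "\<zeta> = (1 / (y \<bullet> b)) *\<^sub>R y - b" unfolding \<zeta>_def graph_vec_def y_def M_def ..
    then have yz: "y = (y \<bullet> b) *\<^sub>R (b + \<zeta>)" using yb by simp
    have yV: "y \<in> V" using yM MV by blast
    have zW: "\<zeta> \<in> W"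
    proof -
      have "\<zeta> = (1 / (y \<bullet> b)) *\<^sub>R (y - (y \<bullet> b) *\<^sub>R b)" using yb by (simp add: z scaleR_diff_right)
      then show ?thesis using dec[OF yV] subspace_scale[OF sW] by simp
    qed
    have "T' \<zeta> = \<zeta>" unfolding z by (simp add: linear_diff[OF lT'] linear_scale[OF lT'] T'b Ty)
    then have Tz: "T \<zeta> = \<zeta>" using T'W[OF zW] by simp
    have spy: "sub_of (pj y) \<subseteq> sub_of M" unfolding pj(2)[OF \<open>y \<noteq> 0\<close>] using yM by (intro span_minimal) (auto simp: subspace_sub_of)
    note N = isP_diff[OF M(1) pj(1)[OF \<open>y \<noteq> 0\<close>] spy]
    have "pj y *v x = 0 \<longleftrightarrow> x \<bullet> y = 0" for x using \<open>y \<noteq> 0\<close> by (simp add: pj inner_commute)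
    then have sN: "sub_of (M - pj y) = {x \<in> sub_of M. x \<bullet> b = 0}" unfolding N(2) using xy by auto
    have o1: "x \<bullet> z = 0" if "x \<in> sub_of (M - pj y)" "z \<in> sub_of (pj y)" for x z
      using that xy sN unfolding pj(2)[OF \<open>y \<noteq> 0\<close>] by (auto simp: span_singleton)
    have "sub_of (M - pj y + pj y) = {x + z |x z. x \<in> sub_of (M - pj y) \<and> z \<in> sub_of (pj y)}"
      by (rule isP_add(2)[OF N(1) pj(1)[OF \<open>y \<noteq> 0\<close>]]) (use o1 in blast)
    then have d1: "dim (sub_of M) = dim (sub_of (M - pj y)) + 1"
      using dim_sum_orthogonal[of "sub_of (M - pj y)" "sub_of (pj y)", OF subspace_sub_of subspace_sub_of o1] \<open>y \<noteq> 0\<close>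
      by (simp add: pj(2) dim_insert)
    have o2: "x \<bullet> z = 0" if "x \<in> sub_of M" "z \<in> sub_of D" for x z
      using isP_orth[OF D(1) that(2)] that(1) M(2) by blast
    have "sub_of (M + D) = {x + z |x z. x \<in> sub_of M \<and> z \<in> sub_of D}"
      by (rule isP_add(2)[OF M(1) D(1)]) (use o2 in blast)
    moreover have "M + D = P" by (simp add: M_def)
    ultimately have "dim (sub_of P) = dim (sub_of M) + d"
      using dim_sum_orthogonal[of "sub_of M" "sub_of D", OF subspace_sub_of subspace_sub_of o2] D(3) by simp
    then have dk: "dim (sub_of (M - pj y)) = k" using d1 P(2) by simp
    have yP: "y \<in> sub_of P" using yM M(2) by blast
    show ?thesis unfolding Let_def M_def[symmetric] y_def[symmetric] \<zeta>_def[symmetric]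
      using yb yz zW Tz M yP N(1) sN xy dk by auto
  qed
  have mainS: "((P - D) *v b) \<bullet> b > 0" "(P - D) *v b = (((P - D) *v b) \<bullet> b) *\<^sub>R (b + graph_vec D b P)" "graph_vec D b P \<in> W" "T (graph_vec D b P) = graph_vec D b P"
    "isP (P - D)" "sub_of (P - D) = {x \<in> sub_of P. D *v x = 0}" "(P - D) *v b \<in> sub_of P"
    "isP (P - D - pj ((P - D) *v b))" "sub_of (P - D - pj ((P - D) *v b)) = {x \<in> sub_of P. D *v x = 0 \<and> x \<bullet> b = 0}"
    "dim (sub_of (P - D - pj ((P - D) *v b))) = k" "\<forall>x\<in>sub_of (P - D). x \<bullet> ((P - D) *v b) = x \<bullet> b"
    if "P \<in> S" for P
    using main[OF that] unfolding Let_def by blast+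
  have bz: "b + graph_vec D b P \<in> sub_of P" if "P \<in> S" for P
  proof -
    have "(1 / (((P - D) *v b) \<bullet> b)) *\<^sub>R ((P - D) *v b) \<in> sub_of P"
      using mainS(7)[OF that] subspace_sub_of by (intro subspace_scale)
    then show ?thesis by (simp add: graph_vec_def)
  qed
  have zb: "graph_vec D b P \<bullet> b = 0" if "P \<in> S" for P using mainS(3)[OF that] by (simp add: W)
  show "b + graph_vec D b P \<in> sub_of P \<and> graph_vec D b P \<in> W" if "P \<in> S" for P using bz[OF that] mainS(3)[OF that] by blast
  show "x - (x \<bullet> b) *\<^sub>R (b + graph_vec D b P) \<in> sub_of P \<and> (x - (x \<bullet> b) *\<^sub>R (b + graph_vec D b P)) \<bullet> b = 0"
    if "P \<in> S" "x \<in> sub_of P" for P x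
    using bz[OF that(1)] zb[OF that(1)] that(2) b(1) subspace_sub_of[of P]
    by (auto simp: inner_diff_left inner_add_left intro!: subspace_diff subspace_scale)
  have xz: "x \<bullet> graph_vec D b P = 0" if PS: "P \<in> S" and x: "x \<in> sub_of P" "D *v x = 0" "x \<bullet> b = 0" for P x
  proof -
    have "x \<bullet> ((P - D) *v b) = 0" using mainS(11)[OF PS] mainS(6)[OF PS] x by simp
    then have "(((P - D) *v b) \<bullet> b) * (x \<bullet> (b + graph_vec D b P)) = 0"
      using mainS(2)[OF PS] by (metis inner_scaleR_right)
    then show ?thesis using mainS(1)[OF PS] x(3) by (simp add: inner_add_right)
  qed
  then show "x \<bullet> graph_vec D b P = 0" if "P \<in> S" "x \<in> sub_of P" "D *v x = 0" "x \<bullet> b = 0" for P x using that by blast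
  have Gi: "(P, z) \<in> Gfix T W k \<longleftrightarrow> isP P \<and> dim (sub_of P) = k \<and> sub_of P \<subseteq> W \<and> (\<forall>x\<in>sub_of P. T x \<in> sub_of P) \<and> z \<in> W \<and> T z = z \<and> P *v z = 0" for P z
    by (auto simp: Gfix_def GG_def Er_def grass_iff)
  let ?h = "\<lambda>P. (P - D - pj ((P - D) *v b), graph_vec D b P)"
  let ?k = "\<lambda>z. fst z + pj (b + snd z) + D"
  have hG: "?h P \<in> Gfix T W k" "?k (?h P) = P" if PS: "P \<in> S" for P
  proof -
    let ?N = "P - D - pj ((P - D) *v b)"
    note m = mainS[OF PS]
    have "?N *v graph_vec D b P = 0"
    proof (rule isP_kerI[OF m(8)])
      fix x assume "x \<in> sub_of ?N"
      then show "graph_vec D b P \<bullet> x = 0" using xz[OF PS, of x] m(9) by (simp add: inner_commute)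
    qed
    moreover have "T x \<in> sub_of ?N" if "x \<in> sub_of ?N" for x
    proof -
      have "x \<in> W" "x \<in> sub_of P" using that m(9) by (auto simp: W)
      then have "T x \<in> W" "T x \<in> sub_of P" using TW PS by (auto simp: S_def)
      then show ?thesis unfolding m(9) by (simp add: W)
    qed
    moreover have "sub_of ?N \<subseteq> W" unfolding m(9) W by blast
    ultimately show "?h P \<in> Gfix T W k" unfolding Gi using m(3,4,8,10) by blast
    have "b + graph_vec D b P \<noteq> 0" using m(1,2) by (metis inner_zero_left less_irrefl scaleR_zero_right)
    then have "pj ((P - D) *v b) = pj (b + graph_vec D b P)"
      using pjs[of "((P - D) *v b) \<bullet> b" "b + graph_vec D b P"] m(1,2) by simp
    then show "?k (?h P) = P" by simp
  qed
  have kG: "?k z \<in> S" "?h (?k z) = z" if z: "z \<in> Gfix T W k" for z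
  proof -
    obtain P q where Pq: "z = (P, q)" by (cases z)
    have P: "isP P" "dim (sub_of P) = k" "sub_of P \<subseteq> W" "\<And>x. x \<in> sub_of P \<Longrightarrow> T x \<in> sub_of P" "q \<in> W" "T q = q" "P *v q = 0"
      using z unfolding Pq Gi by blast+
    let ?v = "b + q"
    have qb: "q \<bullet> b = 0" "D *v q = 0" using P(5) by (auto simp: W)
    have vb: "?v \<bullet> b = 1" using qb b(1) by (simp add: inner_add_left)
    then have v0: "?v \<noteq> 0" by auto
    have Pb: "P *v b = 0" by (rule isP_kerI[OF P(1)]) (use P(3) in \<open>auto simp: W inner_commute\<close>)
    have o1: "x \<bullet> y = 0" if "x \<in> sub_of P" "y \<in> sub_of (pj ?v)" for x y
    proof -
      have "x \<bullet> ?v = 0" using isP_orth[OF P(1) that(1), of ?v] Pb P(7) by (simp add: matrix_vector_right_distrib inner_commute)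
      then show ?thesis using that(2) unfolding pj(2)[OF v0] by (auto simp: span_singleton)
    qed
    have A: "isP (P + pj ?v)" "sub_of (P + pj ?v) = {x + y |x y. x \<in> sub_of P \<and> y \<in> sub_of (pj ?v)}"
      by (rule isP_add[OF P(1) pj(1)[OF v0]]; use o1 in blast)+
    have Dv: "D *v ?v = 0" using b(2) qb(2) by (simp add: matrix_vector_right_distrib)
    have o2: "x \<bullet> y = 0" if x: "x \<in> sub_of (P + pj ?v)" and y: "y \<in> sub_of D" for x y
    proof -
      obtain r s where rs: "x = r + s" "r \<in> sub_of P" "s \<in> sub_of (pj ?v)" using x A(2) by blast
      have "D *v r = 0" using rs(2) P(3) by (auto simp: W)
      moreover have "D *v s = 0" using rs(3) Dv unfolding pj(2)[OF v0] by (auto simp: span_singleton matrix_vector_mult_scaleR)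
      ultimately have "D *v x = 0" unfolding rs(1) by (simp add: matrix_vector_right_distrib)
      then show ?thesis using isP_orth[OF D(1) y] by blast
    qed
    let ?Q = "P + pj ?v + D"
    have B: "isP ?Q" "sub_of ?Q = {x + y |x y. x \<in> sub_of (P + pj ?v) \<and> y \<in> sub_of D}"
      by (rule isP_add[OF A(1) D(1)]; use o2 in blast)+
    have "dim (sub_of (P + pj ?v)) = k + 1"
      using dim_sum_orthogonal[of "sub_of P" "sub_of (pj ?v)", OF subspace_sub_of subspace_sub_of o1] A(2) P(2) v0
      by (simp add: pj(2) dim_insert)
    then have dQ: "dim (sub_of ?Q) = k + 1 + d"
      using dim_sum_orthogonal[of "sub_of (P + pj ?v)" "sub_of D", OF subspace_sub_of subspace_sub_of o2] B(2) D(3) by simp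
    have mem: "x + y + t \<in> sub_of ?Q" if "x \<in> sub_of P" "y \<in> sub_of (pj ?v)" "t \<in> sub_of D" for x y t
      unfolding B(2) A(2) using that by blast
    have zero: "0 \<in> sub_of P" "0 \<in> sub_of (pj ?v)" "0 \<in> sub_of D" using subspace_0[OF subspace_sub_of] by auto
    have DQ: "sub_of D \<subseteq> sub_of ?Q" using mem[OF zero(1,2)] by auto
    have vp: "?v \<in> sub_of (pj ?v)" unfolding pj(2)[OF v0] by (simp add: span_base)
    have vQ: "?v \<in> sub_of ?Q" using mem[OF zero(1) vp zero(3)] by simp
    have TQ: "T x \<in> sub_of ?Q" if x: "x \<in> sub_of ?Q" for x
    proof -
      obtain r s t where r: "x = r + s + t" "r \<in> sub_of P" "s \<in> sub_of (pj ?v)" "t \<in> sub_of D" using x unfolding B(2) A(2) by blast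
      obtain m where m: "s = m *\<^sub>R ?v" using r(3) unfolding pj(2)[OF v0] by (auto simp: span_singleton)
      \<comment> \<open>The line of \<open>b + q\<close> is invariant only modulo the range of
        \<open>D\<close>; the error is a multiple of \<open>T b - b\<close>.\<close>
      have "T s = s + m *\<^sub>R (T b - b)" unfolding m by (simp add: linear_scale[OF l] linear_add[OF l] P(6) algebra_simps)
      then have "T x = T r + s + (m *\<^sub>R (T b - b) + T t)" unfolding r(1) by (simp add: linear_add[OF l])
      moreover have "m *\<^sub>R (T b - b) + T t \<in> sub_of D" using b(3) D(2)[OF r(4)] subspace_sub_of by (intro subspace_add subspace_scale)
      ultimately show ?thesis using mem[OF P(4)[OF r(2)] r(3)] by simp
    qed
    show kS: "?k z \<in> S" unfolding S_def Pq using B(1) dQ DQ vQ vb TQ by (auto simp: grass_iff intro!: bexI[of _ ?v])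
    have Mb: "(?Q - D) *v b = (1 / (?v \<bullet> ?v)) *\<^sub>R ?v"
      using Pb vb by (simp add: matrix_vector_mult_add_rdistrib pj(3)[OF v0])
    have vv: "1 / (?v \<bullet> ?v) \<noteq> 0" using v0 by simp
    have "((?Q - D) *v b) \<bullet> b = 1 / (?v \<bullet> ?v)" unfolding Mb using vb by simp
    then have "graph_vec D b ?Q = q" unfolding graph_vec_def Mb using v0 by simp
    moreover have "pj ((?Q - D) *v b) = pj ?v" unfolding Mb using pjs[OF vv v0] .
    ultimately show "?h (?k z) = z" unfolding Pq by simp
  qed
  have cM: "continuous_on X (\<lambda>P. (P - D) *v b)" for X by (intro continuous_intros)
  show "{P \<in> S. graph_vec D b P \<in> \<Omega>} homeomorphic {(P, z). (P, z) \<in> Gfix T W k \<and> z \<in> \<Omega>}"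
  proof (rule homeomorphicI[of _ ?h _ ?k])
    show "continuous_on {P \<in> S. graph_vec D b P \<in> \<Omega>} ?h"
      unfolding graph_vec_def by (intro continuous_intros cM cpj) (use mainS(1) in force)+
    have "b + z \<noteq> 0" if "z \<in> W" for z
    proof
      assume "b + z = 0"
      then have "(b + z) \<bullet> b = 0" by simp
      then show False using that b(1) by (simp add: W inner_add_left)
    qed
    then show "continuous_on {(P, z). (P, z) \<in> Gfix T W k \<and> z \<in> \<Omega>} ?k"
      by (intro continuous_intros cpj) (auto simp: Gi)
    show "?h P \<in> {(P, z). (P, z) \<in> Gfix T W k \<and> z \<in> \<Omega>}" "?k (?h P) = P" if "P \<in> {P \<in> S. graph_vec D b P \<in> \<Omega>}" for P
      using that hG by auto
    show "?k z \<in> {P \<in> S. graph_vec D b P \<in> \<Omega>}" "?h (?k z) = z" if "z \<in> {(P, z). (P, z) \<in> Gfix T W k \<and> z \<in> \<Omega>}" for z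
      using that kG[of z] by (cases z, auto)+
  qed
qed

section \<open>Hyperbolic isometries\<close>

text \<open>Radial rescaling by \<open>1 / sqrt (1 - z \<bullet> z)\<close> opens the unit ball onto
  the whole space, and the conditions on \<open>z\<close> over a given \<open>P\<close> are stable
  under scaling.\<close>

lemma Gfix_ball:
  fixes T :: "real^'a \<Rightarrow> real^'a"
  assumes T: "linear T" "subspace W"
  shows "{(P, z). (P, z) \<in> Gfix T W k \<and> norm z < 1} homeomorphic Gfix T W k"
proof -
  let ?B = "{(P, z). (P, z) \<in> Gfix T W k \<and> norm z < 1}" and ?a = "\<lambda>z. 1 / sqrt (1 - z \<bullet> z)" and ?b = "\<lambda>z. 1 / sqrt (1 + z \<bullet> z)"
  have n1: "z \<bullet> z < 1" if "norm z < 1" for z :: "real^'a"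
    using that by (simp add: norm_eq_sqrt_inner)
  have pos: "1 + z \<bullet> z > 0" for z :: "real^'a" by (simp add: add_pos_nonneg)
  have sc: "(P, r *\<^sub>R z) \<in> Gfix T W k" if "(P, z) \<in> Gfix T W k" for P z r
    using that subspace_Er[OF T, of 1] by (auto simp: Gfix_def GG_def subspace_scale matrix_vector_mult_scaleR)
  show ?thesis
  proof (rule homeomorphicI[of _ "\<lambda>(P, z). (P, ?a z *\<^sub>R z)" _ "\<lambda>(P, z). (P, ?b z *\<^sub>R z)"])
    show "(\<lambda>(P, z). (P, ?a z *\<^sub>R z)) x \<in> Gfix T W k" if "x \<in> ?B" for x using that sc by auto
    have bb: "(?b z *\<^sub>R z) \<bullet> (?b z *\<^sub>R z) = z \<bullet> z / (1 + z \<bullet> z)" for z :: "real^'a"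
      using pos[of z] by (simp add: divide_simps)
    then have "norm (?b z *\<^sub>R z) < 1" for z :: "real^'a"
      using pos[of z] by (simp add: norm_eq_sqrt_inner)
    then show "(\<lambda>(P, z). (P, ?b z *\<^sub>R z)) x \<in> ?B" if "x \<in> Gfix T W k" for x using that sc by (cases x) auto
    have "?a (?b z *\<^sub>R z) = sqrt (1 + z \<bullet> z)" for z :: "real^'a"
    proof -
      have "1 - z \<bullet> z / (1 + z \<bullet> z) = 1 / (1 + z \<bullet> z)" using pos[of z] by (simp add: field_simps)
      then show ?thesis unfolding bb by (simp add: real_sqrt_divide)
    qed
    then show "(\<lambda>(P, z). (P, ?a z *\<^sub>R z)) ((\<lambda>(P, z). (P, ?b z *\<^sub>R z)) x) = x" for x :: "(real^'a^'a) \<times> (real^'a)"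
      using pos[of "snd x"] by (cases x) simp
    have b: "?b (?a z *\<^sub>R z) = sqrt (1 - z \<bullet> z)" if "norm z < 1" for z :: "real^'a"
    proof -
      have "1 + (?a z *\<^sub>R z) \<bullet> (?a z *\<^sub>R z) = 1 / (1 - z \<bullet> z)" using n1[OF that] by (simp add: field_simps)
      then show ?thesis by (simp add: real_sqrt_divide)
    qed
    show "(\<lambda>(P, z). (P, ?b z *\<^sub>R z)) ((\<lambda>(P, z). (P, ?a z *\<^sub>R z)) x) = x" if "x \<in> ?B" for x
    proof -
      obtain P z where x: "x = (P, z)" by (cases x)
      then have z: "norm z < 1" using that by simp
      have e: "?b (?a z *\<^sub>R z) = sqrt (1 - z \<bullet> z)" using b[OF z] .
      have "?b (?a z *\<^sub>R z) *\<^sub>R (?a z *\<^sub>R z) = z" unfolding e using n1[OF z] by simp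
      then show ?thesis unfolding x by simp
    qed
    have "sqrt (1 - z \<bullet> z) \<noteq> 0" if "norm z < 1" for z :: "real^'a" using n1[OF that] by simp
    then show "continuous_on ?B (\<lambda>(P, z). (P, ?a z *\<^sub>R z))"
      unfolding case_prod_beta by (intro continuous_intros) auto
    have "sqrt (1 + z \<bullet> z) \<noteq> 0" for z :: "real^'a" using pos[of z] by simp
    then show "continuous_on (Gfix T W k) (\<lambda>(P, z). (P, ?b z *\<^sub>R z))"
      unfolding case_prod_beta by (intro continuous_intros) auto
  qed
qed

text \<open>Each row is \<open>P *v axis i 1\<close>, whose squared norm is its inner product with
  the unit vector \<open>axis i 1\<close>, so its norm is at most 1. Compactness is the input to the
  closed graph argument that follows.\<close>

lemma compact_isP: "compact {P :: real^'m^'m. isP P}"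
proof -
  have "norm P \<le> real CARD('m)" if P: "isP P" for P :: "real^'m^'m"
  proof -
    have "norm (P $ i) \<le> 1" for i
    proof -
      have r: "P $ i = P *v axis i 1"
        using P by (metis isP_def column_def matrix_vector_mul_component matrix_vector_mult_basis row_def row_transpose vec_lambda_eta)
      have "(P *v axis i 1) \<bullet> (P *v axis i 1) = (P *v axis i 1) \<bullet> axis i 1"
        using isP_sym[OF P, of "P *v axis i 1" "axis i 1"] isP_idem[OF P, of "axis i 1"] by simp
      also have "\<dots> \<le> norm (P *v axis i 1) * norm (axis i (1::real) :: real^'m)" by (rule norm_cauchy_schwarz)
      finally have "norm (P *v axis i 1) * norm (P *v axis i 1) \<le> norm (P *v axis i 1) * 1"
        by (simp add: norm_axis_1 dot_square_norm power2_eq_square)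
      then show ?thesis unfolding r by (cases "P *v axis i 1 = 0") auto
    qed
    then have "L2_set (\<lambda>i. norm (P $ i)) UNIV \<le> (\<Sum>i\<in>(UNIV::'m set). 1)"
      by (intro order_trans[OF L2_set_le_sum] sum_mono) auto
    then show ?thesis by (simp add: norm_vec_def)
  qed
  then have "bounded {P :: real^'m^'m. isP P}" unfolding bounded_iff by blast
  moreover have "closed {P :: real^'m^'m. isP P}"
    unfolding isP_def transpose_def by (intro closed_Collect_conj closed_Collect_eq continuous_intros)
  ultimately show ?thesis by (simp add: compact_eq_bounded_closed)
qed

lemma continuous_on_sub_of_image:
  fixes L :: "real^'m \<Rightarrow> real^'m"
  assumes L: "linear L" "\<And>x. L (L x) = x" and F: "\<And>P. P \<in> S \<Longrightarrow> isP P" "\<And>P. P \<in> S \<Longrightarrow> isP (F P) \<and> sub_of (F P) = L ` sub_of P"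
  shows "continuous_on S F"
proof -
  have ST: "F \<in> S \<rightarrow> {P. isP P}" using F(2) by blast
  let ?M = "matrix L" and ?N = "transpose (matrix L)"
  have M: "?M *v x = L x" for x by (rule matrix_apply[OF L(1)])
  have N: "(?N *v x) \<bullet> y = x \<bullet> L y" for x y unfolding inner_transpose M ..
  let ?C = "{z :: (real^'m^'m) \<times> (real^'m^'m). snd z ** (?M ** fst z) = ?M ** fst z \<and> snd z ** (?N ** (mat 1 - fst z)) = 0}"
  have "(\<lambda>P. (P, F P)) ` S = S \<times> {P. isP P} \<inter> ?C"
  proof (intro set_eqI iffI)
    fix z assume "z \<in> (\<lambda>P. (P, F P)) ` S"
    then obtain P where z: "z = (P, F P)" "P \<in> S" by blast
    note P = F(1)[OF z(2)] and Q = F(2)[OF z(2)]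
    have "F P *v L (P *v x) = L (P *v x)" for x
    proof -
      have "L (P *v x) \<in> sub_of (F P)" using Q sub_of_mult[of P x] by blast
      then show ?thesis using Q sub_of_iff by blast
    qed
    moreover have "F P *v (?N *v (x - P *v x)) = 0" for x
    proof (rule isP_kerI)
      fix y assume "y \<in> sub_of (F P)"
      then obtain w where w: "y = L w" "w \<in> sub_of P" using Q by blast
      have "P *v (x - P *v x) = 0" using isP_idem[OF P] by (simp add: matrix_vector_mult_diff_distrib)
      then show "(?N *v (x - P *v x)) \<bullet> y = 0" unfolding N w(1) L(2) using isP_orth[OF P w(2)] by blast
    qed (use Q in blast)
    ultimately have "z \<in> ?C"
      unfolding z(1) by (auto simp: matrix_eq matrix_vector_mul_assoc[symmetric] M matrix_vector_mult_diff_rdistrib)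
    then show "z \<in> S \<times> {P. isP P} \<inter> ?C" using z Q by blast
  next
    fix z assume z: "z \<in> S \<times> {P. isP P} \<inter> ?C"
    obtain P Q where PQ: "z = (P, Q)" by (cases z)
    have P: "P \<in> S" "isP P" "isP Q" using z F(1) unfolding PQ by auto
    have c: "Q ** (?M ** P) = ?M ** P" "Q ** (?N ** (mat 1 - P)) = 0" using z unfolding PQ by auto
    have c1: "Q *v L (P *v x) = L (P *v x)" for x
      using arg_cong[OF c(1), of "\<lambda>A. A *v x"] by (simp add: matrix_vector_mul_assoc[symmetric] M)
    have c2: "Q *v (?N *v (x - P *v x)) = 0" for x
      using arg_cong[OF c(2), of "\<lambda>A. A *v x"] by (simp add: matrix_vector_mul_assoc[symmetric] M matrix_vector_mult_diff_rdistrib)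
    have "sub_of Q = L ` sub_of P"
    proof (intro subset_antisym subsetI)
      fix y assume y: "y \<in> sub_of Q"
      have "(x - P *v x) \<bullet> L y = 0" for x using isP_orth[OF P(3) y c2] unfolding N .
      from this[of "L y"] have "(L y - P *v L y) \<bullet> (L y - P *v L y) = - ((L y - P *v L y) \<bullet> (P *v L y))"
        by (simp add: inner_diff_right)
      also have "(L y - P *v L y) \<bullet> (P *v L y) = 0"
        by (rule isP_orth[OF P(2)]) (simp_all add: matrix_vector_mult_diff_distrib isP_idem[OF P(2)])
      finally have "P *v L y = L y" by simp
      then have "L y \<in> sub_of P" using sub_of_iff[OF P(2)] by blast
      then show "y \<in> L ` sub_of P" using L(2)[of y] by (metis image_eqI)
    next
      fix y assume "y \<in> L ` sub_of P"
      then obtain x where "y = L (P *v x)" unfolding sub_of_def by blast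
      then show "y \<in> sub_of Q" using c1 sub_of_iff[OF P(3)] by simp
    qed
    then have "Q = F P" using isP_eqI P F(2)[OF P(1)] by metis
    then show "z \<in> (\<lambda>P. (P, F P)) ` S" using P(1) PQ by blast
  qed
  moreover have "closed ?C" by (intro closed_Collect_conj closed_Collect_eq continuous_intros)
  ultimately show ?thesis
    unfolding continuous_closed_graph_eq[OF compact_isP ST] by (simp add: closedin_closed_Int)
qed

section \<open>Invariant hyperbolic subspaces of each type\<close>

lemma GammaH_iff:
  assumes "lorT i0 T"
  shows "P \<in> GammaH i0 T k \<longleftrightarrow> isP P \<and> dim (sub_of P) = k + 1 \<and> (\<exists>v\<in>sub_of P. lor i0 v v < 0) \<and> (\<forall>x\<in>sub_of P. T x \<in> sub_of P)"
  unfolding GammaH_def mem_Collect_eq grass_iff using lorT_image_eq[OF assms subspace_sub_of] by blast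

text \<open>\<open>L\<close> preserves the Lorentz form but not orthogonality, so conjugating
  \<open>P\<close> by \<open>L\<close> would not give an orthogonal projection; \<open>F P\<close>
  is the projection onto the image of the range instead.\<close>

lemma GammaH_conj:
  fixes L T :: "real^'p::finite \<Rightarrow> real^'p"
  assumes L: "lorT i0 L" "\<And>x. L (L x) = x" and T: "lorT i0 T"
  shows "lorT i0 (\<lambda>x. L (T (L x)))" "GammaH i0 T k homeomorphic GammaH i0 (\<lambda>x. L (T (L x))) k"
proof -
  let ?T = "\<lambda>x. L (T (L x))"
  have l: "linear L" using L(1) by (simp add: lorT_def)
  show T': "lorT i0 ?T"
    using L(1) T linear_compose[OF linear_compose[OF l, of T] l] by (simp add: lorT_def o_def)
  have "\<exists>Q. isP Q \<and> sub_of Q = L ` sub_of P" for P :: "real^'p^'p"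
    using ex_isP[OF linear_subspace_image[OF l subspace_sub_of]] .
  then obtain F where F: "\<And>P. isP (F P) \<and> sub_of (F P) = L ` sub_of P" by metis
  have F2: "isP (F P)" "sub_of (F P) = L ` sub_of P" for P using F by blast+
  have FF: "F (F P) = P" if "isP P" for P
    by (rule isP_eqI) (use F2 that in \<open>simp_all add: image_image L(2)\<close>)
  have dF: "dim (L ` U) = dim U" for U :: "(real^'p) set"
    by (rule dim_image_eq[OF l inj_on_subset[OF lorT_bij(1)[OF L(1)]]]) simp
  have iL: "lor i0 (L x) (L y) = lor i0 x y" for x y using L(1) by (simp add: lorT_def)
  show "GammaH i0 T k homeomorphic GammaH i0 ?T k"
  proof (rule homeomorphicI[of _ F _ F])
    show "F P \<in> GammaH i0 ?T k" if "P \<in> GammaH i0 T k" for P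
      using that by (auto simp: GammaH_iff[OF T] GammaH_iff[OF T'] F2 dF iL L(2))
    show "F P \<in> GammaH i0 T k" if "P \<in> GammaH i0 ?T k" for P
    proof -
      have P: "isP P" "dim (sub_of P) = k + 1" "\<exists>v\<in>sub_of P. lor i0 v v < 0" "\<forall>x\<in>sub_of P. L (T (L x)) \<in> sub_of P"
        using that unfolding GammaH_iff[OF T'] by blast+
      have "T (L x) \<in> L ` sub_of P" if "x \<in> sub_of P" for x
        using P(4) that L(2)[of "T (L x)"] by (metis image_eqI)
      then show ?thesis unfolding GammaH_iff[OF T] using P by (auto simp: F2 dF iL)
    qed
    show "continuous_on (GammaH i0 T k) F" 
      by (rule continuous_on_sub_of_image[OF l L(2)]) (auto simp: GammaH_iff[OF T] F2)
    show "continuous_on (GammaH i0 ?T k) F"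
      by (rule continuous_on_sub_of_image[OF l L(2)]) (auto simp: GammaH_iff[OF T'] F2)
  qed (simp_all add: FF GammaH_iff[OF T] GammaH_iff[OF T'])
qed

lemma Er_csym_conj:
  fixes L T :: "'a::euclidean_space \<Rightarrow> 'a"
  assumes L: "linear L" "\<And>x. L (L x) = x"
  shows "dim (Er (\<lambda>x. L (T (L x))) (L ` W) e) = dim (Er T W e)" "csym (\<lambda>x. L (T (L x))) (L ` W) = csym T W"
proof -
  let ?T = "\<lambda>x. L (T (L x))"
  have iL: "L x = L y \<longleftrightarrow> x = y" for x y using L(2) by metis
  have d: "dim (L ` U) = dim U" for U :: "'a set"
    by (rule dim_image_eq[OF L(1)]) (simp add: inj_on_def iL)
  have E: "Er ?T (L ` W) e = L ` Er T W e"
    by (auto simp: Er_def L(2) linear_scale[OF L(1), symmetric] iL image_iff)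
  show "dim (Er ?T (L ` W) e) = dim (Er T W e)" unfolding E by (rule d)
  have z: "L x = 0 \<longleftrightarrow> x = 0" for x using iL[of x 0] linear_0[OF L(1)] by simp
  have "L (T (T x)) - (2 * c) *\<^sub>R L (T x) + L x = L (T (T x) - (2 * c) *\<^sub>R T x + x)" for x c
    by (simp add: linear_add[OF L(1)] linear_diff[OF L(1)] linear_scale[OF L(1)])
  then have W: "Wc ?T (L ` W) c = L ` Wc T W c" for c
    by (auto simp: Wc_def L(2) z image_iff)
  have "L ` Wc T W c = {0} \<longleftrightarrow> Wc T W c = {0}" for c
    using inj_image_eq_iff[of L "Wc T W c" "{0}"] linear_0[OF L(1)] iL by (simp add: inj_def)
  then have "Wcs ?T (L ` W) = Wcs T W" by (simp add: Wcs_def W)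
  then show "csym ?T (L ` W) = csym T W" by (simp add: csym_def W d)
qed

text \<open>For two unit timelike vectors in the same half of the cone, the half turn that fixes
  their sum \<open>d\<close> and negates the complement of \<open>d\<close> exchanges them.\<close>

lemma ex_lorentz_involution:
  assumes v: "lor i0 v v < 0"
  shows "\<exists>L. lorT i0 L \<and> (\<forall>x. L (L x) = x) \<and> axis i0 1 \<in> span {L v}"
proof -
  let ?a = "axis i0 (1::real)"
  \<comment> \<open>The sign makes \<open>w\<close> future directed, so that
    \<open>lor i0 d d = - 2 * (1 + w $ i0)\<close> cannot vanish.\<close>
  define s where "s = sgn (v $ i0) / sqrt (- lor i0 v v)"
  define w where "w = s *\<^sub>R v"
  have v0: "v $ i0 \<noteq> 0" using lor_nonpos_time[of i0 v] v by force
  have "s * s * lor i0 v v = -1"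
    using v v0 by (simp add: s_def divide_simps sgn_if)
  then have ww: "lor i0 w w = -1" by (simp add: w_def mult.assoc)
  have w0: "w $ i0 > 0" using v v0 by (simp add: w_def s_def sgn_if divide_neg_pos mult_neg_neg)
  have aw: "lor i0 ?a w = - w $ i0" "lor i0 w ?a = - w $ i0" "lor i0 ?a ?a = -1"
    by (auto simp: lor_eq inner_axis inner_axis')
  define d where "d = ?a + w"
  have dd: "lor i0 d d = - 2 * (1 + w $ i0)" by (simp add: d_def aw ww)
  then have dd0: "lor i0 d d \<noteq> 0" using w0 by simp
  define L where "L x = (2 * lor i0 x d / lor i0 d d) *\<^sub>R d - x" for x
  have L: "linear L" by (rule linearI) (simp_all add: L_def algebra_simps add_divide_distrib)
  have "lor i0 (L x) (L y) = lor i0 x y" for x y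
  proof -
    let ?q = "lor i0 d d"
    have 1: "(2 * lor i0 x d / ?q) * ?q = 2 * lor i0 x d" using dd0 by simp
    have "lor i0 (L x) (L y) = (2 * lor i0 y d / ?q) * ((2 * lor i0 x d / ?q) * ?q)
        - (2 * lor i0 x d / ?q) * lor i0 y d - (2 * lor i0 y d / ?q) * lor i0 x d + lor i0 x y"
      by (simp only: L_def lor_linear lor_sym[of i0 d y]) (simp only: algebra_simps)
    also have "\<dots> = lor i0 x y" unfolding 1 by simp
    finally show ?thesis .
  qed
  then have "lorT i0 L" using L by (simp add: lorT_def)
  moreover have Ld: "lor i0 (L x) d = lor i0 x d" for x using dd0 by (simp add: L_def)
  have "L (L x) = x" for x unfolding L_def[of "L x"] Ld by (simp add: L_def)
  moreover have wd: "2 * lor i0 w d / lor i0 d d = 1" using w0 unfolding dd by (simp add: d_def aw ww field_simps)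
  have "L w = ?a" unfolding L_def wd by (simp add: d_def)
  then have "?a = s *\<^sub>R L v" by (simp add: w_def linear_scale[OF L])
  then have "?a \<in> span {L v}" by (simp add: span_base span_scale)
  ultimately show ?thesis by blast
qed

text \<open>Being orthogonal to the time axis in either sense makes the time coordinate 0, and then
  both forms give the same pairing with any vector.\<close>

lemma lperp_axis:
  fixes Y :: "(real^'p::finite) set"
  assumes Y: "axis i0 1 \<in> Y"
  shows "lperp i0 Y = {x. \<forall>y\<in>Y. y \<bullet> x = 0}" "x \<in> lperp i0 Y \<Longrightarrow> x $ i0 = 0"
proof -
  have *: "x $ i0 = 0" if "lor i0 (axis i0 1) x = 0 \<or> axis i0 1 \<bullet> x = 0" for x :: "real^'p"
    using that by (auto simp: lor_eq inner_axis')
  then show "x \<in> lperp i0 Y \<Longrightarrow> x $ i0 = 0" using Y by (auto simp: lperp_def)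
  have "lor i0 y x = y \<bullet> x" if "x $ i0 = 0" for x y :: "real^'p" using that by (simp add: lor_eq)
  then show "lperp i0 Y = {x. \<forall>y\<in>Y. y \<bullet> x = 0}"
    unfolding lperp_def using Y * by (auto; metis)
qed

lemma isoW_lperp_axis:
  assumes T: "lorT i0 T" and Y: "axis i0 1 \<in> Y" "T ` Y = Y"
  shows "isoW T (lperp i0 Y)"
  unfolding isoW_def
proof (intro conjI ballI)
  show "linear T" using T by (simp add: lorT_def)
  show "subspace (lperp i0 Y)" by (rule subspace_lperp)
  fix x assume x: "x \<in> lperp i0 Y"
  show Tx: "T x \<in> lperp i0 Y" by (rule lperp_inv[OF T Y(2) x])
  have "lor i0 (T x) (T x) = lor i0 x x" using T by (simp add: lorT_def)
  then have "T x \<bullet> T x = x \<bullet> x" using lperp_axis(2)[OF Y(1) x] lperp_axis(2)[OF Y(1) Tx] by (simp add: lor_space)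
  then show "norm (T x) = norm x" by (simp add: norm_eq_sqrt_inner)
qed

text \<open>The component of \<open>e\<close> in the complement of \<open>U\<close> is again an
  eigenvector for \<open>\<mu>\<close>; the complement is positive definite and allows only
  eigenvalues with square 1, so that component is zero.\<close>

lemma lorT_eigenvector_in_invariant:
  assumes T: "lorT i0 T" and U: "subspace U" "\<And>x. x \<in> U \<Longrightarrow> T x \<in> U" "v \<in> U" "lor i0 v v < 0"
    and e: "T e = \<mu> *\<^sub>R e" "\<mu> * \<mu> \<noteq> 1"
  shows "e \<in> U"
proof -
  have l: "linear T" using T by (simp add: lorT_def)
  obtain y where y: "y \<in> U" "e - y \<in> lperp i0 U" using lor_split[OF U(1,3,4)] by blast
  let ?w = "e - y"
  have Tw: "T ?w \<in> lperp i0 U" by (rule lperp_inv[OF T lorT_image_eq[OF T U(1,2)] y(2)])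
  have "T ?w - \<mu> *\<^sub>R ?w \<in> lperp i0 U" by (rule subspace_diff[OF subspace_lperp Tw subspace_scale[OF subspace_lperp y(2)]])
  moreover have "T ?w - \<mu> *\<^sub>R ?w = \<mu> *\<^sub>R y - T y" by (simp add: linear_diff[OF l] e(1) algebra_simps)
  moreover have "\<mu> *\<^sub>R y - T y \<in> U" using y(1) U(1,2) by (intro subspace_diff subspace_scale) auto
  ultimately have "T ?w - \<mu> *\<^sub>R ?w = 0" using lperp_Int[OF U(3,4)] by metis
  then have "T ?w = \<mu> *\<^sub>R ?w" by (metis right_minus_eq)
  moreover have "lor i0 (T ?w) (T ?w) = lor i0 ?w ?w" using T unfolding lorT_def by blast
  ultimately have "\<mu> * \<mu> * lor i0 ?w ?w = lor i0 ?w ?w" by (metis lor_linear(5,6) mult.assoc)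
  then have "lor i0 ?w ?w = 0" using e(2) by simp
  then have "?w = 0" using lperp_posdef[OF U(3,4) y(2)] by force
  then show ?thesis using y(1) by simp
qed

text \<open>The component of \<open>x\<close> in the positive definite complement of
  \<open>U\<close> is annihilated by the same power of \<open>T - 1\<close>, hence fixed. It drops
  out of \<open>T x - x\<close>, but \<open>x\<close> itself may lie outside
  \<open>U\<close>.\<close>

lemma lorT_unipotent_in_invariant:
  assumes T: "lorT i0 T" and U: "subspace U" "\<And>x. x \<in> U \<Longrightarrow> T x \<in> U" "v \<in> U" "lor i0 v v < 0"
    and x: "((\<lambda>y. T y - y) ^^ n) x = 0" "n > 0"
  shows "T x - x \<in> U"
proof -
  have l: "linear T" using T by (simp add: lorT_def)
  let ?N = "\<lambda>y. T y - y"
  obtain y where y: "y \<in> U" "x - y \<in> lperp i0 U" using lor_split[OF U(1,3,4)] by blast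
  let ?w = "x - y"
  have TW: "T z \<in> lperp i0 U" if "z \<in> lperp i0 U" for z
    by (rule lperp_inv[OF T lorT_image_eq[OF T U(1,2)] that])
  have NU: "(?N ^^ n) y \<in> U" for n
    using y(1) U(1,2) by (induction n) (auto intro: subspace_diff)
  have NW: "(?N ^^ n) ?w \<in> lperp i0 U" for n
    using y(2) TW by (induction n) (auto intro: subspace_diff[OF subspace_lperp])
  have "(?N ^^ n) ?w = - (?N ^^ n) y"
    using x(1) by (simp add: linear_diff[OF linear_funpow[OF linear_T1[OF l]]])
  then have "(?N ^^ n) ?w \<in> U" using NU U(1) by (simp add: subspace_neg)
  then have N0: "(?N ^^ n) ?w = 0" using lperp_Int[OF U(3,4)] NW by blast
  have "T ?w = ?w"
    by (rule lor_unipotent_fixed[OF T TW subspace_lperp lperp_posdef[OF U(3,4)] y(2) N0 x(2)])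
  then have "T x - T y = x - y" by (simp add: linear_diff[OF l])
  moreover have "T x - x = (T x - T y) - (x - y) + (T y - y)" by simp
  ultimately have "T x - x = T y - y" by simp
  then show ?thesis using y(1) U(1,2) by (auto intro: subspace_diff)
qed

text \<open>\<open>Gfix_quotient\<close> with \<open>D = 0\<close> and the time axis for
  \<open>b\<close>: the subspace has a timelike vector iff the vector \<open>z\<close> attached to
  it has norm below 1, the ball of the projective model. \<open>Gfix_ball\<close> then removes the
  bound.\<close>

lemma GammaH_elliptic:
  fixes T :: "real^'p::finite \<Rightarrow> real^'p"
  assumes T: "lorT i0 T" and v: "T v = v" and a: "axis i0 1 \<in> span {v}"
  shows "comp_dims (GammaH i0 T k) = comp_dims (Gfix T (lperp i0 (span {v})) k)"
proof -
  let ?a = "axis i0 (1::real)" and ?W = "lperp i0 (span {v})"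
  have l: "linear T" using T by (simp add: lorT_def)
  have Ty: "T y = y" if "y \<in> span {v}" for y using that v by (auto simp: span_singleton linear_scale[OF l])
  have iso: "isoW T ?W" by (rule isoW_lperp_axis[OF T a]) (use Ty in force)
  obtain t where t: "?a = t *\<^sub>R v" using a by (auto simp: span_singleton)
  have aa: "?a \<bullet> ?a = 1" by (simp add: inner_axis)
  then have "t \<noteq> 0" using t by auto
  then have sp: "span {v} = span {?a}" 
  proof (intro subset_antisym span_minimal)
    have "v = (1 / t) *\<^sub>R ?a" using t \<open>t \<noteq> 0\<close> by simp
    then show "{v} \<subseteq> span {?a}" using span_scale[OF span_base, of ?a "{?a}" "1 / t"] by simp
  qed (use a in auto)
  have W: "?W = {x. (0 :: real^'p^'p) *v x = 0 \<and> x \<bullet> ?a = 0}"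
    unfolding lperp_axis(1)[OF a] unfolding sp by (auto simp: span_singleton inner_commute)
  have Wi: "x \<in> ?W \<longleftrightarrow> x $ i0 = 0" for x unfolding W by (simp add: inner_axis)
  have z: "sub_of (0 :: real^'p^'p) = {0}" by (rule isP_zero)
  let ?S = "{P \<in> grass (k + 1 + 0). sub_of 0 \<subseteq> sub_of P \<and> (\<exists>x\<in>sub_of P. x \<bullet> ?a \<noteq> 0) \<and> (\<forall>x\<in>sub_of P. T x \<in> sub_of P)}"
  have Q: "{P \<in> ?S. graph_vec 0 ?a P \<in> ball 0 1} homeomorphic {(P, z). (P, z) \<in> Gfix T ?W k \<and> z \<in> ball 0 1}"
    "\<And>P x. P \<in> ?S \<Longrightarrow> x \<in> sub_of P \<Longrightarrow> x - (x \<bullet> ?a) *\<^sub>R (?a + graph_vec 0 ?a P) \<in> sub_of P \<and> (x - (x \<bullet> ?a) *\<^sub>R (?a + graph_vec 0 ?a P)) \<bullet> ?a = 0"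
    "\<And>P. P \<in> ?S \<Longrightarrow> ?a + graph_vec 0 ?a P \<in> sub_of P \<and> graph_vec 0 ?a P \<in> ?W"
    "\<And>P x. P \<in> ?S \<Longrightarrow> x \<in> sub_of P \<Longrightarrow> 0 *v x = 0 \<Longrightarrow> x \<bullet> ?a = 0 \<Longrightarrow> x \<bullet> graph_vec 0 ?a P = 0"
    using Gfix_quotient(1)[OF iso isP_zero(1) _ _ aa _ _ W, where d = 0 and k = k and \<Omega> = "ball 0 1"]
      Gfix_quotient(2-4)[OF iso isP_zero(1) _ _ aa _ _ W, where d = 0 and k = k] z Ty[OF a]
    by (auto simp: linear_0[OF l])
  have "GammaH i0 T k = {P \<in> ?S. graph_vec 0 ?a P \<in> ball 0 1}"
  proof (intro set_eqI iffI)
    fix P assume "P \<in> GammaH i0 T k"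
    then obtain x where P: "isP P" "dim (sub_of P) = k + 1" "\<forall>x\<in>sub_of P. T x \<in> sub_of P" and x: "x \<in> sub_of P" "lor i0 x x < 0"
      unfolding GammaH_iff[OF T] by blast
    have "x $ i0 \<noteq> 0" using lor_nonpos_time[of i0 x] x(2) by force
    then have S: "P \<in> ?S" using P x(1) subspace_0[OF subspace_sub_of[of P]] by (auto simp: grass_iff z inner_axis)
    let ?z = "graph_vec 0 ?a P"
    define r where "r = x - (x \<bullet> ?a) *\<^sub>R (?a + ?z)"
    have r: "r \<in> sub_of P" "r \<bullet> ?a = 0" using Q(2)[OF S x(1)] unfolding r_def by blast+
    have rz: "r \<bullet> ?z = 0" by (rule Q(4)[OF S r(1)]) (use r(2) in auto)
    have z0: "?z $ i0 = 0" "r $ i0 = 0" using Q(3)[OF S] Wi r(2) by (auto simp: inner_axis)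
    define w where "w = ?a + ?z"
    have x_eq: "x = (x \<bullet> ?a) *\<^sub>R w + r" by (simp add: r_def w_def)
    have l1: "lor i0 w w = ?z \<bullet> ?z - 1" "lor i0 w r = 0" "lor i0 r w = 0" "lor i0 r r = r \<bullet> r"
      using z0 rz unfolding w_def by (simp_all add: lor_eq inner_axis inner_axis' inner_add_left inner_add_right inner_commute)
    \<comment> \<open>Since \<open>r\<close> is spacelike and orthogonal to \<open>w\<close>, the
      sign of the coefficient of the first square decides whether a timelike vector exists.\<close>
    have "lor i0 x x = (x \<bullet> ?a)\<^sup>2 * (?z \<bullet> ?z - 1) + r \<bullet> r"
      by (subst (1 2) x_eq) (simp add: l1 power2_eq_square)
    then have "(x \<bullet> ?a)\<^sup>2 * (?z \<bullet> ?z - 1) < 0" using x(2) inner_ge_zero[of r] by linarith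
    then have "?z \<bullet> ?z < 1" by (simp add: mult_less_0_iff)
    then show "P \<in> {P \<in> ?S. graph_vec 0 ?a P \<in> ball 0 1}" using S by (simp add: norm_eq_sqrt_inner)
  next
    fix P assume P: "P \<in> {P \<in> ?S. graph_vec 0 ?a P \<in> ball 0 1}"
    let ?z = "graph_vec 0 ?a P"
    have S: "P \<in> ?S" and n: "?z \<bullet> ?z < 1" using P by (auto simp: norm_eq_sqrt_inner)
    have z0: "?z $ i0 = 0" using Q(3)[OF S] Wi by blast
    have "lor i0 (?a + ?z) (?a + ?z) = ?z \<bullet> ?z - 1" using z0 by (simp add: lor_eq inner_axis inner_axis' inner_add_left inner_add_right)
    then have "\<exists>x\<in>sub_of P. lor i0 x x < 0" using n Q(3)[OF S] by (intro bexI[of _ "?a + ?z"]) auto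
    then show "P \<in> GammaH i0 T k" using S unfolding GammaH_iff[OF T] by (auto simp: grass_iff)
  qed
  then have "GammaH i0 T k homeomorphic {(P, z). (P, z) \<in> Gfix T ?W k \<and> norm z < 1}" using Q(1) by simp
  also have "\<dots> homeomorphic Gfix T ?W k" by (rule Gfix_ball[OF l subspace_lperp])
  finally show ?thesis by (rule comp_dims_homeomorphic)
qed

lemma lperp_axis_isP:
  assumes "axis i0 1 \<in> Y" "isP D" "sub_of D = Y"
  shows "lperp i0 Y = {x. D *v x = 0}"
  unfolding lperp_axis(1)[OF assms(1)] isP_ker_iff[OF assms(2)] assms(3) by (simp add: inner_commute)

text \<open>Every invariant subspace with a timelike vector contains both null eigenvectors, hence
  their plane. This excludes invariant points and leaves, for linear dimension \<open>k + 2\<close>,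
  a subspace of dimension \<open>k\<close> in the complement.\<close>

lemma GammaH_hyperbolic:
  fixes T :: "real^'p::finite \<Rightarrow> real^'p"
  assumes T: "lorT i0 T" and mu: "\<mu> > 0" "\<mu> \<noteq> 1" and eb: "T e = \<mu> *\<^sub>R e" "T b = (1 / \<mu>) *\<^sub>R b"
    and d: "dim (span {e, b}) = 2" and a: "axis i0 1 \<in> span {e, b}"
  shows "GammaH i0 T 0 = {}" "comp_dims (GammaH i0 T (Suc k)) = comp_dims (GG T (lperp i0 (span {e, b})) {0} k)"
proof -
  let ?Y = "span {e, b}"
  have l: "linear T" using T by (simp add: lorT_def)
  have mm: "\<mu> * \<mu> \<noteq> 1" "(1 / \<mu>) * (1 / \<mu>) \<noteq> 1" using mu by (auto simp: square_eq_1_iff field_simps)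
  have TY: "T y \<in> ?Y" if "y \<in> ?Y" for y
  proof -
    have "T y \<in> T ` ?Y" using that by blast
    also have "\<dots> = span (T ` {e, b})" by (rule linear_span_image[OF l, symmetric])
    also have "\<dots> \<subseteq> ?Y" using eb by (intro span_minimal) (auto intro: span_scale span_base)
    finally show ?thesis .
  qed
  have sub: "?Y \<subseteq> sub_of P" if PG: "P \<in> GammaH i0 T k" for P k
  proof -
    obtain v where v: "v \<in> sub_of P" "lor i0 v v < 0" using PG unfolding GammaH_iff[OF T] by blast
    have TP: "T x \<in> sub_of P" if "x \<in> sub_of P" for x using PG that unfolding GammaH_iff[OF T] by blast
    note P = TP v
    have "e \<in> sub_of P" by (rule lorT_eigenvector_in_invariant[OF T subspace_sub_of P eb(1) mm(1)])
    moreover have "b \<in> sub_of P" by (rule lorT_eigenvector_in_invariant[OF T subspace_sub_of P eb(2) mm(2)])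
    ultimately show ?thesis by (intro span_minimal) (auto simp: subspace_sub_of)
  qed
  have "2 \<le> dim (sub_of P)" if "P \<in> GammaH i0 T 0" for P
    using dim_subset[OF sub[OF that]] d by simp
  moreover have "dim (sub_of P) = 1" if "P \<in> GammaH i0 T 0" for P using that unfolding GammaH_iff[OF T] by simp
  ultimately show "GammaH i0 T 0 = {}" by force
  obtain Y where Y: "isP Y" "sub_of Y = ?Y" using ex_isP[OF subspace_span] by blast
  have "GammaH i0 T (Suc k) = {P \<in> grass (k + 2). sub_of Y \<subseteq> sub_of P \<and> (\<forall>x\<in>sub_of P. T x \<in> sub_of P)}"
  proof (intro set_eqI iffI)
    fix P assume "P \<in> GammaH i0 T (Suc k)"
    then show "P \<in> {P \<in> grass (k + 2). sub_of Y \<subseteq> sub_of P \<and> (\<forall>x\<in>sub_of P. T x \<in> sub_of P)}"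
      using sub[of P "Suc k"] unfolding GammaH_iff[OF T] by (auto simp: grass_iff Y(2))
  next
    fix P assume P: "P \<in> {P \<in> grass (k + 2). sub_of Y \<subseteq> sub_of P \<and> (\<forall>x\<in>sub_of P. T x \<in> sub_of P)}"
    have "lor i0 (axis i0 1) (axis i0 1) < 0" by (simp add: lor_eq inner_axis)
    then show "P \<in> GammaH i0 T (Suc k)"
      using P a unfolding GammaH_iff[OF T] by (auto simp: grass_iff Y(2))
  qed
  moreover have "{P \<in> grass (k + 2). sub_of Y \<subseteq> sub_of P \<and> (\<forall>x\<in>sub_of P. T x \<in> sub_of P)} homeomorphic GG T (lperp i0 ?Y) {0} k"
  proof (rule GG_quotient[OF l Y(1)])
    show "lperp i0 ?Y = {x. Y *v x = 0}" by (rule lperp_axis_isP[OF a Y])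
    show "T x \<in> lperp i0 ?Y" if "x \<in> lperp i0 ?Y" for x
      by (rule lperp_inv[OF T lorT_image_eq[OF T subspace_span TY] that])
  qed (use TY d Y(2) in auto)
  ultimately show "comp_dims (GammaH i0 T (Suc k)) = comp_dims (GG T (lperp i0 ?Y) {0} k)"
    using comp_dims_homeomorphic by metis
qed

text \<open>Expand invariance of the form for the pairs \<open>(u, e)\<close>, \<open>(b, e)\<close>
  and \<open>(b, u)\<close> in turn.\<close>

lemma parabolic_chain_products:
  assumes T: "lorT i0 T" and eub: "T e = e" "T u = u + e" "T b = b + u"
  shows "lor i0 e e = 0" "lor i0 e u = 0" "lor i0 u u = - lor i0 b e"
proof -
  have i: "lor i0 (T x) (T y) = lor i0 x y" for x y using T by (simp add: lorT_def)
  show ee: "lor i0 e e = 0" using i[of u e] eub by simp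
  show eu: "lor i0 e u = 0" using i[of b e] eub by (simp add: lor_sym)
  show "lor i0 u u = - lor i0 b e" using i[of b u] eub eu by (simp add: lor_sym)
qed

text \<open>Every invariant subspace with a timelike vector contains \<open>e\<close> and
  \<open>u\<close>, the images of the chain under \<open>T - 1\<close>, but not necessarily
  \<open>b\<close>, which may be displaced by a fixed vector of the complement. Given
  \<open>e\<close>, having a timelike vector means not being contained in the complement of
  \<open>e\<close>; this linear condition bounds no \<open>z\<close>, so \<open>\<Omega>\<close> is
  everything.\<close>

lemma GammaH_parabolic:
  fixes T :: "real^'p::finite \<Rightarrow> real^'p"
  assumes T: "lorT i0 T" and eub: "T e = e" "T u = u + e" "T b = b + u" "lor i0 b e \<noteq> 0"
    and d: "dim (span {e, u}) = 2" and a: "axis i0 1 \<in> span {e, u, b}"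
  shows "GammaH i0 T 0 = {}" "GammaH i0 T 1 = {}"
    "comp_dims (GammaH i0 T (k + 2)) = comp_dims (Gfix T (lperp i0 (span {e, u, b})) k)"
proof -
  let ?D = "span {e, u}" and ?Y = "span {e, u, b}"
  have l: "linear T" using T by (simp add: lorT_def)
  note pr = parabolic_chain_products[OF T eub(1-3)]
  have TD: "T y - y \<in> ?D" "T y \<in> ?D" if "y \<in> ?D" for y
  proof -
    have "T y - y \<in> (\<lambda>y. T y - y) ` ?D" using that by blast
    also have "\<dots> = span ((\<lambda>y. T y - y) ` {e, u})" by (rule linear_span_image[OF linear_T1[OF l], symmetric])
    also have "\<dots> \<subseteq> ?D" using eub by (intro span_minimal) (auto simp: span_zero span_base)
    finally show "T y - y \<in> ?D" .
    then have "(T y - y) + y \<in> ?D" using that by (rule span_add)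
    then show "T y \<in> ?D" by simp
  qed
  have De: "lor i0 y e = 0" if "y \<in> ?D" for y
    using that pr by (induction rule: span_induct_alt) (auto simp: lor_sym[of i0 u e])
  have sub: "?D \<subseteq> sub_of P" if PG: "P \<in> GammaH i0 T k" for P k
  proof -
    obtain v where v: "v \<in> sub_of P" "lor i0 v v < 0" using PG unfolding GammaH_iff[OF T] by blast
    have TP: "T x \<in> sub_of P" if "x \<in> sub_of P" for x using PG that unfolding GammaH_iff[OF T] by blast
    note P = TP v
    have "((\<lambda>y. T y - y) ^^ 3) b = 0" "((\<lambda>y. T y - y) ^^ 3) u = 0"
      using eub by (simp_all add: numeral_3_eq_3 linear_0[OF l])
    then have "T b - b \<in> sub_of P" "T u - u \<in> sub_of P"
      using lorT_unipotent_in_invariant[OF T subspace_sub_of P, of 3] by simp_all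
    then show ?thesis using eub by (intro span_minimal) (auto simp: subspace_sub_of)
  qed
  obtain D where D: "isP D" "sub_of D = ?D" using ex_isP[OF subspace_span] by blast
  \<comment> \<open>The part of \<open>b\<close> orthogonal to \<open>e\<close> and
    \<open>u\<close>. Normalised to \<open>c\<close>, it takes the role of the vector
    \<open>b\<close> in \<open>Gfix_quotient\<close>.\<close>
  define b' where "b' = b - D *v b"
  have Db': "D *v b' = 0" by (simp add: b'_def matrix_vector_mult_diff_distrib isP_idem[OF D(1)])
  have DbD: "D *v b \<in> ?D" using D(2) sub_of_mult[of D b] by simp
  have b'e: "lor i0 b' e = lor i0 b e" using De[OF DbD] by (simp add: b'_def)
  then have b'0: "b' \<noteq> 0" using eub(4) by auto
  define c where "c = (1 / norm b') *\<^sub>R b'"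
  have c: "c \<bullet> c = 1" "D *v c = 0" "lor i0 c e \<noteq> 0"
    using b'0 b'e eub(4) by (simp_all add: c_def dot_square_norm power2_eq_square matrix_vector_mult_scaleR Db')
  have Tc: "T c - c \<in> ?D"
  proof -
    have "T b' - b' = u - (T (D *v b) - D *v b)" by (simp add: b'_def linear_diff[OF l] eub(3))
    also have "\<dots> \<in> ?D" by (intro span_diff TD(1)[OF DbD]) (simp add: span_base)
    finally have "(1 / norm b') *\<^sub>R (T b' - b') \<in> ?D" by (rule span_scale)
    then show ?thesis by (simp add: c_def linear_scale[OF l] scaleR_diff_right)
  qed
  have bc: "b = norm b' *\<^sub>R c + D *v b" using b'0 by (simp add: c_def) (simp add: b'_def)
  have cY: "c \<in> ?Y"
  proof -
    have "D *v b \<in> ?Y" using DbD span_mono[of "{e, u}" "{e, u, b}"] by blast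
    then have "b' \<in> ?Y" unfolding b'_def by (intro span_diff) (simp_all add: span_base)
    then show ?thesis unfolding c_def by (rule span_scale)
  qed
  have W: "lperp i0 ?Y = {x. D *v x = 0 \<and> x \<bullet> c = 0}"
    unfolding lperp_axis(1)[OF a]
  proof (intro set_eqI iffI)
    fix x assume "x \<in> {x. \<forall>y\<in>?Y. y \<bullet> x = 0}"
    then show "x \<in> {x. D *v x = 0 \<and> x \<bullet> c = 0}"
      using cY span_mono[of "{e, u}" "{e, u, b}"] isP_ker_iff[OF D(1)] D(2) by (auto simp: inner_commute)
  next
    fix x assume x: "x \<in> {x. D *v x = 0 \<and> x \<bullet> c = 0}"
    then have o: "y \<bullet> x = 0" if "y \<in> ?D" for y using isP_orth[OF D(1), of y x] that D(2) by (simp add: inner_commute)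
    have eubx: "e \<bullet> x = 0" "u \<bullet> x = 0" "b \<bullet> x = 0"
      using o x o[OF DbD] by (auto simp: span_base) (subst bc, simp add: inner_add_left inner_commute[of c])
    have "y \<bullet> x = 0" if "y \<in> ?Y" for y
      using that by (induction rule: span_induct_alt) (use eubx in \<open>auto simp: inner_add_left\<close>)
    then show "x \<in> {x. \<forall>y\<in>?Y. y \<bullet> x = 0}" by blast
  qed
  have TY: "T y \<in> ?Y" if "y \<in> ?Y" for y
  proof -
    have "T y \<in> T ` ?Y" using that by blast
    also have "\<dots> = span (T ` {e, u, b})" by (rule linear_span_image[OF l, symmetric])
    also have "\<dots> \<subseteq> ?Y" using eub by (intro span_minimal) (auto intro: span_add span_base)
    finally show ?thesis .
  qed
  have iso: "isoW T (lperp i0 ?Y)" by (rule isoW_lperp_axis[OF T a lorT_image_eq[OF T subspace_span TY]])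
  have We: "lor i0 w e = 0" if "D *v w = 0" "w \<bullet> c = 0" for w
  proof -
    have "w \<in> lperp i0 ?Y" using that W by blast
    then have "lor i0 e w = 0" unfolding lperp_def by (auto simp: span_base)
    then show ?thesis by (simp add: lor_sym)
  qed
  \<comment> \<open>\<open>e\<close> is Lorentz orthogonal to \<open>?D\<close> and to the
    complement of \<open>?Y\<close>, so only the coordinate along \<open>c\<close> survives.\<close>
  have xe: "lor i0 x e = (x \<bullet> c) * lor i0 c e" for x
  proof -
    let ?w = "x - D *v x - (x \<bullet> c) *\<^sub>R c"
    have "(D *v x) \<bullet> c = 0" using isP_sym[OF D(1), of x c] c(2) by simp
    then have "?w \<bullet> c = 0" using c(1) by (simp add: inner_diff_left)
    moreover have "D *v ?w = 0" by (simp add: matrix_vector_mult_diff_distrib isP_idem[OF D(1)] matrix_vector_mult_scaleR c(2))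
    ultimately have "lor i0 ?w e = 0" by (intro We)
    moreover have "lor i0 (D *v x) e = 0" by (rule De) (use D(2) sub_of_mult[of D x] in simp)
    ultimately show ?thesis by simp
  qed
  have e0: "e \<noteq> 0" using eub(4) by auto
  have nc: "\<exists>x\<in>sub_of P. x \<bullet> c \<noteq> 0" if "v \<in> sub_of P" "lor i0 v v < 0" for P v
  proof -
    have "lor i0 v e \<noteq> 0" using lor_timelike_orth[of i0 v e] that(2) e0 pr(1) by auto
    then show ?thesis using xe[of v] that(1) by auto
  qed
  have tl: "\<exists>v\<in>sub_of P. lor i0 v v < 0" if P: "?D \<subseteq> sub_of P" "x \<in> sub_of P" "x \<bullet> c \<noteq> 0" for P x
  proof -
    have n: "lor i0 x e \<noteq> 0" using xe[of x] c(3) that(3) by simp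
    \<comment> \<open>As \<open>e\<close> is null, the form at \<open>x + s *\<^sub>R e\<close> is
      affine in \<open>s\<close>; this value brings it to -1.\<close>
    define s where "s = - (lor i0 x x + 1) / (2 * lor i0 x e)"
    have "lor i0 (x + s *\<^sub>R e) (x + s *\<^sub>R e) = lor i0 x x + 2 * s * lor i0 x e"
      using pr(1) by (simp add: lor_sym[of i0 e x])
    also have "\<dots> = -1" using n by (simp add: s_def field_simps)
    finally have "lor i0 (x + s *\<^sub>R e) (x + s *\<^sub>R e) < 0" by simp
    moreover have "e \<in> sub_of P" using P(1) by (auto simp: span_base)
    then have "x + s *\<^sub>R e \<in> sub_of P" using P(2) subspace_sub_of by (intro subspace_add subspace_scale)
    ultimately show ?thesis by blast
  qed
  have no: "k \<ge> 2" if PG: "P \<in> GammaH i0 T k" for P k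
  proof -
    have s: "?D \<subseteq> sub_of P" by (rule sub[OF PG])
    obtain v where P: "dim (sub_of P) = k + 1" "v \<in> sub_of P" "lor i0 v v < 0"
      using PG unfolding GammaH_iff[OF T] by blast
    obtain x where x: "x \<in> sub_of P" "x \<bullet> c \<noteq> 0" using nc[OF P(2,3)] by blast
    have "x \<notin> ?D"
    proof
      assume "x \<in> ?D"
      then have "lor i0 x e = 0" by (rule De)
      then show False using xe[of x] c(3) x(2) by simp
    qed
    then have "dim (insert x {e, u}) = 3" using d by (simp add: dim_insert)
    moreover have "insert x {e, u} \<subseteq> sub_of P" using x(1) s by (auto simp: span_base)
    ultimately have "3 \<le> dim (sub_of P)" using dim_subset by metis
    then show ?thesis using P(1) by simp
  qed
  show "GammaH i0 T 0 = {}" using no[of _ 0] by auto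
  show "GammaH i0 T 1 = {}" using no[of _ 1] by auto
  let ?S = "{P \<in> grass (k + 1 + 2). sub_of D \<subseteq> sub_of P \<and> (\<exists>x\<in>sub_of P. x \<bullet> c \<noteq> 0) \<and> (\<forall>x\<in>sub_of P. T x \<in> sub_of P)}"
  have "{P \<in> ?S. graph_vec D c P \<in> UNIV} homeomorphic {(P, z). (P, z) \<in> Gfix T (lperp i0 ?Y) k \<and> z \<in> UNIV}"
    by (rule Gfix_quotient(1)[OF iso D(1) _ _ c(1,2) _ W]) (use TD D(2) d Tc in auto)
  moreover have "GammaH i0 T (k + 2) = ?S"
  proof (intro set_eqI iffI)
    fix P assume P: "P \<in> GammaH i0 T (k + 2)"
    then show "P \<in> ?S"
      using sub[OF P] nc unfolding GammaH_iff[OF T] by (auto simp: grass_iff D(2))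
  next
    fix P assume "P \<in> ?S"
    then show "P \<in> GammaH i0 T (k + 2)"
      using tl[of P] unfolding GammaH_iff[OF T] by (auto simp: grass_iff D(2))
  qed
  ultimately have "GammaH i0 T (k + 2) homeomorphic Gfix T (lperp i0 ?Y) k" by simp
  then show "comp_dims (GammaH i0 T (k + 2)) = comp_dims (Gfix T (lperp i0 ?Y) k)" by (rule comp_dims_homeomorphic)
qed

section \<open>Eigenvectors and the trichotomy of isometries\<close>

lemma isomH_lorT: "isomH i0 T \<Longrightarrow> lorT i0 T"
  by (simp add: isomH_def lorT_def)

text \<open>Timelike vectors are rescaled onto the hyperboloid. A null vector is reached by
  contradiction, adding a positive multiple of the time axis, which makes it timelike.\<close>

lemma isomH_time:
  assumes T: "isomH i0 T" and x: "lor i0 x x \<le> 0" "x $ i0 > 0"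
  shows "T x $ i0 > 0"
proof -
  have lT: "lorT i0 T" by (rule isomH_lorT[OF T])
  then have l: "linear T" and i: "\<And>x y. lor i0 (T x) (T y) = lor i0 x y" by (auto simp: lorT_def)
  have pos: "T y $ i0 > 0" if y: "lor i0 y y < 0" "y $ i0 > 0" for y
  proof -
    let ?s = "1 / sqrt (- lor i0 y y)"
    have s: "?s > 0" "?s * ?s * lor i0 y y = -1" using y(1) by (simp_all add: divide_simps)
    have "lor i0 (?s *\<^sub>R y) (?s *\<^sub>R y) = -1" "(?s *\<^sub>R y) $ i0 > 0"
      using s y(2) by (simp_all only: lor_linear vector_scaleR_component mult.assoc real_scaleR_def mult_pos_pos)
    then have "T (?s *\<^sub>R y) \<in> hyperboloid i0" using T unfolding isomH_def hyperboloid_def by blast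
    then have "?s * T y $ i0 > 0" by (simp only: hyperboloid_def mem_Collect_eq linear_scale[OF l] vector_scaleR_component real_scaleR_def)
    then show ?thesis using s(1) zero_less_mult_pos by blast
  qed
  let ?a = "axis i0 (1::real)"
  have "x \<noteq> 0" using x(2) by auto
  then have "T x \<noteq> 0" using lorT_bij(1)[OF lT] linear_0[OF l] by (metis injD)
  then have n: "T x $ i0 \<noteq> 0" using lor_nonpos_time[of i0 "T x"] i[of x x] x(1) by simp
  have "0 \<le> T x $ i0"
  proof (rule ccontr)
    assume "\<not> 0 \<le> T x $ i0"
    then have neg: "T x $ i0 < 0" by simp
    have a: "lor i0 ?a ?a = -1" "lor i0 x ?a = - x $ i0" "lor i0 ?a x = - x $ i0" by (auto simp: lor_eq inner_axis inner_axis')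
    have pa: "T ?a $ i0 > 0" by (rule pos) (simp_all add: a)
    \<comment> \<open>Chosen so that the image of \<open>x + r *\<^sub>R ?a\<close> has time
      coordinate exactly 0.\<close>
    define r where "r = - (T x $ i0) / T ?a $ i0"
    have r: "r > 0" using neg pa by (simp add: r_def divide_neg_pos)
    have "lor i0 (x + r *\<^sub>R ?a) (x + r *\<^sub>R ?a) = lor i0 x x - 2 * r * x $ i0 - r * r"
      by (simp add: a algebra_simps)
    moreover have "r * r > 0" "r * x $ i0 > 0" using r x(2) by simp_all
    ultimately have "lor i0 (x + r *\<^sub>R ?a) (x + r *\<^sub>R ?a) < 0" using x(1) by linarith
    then have "T (x + r *\<^sub>R ?a) $ i0 > 0" by (rule pos) (use x(2) r in simp)
    moreover have "T (x + r *\<^sub>R ?a) $ i0 = T x $ i0 + r * T ?a $ i0" by (simp add: linear_add[OF l] linear_scale[OF l])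
    then have "T (x + r *\<^sub>R ?a) $ i0 = 0" using pa by (simp add: r_def)
    ultimately show False by simp
  qed
  then show ?thesis using n by simp
qed

text \<open>Brouwer's theorem on the projectivized future cone.\<close>

lemma isomH_eigenvector:
  fixes T :: "real^'p::finite \<Rightarrow> real^'p"
  assumes T: "isomH i0 T"
  shows "\<exists>x \<mu>. T x = \<mu> *\<^sub>R x \<and> \<mu> > 0 \<and> x \<noteq> 0 \<and> lor i0 x x \<le> 0"
proof -
  have lT: "lorT i0 T" by (rule isomH_lorT[OF T])
  then have l: "linear T" and i: "\<And>x y. lor i0 (T x) (T y) = lor i0 x y" by (auto simp: lorT_def)
  \<comment> \<open>At time coordinate 1 the Lorentz square is the squared norm minus 2, so the ball
    of radius \<open>sqrt 2\<close> cuts out the causal vectors.\<close>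
  define S where "S = {x :: real^'p. x $ i0 = 1} \<inter> cball 0 (sqrt 2)"
  have S: "x \<in> S \<longleftrightarrow> x $ i0 = 1 \<and> lor i0 x x \<le> 0" for x
    by (auto simp: S_def lor_eq norm_eq_sqrt_inner)
  have S1: "compact S" unfolding S_def
    by (intro closed_Int_compact compact_cball closed_Collect_eq continuous_intros)
  have S2: "convex S"
    unfolding S_def
  proof (intro convex_Int convex_cball)
    show "convex {x :: real^'p. x $ i0 = 1}" by (auto simp: convex_def)
  qed
  have "axis i0 1 \<in> S" by (simp add: S lor_eq inner_axis)
  then have S3: "S \<noteq> {}" by blast
  have p: "T x $ i0 > 0" if "x \<in> S" for x using isomH_time[OF T, of x] that by (simp add: S)
  let ?f = "\<lambda>x. (1 / T x $ i0) *\<^sub>R T x"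
  have "continuous_on S T" using l by (simp add: linear_continuous_on linear_conv_bounded_linear)
  then have cf: "continuous_on S ?f" by (intro continuous_intros) (use p in force)+
  have "?f x \<in> S" if "x \<in> S" for x
    using that p[OF that] by (auto simp: S i divide_nonpos_pos mult_nonneg_nonpos)
  then have "?f \<in> S \<rightarrow> S" by blast
  then obtain x where x: "x \<in> S" "?f x = x" using brouwer[OF S1 S2 S3 cf] by blast
  then have "T x $ i0 *\<^sub>R ?f x = T x $ i0 *\<^sub>R x" by simp
  then have "T x = (T x $ i0) *\<^sub>R x" using p[OF x(1)] by simp
  moreover have "x \<noteq> 0" using x(1) by (auto simp: S)
  ultimately show ?thesis using p[OF x(1)] x(1) S by blast
qed

text \<open>The range of \<open>T - 1 / \<mu>\<close> is orthogonal to \<open>e\<close>; since the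
  form is nondegenerate, this map is not surjective and therefore not injective.\<close>

lemma lorT_reciprocal_eigenvector:
  fixes T :: "real^'p::finite \<Rightarrow> real^'p"
  assumes T: "lorT i0 T" and e: "T e = \<mu> *\<^sub>R e" "e \<noteq> 0" "\<mu> \<noteq> 0"
  shows "\<exists>b. b \<noteq> 0 \<and> T b = (1 / \<mu>) *\<^sub>R b"
proof -
  have l: "linear T" and i: "\<And>x y. lor i0 (T x) (T y) = lor i0 x y" using T by (auto simp: lorT_def)
  let ?F = "\<lambda>x. T x - (1 / \<mu>) *\<^sub>R x"
  have lF: "linear ?F" by (rule linearI) (simp_all add: linear_add[OF l] linear_scale[OF l] algebra_simps)
  have o: "lor i0 (?F x) e = 0" for x
  proof -
    have "\<mu> * lor i0 (T x) e = lor i0 x e" using i[of x e] e(1) by simp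
    then show ?thesis using e(3) by (metis lor_linear(3,5) mult.commute nonzero_mult_div_cancel_left right_minus_eq times_divide_eq_left mult_1)
  qed
  have "\<not> surj ?F"
  proof
    assume "surj ?F"
    have "lor i0 e x = 0" for x
    proof -
      obtain y where "x = ?F y" using surjD[OF \<open>surj ?F\<close>] by blast
      then show ?thesis using o[of y] lor_sym[of i0 e x] by simp
    qed
    then show False using lor_nondeg e(2) by blast
  qed
  then have "\<not> inj ?F" using linear_injective_imp_surjective[OF lF] by blast
  then obtain b where "?F b = 0" "b \<noteq> 0" using linear_injective_0[OF lF] by blast
  then show ?thesis by (intro exI[of _ b]) simp
qed

text \<open>The range of \<open>(T - 1)\<^sup>2\<close> is the Lorentz complement of its kernel, and \<open>e\<close> is orthogonal to that kernel.\<close>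

lemma lorT_parabolic_chain:
  fixes T :: "real^'p::finite \<Rightarrow> real^'p"
  assumes T: "lorT i0 T" and e: "T e = e" "e \<noteq> 0" "lor i0 e e = 0"
    and F: "\<And>z. T z = z \<Longrightarrow> lor i0 z e = 0"
  shows "\<exists>u b. T u = u + e \<and> T b = b + u"
proof -
  have l: "linear T" and i: "\<And>x y. lor i0 (T x) (T y) = lor i0 x y" using T by (auto simp: lorT_def)
  let ?N = "\<lambda>y. T y - y"
  define M where "M x = T (T x) - 2 *\<^sub>R T x + x" for x
  have MN: "M x = ?N (?N x)" for x by (simp add: M_def linear_diff[OF l] scaleR_2)
  have lM: "linear M" unfolding M_def by (rule linearI) (simp_all add: linear_add[OF l] linear_scale[OF l] algebra_simps)
  \<comment> \<open>The adjoint of \<open>T\<close> is its inverse, so the adjoint of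
    \<open>M\<close> is \<open>M\<close> up to the bijection \<open>T \<circ> T\<close>, and has the
    same kernel.\<close>
  have adj: "lor i0 (M x) z = lor i0 (T (T x)) (M z)" for x z
    using i[of x z] i[of "T x" z] i[of "T x" "T z"] by (simp add: M_def)
  have ker: "lor i0 e z = 0" if z: "M z = 0" for z
  proof -
    let ?y = "?N z"
    have y: "T ?y = ?y" using z unfolding MN by simp
    have "lor i0 (T z) (T ?y) = lor i0 z ?y" by (rule i)
    then have "lor i0 ?y ?y = 0" unfolding y by simp
    moreover have "lor i0 e ?y = 0" using F[OF y] by (simp add: lor_sym)
    \<comment> \<open>\<open>?y\<close> is fixed and null, and by the hypothesis on fixed vectors
      orthogonal to \<open>e\<close>; null vectors orthogonal to a null vector are proportional to
      it.\<close>
    ultimately obtain c where c: "?y = c *\<^sub>R e" using lor_null_orth(2)[OF e(3,2)] by blast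
    show ?thesis
    proof (cases "c = 0")
      case True
      then have "T z = z" using c by simp
      then show ?thesis using F[of z] lor_sym[of i0 e z] by simp
    next
      case False
      have "T z = z + c *\<^sub>R e" using c by (simp add: algebra_simps)
      then have "2 * c * lor i0 e z = 0" using i[of z z] e(3) by (simp add: lor_sym[of i0 z e])
      then show ?thesis using False by simp
    qed
  qed
  obtain Q where Q: "isP Q" "sub_of Q = range M" using ex_isP[OF linear_subspace_image[OF lM subspace_UNIV]] by blast
  define w where "w = e - Q *v e"
  have Qw: "Q *v w = 0" by (simp add: w_def matrix_vector_mult_diff_distrib isP_idem[OF Q(1)])
  \<comment> \<open>Time reversal converts Euclidean orthogonality to the range of \<open>M\<close>
    into Lorentz orthogonality.\<close>
  define z where "z = w - (2 * w $ i0) *\<^sub>R axis i0 1"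
  have lz: "lor i0 y z = y \<bullet> w" for y by (simp add: z_def lor_eq inner_diff_right inner_axis)
  have "lor i0 (M z) (T (T x)) = 0" for x
  proof -
    have "w \<bullet> M x = 0" by (rule isP_orth[OF Q(1) _ Qw]) (simp add: Q(2))
    then show ?thesis using adj[of x z] lz[of "M x"] by (simp add: inner_commute lor_sym)
  qed
  then have "lor i0 (M z) y = 0" for y using lorT_bij(2)[OF T] by (metis surjD)
  then have "lor i0 e z = 0" by (intro ker lor_nondeg[of i0])
  then have "e \<bullet> w = 0" using lz by simp
  moreover have "(Q *v e) \<bullet> w = 0" using isP_orth[OF Q(1) sub_of_mult Qw] by (simp add: inner_commute)
  ultimately have "w \<bullet> w = 0" by (subst (1) w_def) (simp add: inner_diff_left)
  then have "e = Q *v e" by (simp add: w_def)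
  then have "e \<in> range M" using sub_of_mult[of Q e] Q(2) by simp
  then obtain b where "e = M b" by blast
  then have "T (?N b) = ?N b + e" "T b = b + ?N b" unfolding MN by simp_all
  then show ?thesis by blast
qed

text \<open>A causal eigenvector with eigenvalue other than 1 is null and has a partner for the
  reciprocal eigenvalue. For eigenvalue 1 either some timelike vector is fixed, or all fixed vectors
  are orthogonal to the null vector \<open>e\<close>, and then \<open>e\<close> ends a Jordan chain
  of length three.\<close>

lemma isomH_cases:
  fixes T :: "real^'p::finite \<Rightarrow> real^'p"
  assumes T: "isomH i0 T"
  obtains (elliptic) v where "T v = v" "lor i0 v v < 0"
  | (hyperbolic) \<mu> e b v where "\<mu> > 0" "\<mu> \<noteq> 1" "T e = \<mu> *\<^sub>R e" "T b = (1 / \<mu>) *\<^sub>R b" "e \<noteq> 0" "b \<noteq> 0" "v \<in> span {e, b}" "lor i0 v v < 0"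
  | (parabolic) e u b v where "T e = e" "T u = u + e" "T b = b + u" "e \<noteq> 0" "lor i0 b e \<noteq> 0" "v \<in> span {e, u, b}" "lor i0 v v < 0"
proof -
  have lT: "lorT i0 T" by (rule isomH_lorT[OF T])
  then have l: "linear T" and i: "\<And>x y. lor i0 (T x) (T y) = lor i0 x y" by (auto simp: lorT_def)
  obtain e \<mu> where e: "T e = \<mu> *\<^sub>R e" "\<mu> > 0" "e \<noteq> 0" "lor i0 e e \<le> 0" using isomH_eigenvector[OF T] by blast
  have m: "(\<mu> * \<mu> - 1) * lor i0 e e = 0" using i[of e e] e(1) by (simp add: algebra_simps)
  \<comment> \<open>Two vectors with nonzero product, one of them null, span a plane with a timelike
    vector; the witness brings the form to -1.\<close>
  have adj: "\<exists>s. lor i0 (x + s *\<^sub>R e) (x + s *\<^sub>R e) < 0" if "lor i0 e e = 0" "lor i0 x e \<noteq> 0" for x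
  proof
    have "lor i0 (x + (- (lor i0 x x + 1) / (2 * lor i0 x e)) *\<^sub>R e) (x + (- (lor i0 x x + 1) / (2 * lor i0 x e)) *\<^sub>R e) = -1"
      using that by (simp add: lor_sym[of i0 e x] field_simps)
    then show "lor i0 (x + (- (lor i0 x x + 1) / (2 * lor i0 x e)) *\<^sub>R e) (x + (- (lor i0 x x + 1) / (2 * lor i0 x e)) *\<^sub>R e) < 0" by simp
  qed
  show thesis
  proof (cases "\<mu> = 1")
    case True
    then have Te: "T e = e" using e(1) by simp
    show thesis
    proof (cases "\<exists>v. T v = v \<and> lor i0 v v < 0")
      case True
      then show thesis using elliptic by blast
    next
      case False
      then have ee: "lor i0 e e = 0" using Te e(4) by force
      have F: "lor i0 z e = 0" if "T z = z" for z
      proof (rule ccontr)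
        assume "lor i0 z e \<noteq> 0"
        then obtain s where "lor i0 (z + s *\<^sub>R e) (z + s *\<^sub>R e) < 0" using adj[OF ee] by blast
        moreover have "T (z + s *\<^sub>R e) = z + s *\<^sub>R e" using that Te by (simp add: linear_add[OF l] linear_scale[OF l])
        ultimately show False using False by blast
      qed
      obtain u b where ub: "T u = u + e" "T b = b + u" using lorT_parabolic_chain[OF lT Te e(3) ee F] by blast
      note pr = parabolic_chain_products[OF lT Te ub]
      have be: "lor i0 b e \<noteq> 0"
      proof
        assume "lor i0 b e = 0"
        then have "lor i0 u u = 0" using pr(3) by simp
        then obtain t where "u = t *\<^sub>R e" using lor_null_orth(2)[OF ee e(3) pr(2)] by blast
        then have "T u = u" using Te by (simp add: linear_scale[OF l])
        then show False using ub(1) e(3) by simp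
      qed
      obtain s where "lor i0 (b + s *\<^sub>R e) (b + s *\<^sub>R e) < 0" using adj[OF ee be] by blast
      moreover have "b + s *\<^sub>R e \<in> span {e, u, b}" by (intro span_add span_scale) (simp_all add: span_base)
      ultimately show thesis using parabolic[OF Te ub e(3) be] by blast
    qed
  next
    case False
    then have mm: "\<mu> * \<mu> \<noteq> 1" using e(2) by (auto simp: square_eq_1_iff)
    then have ee: "lor i0 e e = 0" using m by simp
    obtain b where b: "b \<noteq> 0" "T b = (1 / \<mu>) *\<^sub>R b" using lorT_reciprocal_eigenvector[OF lT e(1,3)] e(2) by auto
    have "lor i0 b b = \<mu> * \<mu> * lor i0 b b" using i[of b b] b(2) e(2) by (simp add: field_simps)
    then have bb: "lor i0 b b = 0" using mm by simp
    have be: "lor i0 b e \<noteq> 0"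
    proof
      assume "lor i0 b e = 0"
      then obtain t where t: "b = t *\<^sub>R e" using lor_null_orth(2)[OF ee e(3) _ bb] by (auto simp: lor_sym)
      then have "T b = \<mu> *\<^sub>R b" using e(1) by (simp add: linear_scale[OF l])
      then have "\<mu> *\<^sub>R b = (1 / \<mu>) *\<^sub>R b" using b(2) by (rule trans[OF sym])
      then have "\<mu> = 1 / \<mu>" using b(1) by (metis scaleR_cancel_right)
      then show False using mm e(2) by (simp add: field_simps)
    qed
    obtain s where "lor i0 (b + s *\<^sub>R e) (b + s *\<^sub>R e) < 0" using adj[OF ee be] by blast
    moreover have "b + s *\<^sub>R e \<in> span {e, b}" by (intro span_add span_scale) (simp_all add: span_base)
    ultimately show thesis using hyperbolic[OF e(2) False e(1) b(2) e(3) b(1)] by blast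
  qed
qed

section \<open>Assembling the hyperbolic case\<close>

lemma lperp_image:
  assumes L: "lorT i0 L" "\<And>x. L (L x) = x"
  shows "lperp i0 (L ` Y) = L ` lperp i0 Y"
proof -
  have "lor i0 (L y) x = lor i0 y (L x)" for x y using L by (metis lorT_def)
  then have "x \<in> lperp i0 (L ` Y) \<longleftrightarrow> L x \<in> lperp i0 Y" for x by (simp add: lperp_def)
  moreover have "x \<in> L ` lperp i0 Y \<longleftrightarrow> L x \<in> lperp i0 Y" for x using L(2) by (metis image_iff)
  ultimately show ?thesis by blast
qed

text \<open>After conjugation by a Lorentz involution the time axis lies in the invariant subspace, so that
  its Lorentz complement is also its Euclidean one.\<close>

lemma lorT_conj_axis:
  fixes T :: "real^'p::finite \<Rightarrow> real^'p"
  assumes T: "lorT i0 T" and v: "v \<in> span B" "lor i0 v v < 0" and TB: "T ` B \<subseteq> span B"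
  obtains L A where "linear L" "\<And>x. L (L x) = x" "A = (\<lambda>x. L (T (L x)))" "axis i0 1 \<in> span (L ` B)"
    "lorT i0 A" "isoW A (lperp i0 (span (L ` B)))" "dim (span (L ` B)) = dim (span B)" "\<And>x y. lor i0 (L x) (L y) = lor i0 x y"
    "\<And>k. comp_dims (GammaH i0 T k) = comp_dims (GammaH i0 A k)"
    "\<And>e. dim (Er A (lperp i0 (span (L ` B))) e) = dim (Er T (lperp i0 (span B)) e)"
    "csym A (lperp i0 (span (L ` B))) = csym T (lperp i0 (span B))"
proof -
  obtain L where L: "lorT i0 L" "\<And>x. L (L x) = x" "axis i0 1 \<in> span {L v}" using ex_lorentz_involution[OF v(2)] by blast
  have lL: "linear L" and l: "linear T" using L(1) T by (simp_all add: lorT_def)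
  define A where "A = (\<lambda>x. L (T (L x)))"
  have sp: "span (L ` B) = L ` span B" by (rule linear_span_image[OF lL])
  have "span {L v} \<subseteq> span (L ` B)" unfolding sp using v(1) by (intro span_minimal linear_subspace_image[OF lL]) auto
  then have a: "axis i0 1 \<in> span (L ` B)" using L(3) by blast
  note C = GammaH_conj[OF L(1,2) T, folded A_def]
  have W: "lperp i0 (span (L ` B)) = L ` lperp i0 (span B)" unfolding sp by (rule lperp_image[OF L(1,2)])
  have "T ` span B \<subseteq> span B" unfolding linear_span_image[OF l, symmetric] using TB by (intro span_minimal) auto
  then have "A y \<in> span (L ` B)" if "y \<in> span (L ` B)" for y
    using that L(2) unfolding sp A_def by auto
  then have iso: "isoW A (lperp i0 (span (L ` B)))"
    by (intro isoW_lperp_axis[OF C(1) a] lorT_image_eq[OF C(1) subspace_span])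
  have d: "dim (span (L ` B)) = dim (span B)"
    unfolding sp by (rule dim_image_eq[OF lL inj_on_subset[OF lorT_bij(1)[OF L(1)]]]) simp
  have iL: "lor i0 (L x) (L y) = lor i0 x y" for x y using L(1) by (simp add: lorT_def)
  show thesis
    by (rule that[OF lL L(2) A_def a C(1) iso d iL comp_dims_homeomorphic[OF C(2)]])
      (simp_all add: W A_def Er_csym_conj[OF lL L(2)])
qed

text \<open>The symbol is computed for \<open>T\<close> and the spaces for its conjugate; dimensions
  and \<open>csym\<close> agree. In the elliptic and parabolic types the fixed vectors belong to
  \<open>Vt\<close> and only \<open>-1\<close> remains in the last entry, matching
  \<open>core_fixed\<close>. In the hyperbolic type both eigenvalues remain there unordered,
  matching \<open>core_0\<close>.\<close>

lemma segreH_data: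
  fixes T :: "real^'p::finite \<Rightarrow> real^'p"
  assumes T: "isomH i0 T"
  obtains (Ell) A :: "real^'p \<Rightarrow> real^'p" and W where "isoW A W"
      "segreH i0 T = (Ell, 1 + dim (Er A W 1), image_mset (\<lambda>n. n div 2) (csym A W), nz (dim (Er A W (-1))))"
      "\<And>k. comp_dims (GammaH i0 T k) = comp_dims (Gfix A W k)"
  | (Hyp) A :: "real^'p \<Rightarrow> real^'p" and W where "isoW A W"
      "segreH i0 T = (Hyp, 2, image_mset (\<lambda>n. n div 2) (csym A W), nz (dim (Er A W 1)) + nz (dim (Er A W (-1))))"
      "comp_dims (GammaH i0 T 0) = {#}" "\<And>k. comp_dims (GammaH i0 T (Suc k)) = comp_dims (GG A W {0} k)"
  | (Par) A :: "real^'p \<Rightarrow> real^'p" and W where "isoW A W"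
      "segreH i0 T = (Par, 3 + dim (Er A W 1), image_mset (\<lambda>n. n div 2) (csym A W), nz (dim (Er A W (-1))))"
      "comp_dims (GammaH i0 T 0) = {#}" "comp_dims (GammaH i0 T 1) = {#}"
      "\<And>k. comp_dims (GammaH i0 T (k + 2)) = comp_dims (Gfix A W k)"
proof -
  have lT: "lorT i0 T" by (rule isomH_lorT[OF T])
  from T show thesis
  proof (cases rule: isomH_cases)
    case (elliptic v)
    have TB: "T ` {v} \<subseteq> span {v}" using elliptic(1) by (simp add: span_base)
    show thesis
    proof (rule lorT_conj_axis[OF lT span_base elliptic(2) TB])
      fix L A assume L: "linear L" "\<And>x. L (L x) = x" and A: "A = (\<lambda>x. L (T (L x)))" and a: "axis i0 1 \<in> span (L ` {v})"
        and lA: "lorT i0 A" and iso: "isoW A (lperp i0 (span (L ` {v})))"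
        and G: "\<And>k. comp_dims (GammaH i0 T k) = comp_dims (GammaH i0 A k)"
        and E: "\<And>e. dim (Er A (lperp i0 (span (L ` {v}))) e) = dim (Er T (lperp i0 (span {v})) e)"
        "csym A (lperp i0 (span (L ` {v}))) = csym T (lperp i0 (span {v}))"
      have sp: "L ` {v} = {L v}" by simp
      have "A (L v) = L v" using elliptic(1) by (simp add: A L(2))
      note GE = GammaH_elliptic[OF lA this a[unfolded sp]]
      show thesis
        by (rule Ell[OF iso], unfold sp E[unfolded sp] G GE segreH_elliptic[OF lT elliptic], (rule refl)+)
    qed simp
  next
    case (hyperbolic \<mu> e b v)
    have TB: "T ` {e, b} \<subseteq> span {e, b}" using hyperbolic(3,4) by (auto intro: span_scale span_base)
    show thesis
    proof (rule lorT_conj_axis[OF lT hyperbolic(7,8) TB])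
      fix L A assume L: "linear L" "\<And>x. L (L x) = x" and A: "A = (\<lambda>x. L (T (L x)))" and a: "axis i0 1 \<in> span (L ` {e, b})"
        and lA: "lorT i0 A" and iso: "isoW A (lperp i0 (span (L ` {e, b})))" and d: "dim (span (L ` {e, b})) = dim (span {e, b})"
        and G: "\<And>k. comp_dims (GammaH i0 T k) = comp_dims (GammaH i0 A k)"
        and E: "\<And>x. dim (Er A (lperp i0 (span (L ` {e, b}))) x) = dim (Er T (lperp i0 (span {e, b})) x)"
        "csym A (lperp i0 (span (L ` {e, b}))) = csym T (lperp i0 (span {e, b}))"
      have sp: "L ` {e, b} = {L e, L b}" by simp
      note sg = segreH_hyperbolic[OF lT hyperbolic]
      have Ae: "A (L e) = \<mu> *\<^sub>R L e" "A (L b) = (1 / \<mu>) *\<^sub>R L b"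
        using hyperbolic(3,4) by (simp_all add: A L(2) linear_scale[OF L(1)])
      note GH = GammaH_hyperbolic[OF lA hyperbolic(1,2) Ae d[unfolded sp sg(2)] a[unfolded sp]]
      show thesis
        by (rule Hyp[OF iso], unfold sp E[unfolded sp] G GH sg(1) comp_dims_empty, (rule refl)+)
    qed
  next
    case (parabolic e u b v)
    have TB: "T ` {e, u, b} \<subseteq> span {e, u, b}" using parabolic(1-3) by (auto intro: span_add span_base)
    show thesis
    proof (rule lorT_conj_axis[OF lT parabolic(6,7) TB])
      fix L A assume L: "linear L" "\<And>x. L (L x) = x" and A: "A = (\<lambda>x. L (T (L x)))" and a: "axis i0 1 \<in> span (L ` {e, u, b})"
        and lA: "lorT i0 A" and iso: "isoW A (lperp i0 (span (L ` {e, u, b})))"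
        and iL: "\<And>x y. lor i0 (L x) (L y) = lor i0 x y"
        and G: "\<And>k. comp_dims (GammaH i0 T k) = comp_dims (GammaH i0 A k)"
        and E: "\<And>x. dim (Er A (lperp i0 (span (L ` {e, u, b}))) x) = dim (Er T (lperp i0 (span {e, u, b})) x)"
        "csym A (lperp i0 (span (L ` {e, u, b}))) = csym T (lperp i0 (span {e, u, b}))"
      have sp: "L ` {e, u, b} = {L e, L u, L b}" by simp
      note sg = segreH_parabolic[OF lT parabolic(1-4,6,7)]
      have Ae: "A (L e) = L e" "A (L u) = L u + L e" "A (L b) = L b + L u"
        using parabolic(1-3) by (simp_all add: A L(2) linear_add[OF L(1)])
      have be: "lor i0 (L b) (L e) \<noteq> 0" using parabolic(5) iL by simp
      have "inj_on L (span {e, u})" using L(2) by (metis inj_onI)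
      from dim_image_eq[OF L(1) this] have d: "dim (span {L e, L u}) = 2" using sg(2) by simp
      note GP = GammaH_parabolic[OF lA Ae be d a[unfolded sp]]
      show thesis
        by (rule Par[OF iso], unfold sp E[unfolded sp] G GP sg(1) comp_dims_empty, (rule refl)+)
    qed
  qed
qed

text \<open>\<open>GammaH\<close> for \<open>k = 0\<close> is nonempty exactly for elliptic maps,
  and for \<open>k = 1\<close> it then separates hyperbolic from parabolic ones. Hence the type of
  \<open>g\<close> follows, and the type of \<open>f\<close> alone decides how far the comparison
  has to reach.\<close>

theorem segreH_determined:
  fixes f g :: "real^'p::finite \<Rightarrow> real^'p"
  assumes f: "isomH i0 f" and g: "isomH i0 g"
    and eq: "\<And>k. k \<le> 2 \<Longrightarrow> comp_dims (GammaH i0 f k) = comp_dims (GammaH i0 g k)"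
    and eq3: "fst (segreH i0 f) \<noteq> Ell \<Longrightarrow> comp_dims (GammaH i0 f 3) = comp_dims (GammaH i0 g 3)"
    and eq4: "fst (segreH i0 f) = Par \<Longrightarrow> comp_dims (GammaH i0 f 4) = comp_dims (GammaH i0 g 4)"
  shows "segreH i0 f = segreH i0 g"
proof -
  have eq01: "comp_dims (GammaH i0 f 0) = comp_dims (GammaH i0 g 0)" "comp_dims (GammaH i0 f 1) = comp_dims (GammaH i0 g 1)"
    using eq by simp_all
  have ne: "comp_dims (Gfix A W 0) \<noteq> {#}" "comp_dims (GG A W {0} 0) \<noteq> {#}" if "isoW A W" for A :: "real^'p \<Rightarrow> real^'p" and W
    using that comp_dims_GG_0[of A W "Er A W 1"] comp_dims_GG_0[of A W "{0}"] subspace_Er[of A W 1] subspace_single_0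
    by (auto simp: isoW_def Gfix_def)
  from f show ?thesis
  proof (cases rule: segreH_data)
    case f': (Ell A W)
    from g show ?thesis
    proof (cases rule: segreH_data)
      case g': (Ell B V)
      show ?thesis using core_fixed[OF f'(1) g'(1), folded Gfix_def] eq f'(2,3) g'(2,3) by simp
    qed (use eq01 f'(3) ne[OF f'(1)] in simp_all)
  next
    case f': (Hyp A W)
    from g show ?thesis
    proof (cases rule: segreH_data)
      case g': (Ell B V)
      then show ?thesis using eq01 f'(3) ne by simp
    next
      case g': (Hyp B V)
      have "comp_dims (GG A W {0} k) = comp_dims (GG B V {0} k)" if "k \<le> 2" for k
      proof -
        have "Suc k \<le> 2 \<or> Suc k = 3" using that by linarith
        then have "comp_dims (GammaH i0 f (Suc k)) = comp_dims (GammaH i0 g (Suc k))" using eq[of "Suc k"] eq3 f'(2) by auto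
        then show ?thesis unfolding f'(4) g'(4) .
      qed
      then show ?thesis using core_0[OF f'(1) g'(1)] f'(2) g'(2) by simp
    next
      case g': (Par B V)
      show ?thesis using eq01(2) g'(4) f'(4)[of 0] ne(2)[OF f'(1)] unfolding One_nat_def by simp
    qed
  next
    case f': (Par A W)
    from g show ?thesis
    proof (cases rule: segreH_data)
      case g': (Ell B V)
      then show ?thesis using eq01 f'(3) ne by simp
    next
      case g': (Hyp B V)
      show ?thesis using eq01(2) f'(4) g'(4)[of 0] ne(2)[OF g'(1)] unfolding One_nat_def by simp
    next
      case g': (Par B V)
      have "comp_dims (Gfix A W k) = comp_dims (Gfix B V k)" if "k \<le> 2" for k
      proof -
        have "k + 2 \<le> 2 \<or> k + 2 = 3 \<or> k + 2 = 4" using that by linarith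
        then have "comp_dims (GammaH i0 f (k + 2)) = comp_dims (GammaH i0 g (k + 2))" using eq[of "k + 2"] eq3 eq4 f'(2) by auto
        then show ?thesis unfolding f'(5) g'(5) .
      qed
      then show ?thesis using core_fixed[OF f'(1) g'(1), folded Gfix_def] f'(2) g'(2) by simp
    qed
  qed
qed

theorem mainTheorem6:
  shows
  "(\<forall>(f::real^'m::finite \<Rightarrow> real^'m) (g::real^'m \<Rightarrow> real^'m). orthogonal_transformation f \<and> orthogonal_transformation g
      \<and> (\<forall>k\<le>1. comp_dims (GammaS f k) = comp_dims (GammaS g k))
      \<longrightarrow> segreS f = segreS g)
 \<and> (\<forall>(f::real^'n::finite \<Rightarrow> real^'n) (g::real^'n \<Rightarrow> real^'n). isomE f \<and> isomE g
      \<and> (\<forall>k\<le>3. comp_dims (GammaE f k) = comp_dims (GammaE g k))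
      \<longrightarrow> segreE f = segreE g)
 \<and> (\<forall>(f::real^'n::finite \<Rightarrow> real^'n) (g::real^'n \<Rightarrow> real^'n). isomE f \<and> isomE g \<and> fst (segreE f) = Ell
      \<and> (\<forall>k\<le>2. comp_dims (GammaE f k) = comp_dims (GammaE g k))
      \<longrightarrow> segreE f = segreE g)
 \<and> (\<forall>(i0::'p::finite) (f::real^'p \<Rightarrow> real^'p) (g::real^'p \<Rightarrow> real^'p). isomH i0 f \<and> isomH i0 g
      \<and> (\<forall>k\<le>4. comp_dims (GammaH i0 f k) = comp_dims (GammaH i0 g k))
      \<longrightarrow> segreH i0 f = segreH i0 g)
 \<and> (\<forall>(i0::'p::finite) (f::real^'p \<Rightarrow> real^'p) (g::real^'p \<Rightarrow> real^'p). isomH i0 f \<and> isomH i0 g \<and> fst (segreH i0 f) = Ell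
      \<and> (\<forall>k\<le>2. comp_dims (GammaH i0 f k) = comp_dims (GammaH i0 g k))
      \<longrightarrow> segreH i0 f = segreH i0 g)
 \<and> (\<forall>(i0::'p::finite) (f::real^'p \<Rightarrow> real^'p) (g::real^'p \<Rightarrow> real^'p). isomH i0 f \<and> isomH i0 g \<and> fst (segreH i0 f) = Hyp
      \<and> (\<forall>k\<le>3. comp_dims (GammaH i0 f k) = comp_dims (GammaH i0 g k))
      \<longrightarrow> segreH i0 f = segreH i0 g)"
proof (intro conjI allI impI; elim conjE)
  show "segreS f = segreS g" if "orthogonal_transformation f" "orthogonal_transformation g"
    "\<forall>k\<le>1. comp_dims (GammaS f k) = comp_dims (GammaS g k)" for f g :: "real^'m \<Rightarrow> real^'m"
    using segreS_determined that by blast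
  show "segreE f = segreE g" if "isomE f" "isomE g"
    "\<forall>k\<le>3. comp_dims (GammaE f k) = comp_dims (GammaE g k)" for f g :: "real^'n \<Rightarrow> real^'n"
    using segreE_determined[OF that(1,2)] that(3) by simp
  show "segreE f = segreE g" if "isomE f" "isomE g" "fst (segreE f) = Ell"
    "\<forall>k\<le>2. comp_dims (GammaE f k) = comp_dims (GammaE g k)" for f g :: "real^'n \<Rightarrow> real^'n"
    using segreE_determined[OF that(1,2)] that(3,4) by simp
  show "segreH i0 f = segreH i0 g" if "isomH i0 f" "isomH i0 g"
    "\<forall>k\<le>4. comp_dims (GammaH i0 f k) = comp_dims (GammaH i0 g k)" for i0 and f g :: "real^'p \<Rightarrow> real^'p"
    using segreH_determined[OF that(1,2)] that(3) by simp
  show "segreH i0 f = segreH i0 g" if "isomH i0 f" "isomH i0 g" "fst (segreH i0 f) = Ell"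
    "\<forall>k\<le>2. comp_dims (GammaH i0 f k) = comp_dims (GammaH i0 g k)" for i0 and f g :: "real^'p \<Rightarrow> real^'p"
    using segreH_determined[OF that(1,2)] that(3,4) by simp
  show "segreH i0 f = segreH i0 g" if "isomH i0 f" "isomH i0 g" "fst (segreH i0 f) = Hyp"
    "\<forall>k\<le>3. comp_dims (GammaH i0 f k) = comp_dims (GammaH i0 g k)" for i0 and f g :: "real^'p \<Rightarrow> real^'p"
    using segreH_determined[OF that(1,2)] that(3,4) by simp
qed

end
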